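(* Let $X$ be a normal complex projective variety, and let $G$ be a finite group acting on $X$. Let $\pi : X\to X/G$ be the quotient map, and assume that $\pi$ is flat. Then $$\pi^{*}=\pi^{*}_{\mathrm{sp}}: Z_{*}(X/G)\to Z_{*}(X).$$
   Context: $Z_{*}(V)$ denotes the group of cycles on $V$ with $\mathbb{R}$-coefficients. The map $\pi^*$ is the flat pullback of cycles. For a subvariety $W$ of $X$, the inertia group is $I_W=\{g\in G : g|_W=\mathrm{id}_W\}$, and $e_W=\mathrm{card}(I_W)/\deg_i(W/V)$, where $V=\pi(W)$ and $\deg_i(W/V)$ is the degree of inseparability of the function field $K(W)$ over $K(V)$ (which is $1$ over $\mathbb{C}$). The special pullback $\pi^*_{\mathrm{sp}}:Z_*(X/G)\to Z_*(X)$ is the linear map defined on a subvariety $V$ of $X/G$ by $\pi^*_{\mathrm{sp}}[V]=\sum e_W[W]$, the sum being over all irreducible components $W$ of $\pi^{-1}(V)$.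
   Formalization: The action of G on X is assumed faithful; for a non-faithful action the equality always fails at [X/G], since π^*[X/G]=[X] while e_X=card(I_X)>1 (e.g. Z/2 acting trivially). *)

theory Defs
  imports "HOL-Analysis.Analysis" "HOL-Algebra.Algebra" "HOL-Library.Extended_Nat"
begin

text \<open>
  Varieties are treated in the classical language of irreducible spaces with functions (Serre): a
  topological space together with a sheaf of complex-valued functions.  The points of the associated
  scheme are the irreducible closed subsets \<open>W\<close>, and the local ring of the scheme at the generic
  point of \<open>W\<close> is the ring \<open>stalk\<close> of germs along \<open>W\<close>.
\<close>

no_notation var (\<open>X\<index>\<close>)
no_notation eq_closure_of (\<open>closure'_of\<index>\<close>)

section \<open>Irreducible subsets\<close>

definition irreducible_in :: "'a topology \<Rightarrow> 'a set \<Rightarrow> bool" where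
  "irreducible_in T S \<longleftrightarrow> S \<subseteq> topspace T \<and> S \<noteq> {} \<and>
     (\<forall>C D. closedin T C \<and> closedin T D \<and> S \<subseteq> C \<union> D \<longrightarrow> S \<subseteq> C \<or> S \<subseteq> D)"

definition irreducible_components :: "'a topology \<Rightarrow> 'a set \<Rightarrow> 'a set set" where
  "irreducible_components T Z =
     {W. irreducible_in T W \<and> W \<subseteq> Z \<and> (\<forall>W'. irreducible_in T W' \<and> W' \<subseteq> Z \<and> W \<subseteq> W' \<longrightarrow> W' = W)}"

lemma irreducible_in_closure_of:
  assumes "irreducible_in T S" shows "irreducible_in T (T closure_of S)"
proof -
  have sub: "S \<subseteq> T closure_of S"
    using assms by (simp add: irreducible_in_def closure_of_subset)
  have "T closure_of S \<subseteq> C \<or> T closure_of S \<subseteq> D"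
    if C: "closedin T C" and D: "closedin T D" and CD: "T closure_of S \<subseteq> C \<union> D" for C D
  proof -
    have "S \<subseteq> C \<union> D" using sub CD by (rule subset_trans)
    then have "S \<subseteq> C \<or> S \<subseteq> D" using assms C D unfolding irreducible_in_def by blast
    then show ?thesis using closure_of_minimal[OF _ C] closure_of_minimal[OF _ D] by blast
  qed
  moreover have "T closure_of S \<noteq> {}" using assms sub unfolding irreducible_in_def by blast
  ultimately show ?thesis
    using closure_of_subset_topspace[of T S] unfolding irreducible_in_def by blast
qed

lemma closedin_irreducible_component:
  assumes "closedin T Z" "W \<in> irreducible_components T Z" shows "closedin T W"
proof -
  have W: "irreducible_in T W" "W \<subseteq> Z"
    and max: "\<And>W'. irreducible_in T W' \<Longrightarrow> W' \<subseteq> Z \<Longrightarrow> W \<subseteq> W' \<Longrightarrow> W' = W"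
    using assms(2) by (auto simp: irreducible_components_def)
  have "T closure_of W \<subseteq> Z" using assms(1) W(2) by (rule closure_of_minimal[rotated])
  moreover have "W \<subseteq> T closure_of W"
    using W(1) by (simp add: irreducible_in_def closure_of_subset)
  ultimately have "T closure_of W = W" using max irreducible_in_closure_of[OF W(1)] by blast
  then show ?thesis using closedin_closure_of by metis
qed

section \<open>Spaces with functions\<close>

text \<open>Sections over \<open>U\<close> are extensional functions, i.e. \<open>undefined\<close> outside \<open>U\<close>.\<close>

record 'a fspace =
  space_top :: "'a topology"
  sections :: "'a set \<Rightarrow> ('a \<Rightarrow> complex) set"

abbreviation points :: "'a fspace \<Rightarrow> 'a set" where
  "points S \<equiv> topspace (space_top S)"

definition morphism :: "'a fspace \<Rightarrow> 'b fspace \<Rightarrow> ('a \<Rightarrow> 'b) \<Rightarrow> bool" where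
  "morphism S T \<phi> \<longleftrightarrow> continuous_map (space_top S) (space_top T) \<phi> \<and>
     (\<forall>U f. openin (space_top T) U \<and> f \<in> sections T U \<longrightarrow>
        restrict (f \<circ> \<phi>) {x \<in> points S. \<phi> x \<in> U} \<in> sections S {x \<in> points S. \<phi> x \<in> U})"

definition subvarieties :: "'a fspace \<Rightarrow> 'a set set" where
  "subvarieties S = {W. closedin (space_top S) W \<and> irreducible_in (space_top S) W}"

text \<open>The reduced structure on a subset: functions that locally extend to the ambient space.\<close>

definition subspace_of :: "'a fspace \<Rightarrow> 'a set \<Rightarrow> 'a fspace" where
  "subspace_of S W = \<lparr>
     space_top = subtopology (space_top S) W,
     sections = (\<lambda>U. {f \<in> extensional U. \<forall>x\<in>U. \<exists>U' g. openin (space_top S) U' \<and> x \<in> U' \<and>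
                      g \<in> sections S U' \<and> (\<forall>y \<in> U' \<inter> U. f y = g y)}) \<rparr>"

section \<open>Projective varieties\<close>

text \<open>Homogeneous polynomials of degree \<open>d\<close>, as functions (the base field is infinite).\<close>

inductive form :: "nat \<Rightarrow> (complex^'n \<Rightarrow> complex) \<Rightarrow> bool" where
  form_const: "form 0 (\<lambda>v. c)"
| form_coord: "form 1 (\<lambda>v. v $ i)"
| form_add: "form d F \<Longrightarrow> form d H \<Longrightarrow> form d (\<lambda>v. F v + H v)"
| form_mult: "form d F \<Longrightarrow> form e H \<Longrightarrow> form (d + e) (\<lambda>v. F v * H v)"

text \<open>Projective space of dimension \<open>CARD('n) - 1\<close>, as the set of lines in affine space.\<close>

definition proj_points :: "(complex^'n) set set" where
  "proj_points = {L. vec.subspace L \<and> vec.dim L = 1}"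

definition zero_locus :: "(complex^'n \<Rightarrow> complex) set \<Rightarrow> (complex^'n) set set" where
  "zero_locus \<F> = {L \<in> proj_points. \<forall>F\<in>\<F>. \<forall>v\<in>L. F v = 0}"

definition zariski_closed :: "(complex^'n) set set \<Rightarrow> bool" where
  "zariski_closed Z \<longleftrightarrow> (\<exists>\<F>. (\<forall>F\<in>\<F>. \<exists>d. form d F) \<and> Z = zero_locus \<F>)"

definition zariski :: "(complex^'n) set topology" where
  "zariski = topology (\<lambda>U. U \<subseteq> proj_points \<and> zariski_closed (proj_points - U))"

lemma form_scale: "form d F \<Longrightarrow> F (c *s v) = c ^ d * F v" for v :: "complex^'n"
  by (induction rule: form.induct) (simp_all add: distrib_left power_add mult_ac)

lemma proj_points_scale:
  fixes v w :: "complex^'n"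
  assumes L: "L \<in> proj_points" "v \<in> L" "w \<in> L" "v \<noteq> 0"
  shows "\<exists>c. w = c *s v"
proof -
  have d: "vec.dim L = 1" using L(1) by (simp add: proj_points_def)
  have "vec.independent {v}" using L(4) by simp
  then have "L \<subseteq> vec.span {v}"
    using vec.card_ge_dim_independent[of "{v}" L] d L(2) by simp
  then show ?thesis using L(3) by (auto simp: vec.span_singleton)
qed

lemma zero_locus_mult:
  fixes \<F> \<F>' :: "(complex^'n \<Rightarrow> complex) set"
  assumes \<F>: "\<forall>F\<in>\<F>. \<exists>d. form d F" and \<F>': "\<forall>F\<in>\<F>'. \<exists>d. form d F"
  shows "zero_locus {\<lambda>v. F v * F' v | F F'. F \<in> \<F> \<and> F' \<in> \<F>'} = zero_locus \<F> \<union> zero_locus \<F>'"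
    (is "zero_locus ?P = _")
proof (intro equalityI subsetI)
  fix L assume L: "L \<in> zero_locus ?P"
  then have LP: "L \<in> proj_points" by (simp add: zero_locus_def)
  show "L \<in> zero_locus \<F> \<union> zero_locus \<F>'"
  proof (rule ccontr)
    assume "\<not> ?thesis"
    then have "L \<notin> zero_locus \<F>" "L \<notin> zero_locus \<F>'" by simp_all
    then obtain F v F' w where F: "F \<in> \<F>" "v \<in> L" "F v \<noteq> 0" and F': "F' \<in> \<F>'" "w \<in> L" "F' w \<noteq> 0"
      using LP unfolding zero_locus_def by blast
    have P: "(\<lambda>v. F v * F' v) \<in> ?P" using F(1) F'(1) by blast
    have "L \<in> proj_points \<and> (\<forall>H\<in>?P. \<forall>u\<in>L. H u = 0)" using L unfolding zero_locus_def by (rule CollectD)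
    then have "\<forall>H\<in>?P. \<forall>u\<in>L. H u = 0" by (rule conjunct2)
    then have "\<forall>u\<in>L. F u * F' u = 0" using P by (rule bspec)
    then have van: "F v * F' v = 0" "F w * F' w = 0" using F(2) F'(2) by simp_all
    obtain d d' where d: "form d F" "form d' F'" using F(1) F'(1) \<F> \<F>' by blast
    show False
    proof (cases "v = 0")
      case False
      then obtain c where "w = c *s v" using proj_points_scale[OF LP F(2) F'(2)] by blast
      then have "F' v \<noteq> 0" using form_scale[OF d(2), of c v] F'(3) by (metis mult_zero_right)
      then show False using F(3) van(1) by (metis mult_eq_0_iff)
    next
      case True
      then have "F (0 *s w) \<noteq> 0" using F(3) by (metis vec.scale_zero_left)
      then have "F w \<noteq> 0" using form_scale[OF d(1), of 0 w] by (metis mult_zero_right)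
      then show False using F'(3) van(2) by (metis mult_eq_0_iff)
    qed
  qed
next
  fix L assume L: "L \<in> zero_locus \<F> \<union> zero_locus \<F>'"
  then have "L \<in> proj_points" by (auto simp: zero_locus_def)
  moreover have "H v = 0" if H: "H \<in> ?P" and v: "v \<in> L" for H v
  proof -
    obtain F F' where F: "H = (\<lambda>v. F v * F' v)" "F \<in> \<F>" "F' \<in> \<F>'" using H by blast
    have "F v = 0 \<or> F' v = 0" using L F(2,3) v unfolding zero_locus_def by blast
    then show ?thesis unfolding F(1) by (simp only: mult_eq_0_iff)
  qed
  ultimately show "L \<in> zero_locus ?P"
    unfolding zero_locus_def by (intro CollectI conjI ballI)
qed

lemma istopology_zariski:
  "istopology (\<lambda>U. U \<subseteq> (proj_points :: (complex^'n) set set) \<and> zariski_closed (proj_points - U))"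
proof -
  have int: "zariski_closed (proj_points - U \<inter> U')"
    if U: "zariski_closed (proj_points - U)" and U': "zariski_closed (proj_points - U')"
    for U U' :: "(complex^'n) set set"
  proof -
    obtain \<F> where \<F>: "\<forall>F\<in>\<F>. \<exists>d. form d F" "proj_points - U = zero_locus \<F>"
      using U unfolding zariski_closed_def by blast
    obtain \<F>' where \<F>': "\<forall>F\<in>\<F>'. \<exists>d. form d F" "proj_points - U' = zero_locus \<F>'"
      using U' unfolding zariski_closed_def by blast
    let ?P = "{\<lambda>v. F v * F' v | F F'. F \<in> \<F> \<and> F' \<in> \<F>'}"
    have "proj_points - U \<inter> U' = zero_locus \<F> \<union> zero_locus \<F>'"
      unfolding Diff_Int \<F>(2) \<F>'(2) ..
    also have "\<dots> = zero_locus ?P"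
      by (rule zero_locus_mult[OF \<F>(1) \<F>'(1), symmetric])
    finally have "proj_points - U \<inter> U' = zero_locus ?P" .
    moreover have "\<forall>F\<in>?P. \<exists>d. form d F"
    proof
      fix H assume "H \<in> ?P"
      then obtain F F' where H: "H = (\<lambda>v. F v * F' v)" "F \<in> \<F>" "F' \<in> \<F>'" by blast
      then obtain d d' where "form d F" "form d' F'" using \<F>(1) \<F>'(1) by blast
      then have "form (d + d') H" unfolding H(1) by (rule form_mult)
      then show "\<exists>d. form d H" ..
    qed
    ultimately show ?thesis unfolding zariski_closed_def by (intro exI[of _ ?P] conjI)
  qed
  have Un: "zariski_closed (proj_points - \<Union>\<K>)"
    if \<K>: "\<forall>U\<in>\<K>. zariski_closed (proj_points - U)" for \<K> :: "(complex^'n) set set set"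
  proof -
    obtain \<F> where \<F>: "\<forall>U\<in>\<K>. (\<forall>F\<in>\<F> U. \<exists>d. form d F) \<and> proj_points - U = zero_locus (\<F> U)"
    proof -
      have "\<forall>U\<in>\<K>. \<exists>\<F>. (\<forall>F\<in>\<F>. \<exists>d. form d F) \<and> proj_points - U = zero_locus \<F>"
        using \<K> by (simp only: zariski_closed_def)
      from bchoice[OF this] show ?thesis using that by blast
    qed
    have "proj_points - \<Union>\<K> = {L \<in> proj_points. \<forall>U\<in>\<K>. L \<in> proj_points - U}" by blast
    also have "\<dots> = {L \<in> proj_points. \<forall>U\<in>\<K>. L \<in> zero_locus (\<F> U)}" using \<F> by simp
    also have "\<dots> = zero_locus (\<Union>U\<in>\<K>. \<F> U)" unfolding zero_locus_def by blast
    finally show ?thesis using \<F> unfolding zariski_closed_def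
      by (intro exI[of _ "\<Union>U\<in>\<K>. \<F> U"]) blast
  qed
  show ?thesis unfolding istopology_def
  proof (intro conjI allI impI)
    fix U U' :: "(complex^'n) set set"
    assume "U \<subseteq> proj_points \<and> zariski_closed (proj_points - U)"
      and "U' \<subseteq> proj_points \<and> zariski_closed (proj_points - U')"
    then show "U \<inter> U' \<subseteq> proj_points" and "zariski_closed (proj_points - U \<inter> U')"
      using int by blast+
  next
    fix \<K> :: "(complex^'n) set set set"
    assume "\<forall>U\<in>\<K>. U \<subseteq> proj_points \<and> zariski_closed (proj_points - U)"
    then show "\<Union>\<K> \<subseteq> proj_points" and "zariski_closed (proj_points - \<Union>\<K>)"
      using Un by blast+
  qed
qed

lemma closedin_zariski:
  "closedin zariski (Z :: (complex^'n) set set) \<longleftrightarrow> Z \<subseteq> proj_points \<and> zariski_closed Z"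
proof -
  have op: "openin zariski U \<longleftrightarrow> U \<subseteq> proj_points \<and> zariski_closed (proj_points - U)"
    for U :: "(complex^'n) set set"
    unfolding zariski_def topology_inverse'[OF istopology_zariski] ..
  have e: "zariski_closed ({} :: (complex^'n) set set)"
  proof -
    have "0 \<in> L" if "L \<in> proj_points" for L :: "(complex^'n) set"
      using that by (simp add: proj_points_def vec.subspace_0)
    then have "{} = zero_locus {\<lambda>v::complex^'n. 1}"
      by (auto simp: zero_locus_def)
    moreover have "\<forall>F\<in>{\<lambda>v::complex^'n. 1}. \<exists>d. form d F" using form_const by blast
    ultimately show ?thesis unfolding zariski_closed_def
      by (intro exI[of _ "{\<lambda>v. 1}"] conjI)
  qed
  have "openin zariski (proj_points :: (complex^'n) set set)" using e by (simp add: op)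
  moreover have "topspace zariski \<subseteq> (proj_points :: (complex^'n) set set)"
    using op[of "topspace zariski"] openin_topspace by blast
  ultimately have top: "topspace zariski = (proj_points :: (complex^'n) set set)"
    by (simp add: openin_subset subset_antisym)
  show ?thesis unfolding closedin_def top op by (auto simp: double_diff)
qed

definition projective_space :: "(complex^'n) set fspace" where
  "projective_space = \<lparr>
     space_top = zariski,
     sections = (\<lambda>U. {f \<in> extensional U. \<forall>x\<in>U. \<exists>d F H U'. form d F \<and> form d H \<and>
        openin zariski U' \<and> x \<in> U' \<and> U' \<subseteq> U \<and>
        (\<forall>L\<in>U'. \<forall>v \<in> L - {0}. H v \<noteq> 0 \<and> f L = F v / H v)}) \<rparr>"

definition projective_variety :: "(complex^'n) set fspace \<Rightarrow> bool" where
  "projective_variety S \<longleftrightarrow> (\<exists>W \<in> subvarieties projective_space. S = subspace_of projective_space W)"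

section \<open>Local rings\<close>

text \<open>Pairs \<open>(U, f)\<close> of an open set meeting \<open>W\<close> and a section over it.\<close>

definition local_sections :: "'a fspace \<Rightarrow> 'a set \<Rightarrow> ('a set \<times> ('a \<Rightarrow> complex)) set" where
  "local_sections S W = {(U, f). openin (space_top S) U \<and> U \<inter> W \<noteq> {} \<and> f \<in> sections S U}"

definition germ_rel ::
  "'a fspace \<Rightarrow> 'a set \<Rightarrow> (('a set \<times> ('a \<Rightarrow> complex)) \<times> ('a set \<times> ('a \<Rightarrow> complex))) set" where
  "germ_rel S W = {((U, f), (U', f')). (U, f) \<in> local_sections S W \<and> (U', f') \<in> local_sections S W \<and>
     (\<exists>U0. openin (space_top S) U0 \<and> U0 \<inter> W \<noteq> {} \<and> U0 \<subseteq> U \<inter> U' \<and> (\<forall>y\<in>U0. f y = f' y))}"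

abbreviation germ :: "'a fspace \<Rightarrow> 'a set \<Rightarrow> 'a set \<Rightarrow> ('a \<Rightarrow> complex) \<Rightarrow> ('a set \<times> ('a \<Rightarrow> complex)) set" where
  "germ S W U f \<equiv> germ_rel S W `` {(U, f)}"

lemma equiv_germ_rel:
  assumes "irreducible_in (space_top S) W"
  shows "equiv (local_sections S W) (germ_rel S W)"
proof -
  have meet: "U \<inter> U' \<inter> W \<noteq> {}"
    if "openin (space_top S) U" "openin (space_top S) U'" "U \<inter> W \<noteq> {}" "U' \<inter> W \<noteq> {}" for U U'
  proof
    assume "U \<inter> U' \<inter> W = {}"
    moreover have "W \<subseteq> points S" using assms by (simp add: irreducible_in_def)
    ultimately have "W \<subseteq> (points S - U) \<union> (points S - U')" by blast
    then have "W \<subseteq> points S - U \<or> W \<subseteq> points S - U'"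
      using assms that(1,2) unfolding irreducible_in_def by blast
    then show False using that(3,4) by blast
  qed
  show ?thesis
  proof (rule equivI)
    show "germ_rel S W \<subseteq> local_sections S W \<times> local_sections S W" by (auto simp: germ_rel_def)
    show "refl_on (local_sections S W) (germ_rel S W)"
      by (auto simp: refl_on_def germ_rel_def local_sections_def)
    show "sym (germ_rel S W)" unfolding sym_def germ_rel_def by (auto simp: Int_commute)
    show "trans (germ_rel S W)"
    proof (rule transI)
      fix p q r assume pq: "(p, q) \<in> germ_rel S W" and qr: "(q, r) \<in> germ_rel S W"
      obtain U f U' f' U'' f'' where pqr: "p = (U, f)" "q = (U', f')" "r = (U'', f'')"
        by (cases p, cases q, cases r)
      obtain A where A: "openin (space_top S) A" "A \<inter> W \<noteq> {}" "A \<subseteq> U \<inter> U'" "\<forall>y\<in>A. f y = f' y"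
        and p: "(U, f) \<in> local_sections S W"
        using pq unfolding pqr germ_rel_def by blast
      obtain B where B: "openin (space_top S) B" "B \<inter> W \<noteq> {}" "B \<subseteq> U' \<inter> U''" "\<forall>y\<in>B. f' y = f'' y"
        and r: "(U'', f'') \<in> local_sections S W"
        using qr unfolding pqr germ_rel_def by blast
      have "openin (space_top S) (A \<inter> B)" using A(1) B(1) by (rule openin_Int)
      moreover have "A \<inter> B \<inter> W \<noteq> {}" using A(1) B(1) A(2) B(2) by (rule meet)
      moreover have "A \<inter> B \<subseteq> U \<inter> U''" "\<forall>y\<in>A \<inter> B. f y = f'' y" using A(3,4) B(3,4) by auto
      ultimately show "(p, r) \<in> germ_rel S W" using p r unfolding pqr germ_rel_def by blast
    qed
  qed
qed

definition stalk :: "'a fspace \<Rightarrow> 'a set \<Rightarrow> ('a set \<times> ('a \<Rightarrow> complex)) set ring" where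
  "stalk S W = \<lparr>
     carrier = local_sections S W // germ_rel S W,
     monoid.mult = (\<lambda>a b. \<Union>(U, f)\<in>a. \<Union>(U', g)\<in>b. germ S W (U \<inter> U') (\<lambda>y\<in>U \<inter> U'. f y * g y)),
     monoid.one = germ S W (points S) (\<lambda>y\<in>points S. 1),
     ring.zero = germ S W (points S) (\<lambda>y\<in>points S. 0),
     ring.add = (\<lambda>a b. \<Union>(U, f)\<in>a. \<Union>(U', g)\<in>b. germ S W (U \<inter> U') (\<lambda>y\<in>U \<inter> U'. f y + g y)) \<rparr>"

text \<open>
  For \<open>\<phi>\<close> a morphism from \<open>S\<close> to \<open>T\<close>, this is the ring map from the germs along the closure of
  \<open>\<phi> ` W\<close> to the germs along \<open>W\<close>.
\<close>

definition germ_pullback :: "'a fspace \<Rightarrow> 'a set \<Rightarrow> ('a \<Rightarrow> 'b) \<Rightarrow>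
    ('b set \<times> ('b \<Rightarrow> complex)) set \<Rightarrow> ('a set \<times> ('a \<Rightarrow> complex)) set" where
  "germ_pullback S W \<phi> a = (\<Union>(U, f)\<in>a.
     germ S W {x \<in> points S. \<phi> x \<in> U} (restrict (f \<circ> \<phi>) {x \<in> points S. \<phi> x \<in> U}))"

definition function_field :: "'a fspace \<Rightarrow> ('a set \<times> ('a \<Rightarrow> complex)) set ring" where
  "function_field S = stalk S (points S)"

section \<open>Normality\<close>

definition integral_over :: "('r, 'm) ring_scheme \<Rightarrow> 'r set \<Rightarrow> 'r \<Rightarrow> bool" where
  "integral_over L K x \<longleftrightarrow>
     (\<exists>p. polynomial\<^bsub>L\<^esub> K p \<and> p \<noteq> [] \<and> hd p = \<one>\<^bsub>L\<^esub> \<and> ring.eval L p x = \<zero>\<^bsub>L\<^esub>)"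

text \<open>The local rings embed into the function field by restricting germs.\<close>

definition normal_variety :: "'a fspace \<Rightarrow> bool" where
  "normal_variety S \<longleftrightarrow> (\<forall>W \<in> subvarieties S. \<forall>x \<in> carrier (function_field S).
     integral_over (function_field S) (germ_pullback S (points S) id ` carrier (stalk S W)) x \<longrightarrow>
     x \<in> germ_pullback S (points S) id ` carrier (stalk S W))"

section \<open>Flatness\<close>

definition tensor_relations :: "('r, 'k) ring_scheme \<Rightarrow> ('r, 'a, 'l) module_scheme \<Rightarrow>
    ('r, 'b, 'm) module_scheme \<Rightarrow> ('a \<times> 'b \<Rightarrow>\<^sub>0 int) set" where
  "tensor_relations A M N =
     {frag_of (x \<oplus>\<^bsub>M\<^esub> x', y) - frag_of (x, y) - frag_of (x', y) | x x' y.
        x \<in> carrier M \<and> x' \<in> carrier M \<and> y \<in> carrier N} \<union>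
     {frag_of (x, y \<oplus>\<^bsub>N\<^esub> y') - frag_of (x, y) - frag_of (x, y') | x y y'.
        x \<in> carrier M \<and> y \<in> carrier N \<and> y' \<in> carrier N} \<union>
     {frag_of (a \<odot>\<^bsub>M\<^esub> x, y) - frag_of (x, a \<odot>\<^bsub>N\<^esub> y) | a x y.
        a \<in> carrier A \<and> x \<in> carrier M \<and> y \<in> carrier N}"

definition tensor_kernel :: "('r, 'k) ring_scheme \<Rightarrow> ('r, 'a, 'l) module_scheme \<Rightarrow>
    ('r, 'b, 'm) module_scheme \<Rightarrow> ('a \<times> 'b \<Rightarrow>\<^sub>0 int) set" where
  "tensor_kernel A M N =
     generate (free_Abelian_group (carrier M \<times> carrier N)) (tensor_relations A M N)"

definition tensor_product :: "('r, 'k) ring_scheme \<Rightarrow> ('r, 'a, 'l) module_scheme \<Rightarrow>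
    ('r, 'b, 'm) module_scheme \<Rightarrow> ('a \<times> 'b \<Rightarrow>\<^sub>0 int) set monoid" where
  "tensor_product A M N = free_Abelian_group (carrier M \<times> carrier N) Mod tensor_kernel A M N"

text \<open>The map induced by \<open>f\<close> (with values in \<open>M'\<close>) and the identity of \<open>N\<close>.\<close>

definition tensor_map :: "('r, 'k) ring_scheme \<Rightarrow> ('r, 'c, 'l) module_scheme \<Rightarrow>
    ('r, 'b, 'm) module_scheme \<Rightarrow> ('a \<Rightarrow> 'c) \<Rightarrow> ('a \<times> 'b \<Rightarrow>\<^sub>0 int) set \<Rightarrow> ('c \<times> 'b \<Rightarrow>\<^sub>0 int) set" where
  "tensor_map A M' N f C = (\<Union>z\<in>C. tensor_kernel A M' N #>\<^bsub>free_Abelian_group (carrier M' \<times> carrier N)\<^esub>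
     frag_extend (\<lambda>(x, y). frag_of (f x, y)) z)"

definition linear_maps :: "('r, 'k) ring_scheme \<Rightarrow> ('r, 'a, 'l) module_scheme \<Rightarrow>
    ('r, 'b, 'm) module_scheme \<Rightarrow> ('a \<Rightarrow> 'b) set" where
  "linear_maps A M M' = {f \<in> hom (add_monoid M) (add_monoid M').
     \<forall>a \<in> carrier A. \<forall>x \<in> carrier M. f (a \<odot>\<^bsub>M\<^esub> x) = a \<odot>\<^bsub>M'\<^esub> f x}"

text \<open>
  \<open>N\<close> is flat if tensoring with \<open>N\<close> preserves injectivity of linear maps.  HOL cannot quantify over
  modules of arbitrary type; the test modules range over those carried by the type
  \<open>(nat \<Rightarrow> 'r) set\<close>.  Up to isomorphism this includes all quotients of free modules of finite (even
  countable) rank, in particular all finitely generated modules, to which flatness reduces.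
\<close>

definition flat_module :: "('r, 'k) ring_scheme \<Rightarrow> ('r, 'b, 'm) module_scheme \<Rightarrow> bool" where
  "flat_module A N \<longleftrightarrow> module A N \<and>
     (\<forall>(M :: ('r, (nat \<Rightarrow> 'r) set) module) (M' :: ('r, (nat \<Rightarrow> 'r) set) module) f.
        module A M \<and> module A M' \<and> f \<in> linear_maps A M M' \<and> inj_on f (carrier M) \<longrightarrow>
        inj_on (tensor_map A M' N f) (carrier (tensor_product A M N)))"

definition restrict_scalars :: "('b, 'm) ring_scheme \<Rightarrow> ('r \<Rightarrow> 'b) \<Rightarrow> ('r, 'b) module" where
  "restrict_scalars B h = \<lparr> carrier = carrier B, monoid.mult = monoid.mult B, monoid.one = monoid.one B, ring.zero = ring.zero B,
     ring.add = ring.add B, smult = (\<lambda>a b. h a \<otimes>\<^bsub>B\<^esub> b) \<rparr>"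

text \<open>Flatness at every point of the scheme associated with \<open>S\<close>.\<close>

definition flat_morphism :: "'a fspace \<Rightarrow> 'b fspace \<Rightarrow> ('a \<Rightarrow> 'b) \<Rightarrow> bool" where
  "flat_morphism S T \<phi> \<longleftrightarrow> morphism S T \<phi> \<and>
     (\<forall>W \<in> subvarieties S. flat_module (stalk T (space_top T closure_of (\<phi> ` W)))
        (restrict_scalars (stalk S W) (germ_pullback S W \<phi>)))"

section \<open>Cycles and flat pullback\<close>

definition cycles :: "'a fspace \<Rightarrow> ('a set \<Rightarrow>\<^sub>0 real) set" where
  "cycles S = {z. Poly_Mapping.keys z \<subseteq> subvarieties S}"

text \<open>
  The linear map taking the generator \<open>[V]\<close> to the sum of \<open>c V W [W]\<close> over the irreducible
  components \<open>W\<close> of the preimage of \<open>V\<close>.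
\<close>

definition component_pullback ::
  "('b set \<Rightarrow> 'a set \<Rightarrow> real) \<Rightarrow> 'a fspace \<Rightarrow> ('a \<Rightarrow> 'b) \<Rightarrow> ('b set \<Rightarrow>\<^sub>0 real) \<Rightarrow> ('a set \<Rightarrow>\<^sub>0 real)" where
  "component_pullback c S \<phi> z = (\<Sum>V\<in>Poly_Mapping.keys z.
     \<Sum>W\<in>irreducible_components (space_top S) {x \<in> points S. \<phi> x \<in> V}.
       Poly_Mapping.single W (Poly_Mapping.lookup z V * c V W))"

lemma component_pullback_cycles:
  assumes "continuous_map (space_top S) (space_top T) \<phi>" and "z \<in> cycles T"
  shows "component_pullback c S \<phi> z \<in> cycles S"
proof -
  have "W \<in> subvarieties S"
    if "V \<in> Poly_Mapping.keys z" "W \<in> irreducible_components (space_top S) {x \<in> points S. \<phi> x \<in> V}" for V W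
  proof -
    have "closedin (space_top T) V" using that(1) assms(2) by (auto simp: cycles_def subvarieties_def)
    then have "closedin (space_top S) {x \<in> points S. \<phi> x \<in> V}"
      using assms(1) by (rule closedin_continuous_map_preimage[rotated])
    then show ?thesis using that(2) closedin_irreducible_component
      by (auto simp: subvarieties_def irreducible_components_def)
  qed
  moreover have "cycles S = {z. \<forall>W. W \<notin> subvarieties S \<longrightarrow> Poly_Mapping.lookup z W = 0}"
    by (auto simp: cycles_def in_keys_iff subset_iff)
  ultimately show ?thesis
    unfolding component_pullback_def
    by (auto simp: lookup_sum lookup_single when_def intro!: sum.neutral)
qed

text \<open>
  The length of a ring as a module over itself.  The multiplicities below use the finite value; the
  local ring of a fibre at a component is Artinian.
\<close>

definition ring_length :: "('r, 'm) ring_scheme \<Rightarrow> enat" where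
  "ring_length R = Sup {enat n | n. \<exists>I. (\<forall>i\<le>n. ideal (I i) R) \<and> (\<forall>i<n. I i \<subset> I (Suc i))}"

text \<open>The stalk, at the generic point of \<open>V'\<close>, of the ideal sheaf of \<open>V\<close>.\<close>

definition vanishing_germs :: "'a fspace \<Rightarrow> 'a set \<Rightarrow> 'a set \<Rightarrow> ('a set \<times> ('a \<Rightarrow> complex)) set set" where
  "vanishing_germs T V' V = {a \<in> carrier (stalk T V'). \<exists>(U, f)\<in>a. \<forall>y \<in> U \<inter> V. f y = 0}"

text \<open>The local ring of the scheme-theoretic inverse image of \<open>V\<close> at the generic point of \<open>W\<close>.\<close>

definition fibre_local_ring ::
  "'a fspace \<Rightarrow> 'b fspace \<Rightarrow> ('a \<Rightarrow> 'b) \<Rightarrow> 'b set \<Rightarrow> 'a set \<Rightarrow> ('a set \<times> ('a \<Rightarrow> complex)) set set ring" where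
  "fibre_local_ring S T \<phi> V W = stalk S W Quot
     (Idl\<^bsub>stalk S W\<^esub> (germ_pullback S W \<phi> ` vanishing_germs T (space_top T closure_of (\<phi> ` W)) V))"

definition flat_pullback ::
  "'a fspace \<Rightarrow> 'b fspace \<Rightarrow> ('a \<Rightarrow> 'b) \<Rightarrow> ('b set \<Rightarrow>\<^sub>0 real) \<Rightarrow> ('a set \<Rightarrow>\<^sub>0 real)" where
  "flat_pullback S T \<phi> =
     component_pullback (\<lambda>V W. real (the_enat (ring_length (fibre_local_ring S T \<phi> V W)))) S \<phi>"

section \<open>Quotients by finite groups and special pullback\<close>

text \<open>
  A finite group of automorphisms of \<open>S\<close>.  Faithfulness is part of the convention: an element
  acting trivially on \<open>S\<close> would count in \<open>card (inertia_group G act W)\<close> for every \<open>W\<close> although it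
  does not affect the quotient map, and then the two pullbacks of \<open>[S/G]\<close> would differ.
\<close>

definition finite_group_acting ::
  "('g, 'm) monoid_scheme \<Rightarrow> 'a fspace \<Rightarrow> ('g \<Rightarrow> 'a \<Rightarrow> 'a) \<Rightarrow> bool" where
  "finite_group_acting G S act \<longleftrightarrow> finite (carrier G) \<and> faithful_action G (points S) act \<and>
     (\<forall>g \<in> carrier G. morphism S S (act g))"

text \<open>The orbit space with the quotient topology and the sheaf of invariant functions.\<close>

definition quotient_space :: "('g, 'm) monoid_scheme \<Rightarrow> 'a fspace \<Rightarrow> ('g \<Rightarrow> 'a \<Rightarrow> 'a) \<Rightarrow> 'a set fspace" where
  "quotient_space G S act = \<lparr>
     space_top = topology (\<lambda>U. U \<subseteq> orbits G (points S) act \<and>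
                    openin (space_top S) {x \<in> points S. orbit G act x \<in> U}),
     sections = (\<lambda>U. {f \<in> extensional U.
        restrict (f \<circ> orbit G act) {x \<in> points S. orbit G act x \<in> U}
          \<in> sections S {x \<in> points S. orbit G act x \<in> U}}) \<rparr>"

lemma istopology_quotient_space:
  "istopology (\<lambda>U. U \<subseteq> orbits G (points S) act \<and>
     openin (space_top S) {x \<in> points S. orbit G act x \<in> U})"
proof -
  have "{x \<in> points S. orbit G act x \<in> U \<inter> U'} =
      {x \<in> points S. orbit G act x \<in> U} \<inter> {x \<in> points S. orbit G act x \<in> U'}" for U U'
    by blast
  moreover have "{x \<in> points S. orbit G act x \<in> \<Union>\<K>} =
      (\<Union>U\<in>\<K>. {x \<in> points S. orbit G act x \<in> U})" for \<K>
    by blast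
  ultimately show ?thesis unfolding istopology_def by auto
qed

lemma quotient_map_orbit:
  "quotient_map (space_top S) (space_top (quotient_space G S act)) (orbit G act)"
proof -
  let ?T = "space_top (quotient_space G S act)"
  have op: "openin ?T U \<longleftrightarrow> U \<subseteq> orbits G (points S) act \<and>
      openin (space_top S) {x \<in> points S. orbit G act x \<in> U}" for U
    unfolding quotient_space_def fspace.simps topology_inverse'[OF istopology_quotient_space] ..
  have im: "orbit G act ` points S = orbits G (points S) act" by (auto simp: orbits_def)
  have "{x \<in> points S. orbit G act x \<in> orbits G (points S) act} = points S" by (auto simp: orbits_def)
  then have "openin ?T (orbits G (points S) act)" by (simp add: op)
  moreover have "topspace ?T \<subseteq> orbits G (points S) act"
    using op[of "topspace ?T"] openin_topspace by blast
  ultimately have "topspace ?T = orbits G (points S) act"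
    by (meson openin_subset subset_antisym)
  then show ?thesis using im by (simp add: quotient_map_def op)
qed

definition inertia_group :: "('g, 'm) monoid_scheme \<Rightarrow> ('g \<Rightarrow> 'a \<Rightarrow> 'a) \<Rightarrow> 'a set \<Rightarrow> 'g set" where
  "inertia_group G act W = {g \<in> carrier G. \<forall>x\<in>W. act g x = x}"

text \<open>An algebraic element is separable if it is a simple root of its minimal polynomial.\<close>

definition separable_closure :: "('r, 'm) ring_scheme \<Rightarrow> 'r set \<Rightarrow> 'r set" where
  "separable_closure L K = {x \<in> carrier L. \<not> ring.transcendental L K x \<and>
     ring.alg_mult L (ring.Irr L K x) x = 1}"

definition inseparability_degree :: "('r, 'm) ring_scheme \<Rightarrow> 'r set \<Rightarrow> nat" where
  "inseparability_degree L K = ring.dim L (separable_closure L K) (carrier L)"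

text \<open>\<open>K(V)\<close>, for \<open>V\<close> the image of \<open>W\<close>, as a subfield of \<open>K(W)\<close>.\<close>

definition base_function_field ::
  "'a fspace \<Rightarrow> 'b fspace \<Rightarrow> ('a \<Rightarrow> 'b) \<Rightarrow> 'a set \<Rightarrow> ('a set \<times> ('a \<Rightarrow> complex)) set set" where
  "base_function_field S T \<phi> W = germ_pullback (subspace_of S W) W \<phi> `
     carrier (function_field (subspace_of T (\<phi> ` W)))"

definition special_multiplicity ::
  "('g, 'm) monoid_scheme \<Rightarrow> 'a fspace \<Rightarrow> ('g \<Rightarrow> 'a \<Rightarrow> 'a) \<Rightarrow> 'a set \<Rightarrow> real" where
  "special_multiplicity G S act W =
     real (card (inertia_group G act W)) /
     real (inseparability_degree (function_field (subspace_of S W))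
        (base_function_field S (quotient_space G S act) (orbit G act) W))"

definition special_pullback ::
  "('g, 'm) monoid_scheme \<Rightarrow> 'a fspace \<Rightarrow> ('g \<Rightarrow> 'a \<Rightarrow> 'a) \<Rightarrow> ('a set set \<Rightarrow>\<^sub>0 real) \<Rightarrow> ('a set \<Rightarrow>\<^sub>0 real)" where
  "special_pullback G S act =
     component_pullback (\<lambda>V W. special_multiplicity G S act W) S (orbit G act)"

end

theory Submission
  imports Defs "HOL-Library.Function_Algebras" "HOL-Computational_Algebra.Polynomial"
begin

text \<open>
  Both pullbacks of \<open>[V]\<close> are sums over the components \<open>W\<close> of the preimage of \<open>V\<close>, so it suffices
  to compare multiplicities.  In characteristic zero the inseparability degree is \<open>1\<close>, and the
  claim is that the local ring of the fibre at \<open>W\<close> has length equal to the order of the inertia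
  group of \<open>W\<close>.

  Let \<open>C\<close> be the semilocal ring of \<open>X\<close> along the orbit of \<open>W\<close>, and \<open>A\<close> its ring of invariants,
  which is the local ring of \<open>X/G\<close> along \<open>V\<close>.  Flatness makes \<open>C\<close> a free \<open>A\<close>-module.  Its rank is the
  order of \<open>G\<close>, since \<open>G\<close> acts faithfully: this is the Galois count at the generic point.  Let \<open>e\<close>
  be the length of the fibre at \<open>W\<close>.  The fibre has one conjugate local ring, of dimension \<open>e * f\<close>
  over the residue field of \<open>A\<close>, for each of the conjugates of \<open>W\<close>, where \<open>f\<close> is the residue degree.
  The group of automorphisms of the residue field of \<open>C\<close> at \<open>W\<close> induced by the decomposition group
  \<open>D\<close> has the inertia group \<open>I\<close> as kernel, so that \<open>f * card I = card D\<close> by Artin's theorem.  Comparing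
  \<open>card G = (card G / card D) * e * f\<close> with this gives \<open>e = card I\<close>.
\<close>

section \<open>Ideals and families of elements relative to a prime\<close>

text \<open>No localisation and no residue ring is formed. \<open>C\<close> is a set of honest
  functions, and every count is made modulo an ideal of it: \<open>Z\<close> for the generic point,
  \<open>n\<close> for the residue field, \<open>mC\<close> for the fibre. The ideals of the local
  ring of the fibre are represented by the \<open>saturated\<close> ideals of \<open>C\<close>. The
  length is a supremum over chains, not a dimension, so freeness and the product
  \<open>e * f\<close> appear as two inequalities. A chain of length \<open>l\<close> yields
  \<open>l * f\<close> elements for each conjugate of \<open>W\<close> that are independent modulo
  \<open>mC\<close>; flatness lifts independence to the generic point, where the order of the group
  bounds it. A chain that cannot be refined yields equally many elements spanning modulo
  \<open>mC\<close>, and Nakayama's lemma lifts spanning; the finiteness that it needs comes from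
  integrality over the invariants. Flatness is available at \<open>W\<close> only, while the count
  concerns the whole orbit. The bridge is that coefficients in \<open>A\<close> are fixed exactly,
  so a relation can be moved to every conjugate. Exact invariants are obtained by adding up
  conjugates, which is harmless because the order of the group is invertible.\<close>

locale subring_of =
  fixes C :: "'r::comm_ring_1 set"
  assumes one_C: "1 \<in> C"
    and add_C: "x \<in> C \<Longrightarrow> y \<in> C \<Longrightarrow> x + y \<in> C"
    and mult_C: "x \<in> C \<Longrightarrow> y \<in> C \<Longrightarrow> x * y \<in> C"
    and uminus_C: "x \<in> C \<Longrightarrow> - x \<in> C"
begin

lemma zero_C: "0 \<in> C"
  using add_C[OF one_C uminus_C[OF one_C]] by simp

lemma diff_C: "x \<in> C \<Longrightarrow> y \<in> C \<Longrightarrow> x - y \<in> C"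
  using add_C[OF _ uminus_C] by fastforce

lemma sum_C: "(\<And>i. i \<in> K \<Longrightarrow> f i \<in> C) \<Longrightarrow> (\<Sum>i\<in>K. f i) \<in> C"
  by (induction K rule: infinite_finite_induct) (auto simp: zero_C add_C)

lemma prod_C: "(\<And>i. i \<in> K \<Longrightarrow> f i \<in> C) \<Longrightarrow> (\<Prod>i\<in>K. f i) \<in> C"
  by (induction K rule: infinite_finite_induct) (auto simp: one_C mult_C)

lemma power_C: "x \<in> C \<Longrightarrow> x ^ k \<in> C"
  by (induction k) (auto simp: one_C mult_C)

lemma of_nat_C: "of_nat k \<in> C"
  by (induction k) (auto simp: zero_C one_C add_C)

definition ideal_in :: "'r set \<Rightarrow> bool" where
  "ideal_in J \<longleftrightarrow> J \<subseteq> C \<and> 0 \<in> J \<and> (\<forall>x\<in>J. \<forall>y\<in>J. x + y \<in> J) \<and> (\<forall>c\<in>C. \<forall>x\<in>J. c * x \<in> J)"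

definition prime_in :: "'r set \<Rightarrow> bool" where
  "prime_in P \<longleftrightarrow> ideal_in P \<and> 1 \<notin> P \<and> (\<forall>x\<in>C. \<forall>y\<in>C. x * y \<in> P \<longrightarrow> x \<in> P \<or> y \<in> P)"

lemma ideal_inD:
  assumes "ideal_in J"
  shows "x \<in> J \<Longrightarrow> x \<in> C" "0 \<in> J" "x \<in> J \<Longrightarrow> y \<in> J \<Longrightarrow> x + y \<in> J"
    "c \<in> C \<Longrightarrow> x \<in> J \<Longrightarrow> c * x \<in> J" "c \<in> C \<Longrightarrow> x \<in> J \<Longrightarrow> x * c \<in> J"
  using assms by (auto simp: ideal_in_def mult.commute)

lemma ideal_uminus: "ideal_in J \<Longrightarrow> x \<in> J \<Longrightarrow> - x \<in> J"
  using ideal_inD(4)[of J "- 1" x] uminus_C[OF one_C] by simp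

lemma ideal_diff: "ideal_in J \<Longrightarrow> x \<in> J \<Longrightarrow> y \<in> J \<Longrightarrow> x - y \<in> J"
  using ideal_inD(3)[of J x "- y"] ideal_uminus by simp

lemma ideal_sum: "ideal_in J \<Longrightarrow> (\<And>i. i \<in> K \<Longrightarrow> f i \<in> J) \<Longrightarrow> (\<Sum>i\<in>K. f i) \<in> J"
  by (induction K rule: infinite_finite_induct) (auto simp: ideal_inD)

lemma ideal_add_cancel: "ideal_in J \<Longrightarrow> y \<in> J \<Longrightarrow> x + y \<in> J \<longleftrightarrow> x \<in> J"
  using ideal_diff[of J "x + y" y] ideal_inD(3)[of J x y] by auto

lemma prime_inD:
  assumes "prime_in P"
  shows "ideal_in P" "1 \<notin> P" "x \<in> C \<Longrightarrow> y \<in> C \<Longrightarrow> x * y \<in> P \<Longrightarrow> x \<in> P \<or> y \<in> P"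
  using assms by (auto simp: prime_in_def)

lemma prime_prod:
  assumes "prime_in P" "finite K" "\<And>i. i \<in> K \<Longrightarrow> f i \<in> C" "\<And>i. i \<in> K \<Longrightarrow> f i \<notin> P"
  shows "(\<Prod>i\<in>K. f i) \<notin> P"
  using assms(2,3,4)
proof (induction K)
  case empty
  then show ?case using prime_inD(2)[OF assms(1)] by simp
next
  case (insert i K)
  then show ?case using prime_inD(3)[OF assms(1), of "f i" "prod f K"] prod_C[of K f] by auto
qed

lemma prime_power: "prime_in P \<Longrightarrow> x \<in> C \<Longrightarrow> x \<notin> P \<Longrightarrow> x ^ k \<notin> P"
  using prime_prod[of P "{..<k}" "\<lambda>_. x"] by simp

lemma ideal_prod:
  assumes "ideal_in J" "finite K" "k \<in> K" "f k \<in> J" "\<And>i. i \<in> K \<Longrightarrow> f i \<in> C"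
  shows "(\<Prod>i\<in>K. f i) \<in> J"
  using assms ideal_inD(5)[OF assms(1), of "prod f (K - {k})" "f k"] prod_C[of "K - {k}" f]
  by (simp add: prod.remove)

text \<open>Gaussian elimination without division, for a homogeneous system over the fraction field
  of \<open>C\<close> modulo \<open>P\<close>. The pivot is cleared by cross-multiplication, and
  primality keeps a nonzero unknown nonzero after multiplication by the pivot.\<close>

lemma linear_system_mod_prime:
  assumes P: "prime_in P" and "finite E" "finite K" "card E < card K"
    and "\<And>e i. e \<in> E \<Longrightarrow> i \<in> K \<Longrightarrow> M e i \<in> C"
  shows "\<exists>x. (\<forall>i\<in>K. x i \<in> C) \<and> (\<exists>i\<in>K. x i \<notin> P) \<and> (\<forall>e\<in>E. (\<Sum>i\<in>K. M e i * x i) \<in> P)"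
  using assms(2-)
proof (induction E arbitrary: K M rule: finite_induct)
  case empty
  then obtain i where "i \<in> K" by fastforce
  then show ?case using prime_inD(2)[OF P] one_C by (intro exI[of _ "\<lambda>_. 1"]) auto
next
  case (insert e E)
  note I = prime_inD(1)[OF P]
  show ?case
  proof (cases "\<forall>i\<in>K. M e i \<in> P")
    case True
    obtain x where x: "\<forall>i\<in>K. x i \<in> C" "\<exists>i\<in>K. x i \<notin> P" "\<forall>e\<in>E. (\<Sum>i\<in>K. M e i * x i) \<in> P"
      using insert.IH[of K M] insert.prems insert.hyps by auto
    moreover have "(\<Sum>i\<in>K. M e i * x i) \<in> P"
      using True x(1) by (intro ideal_sum[OF I] ideal_inD(5)[OF I]) auto
    ultimately show ?thesis by (intro exI[of _ x]) auto
  next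
    case False
    then obtain k where k: "k \<in> K" "M e k \<notin> P" by blast
    define p where "p = M e k"
    define M' where "M' e' i = p * M e' i - M e' k * M e i" for e' i
    have pC: "p \<in> C" using insert.prems(3) k by (simp add: p_def)
    have "card E < card (K - {k})" using insert.prems(1,2) insert.hyps k(1) by simp
    moreover have "M' e' i \<in> C" if "e' \<in> E" "i \<in> K - {k}" for e' i
      unfolding M'_def using that insert.prems(3) k(1) pC by (intro diff_C mult_C) auto
    ultimately obtain x where x: "\<forall>i\<in>K - {k}. x i \<in> C" "\<exists>i\<in>K - {k}. x i \<notin> P"
        "\<forall>e'\<in>E. (\<Sum>i\<in>K - {k}. M' e' i * x i) \<in> P"
      using insert.IH[of "K - {k}" M'] insert.prems(1) by auto
    define y where "y i = (if i = k then - (\<Sum>i\<in>K - {k}. M e i * x i) else p * x i)" for i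
    have sy: "(\<Sum>i\<in>K. f i * y i) = (\<Sum>i\<in>K - {k}. (p * f i - f k * M e i) * x i)" for f
    proof -
      have "(\<Sum>i\<in>K. f i * y i) = f k * y k + (\<Sum>i\<in>K - {k}. f i * y i)"
        using insert.prems(1) k(1) by (simp add: sum.remove)
      also have "(\<Sum>i\<in>K - {k}. f i * y i) = (\<Sum>i\<in>K - {k}. p * f i * x i)"
        by (rule sum.cong) (auto simp: y_def)
      also have "f k * y k = (\<Sum>i\<in>K - {k}. - (f k * M e i * x i))"
        by (simp add: y_def sum_distrib_left sum_negf mult.assoc)
      also have "\<dots> + (\<Sum>i\<in>K - {k}. p * f i * x i) = (\<Sum>i\<in>K - {k}. (p * f i - f k * M e i) * x i)"
        by (simp add: sum.distrib[symmetric] left_diff_distrib)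
      finally show ?thesis .
    qed
    have "y i \<in> C" if "i \<in> K" for i
      using that x(1) insert.prems(3) pC by (auto simp: y_def intro!: uminus_C sum_C mult_C)
    moreover have "\<exists>i\<in>K. y i \<notin> P"
    proof -
      obtain i where "i \<in> K - {k}" "x i \<notin> P" using x(2) by blast
      then have "y i \<notin> P" using prime_inD(3)[OF P pC, of "x i"] x(1) k(2) by (auto simp: y_def p_def)
      then show ?thesis using \<open>i \<in> K - {k}\<close> by blast
    qed
    moreover have "(\<Sum>i\<in>K. M e' i * y i) \<in> P" if "e' \<in> insert e E" for e'
    proof (cases "e' = e")
      case True
      then show ?thesis unfolding sy using ideal_inD(2)[OF I] by (simp add: p_def mult.commute)
    next
      case False
      then show ?thesis using x(3) that unfolding sy M'_def by simp
    qed
    ultimately show ?thesis by (intro exI[of _ y]) auto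
  qed
qed

text \<open>Dedekind's independence of characters, for homomorphisms from \<open>C\<close> to
  \<open>C\<close> modulo \<open>P\<close>. Subtracting \<open>\<delta> b\<close> times the relation
  at \<open>c\<close> from the relation at \<open>b * c\<close> removes the term of
  \<open>\<delta>\<close> and multiplies the term of \<open>\<sigma>\<close> by
  \<open>\<sigma> b - \<delta> b\<close>, where \<open>b\<close> is chosen to keep this factor out
  of \<open>P\<close>.\<close>

lemma dedekind_mod_prime:
  assumes P: "prime_in P" and "finite D"
    and "\<And>\<sigma> c. \<sigma> \<in> D \<Longrightarrow> c \<in> C \<Longrightarrow> \<sigma> c \<in> C"
    and "\<And>\<sigma> b c. \<sigma> \<in> D \<Longrightarrow> b \<in> C \<Longrightarrow> c \<in> C \<Longrightarrow> \<sigma> (b * c) = \<sigma> b * \<sigma> c"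
    and "\<And>\<sigma>. \<sigma> \<in> D \<Longrightarrow> \<sigma> 1 = 1"
    and "\<And>\<sigma> \<tau>. \<sigma> \<in> D \<Longrightarrow> \<tau> \<in> D \<Longrightarrow> \<sigma> \<noteq> \<tau> \<Longrightarrow> \<exists>c\<in>C. \<sigma> c - \<tau> c \<notin> P"
    and "\<And>\<sigma>. \<sigma> \<in> D \<Longrightarrow> x \<sigma> \<in> C"
    and "\<And>c. c \<in> C \<Longrightarrow> (\<Sum>\<sigma>\<in>D. x \<sigma> * \<sigma> c) \<in> P"
  shows "\<forall>\<sigma>\<in>D. x \<sigma> \<in> P"
  using assms(2-)
proof (induction D arbitrary: x rule: finite_induct)
  case (insert \<delta> D)
  note I = prime_inD(1)[OF P]
  have D: "x \<sigma> \<in> P" if \<sigma>: "\<sigma> \<in> D" for \<sigma>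
  proof -
    have "\<sigma> \<noteq> \<delta>" using insert.hyps(2) \<sigma> by blast
    then obtain b where b: "b \<in> C" "\<sigma> b - \<delta> b \<notin> P" using insert.prems(4)[of \<sigma> \<delta>] \<sigma> by blast
    have "\<forall>\<sigma>\<in>D. x \<sigma> * (\<sigma> b - \<delta> b) \<in> P"
    proof (rule insert.IH)
      fix c assume c: "c \<in> C"
      have "(\<Sum>\<sigma>\<in>D. x \<sigma> * (\<sigma> b - \<delta> b) * \<sigma> c)
          = (\<Sum>\<sigma>\<in>D. x \<sigma> * (\<sigma> b * \<sigma> c)) - \<delta> b * (\<Sum>\<sigma>\<in>D. x \<sigma> * \<sigma> c)"
        by (simp add: sum_distrib_left sum_subtractf[symmetric] algebra_simps)
      also have "(\<Sum>\<sigma>\<in>D. x \<sigma> * (\<sigma> b * \<sigma> c)) = (\<Sum>\<sigma>\<in>D. x \<sigma> * \<sigma> (b * c))"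
        using insert.prems(2) b c by (intro sum.cong) auto
      also have "\<dots> - \<delta> b * (\<Sum>\<sigma>\<in>D. x \<sigma> * \<sigma> c)
          = (\<Sum>\<sigma>\<in>insert \<delta> D. x \<sigma> * \<sigma> (b * c)) - \<delta> b * (\<Sum>\<sigma>\<in>insert \<delta> D. x \<sigma> * \<sigma> c)"
        using insert.hyps insert.prems(2)[of \<delta> b c] b c by (simp add: algebra_simps)
      also have "\<dots> \<in> P"
        using insert.prems(1,6) mult_C[OF b(1) c] b(1) c
        by (intro ideal_diff[OF I] ideal_inD(4)[OF I]) auto
      finally show "(\<Sum>\<sigma>\<in>D. x \<sigma> * (\<sigma> b - \<delta> b) * \<sigma> c) \<in> P" .
    qed (use insert.prems b(1) in \<open>auto intro!: mult_C diff_C\<close>)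
    then show ?thesis
      using prime_inD(3)[OF P, of "x \<sigma>" "\<sigma> b - \<delta> b"] b insert.prems(1,5) \<sigma> diff_C by auto
  qed
  \<comment> \<open>Once all other coefficients lie in \<open>P\<close>, evaluation at 1 isolates
    the last one.\<close>
  have "(\<Sum>\<sigma>\<in>insert \<delta> D. x \<sigma> * \<sigma> 1) \<in> P" using insert.prems(6) one_C by blast
  moreover have "(\<Sum>\<sigma>\<in>insert \<delta> D. x \<sigma> * \<sigma> 1) = x \<delta> + (\<Sum>\<sigma>\<in>D. x \<sigma>)"
  proof -
    have "(\<Sum>\<sigma>\<in>D. x \<sigma> * \<sigma> 1) = (\<Sum>\<sigma>\<in>D. x \<sigma>)"
    proof (rule sum.cong)
      fix \<sigma> assume "\<sigma> \<in> D"
      then have "\<sigma> 1 = 1" using insert.prems(3) by blast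
      then show "x \<sigma> * \<sigma> 1 = x \<sigma>" by simp
    qed simp
    then show ?thesis using insert.hyps insert.prems(3)[of \<delta>] by simp
  qed
  moreover have "(\<Sum>\<sigma>\<in>D. x \<sigma>) \<in> P" using D by (intro ideal_sum[OF I])
  ultimately show ?case using D ideal_add_cancel[OF I] by auto
qed simp

end

section \<open>Rings with a finite group of automorphisms\<close>

locale automorphism_group = subring_of C for C :: "'r::comm_ring_1 set" +
  fixes G :: "('r \<Rightarrow> 'r) set"
  assumes finite_G: "finite G"
    and id_G: "id \<in> G"
    and comp_G: "\<sigma> \<in> G \<Longrightarrow> \<tau> \<in> G \<Longrightarrow> \<sigma> \<circ> \<tau> \<in> G"
    and ex_inverse_G: "\<sigma> \<in> G \<Longrightarrow> \<exists>\<tau>\<in>G. \<sigma> \<circ> \<tau> = id \<and> \<tau> \<circ> \<sigma> = id"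
    and hom_add: "\<sigma> \<in> G \<Longrightarrow> \<sigma> (x + y) = \<sigma> x + \<sigma> y"
    and hom_mult: "\<sigma> \<in> G \<Longrightarrow> \<sigma> (x * y) = \<sigma> x * \<sigma> y"
    and hom_one: "\<sigma> \<in> G \<Longrightarrow> \<sigma> 1 = 1"
    and hom_C: "\<sigma> \<in> G \<Longrightarrow> c \<in> C \<Longrightarrow> \<sigma> c \<in> C"
begin

lemma hom_zero: "\<sigma> \<in> G \<Longrightarrow> \<sigma> 0 = 0"
  using hom_add[of \<sigma> 0 0] by simp

lemma hom_uminus: "\<sigma> \<in> G \<Longrightarrow> \<sigma> (- x) = - \<sigma> x"
  using hom_add[of \<sigma> x "- x"] hom_zero[of \<sigma>] by (simp add: eq_neg_iff_add_eq_0 add.commute)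

lemma hom_diff: "\<sigma> \<in> G \<Longrightarrow> \<sigma> (x - y) = \<sigma> x - \<sigma> y"
  using hom_add[of \<sigma> x "- y"] hom_uminus[of \<sigma> y] by simp

lemma hom_sum: "\<sigma> \<in> G \<Longrightarrow> \<sigma> (\<Sum>i\<in>K. f i) = (\<Sum>i\<in>K. \<sigma> (f i))"
  by (induction K rule: infinite_finite_induct) (auto simp: hom_zero hom_add)

lemma hom_prod: "\<sigma> \<in> G \<Longrightarrow> \<sigma> (\<Prod>i\<in>K. f i) = (\<Prod>i\<in>K. \<sigma> (f i))"
  by (induction K rule: infinite_finite_induct) (auto simp: hom_one hom_mult)

lemma hom_power: "\<sigma> \<in> G \<Longrightarrow> \<sigma> (x ^ k) = \<sigma> x ^ k"
  by (induction k) (auto simp: hom_one hom_mult)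

definition inv_G :: "('r \<Rightarrow> 'r) \<Rightarrow> 'r \<Rightarrow> 'r" where
  "inv_G \<sigma> = (SOME \<tau>. \<tau> \<in> G \<and> \<sigma> \<circ> \<tau> = id \<and> \<tau> \<circ> \<sigma> = id)"

lemma inv_G:
  assumes "\<sigma> \<in> G"
  shows "inv_G \<sigma> \<in> G" "\<sigma> \<circ> inv_G \<sigma> = id" "inv_G \<sigma> \<circ> \<sigma> = id"
    "\<sigma> (inv_G \<sigma> x) = x" "inv_G \<sigma> (\<sigma> x) = x"
proof -
  have "inv_G \<sigma> \<in> G \<and> \<sigma> \<circ> inv_G \<sigma> = id \<and> inv_G \<sigma> \<circ> \<sigma> = id"
  proof -
    obtain \<tau> where "\<tau> \<in> G \<and> \<sigma> \<circ> \<tau> = id \<and> \<tau> \<circ> \<sigma> = id"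
      using ex_inverse_G[OF assms] by blast
    then show ?thesis
      unfolding inv_G_def by (rule someI[where P = "\<lambda>\<tau>. \<tau> \<in> G \<and> \<sigma> \<circ> \<tau> = id \<and> \<tau> \<circ> \<sigma> = id"])
  qed
  then show "inv_G \<sigma> \<in> G" "\<sigma> \<circ> inv_G \<sigma> = id" "inv_G \<sigma> \<circ> \<sigma> = id"
    "\<sigma> (inv_G \<sigma> x) = x" "inv_G \<sigma> (\<sigma> x) = x"
    by (auto simp: fun_eq_iff)
qed

lemma comp_inv_G:
  assumes "\<sigma> \<in> G" shows "inv_G \<sigma> \<circ> (\<sigma> \<circ> \<tau>) = \<tau>" "\<sigma> \<circ> (inv_G \<sigma> \<circ> \<tau>) = \<tau>"
  using inv_G(4,5)[OF assms] by (simp_all add: fun_eq_iff)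

lemma bij_betw_comp_left:
  assumes "\<sigma> \<in> G" shows "bij_betw (\<lambda>\<tau>. \<sigma> \<circ> \<tau>) G G"
proof (rule bij_betwI[where g = "\<lambda>\<tau>. inv_G \<sigma> \<circ> \<tau>"])
qed (use assms inv_G(1)[OF assms] comp_G comp_inv_G[OF assms] in auto)

definition A :: "'r set" where
  "A = {a \<in> C. \<forall>\<sigma>\<in>G. \<sigma> a = a}"

lemma AC: "a \<in> A \<Longrightarrow> a \<in> C" and A_fixed: "\<sigma> \<in> G \<Longrightarrow> a \<in> A \<Longrightarrow> \<sigma> a = a"
  by (auto simp: A_def)

lemma A_I: "a \<in> C \<Longrightarrow> (\<And>\<sigma>. \<sigma> \<in> G \<Longrightarrow> \<sigma> a = a) \<Longrightarrow> a \<in> A"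
  unfolding A_def by blast

sublocale A: subring_of A
proof
  show "1 \<in> A" by (rule A_I) (auto simp: one_C hom_one)
  fix x y assume x: "x \<in> A" and y: "y \<in> A"
  note C = AC[OF x] AC[OF y] and fixed = A_fixed[OF _ x] A_fixed[OF _ y]
  show "x + y \<in> A"
  proof (rule A_I)
    fix \<sigma> assume \<sigma>: "\<sigma> \<in> G"
    show "\<sigma> (x + y) = x + y" unfolding hom_add[OF \<sigma>] fixed[OF \<sigma>] ..
  qed (use C in \<open>rule add_C\<close>)
  show "x * y \<in> A"
  proof (rule A_I)
    fix \<sigma> assume \<sigma>: "\<sigma> \<in> G"
    show "\<sigma> (x * y) = x * y" unfolding hom_mult[OF \<sigma>] fixed[OF \<sigma>] ..
  qed (use C in \<open>rule mult_C\<close>)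
next
  fix x assume x: "x \<in> A"
  show "- x \<in> A"
  proof (rule A_I)
    fix \<sigma> assume \<sigma>: "\<sigma> \<in> G"
    show "\<sigma> (- x) = - x" unfolding hom_uminus[OF \<sigma>] A_fixed[OF \<sigma> x] ..
  qed (rule uminus_C[OF AC[OF x]])
qed

lemma trace_A:
  assumes "x \<in> C" shows "(\<Sum>\<sigma>\<in>G. \<sigma> x) \<in> A"
proof (rule A_I)
  fix \<tau> assume \<tau>: "\<tau> \<in> G"
  show "\<tau> (\<Sum>\<sigma>\<in>G. \<sigma> x) = (\<Sum>\<sigma>\<in>G. \<sigma> x)"
    unfolding hom_sum[OF \<tau>]
    using sum.reindex_bij_betw[OF bij_betw_comp_left[OF \<tau>], of "\<lambda>\<rho>. \<rho> x"] by simp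
next
  show "(\<Sum>\<sigma>\<in>G. \<sigma> x) \<in> C" proof (rule sum_C)
    fix \<sigma> assume "\<sigma> \<in> G"
    then show "\<sigma> x \<in> C" using assms by (rule hom_C)
  qed
qed

lemma norm_A:
  assumes "x \<in> C" shows "(\<Prod>\<sigma>\<in>G. \<sigma> x) \<in> A"
proof (rule A_I)
  fix \<tau> assume \<tau>: "\<tau> \<in> G"
  show "\<tau> (\<Prod>\<sigma>\<in>G. \<sigma> x) = (\<Prod>\<sigma>\<in>G. \<sigma> x)"
    unfolding hom_prod[OF \<tau>]
    using prod.reindex_bij_betw[OF bij_betw_comp_left[OF \<tau>], of "\<lambda>\<rho>. \<rho> x"] by simp
next
  show "(\<Prod>\<sigma>\<in>G. \<sigma> x) \<in> C" proof (rule prod_C)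
    fix \<sigma> assume "\<sigma> \<in> G"
    then show "\<sigma> x \<in> C" using assms by (rule hom_C)
  qed
qed

text \<open>This is linear independence of the classes of the \<open>c i\<close> in \<open>C\<close>
  modulo \<open>J\<close> over the image of \<open>A\<close>, with membership in \<open>J\<close> in
  the place of being zero. It is used for \<open>J\<close> equal to \<open>Z\<close>,
  \<open>n\<close> and \<open>mC\<close>: generically, in the residue field and in the
  fibre.\<close>

definition independent :: "'r set \<Rightarrow> 'i set \<Rightarrow> ('i \<Rightarrow> 'r) \<Rightarrow> bool" where
  "independent J K c \<longleftrightarrow>
     (\<forall>a. (\<forall>i\<in>K. a i \<in> A) \<and> (\<Sum>i\<in>K. a i * c i) \<in> J \<longrightarrow> (\<forall>i\<in>K. a i \<in> J))"

definition spanning :: "'r set \<Rightarrow> 'i set \<Rightarrow> ('i \<Rightarrow> 'r) \<Rightarrow> bool" where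
  "spanning J K c \<longleftrightarrow> (\<forall>x\<in>C. \<exists>a. (\<forall>i\<in>K. a i \<in> A) \<and> x - (\<Sum>i\<in>K. a i * c i) \<in> J)"

subsection \<open>Decomposition and inertia\<close>

definition decomposition :: "'r set \<Rightarrow> ('r \<Rightarrow> 'r) set" where
  "decomposition P = {\<sigma> \<in> G. \<forall>c\<in>C. \<sigma> c \<in> P \<longleftrightarrow> c \<in> P}"

definition inertia :: "'r set \<Rightarrow> ('r \<Rightarrow> 'r) set" where
  "inertia P = {\<sigma> \<in> G. \<forall>c\<in>C. \<sigma> c - c \<in> P}"

lemma decompositionD: "\<sigma> \<in> decomposition P \<Longrightarrow> \<sigma> \<in> G"
    "\<sigma> \<in> decomposition P \<Longrightarrow> c \<in> C \<Longrightarrow> \<sigma> c \<in> P \<longleftrightarrow> c \<in> P"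
  by (auto simp: decomposition_def)

lemma id_decomposition: "id \<in> decomposition P"
  by (simp add: decomposition_def id_G)

lemma inv_decomposition: "\<sigma> \<in> decomposition P \<Longrightarrow> inv_G \<sigma> \<in> decomposition P"
proof -
  assume \<sigma>: "\<sigma> \<in> decomposition P"
  have "inv_G \<sigma> c \<in> P \<longleftrightarrow> c \<in> P" if "c \<in> C" for c
    using decompositionD(2)[OF \<sigma> hom_C[OF inv_G(1)[OF decompositionD(1)[OF \<sigma>]] that]]
    unfolding inv_G(4)[OF decompositionD(1)[OF \<sigma>]] by simp
  then show ?thesis
    using inv_G(1)[OF decompositionD(1)[OF \<sigma>]] unfolding decomposition_def by blast
qed

lemma comp_decomposition:
  "\<sigma> \<in> decomposition P \<Longrightarrow> \<tau> \<in> decomposition P \<Longrightarrow> \<sigma> \<circ> \<tau> \<in> decomposition P"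
  unfolding decomposition_def using hom_C comp_G by simp

lemma finite_decomposition: "finite (decomposition P)"
  using finite_G by (simp add: decomposition_def)

lemma inertia_decomposition:
  assumes "ideal_in P" shows "inertia P \<subseteq> decomposition P"
proof
  fix \<sigma> assume \<sigma>: "\<sigma> \<in> inertia P"
  have "\<sigma> c \<in> P \<longleftrightarrow> c \<in> P" if "c \<in> C" for c
    using ideal_add_cancel[OF assms, of "\<sigma> c - c" c] \<sigma> that
    by (auto simp: inertia_def)
  then show "\<sigma> \<in> decomposition P" using \<sigma> by (auto simp: inertia_def decomposition_def)
qed

text \<open>By finiteness two powers of \<open>\<sigma>\<close> coincide. That the inverse is a
  power turns one inclusion between conjugates of a prime into an equality.\<close>

lemma finite_order:
  assumes "\<sigma> \<in> G" shows "\<exists>k. inv_G \<sigma> = \<sigma> ^^ k"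
proof -
  have G: "\<sigma> ^^ k \<in> G" for k
  proof (induction k)
    case 0
    then show ?case using id_G by (simp add: id_def)
  next
    case (Suc k)
    show ?case unfolding funpow.simps using assms Suc by (rule comp_G)
  qed
  have "\<not> inj (\<lambda>k. \<sigma> ^^ k)"
  proof
    assume "inj (\<lambda>k. \<sigma> ^^ k)"
    moreover have "range (\<lambda>k. \<sigma> ^^ k) \<subseteq> G" using G by (rule image_subsetI)
    ultimately show False
      using finite_subset[OF _ finite_G] finite_imageD infinite_UNIV_nat by blast
  qed
  then obtain i j where ij: "\<sigma> ^^ i = \<sigma> ^^ j" "i < j"
    unfolding inj_def by (metis linorder_neqE_nat)
  obtain k where k: "j = i + Suc k" using ij(2) less_iff_Suc_add by auto
  have "(\<sigma> ^^ i) ((\<sigma> ^^ Suc k) x) = (\<sigma> ^^ i) x" for x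
    using ij(1) unfolding k funpow_add by (simp add: fun_eq_iff)
  then have "(\<sigma> ^^ Suc k) x = x" for x
    using inv_G(5)[OF G[of i]] by metis
  then have "\<sigma> ((\<sigma> ^^ k) x) = x" for x by simp
  then have "(\<sigma> ^^ k) x = inv_G \<sigma> x" for x
    using inv_G(5)[OF assms] by metis
  then show ?thesis by (metis ext)
qed

text \<open>Distinct conjugates of \<open>P\<close> are incomparable. If
  \<open>\<sigma> c \<in> P\<close> always forced \<open>c \<in> P\<close>, the same would hold for
  every power of \<open>\<sigma>\<close>, in particular for its inverse, and \<open>\<sigma>\<close>
  would belong to the decomposition group.\<close>

lemma ex_notin_conjugate_in:
  assumes \<sigma>: "\<sigma> \<in> G" "\<sigma> \<notin> decomposition P"
  shows "\<exists>c\<in>C. c \<notin> P \<and> \<sigma> c \<in> P"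
proof (rule ccontr)
  assume "\<not> ?thesis"
  then have down: "c \<in> P" if "c \<in> C" "\<sigma> c \<in> P" for c using that by blast
  have C: "(\<sigma> ^^ k) c \<in> C" if "c \<in> C" for k c
    using that by (induction k) (auto simp: hom_C \<sigma>(1))
  have down_pow: "c \<in> P" if "c \<in> C" "(\<sigma> ^^ k) c \<in> P" for c k
    using that by (induction k) (auto dest: down[OF C])
  obtain k where k: "inv_G \<sigma> = \<sigma> ^^ k" using finite_order[OF \<sigma>(1)] by blast
  have "\<sigma> c \<in> P" if "c \<in> C" "c \<in> P" for c
    using down_pow[of "\<sigma> c" k] that hom_C[OF \<sigma>(1)] inv_G(5)[OF \<sigma>(1), of c] unfolding k by simp
  then show False using \<sigma> down by (auto simp: decomposition_def)
qed

text \<open>A product of elements outside \<open>P\<close>, one for each \<open>\<sigma>\<close>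
  outside the decomposition group and sent into \<open>P\<close> by it. As a factor it cuts a sum
  over \<open>G\<close> down to the decomposition group, modulo \<open>P\<close>.\<close>

lemma ex_separating:
  assumes P: "prime_in P"
  shows "\<exists>e\<in>C. e \<notin> P \<and> (\<forall>\<sigma>\<in>G - decomposition P. \<sigma> e \<in> P)"
proof -
  have "\<forall>\<sigma>\<in>G - decomposition P. \<exists>c\<in>C. c \<notin> P \<and> \<sigma> c \<in> P"
    using ex_notin_conjugate_in by blast
  then obtain c where c: "\<And>\<sigma>. \<sigma> \<in> G - decomposition P \<Longrightarrow> c \<sigma> \<in> C \<and> c \<sigma> \<notin> P \<and> \<sigma> (c \<sigma>) \<in> P"
    by metis
  let ?e = "\<Prod>\<sigma>\<in>G - decomposition P. c \<sigma>"
  have "?e \<in> C" using c by (intro prod_C) auto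
  moreover have "?e \<notin> P" using c finite_G by (intro prime_prod[OF P]) auto
  moreover have "\<sigma> ?e \<in> P" if "\<sigma> \<in> G - decomposition P" for \<sigma>
    unfolding hom_prod[OF DiffD1[OF that]]
    using that c finite_G hom_C
    by (intro ideal_prod[OF prime_inD(1)[OF P], of _ \<sigma>]) auto
  ultimately show ?thesis by blast
qed

text \<open>\<open>D\<close> represents the cosets of the inertia group, hence the group of
  automorphisms that the decomposition group induces on \<open>C\<close> modulo \<open>P\<close>,
  without that quotient being formed.\<close>

lemma ex_decomposition_representatives:
  assumes P: "prime_in P"
  obtains D where "D \<subseteq> decomposition P" "card D * card (inertia P) = card (decomposition P)"
    "\<And>\<sigma>. \<sigma> \<in> decomposition P \<Longrightarrow> \<exists>\<delta>\<in>D. \<forall>c\<in>C. \<sigma> c - \<delta> c \<in> P"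
    "\<And>\<sigma> \<tau>. \<sigma> \<in> D \<Longrightarrow> \<tau> \<in> D \<Longrightarrow> \<sigma> \<noteq> \<tau> \<Longrightarrow> \<exists>c\<in>C. \<sigma> c - \<tau> c \<notin> P"
proof -
  note I = prime_inD(1)[OF P]
  define R where "R = {(\<sigma>, \<tau>). \<sigma> \<in> decomposition P \<and> \<tau> \<in> decomposition P \<and> (\<forall>c\<in>C. \<sigma> c - \<tau> c \<in> P)}"
  have refl: "(\<sigma>, \<sigma>) \<in> R" if "\<sigma> \<in> decomposition P" for \<sigma>
    using that ideal_inD(2)[OF I] by (simp add: R_def)
  have sym: "(\<tau>, \<sigma>) \<in> R" if "(\<sigma>, \<tau>) \<in> R" for \<sigma> \<tau>
    using that ideal_uminus[OF I] unfolding R_def by fastforce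
  have trans: "(\<sigma>, \<rho>) \<in> R" if "(\<sigma>, \<tau>) \<in> R" "(\<tau>, \<rho>) \<in> R" for \<sigma> \<tau> \<rho>
    using that ideal_inD(3)[OF I, of "\<sigma> c - \<tau> c" "\<tau> c - \<rho> c" for c] unfolding R_def by fastforce
  define rep where "rep \<sigma> = (SOME \<tau>. (\<sigma>, \<tau>) \<in> R)" for \<sigma>
  have rep: "(\<sigma>, rep \<sigma>) \<in> R" if "\<sigma> \<in> decomposition P" for \<sigma>
    unfolding rep_def using refl[OF that] by (rule someI[where P = "\<lambda>\<tau>. (\<sigma>, \<tau>) \<in> R"])
  have rep_eq: "rep \<sigma> = rep \<tau>" if "(\<sigma>, \<tau>) \<in> R" for \<sigma> \<tau>
  proof -
    have "(\<sigma>, \<rho>) \<in> R \<longleftrightarrow> (\<tau>, \<rho>) \<in> R" for \<rho>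
      using that sym trans by blast
    then show ?thesis by (simp add: rep_def)
  qed
  have inRD: "\<sigma> \<in> decomposition P" "\<tau> \<in> decomposition P" if "(\<sigma>, \<tau>) \<in> R" for \<sigma> \<tau>
    using that by (auto simp: R_def)
  let ?D = "rep ` decomposition P"
  have D: "?D \<subseteq> decomposition P" using rep inRD by blast
  have rep_id: "rep \<delta> = \<delta>" if "\<delta> \<in> ?D" for \<delta>
  proof -
    obtain \<sigma> where \<sigma>: "\<sigma> \<in> decomposition P" "\<delta> = rep \<sigma>"
      using \<open>\<delta> \<in> ?D\<close> by (rule imageE)
    show ?thesis using rep_eq[OF rep[OF \<sigma>(1)]] \<sigma>(2) by simp
  qed
  \<comment> \<open>The class of \<open>\<delta>\<close> consists of the
    \<open>\<delta> \<circ> \<iota>\<close> with \<open>\<iota>\<close> in the inertia group, so all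
    classes have the same size.\<close>
  have fibre: "card {\<sigma> \<in> decomposition P. rep \<sigma> = \<delta>} = card (inertia P)" if \<delta>: "\<delta> \<in> ?D" for \<delta>
  proof -
    have \<delta>': "\<delta> \<in> decomposition P" "\<delta> \<in> G" using D \<delta> decompositionD by blast+
    have "{\<sigma> \<in> decomposition P. rep \<sigma> = \<delta>} = {\<sigma>. (\<delta>, \<sigma>) \<in> R}"
    proof (intro equalityI subsetI)
      fix \<sigma> assume "\<sigma> \<in> {\<sigma> \<in> decomposition P. rep \<sigma> = \<delta>}"
      then have "(\<sigma>, \<delta>) \<in> R" using rep by blast
      then show "\<sigma> \<in> {\<sigma>. (\<delta>, \<sigma>) \<in> R}" using sym by blast
    next
      fix \<sigma> assume "\<sigma> \<in> {\<sigma>. (\<delta>, \<sigma>) \<in> R}"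
      then have \<sigma>: "(\<delta>, \<sigma>) \<in> R" by simp
      then have "rep \<sigma> = \<delta>" using rep_eq[OF \<sigma>] rep_id[OF \<delta>] by simp
      then show "\<sigma> \<in> {\<sigma> \<in> decomposition P. rep \<sigma> = \<delta>}" using inRD(2)[OF \<sigma>] by blast
    qed
    also have "bij_betw (\<lambda>\<iota>. \<delta> \<circ> \<iota>) (inertia P) {\<sigma>. (\<delta>, \<sigma>) \<in> R}"
    proof (rule bij_betwI[where g = "\<lambda>\<sigma>. inv_G \<delta> \<circ> \<sigma>"])
      show "(\<lambda>\<iota>. \<delta> \<circ> \<iota>) \<in> inertia P \<rightarrow> {\<sigma>. (\<delta>, \<sigma>) \<in> R}"
      proof
        fix \<iota> assume \<iota>: "\<iota> \<in> inertia P"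
        then have \<iota>': "\<iota> \<in> decomposition P" using inertia_decomposition[OF I] by blast
        have "\<delta> c - \<delta> (\<iota> c) \<in> P" if c: "c \<in> C" for c
        proof -
          have cC: "c - \<iota> c \<in> C" using c hom_C decompositionD(1)[OF \<iota>'] by (intro diff_C) auto
          have "\<iota> c - c \<in> P" using \<iota> c by (auto simp: inertia_def)
          then have "c - \<iota> c \<in> P" using ideal_uminus[OF I] by fastforce
          then have "\<delta> (c - \<iota> c) \<in> P" using decompositionD(2)[OF \<delta>'(1) cC] by blast
          then show ?thesis by (simp add: hom_diff[OF \<delta>'(2)])
        qed
        then show "\<delta> \<circ> \<iota> \<in> {\<sigma>. (\<delta>, \<sigma>) \<in> R}"
          using \<delta>' comp_decomposition[OF \<delta>'(1) \<iota>'] by (simp add: R_def)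
      qed
      show "(\<lambda>\<sigma>. inv_G \<delta> \<circ> \<sigma>) \<in> {\<sigma>. (\<delta>, \<sigma>) \<in> R} \<rightarrow> inertia P"
      proof
        fix \<sigma> assume "\<sigma> \<in> {\<sigma>. (\<delta>, \<sigma>) \<in> R}"
        then have \<sigma>: "\<sigma> \<in> decomposition P" "\<And>c. c \<in> C \<Longrightarrow> \<delta> c - \<sigma> c \<in> P" by (auto simp: R_def)
        have "inv_G \<delta> (\<sigma> c) - c \<in> P" if c: "c \<in> C" for c
        proof -
          have "\<sigma> c - \<delta> c \<in> P" using ideal_uminus[OF I \<sigma>(2)[OF c]] by simp
          moreover have "\<sigma> c - \<delta> c \<in> C"
            using c hom_C decompositionD(1)[OF \<sigma>(1)] \<delta>'(2) by (intro diff_C) auto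
          ultimately have "inv_G \<delta> (\<sigma> c - \<delta> c) \<in> P"
            using decompositionD(2)[OF inv_decomposition[OF \<delta>'(1)]] by blast
          then show ?thesis by (simp add: hom_diff inv_G[OF \<delta>'(2)])
        qed
        then show "inv_G \<delta> \<circ> \<sigma> \<in> inertia P"
          using comp_G[OF inv_G(1)[OF \<delta>'(2)] decompositionD(1)[OF \<sigma>(1)]]
          unfolding inertia_def by (intro CollectI conjI ballI) simp_all
      qed
    qed (rule comp_inv_G[OF \<delta>'(2)])+
    ultimately show ?thesis using bij_betw_same_card by metis
  qed
  have "card (decomposition P) = (\<Sum>\<delta>\<in>?D. card {\<sigma> \<in> decomposition P. rep \<sigma> = \<delta>})"
    using finite_decomposition sum.image_gen[of "decomposition P" "\<lambda>_. 1::nat" rep] by simp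
  also have "\<dots> = card ?D * card (inertia P)" using fibre by simp
  finally have card: "card ?D * card (inertia P) = card (decomposition P)" ..
  show ?thesis
  proof (rule that[OF D card])
    show "\<exists>\<delta>\<in>?D. \<forall>c\<in>C. \<sigma> c - \<delta> c \<in> P" if "\<sigma> \<in> decomposition P" for \<sigma>
      using rep[OF that] that by (auto simp: R_def)
    show "\<exists>c\<in>C. \<sigma> c - \<tau> c \<notin> P" if "\<sigma> \<in> ?D" "\<tau> \<in> ?D" "\<sigma> \<noteq> \<tau>" for \<sigma> \<tau>
    proof (rule ccontr)
      assume "\<not> ?thesis"
      then have "(\<sigma>, \<tau>) \<in> R" using that D by (auto simp: R_def)
      then show False using rep_eq rep_id that by metis
    qed
  qed
qed

text \<open>One half of Artin's theorem: the degree is at most the order of the induced group. With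
  more elements than automorphisms there is a nontrivial vector \<open>x\<close> orthogonal modulo
  \<open>P\<close> to all conjugates of the \<open>c i\<close>. Its entries need not be invariant;
  adding up their conjugates over \<open>G\<close> gives a relation with coefficients in
  \<open>A\<close>. The factors \<open>e\<close> and \<open>y\<close> make this sum ignore the
  elements outside the decomposition group and keep one coefficient outside
  \<open>P\<close>.\<close>

lemma card_inertia_le_independent:
  assumes P: "prime_in P" and char: "\<And>k::nat. k > 0 \<Longrightarrow> of_nat k \<notin> P"
    and K: "finite K" "\<And>i. i \<in> K \<Longrightarrow> c i \<in> C" "independent P K c"
  shows "card K * card (inertia P) \<le> card (decomposition P)"
proof (rule ccontr)
  note I = prime_inD(1)[OF P]
  assume less: "\<not> ?thesis"
  obtain D where D: "D \<subseteq> decomposition P" "card D * card (inertia P) = card (decomposition P)"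
    "\<And>\<sigma>. \<sigma> \<in> decomposition P \<Longrightarrow> \<exists>\<delta>\<in>D. \<forall>c\<in>C. \<sigma> c - \<delta> c \<in> P"
    using ex_decomposition_representatives[OF P] by metis
  have "card D < card K"
  proof (rule ccontr)
    assume "\<not> ?thesis"
    then have "card K * card (inertia P) \<le> card D * card (inertia P)" by simp
    then show False using less D(2) by simp
  qed
  moreover have "finite D" using D(1) finite_decomposition finite_subset by blast
  moreover have "\<delta> (c i) \<in> C" if "\<delta> \<in> D" "i \<in> K" for \<delta> i
    using that D(1) K(2) hom_C decompositionD(1) by blast
  ultimately obtain x where x: "\<forall>i\<in>K. x i \<in> C" "\<exists>i\<in>K. x i \<notin> P"
      "\<forall>\<delta>\<in>D. (\<Sum>i\<in>K. \<delta> (c i) * x i) \<in> P"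
    using linear_system_mod_prime[OF P, of D K "\<lambda>\<delta> i. \<delta> (c i)"] K(1) by auto
  have xD: "(\<Sum>i\<in>K. \<sigma> (c i) * x i) \<in> P" if \<sigma>: "\<sigma> \<in> decomposition P" for \<sigma>
  proof -
    obtain \<delta> where \<delta>: "\<delta> \<in> D" "\<forall>c\<in>C. \<sigma> c - \<delta> c \<in> P" using D(3)[OF \<sigma>] by blast
    have "(\<Sum>i\<in>K. \<sigma> (c i) * x i) = (\<Sum>i\<in>K. (\<sigma> (c i) - \<delta> (c i)) * x i) + (\<Sum>i\<in>K. \<delta> (c i) * x i)"
      by (simp add: sum.distrib[symmetric] left_diff_distrib)
    also have "\<dots> \<in> P"
    proof (rule ideal_inD(3)[OF I])
      show "(\<Sum>i\<in>K. (\<sigma> (c i) - \<delta> (c i)) * x i) \<in> P"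
        using x \<delta> K(2) by (intro ideal_sum[OF I] ideal_inD(5)[OF I]) auto
      show "(\<Sum>i\<in>K. \<delta> (c i) * x i) \<in> P" using x(3) \<delta>(1) by blast
    qed
    finally show ?thesis .
  qed
  obtain k where k: "k \<in> K" "x k \<notin> P" using x(2) by blast
  obtain e where e: "e \<in> C" "e \<notin> P" "\<And>\<sigma>. \<sigma> \<in> G \<Longrightarrow> \<sigma> \<notin> decomposition P \<Longrightarrow> \<sigma> e \<in> P"
    using ex_separating[OF P] by blast
  \<comment> \<open>\<open>y\<close> collects the factors other than \<open>e * x k\<close> of the
    norm \<open>N\<close> over the decomposition group, so that \<open>e * y * x k\<close> is
    \<open>N\<close>.\<close>
  define y where "y = (\<Prod>\<sigma>\<in>decomposition P - {id}. \<sigma> (e * x k))"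
  define N where "N = (\<Prod>\<sigma>\<in>decomposition P. \<sigma> (e * x k))"
  have N: "N = e * y * x k"
    using prod.remove[OF finite_decomposition id_decomposition, of "\<lambda>\<sigma>. \<sigma> (e * x k)" P]
    by (simp add: N_def y_def mult_ac)
  have ek: "e * x k \<in> C" "e * x k \<notin> P"
    using e(1,2) k x(1) mult_C prime_inD(3)[OF P, of e "x k"] by auto
  have yC: "y \<in> C" using ek(1) hom_C decompositionD(1) by (auto simp: y_def intro!: prod_C)
  have NC: "N \<in> C" using ek(1) hom_C decompositionD(1) by (auto simp: N_def intro!: prod_C)
  have NP: "N \<notin> P" unfolding N_def
    using ek decompositionD hom_C finite_decomposition by (intro prime_prod[OF P]) auto
  define a where "a i = (\<Sum>\<sigma>\<in>G. \<sigma> (e * y * x i))" for i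
  have "a i \<in> A" if "i \<in> K" for i
    unfolding a_def using that x(1) e(1) yC by (intro trace_A mult_C) auto
  moreover have "(\<Sum>i\<in>K. a i * c i) \<in> P"
  proof -
    have "(\<Sum>i\<in>K. a i * c i) = (\<Sum>\<sigma>\<in>G. \<Sum>i\<in>K. \<sigma> (e * y * x i) * c i)"
      unfolding a_def sum_distrib_right by (rule sum.swap)
    \<comment> \<open>Writing \<open>c i\<close> as \<open>\<sigma> (inv_G \<sigma> (c i))\<close>
      exhibits each summand as \<open>\<sigma>\<close> applied to a multiple of a scalar product of
      \<open>x\<close> with conjugates of the \<open>c i\<close>.\<close>
    also have "\<dots> = (\<Sum>\<sigma>\<in>G. \<sigma> (e * y * (\<Sum>i\<in>K. inv_G \<sigma> (c i) * x i)))"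
      by (intro sum.cong refl) (simp add: hom_mult hom_sum inv_G sum_distrib_left mult_ac)
    also have "\<dots> \<in> P"
    proof (rule ideal_sum[OF I])
      fix \<sigma> assume \<sigma>: "\<sigma> \<in> G"
      have sC: "(\<Sum>i\<in>K. inv_G \<sigma> (c i) * x i) \<in> C"
        using x(1) K(2) hom_C inv_G(1)[OF \<sigma>] by (intro sum_C mult_C) auto
      show "\<sigma> (e * y * (\<Sum>i\<in>K. inv_G \<sigma> (c i) * x i)) \<in> P"
      proof (cases "\<sigma> \<in> decomposition P")
        case True
        have "e * y * (\<Sum>i\<in>K. inv_G \<sigma> (c i) * x i) \<in> P"
          using xD[OF inv_decomposition[OF True]] e(1) yC by (intro ideal_inD(4)[OF I] mult_C)
        then show ?thesis using decompositionD(2)[OF True] mult_C e(1) yC sC by blast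
      next
        case False
        then show ?thesis
          unfolding hom_mult[OF \<sigma>] mult.assoc using e(3)[OF \<sigma>] hom_C[OF \<sigma>] yC sC
          by (intro ideal_inD(5)[OF I] mult_C) auto
      qed
    qed
    finally show ?thesis .
  qed
  ultimately have "a k \<in> P" using K(3) k(1) unfolding independent_def by blast
  moreover have "a k \<notin> P"
  proof
    assume ak: "a k \<in> P"
    \<comment> \<open>\<open>N\<close> is fixed by the decomposition group, so modulo
      \<open>P\<close> the coefficient \<open>a k\<close> is the order of that group times
      \<open>N\<close>. Here characteristic zero enters.\<close>
    have "a k = (\<Sum>\<sigma>\<in>decomposition P. \<sigma> N) + (\<Sum>\<sigma>\<in>G - decomposition P. \<sigma> N)"
      unfolding a_def N[symmetric]
      using sum.subset_diff[of "decomposition P" G "\<lambda>\<sigma>. \<sigma> N"] decompositionD(1) finite_G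
      by (auto simp: add.commute)
    moreover have "(\<Sum>\<sigma>\<in>G - decomposition P. \<sigma> N) \<in> P"
    proof (rule ideal_sum[OF I])
      fix \<sigma> assume \<sigma>: "\<sigma> \<in> G - decomposition P"
      then show "\<sigma> N \<in> P"
        unfolding N hom_mult[OF DiffD1[OF \<sigma>]] mult.assoc
        using e(3) hom_C yC x(1) k(1) by (intro ideal_inD(5)[OF I] mult_C) auto
    qed
    moreover have "(\<Sum>\<sigma>\<in>decomposition P. \<sigma> N) = of_nat (card (decomposition P)) * N"
    proof -
      have "\<sigma> N = N" if \<sigma>: "\<sigma> \<in> decomposition P" for \<sigma>
      proof -
        have "bij_betw (\<lambda>\<tau>. \<sigma> \<circ> \<tau>) (decomposition P) (decomposition P)"
        proof (rule bij_betwI[where g = "\<lambda>\<tau>. inv_G \<sigma> \<circ> \<tau>"])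
        qed (use \<sigma> inv_decomposition comp_decomposition comp_inv_G[OF decompositionD(1)[OF \<sigma>]]
            in blast)+
        from prod.reindex_bij_betw[OF this, of "\<lambda>\<rho>. \<rho> (e * x k)"]
        show ?thesis unfolding N_def hom_prod[OF decompositionD(1)[OF \<sigma>]] by simp
      qed
      then have "(\<Sum>\<sigma>\<in>decomposition P. \<sigma> N) = (\<Sum>\<sigma>\<in>decomposition P. N)"
        by (intro sum.cong refl)
      then show ?thesis by simp
    qed
    ultimately have "of_nat (card (decomposition P)) * N \<in> P"
      using ak ideal_add_cancel[OF I] by metis
    moreover have "card (decomposition P) > 0"
      using finite_decomposition id_decomposition card_gt_0_iff by blast
    ultimately show False
      using prime_inD(3)[OF P of_nat_C NC] char NP by blast
  qed
  ultimately show False by blast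
qed

text \<open>The other half of Artin's theorem. With fewer spanning elements than induced
  automorphisms, a nontrivial combination of the automorphisms vanishes modulo \<open>P\<close> on
  the spanning elements, and then on all of \<open>C\<close>, because the automorphisms fix the
  coefficients from \<open>A\<close>. Dedekind's lemma excludes this.\<close>

lemma card_inertia_ge_spanning:
  assumes P: "prime_in P" and K: "finite K" "\<And>i. i \<in> K \<Longrightarrow> c i \<in> C" "spanning P K c"
  shows "card (decomposition P) \<le> card K * card (inertia P)"
proof (rule ccontr)
  note I = prime_inD(1)[OF P]
  assume less: "\<not> ?thesis"
  obtain D where D: "D \<subseteq> decomposition P" "card D * card (inertia P) = card (decomposition P)"
    "\<And>\<sigma> \<tau>. \<sigma> \<in> D \<Longrightarrow> \<tau> \<in> D \<Longrightarrow> \<sigma> \<noteq> \<tau> \<Longrightarrow> \<exists>c\<in>C. \<sigma> c - \<tau> c \<notin> P"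
    using ex_decomposition_representatives[OF P] by metis
  have DG: "\<delta> \<in> G" if "\<delta> \<in> D" for \<delta> using that D(1) decompositionD(1) by blast
  have "card K < card D"
  proof (rule ccontr)
    assume "\<not> ?thesis"
    then have "card D * card (inertia P) \<le> card K * card (inertia P)" by simp
    then show False using less D(2) by simp
  qed
  moreover have fin: "finite D" using D(1) finite_decomposition finite_subset by blast
  ultimately obtain x where x: "\<forall>\<delta>\<in>D. x \<delta> \<in> C" "\<exists>\<delta>\<in>D. x \<delta> \<notin> P"
      "\<forall>i\<in>K. (\<Sum>\<delta>\<in>D. \<delta> (c i) * x \<delta>) \<in> P"
    using linear_system_mod_prime[OF P, of K D "\<lambda>i \<delta>. \<delta> (c i)"] K(1,2) hom_C DG by blast
  have "(\<Sum>\<delta>\<in>D. x \<delta> * \<delta> b) \<in> P" if b: "b \<in> C" for b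
  proof -
    obtain a where a: "\<forall>i\<in>K. a i \<in> A" "b - (\<Sum>i\<in>K. a i * c i) \<in> P"
      using K(3) b unfolding spanning_def by blast
    let ?r = "b - (\<Sum>i\<in>K. a i * c i)"
    have "\<delta> b = \<delta> ?r + (\<Sum>i\<in>K. a i * \<delta> (c i))" if "\<delta> \<in> D" for \<delta>
    proof -
      have "\<delta> (a i) = a i" if "i \<in> K" for i
        using A_fixed[OF DG[OF \<open>\<delta> \<in> D\<close>]] a(1) that by blast
      then show ?thesis using DG[OF that] by (simp add: hom_diff hom_sum hom_mult)
    qed
    then have "x \<delta> * \<delta> b = x \<delta> * \<delta> ?r + (\<Sum>i\<in>K. a i * (\<delta> (c i) * x \<delta>))" if "\<delta> \<in> D" for \<delta>
      unfolding \<open>\<And>\<delta>. \<delta> \<in> D \<Longrightarrow> \<delta> b = \<delta> ?r + (\<Sum>i\<in>K. a i * \<delta> (c i))\<close>[OF that]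
      by (simp add: distrib_left sum_distrib_left mult_ac)
    then have "(\<Sum>\<delta>\<in>D. x \<delta> * \<delta> b) = (\<Sum>\<delta>\<in>D. x \<delta> * \<delta> ?r) + (\<Sum>\<delta>\<in>D. \<Sum>i\<in>K. a i * (\<delta> (c i) * x \<delta>))"
      unfolding sum.distrib[symmetric] by (rule sum.cong[OF refl])
    also have "(\<Sum>\<delta>\<in>D. \<Sum>i\<in>K. a i * (\<delta> (c i) * x \<delta>)) = (\<Sum>i\<in>K. a i * (\<Sum>\<delta>\<in>D. \<delta> (c i) * x \<delta>))"
      by (subst sum.swap) (simp add: sum_distrib_left)
    also have "(\<Sum>\<delta>\<in>D. x \<delta> * \<delta> ?r) + \<dots> \<in> P"
    proof (rule ideal_inD(3)[OF I])
      have "\<delta> ?r \<in> P" if "\<delta> \<in> D" for \<delta>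
        using a(2) decompositionD(2) D(1) that ideal_inD(1)[OF I a(2)] by blast
      then show "(\<Sum>\<delta>\<in>D. x \<delta> * \<delta> ?r) \<in> P"
        using x(1) by (intro ideal_sum[OF I] ideal_inD(4)[OF I]) auto
      show "(\<Sum>i\<in>K. a i * (\<Sum>\<delta>\<in>D. \<delta> (c i) * x \<delta>)) \<in> P"
      proof (rule ideal_sum[OF I])
        fix i assume "i \<in> K"
        then show "a i * (\<Sum>\<delta>\<in>D. \<delta> (c i) * x \<delta>) \<in> P"
          using x(3) a(1) AC by (intro ideal_inD(4)[OF I]) auto
      qed
    qed
    finally show ?thesis .
  qed
  then have "\<forall>\<delta>\<in>D. x \<delta> \<in> P"
    using x(1) D(3) DG fin
    by (intro dedekind_mod_prime[OF P]) (auto simp: hom_C hom_mult hom_one)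
  then show False using x(2) by blast
qed

end

section \<open>Integrality over the ring of invariants\<close>

context automorphism_group begin

inductive_set adjoin :: "'r set \<Rightarrow> 'r set" for E where
  adjoin_A: "a \<in> A \<Longrightarrow> a \<in> adjoin E"
| adjoin_gen: "e \<in> E \<Longrightarrow> e \<in> adjoin E"
| adjoin_add: "x \<in> adjoin E \<Longrightarrow> y \<in> adjoin E \<Longrightarrow> x + y \<in> adjoin E"
| adjoin_mult: "x \<in> adjoin E \<Longrightarrow> y \<in> adjoin E \<Longrightarrow> x * y \<in> adjoin E"

lemma adjoin_mono: "x \<in> adjoin E \<Longrightarrow> E \<subseteq> E' \<Longrightarrow> x \<in> adjoin E'"
  by (induction rule: adjoin.induct) (auto intro: adjoin.intros)

lemma adjoin_C: "x \<in> adjoin E \<Longrightarrow> E \<subseteq> C \<Longrightarrow> x \<in> C"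
  by (induction rule: adjoin.induct) (auto simp: AC add_C mult_C)

lemma adjoin_prod: "(\<And>i. i \<in> K \<Longrightarrow> f i \<in> adjoin E) \<Longrightarrow> (\<Prod>i\<in>K. f i) \<in> adjoin E"
  by (induction K rule: infinite_finite_induct) (auto intro: adjoin.intros A.one_C)

lemma hom_adjoin:
  assumes "x \<in> adjoin E" "\<sigma> \<in> G" "\<And>e. e \<in> E \<Longrightarrow> \<sigma> e \<in> E"
  shows "\<sigma> x \<in> adjoin E"
  using assms(1)
proof (induction rule: adjoin.induct)
  case (adjoin_A a)
  then show ?case using A_fixed[OF assms(2)] adjoin.adjoin_A by simp
next
  case (adjoin_gen e)
  then show ?case using assms(3) adjoin.adjoin_gen by blast
next
  case (adjoin_add x y)
  then show ?case unfolding hom_add[OF assms(2)] by (intro adjoin.adjoin_add)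
next
  case (adjoin_mult x y)
  then show ?case unfolding hom_mult[OF assms(2)] by (intro adjoin.adjoin_mult)
qed

lemma map_poly_hom_prod:
  assumes "\<sigma> \<in> G"
  shows "map_poly \<sigma> (\<Prod>i\<in>K. p i) = (\<Prod>i\<in>K. map_poly \<sigma> (p i))"
proof -
  have mult: "map_poly \<sigma> (p * q) = map_poly \<sigma> p * map_poly \<sigma> q" for p q
    by (rule poly_eqI)
      (simp add: coeff_map_poly hom_zero[OF assms] Polynomial.coeff_mult hom_sum[OF assms] hom_mult[OF assms])
  have "map_poly \<sigma> 1 = 1"
    by (rule poly_eqI) (simp add: coeff_map_poly hom_zero[OF assms] hom_one[OF assms] coeff_1)
  then show ?thesis by (induction K rule: infinite_finite_induct) (auto simp: mult)
qed

text \<open>The witnesses are the coefficients of the product of all \<open>X - \<sigma> c\<close>.\<close>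

lemma ex_integral_relation:
  assumes c: "c \<in> C"
  obtains a where "\<And>i. a i \<in> A" "a (card G) = 1" "(\<Sum>i\<le>card G. a i * c ^ i) = 0"
proof -
  define q where "q \<sigma> = [:- \<sigma> c, 1:]" for \<sigma> :: "'r \<Rightarrow> 'r"
  define p where "p = (\<Prod>\<sigma>\<in>G. q \<sigma>)"
  have deg: "Polynomial.degree (\<Prod>\<sigma>\<in>K. q \<sigma>) \<le> card K \<and> Polynomial.coeff (\<Prod>\<sigma>\<in>K. q \<sigma>) (card K) = 1" if "finite K" for K
    using that
  proof (induction K)
    case (insert \<sigma> K)
    have "q \<sigma> * prod q K = Polynomial.smult (- \<sigma> c) (prod q K) + pCons 0 (prod q K)"
      by (simp add: q_def)
    moreover have "Polynomial.coeff (prod q K) (Suc (card K)) = 0"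
      using insert.IH by (simp add: Polynomial.coeff_eq_0)
    moreover have "Polynomial.degree (q \<sigma> * prod q K) \<le> 1 + card K"
      by (rule order_trans[OF degree_mult_le]) (use insert.IH in \<open>simp add: q_def\<close>)
    ultimately show ?case using insert.hyps insert.IH by simp
  qed simp
  have "map_poly \<tau> p = p" if \<tau>: "\<tau> \<in> G" for \<tau>
  proof -
    have "map_poly \<tau> (q \<sigma>) = q (\<tau> \<circ> \<sigma>)" for \<sigma>
      by (rule poly_eqI)
        (simp add: q_def coeff_map_poly hom_zero[OF \<tau>] coeff_pCons hom_uminus[OF \<tau>] hom_one[OF \<tau>]
          split: nat.split)
    then show ?thesis
      unfolding p_def map_poly_hom_prod[OF \<tau>]
      using prod.reindex_bij_betw[OF bij_betw_comp_left[OF \<tau>], of q] by simp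
  qed
  then have fixed: "\<tau> (Polynomial.coeff p i) = Polynomial.coeff p i" if "\<tau> \<in> G" for \<tau> i
    using coeff_map_poly[of \<tau> p i] hom_zero that by simp
  have "Polynomial.coeff (\<Prod>\<sigma>\<in>K. q \<sigma>) i \<in> C" if "K \<subseteq> G" for K i
    using finite_subset[OF that finite_G] that
  proof (induction K arbitrary: i)
    case empty
    then show ?case by (simp add: coeff_1 one_C zero_C)
  next
    case (insert \<sigma> K)
    have "q \<sigma> * prod q K = Polynomial.smult (- \<sigma> c) (prod q K) + pCons 0 (prod q K)"
      by (simp add: q_def)
    then show ?case
      using insert c hom_C
      by (auto simp: coeff_pCons intro!: add_C diff_C mult_C uminus_C zero_C split: nat.split)
  qed
  then have "Polynomial.coeff p i \<in> A" for i
    unfolding p_def[symmetric] using fixed by (intro A_I) (auto simp: p_def)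
  moreover have "Polynomial.coeff p (card G) = 1" using deg[OF finite_G] by (simp add: p_def)
  moreover have "(\<Sum>i\<le>card G. Polynomial.coeff p i * c ^ i) = 0"
  proof -
    have "Polynomial.degree p \<le> card G" using deg[OF finite_G] by (simp add: p_def)
    then have "(\<Sum>i\<le>card G. Polynomial.coeff p i * c ^ i) = poly p c"
      unfolding poly_altdef by (intro sum.mono_neutral_right) (auto simp: Polynomial.coeff_eq_0)
    also have "\<dots> = 0"
      unfolding p_def poly_prod
      by (rule prod_zero[OF finite_G]) (use id_G in \<open>auto simp: q_def intro: bexI[of _ id]\<close>)
    finally show ?thesis .
  qed
  ultimately show ?thesis by (rule that)
qed

text \<open>The monomials in \<open>E\<close> with all exponents below the order of \<open>G\<close>
  suffice: each element of \<open>C\<close> satisfies a monic equation of that degree over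
  \<open>A\<close>, which lowers an exponent that has become too large.\<close>

lemma adjoin_finite_spanning:
  assumes E: "finite E" "E \<subseteq> C"
  obtains F :: "('r \<Rightarrow> nat) set" and b where "finite F" "\<And>k. k \<in> F \<Longrightarrow> b k \<in> C"
    "\<And>x. x \<in> adjoin E \<Longrightarrow> \<exists>a. (\<forall>k\<in>F. a k \<in> A) \<and> x = (\<Sum>k\<in>F. a k * b k)"
proof -
  define N where "N = card G"
  have N: "0 < N" using finite_G id_G card_gt_0_iff unfolding N_def by blast
  define F where "F = (E \<rightarrow>\<^sub>E {..<N})"
  define b where "b k = (\<Prod>e\<in>E. e ^ k e)" for k :: "'r \<Rightarrow> nat"
  define T where "T = {x. \<exists>a. (\<forall>k\<in>F. a k \<in> A) \<and> x = (\<Sum>k\<in>F. a k * b k)}"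
  have F: "finite F" unfolding F_def using E(1) by (intro finite_PiE) auto
  have bC: "b k \<in> C" for k unfolding b_def using E(2) by (intro prod_C power_C) auto
  have bT: "b k \<in> T" if "k \<in> F" for k
  proof -
    have "(\<Sum>k'\<in>F. (if k' = k then 1 else 0) * b k') = (\<Sum>k'\<in>F. if k' = k then b k' else 0)"
      by (intro sum.cong) auto
    then show ?thesis unfolding T_def using that F A.zero_C A.one_C
      by (intro CollectI exI[of _ "\<lambda>k'. if k' = k then 1 else 0"]) simp
  qed
  have addT: "x + y \<in> T" if xy: "x \<in> T" "y \<in> T" for x y
  proof -
    obtain a a' where "\<forall>k\<in>F. a k \<in> A" "x = (\<Sum>k\<in>F. a k * b k)"
        "\<forall>k\<in>F. a' k \<in> A" "y = (\<Sum>k\<in>F. a' k * b k)"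
      using xy unfolding T_def by blast
    then show ?thesis unfolding T_def
      by (intro CollectI exI[of _ "\<lambda>k. a k + a' k"])
        (simp add: A.add_C sum.distrib distrib_right)
  qed
  have AT: "r * x \<in> T" if r: "r \<in> A" "x \<in> T" for r x
  proof -
    obtain a where "\<forall>k\<in>F. a k \<in> A" "x = (\<Sum>k\<in>F. a k * b k)"
      using r(2) unfolding T_def by blast
    then show ?thesis unfolding T_def using r(1)
      by (intro CollectI exI[of _ "\<lambda>k. r * a k"]) (simp add: A.mult_C sum_distrib_left mult.assoc)
  qed
  have zeroT: "0 \<in> T" unfolding T_def
    by (intro CollectI exI[of _ "\<lambda>_. 0"]) (simp add: A.zero_C)
  have sumT: "(\<Sum>i\<in>K. f i) \<in> T" if "\<And>i. i \<in> K \<Longrightarrow> f i \<in> T" for K and f :: "'i \<Rightarrow> 'r"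
    using that by (induction K rule: infinite_finite_induct) (auto simp: zeroT addT)
  \<comment> \<open>Multiplication by \<open>e\<close> raises one exponent; if it reaches
    \<open>N\<close>, the integral relation of \<open>e\<close> replaces the power by lower ones.
    The part of the monomial free of \<open>e\<close> is \<open>m\<close>.\<close>
  have eb: "e * b k \<in> T" if e: "e \<in> E" and k: "k \<in> F" for e k
  proof -
    define m where "m = (\<Prod>e'\<in>E - {e}. e' ^ k e')"
    have upd: "b (k(e := i)) = e ^ i * m" for i
    proof -
      have "(\<Prod>e'\<in>E - {e}. e' ^ (k(e := i)) e') = m"
        unfolding m_def by (intro prod.cong) auto
      then show ?thesis using prod.remove[OF E(1) e, of "\<lambda>e'. e' ^ (k(e := i)) e'"]
        by (simp add: b_def)
    qed
    have "k(e := i) \<in> F" if "i < N" for i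
      using k e that by (auto simp: F_def PiE_iff extensional_def)
    then have updT: "e ^ i * m \<in> T" if "i < N" for i
      using bT upd that by metis
    have "b k = e ^ k e * m" using upd[of "k e"] by simp
    then have ebk: "e * b k = e ^ Suc (k e) * m" by (simp add: mult.assoc)
    have "k e < N" using k e by (auto simp: F_def)
    then consider "Suc (k e) < N" | "Suc (k e) = N" by linarith
    then show ?thesis
    proof cases
      case 1
      then show ?thesis using updT[OF 1] unfolding ebk by blast
    next
      case 2
      obtain a where a: "\<And>i. a i \<in> A" "a (card G) = 1" "(\<Sum>i\<le>card G. a i * e ^ i) = 0"
        using ex_integral_relation[of e] e E(2) by blast
      have "(\<Sum>i\<le>N. a i * e ^ i) = (\<Sum>i<N. a i * e ^ i) + e ^ N"
        using a(2) by (simp add: N_def lessThan_Suc_atMost[symmetric])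
      then have "e ^ N + (\<Sum>i<N. a i * e ^ i) = 0"
        using a(3) by (simp add: N_def add.commute)
      then have "e ^ N = - (\<Sum>i<N. a i * e ^ i)" by (simp add: eq_neg_iff_add_eq_0)
      then have "e * b k = (\<Sum>i<N. - a i * (e ^ i * m))"
        unfolding ebk 2 by (simp add: sum_negf[symmetric] sum_distrib_right mult.assoc)
      moreover have "(\<Sum>i<N. - a i * (e ^ i * m)) \<in> T"
        using AT[OF A.uminus_C[OF a(1)] updT] by (intro sumT) blast
      ultimately show ?thesis by metis
    qed
  qed
  have mult: "x * t \<in> T" if "x \<in> adjoin E" "t \<in> T" for x t
    using that
  proof (induction arbitrary: t rule: adjoin.induct)
    case (adjoin_A a)
    then show ?case using AT by blast
  next
    case (adjoin_gen e)
    obtain a where a: "\<forall>k\<in>F. a k \<in> A" "t = (\<Sum>k\<in>F. a k * b k)"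
      using adjoin_gen(2) unfolding T_def by blast
    have "e * t = (\<Sum>k\<in>F. a k * (e * b k))" unfolding a(2) by (simp add: sum_distrib_left mult_ac)
    moreover have "(\<Sum>k\<in>F. a k * (e * b k)) \<in> T"
      using AT[OF bspec[OF a(1)] eb[OF adjoin_gen(1)]] by (intro sumT) blast
    ultimately show ?case by metis
  next
    case (adjoin_add x y)
    then show ?case by (simp add: distrib_right addT)
  next
    case (adjoin_mult x y)
    then show ?case by (simp add: mult.assoc)
  qed
  \<comment> \<open>Exponent zero is admissible because \<open>N\<close> is positive, so 1 lies in
    the span, and the span is closed under multiplication by \<open>adjoin E\<close>.\<close>
  have "b (\<lambda>e\<in>E. 0) \<in> T" using N by (intro bT) (auto simp: F_def)
  moreover have "b (\<lambda>e\<in>E. 0) = 1" by (simp add: b_def cong: prod.cong)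
  ultimately have T: "x \<in> T" if "x \<in> adjoin E" for x
    using mult[OF that, of 1] by simp
  show ?thesis
  proof (rule that[OF F bC])
    fix x assume "x \<in> adjoin E"
    from T[OF this] show "\<exists>a. (\<forall>k\<in>F. a k \<in> A) \<and> x = (\<Sum>k\<in>F. a k * b k)"
      unfolding T_def mem_Collect_eq .
  qed
qed

end

section \<open>Localisation at a prime\<close>

text \<open>
  \<open>C\<close> modulo \<open>Z\<close> is a semilocal domain whose maximal ideals are the conjugates of \<open>n\<close>; the ring
  \<open>A\<close> of invariants is local with maximal ideal \<open>A \<inter> n\<close>.
\<close>

locale semilocal_action = automorphism_group +
  fixes Z n
  assumes prime_Z: "prime_in Z" and prime_n: "prime_in n" and Z_n: "Z \<subseteq> n"
    and hom_Z: "\<sigma> \<in> G \<Longrightarrow> z \<in> Z \<Longrightarrow> \<sigma> z \<in> Z"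
    and faithful: "\<sigma> \<in> G \<Longrightarrow> \<sigma> \<noteq> id \<Longrightarrow> \<exists>c\<in>C. \<sigma> c - c \<notin> Z"
    and char: "0 < (k::nat) \<Longrightarrow> of_nat k \<notin> n"
    and semilocal: "c \<in> C \<Longrightarrow> \<forall>\<sigma>\<in>G. \<sigma> c \<notin> n \<Longrightarrow> \<exists>d\<in>C. c * d - 1 \<in> Z"
begin

lemmas ideal_Z = prime_inD(1)[OF prime_Z] and ideal_n = prime_inD(1)[OF prime_n]

lemma ZC: "z \<in> Z \<Longrightarrow> z \<in> C" and nC: "x \<in> n \<Longrightarrow> x \<in> C"
  using ideal_inD(1)[OF ideal_Z] ideal_inD(1)[OF ideal_n] by auto

text \<open>The ideal of \<open>C\<close> generated by \<open>Z\<close> and the maximal ideal of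
  \<open>A\<close>. Adding one multiple of a generator at a time gives an induction principle in
  place of finite sums.\<close>

inductive_set mC where
  mC_Z: "z \<in> Z \<Longrightarrow> z \<in> mC"
| mC_step: "a \<in> A \<Longrightarrow> a \<in> n \<Longrightarrow> c \<in> C \<Longrightarrow> x \<in> mC \<Longrightarrow> a * c + x \<in> mC"

lemma ideal_mC: "ideal_in mC"
proof -
  have "x \<in> C" if "x \<in> mC" for x
    using that by induction (auto simp: ZC AC add_C mult_C)
  moreover have "x + y \<in> mC" if "x \<in> mC" "y \<in> mC" for x y
    using that
  proof (induction arbitrary: y)
    case (mC_Z z)
    from mC_Z(2,1) show ?case
    proof induction
      case (mC_Z w)
      then show ?case using ideal_inD(3)[OF ideal_Z] mC.mC_Z by blast
    next
      case (mC_step a c x)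
      then show ?case using mC.mC_step[of a c "z + x"] by (simp add: algebra_simps)
    qed
  next
    case (mC_step a c x)
    then show ?case using mC.mC_step[of a c "x + y"] by (simp add: add.assoc)
  qed
  moreover have "d * x \<in> mC" if "d \<in> C" "x \<in> mC" for d x
    using that(2)
  proof induction
    case (mC_Z z)
    then show ?case using ideal_inD(4)[OF ideal_Z that(1)] mC.mC_Z by blast
  next
    case (mC_step a c x)
    then show ?case using mC.mC_step[of a "d * c" "d * x"] mult_C[OF that(1)] by (simp add: algebra_simps)
  qed
  ultimately show ?thesis
    using mC_Z[OF ideal_inD(2)[OF ideal_Z]] unfolding ideal_in_def by blast
qed

lemma mC_n: "x \<in> mC \<Longrightarrow> x \<in> n"
proof (induction rule: mC.induct)
  case (mC_Z z)
  then show ?case using Z_n by blast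
next
  case (mC_step a c x)
  then show ?case by (intro ideal_inD(3)[OF ideal_n] ideal_inD(5)[OF ideal_n])
qed

lemma mC_mult: "a \<in> A \<Longrightarrow> a \<in> n \<Longrightarrow> c \<in> C \<Longrightarrow> a * c \<in> mC"
  using mC_step[of a c 0] mC_Z[OF ideal_inD(2)[OF ideal_Z]] by simp

lemma mC_A: "a \<in> A \<Longrightarrow> a \<in> mC \<longleftrightarrow> a \<in> n"
  using mC_mult[of a 1] one_C mC_n by auto

lemma hom_mC: "x \<in> mC \<Longrightarrow> \<sigma> \<in> G \<Longrightarrow> \<sigma> x \<in> mC"
proof (induction rule: mC.induct)
  case (mC_Z z)
  then show ?case using hom_Z mC.mC_Z by blast
next
  case (mC_step a c x)
  then show ?case
    unfolding hom_add[OF mC_step.prems] hom_mult[OF mC_step.prems] A_fixed[OF mC_step.prems mC_step.hyps(1)]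
    using mC_step by (intro mC.mC_step hom_C[OF mC_step.prems]) blast+
qed

text \<open>Saturated ideals are the contractions of those ideals of the localisation of
  \<open>C\<close> at \<open>n\<close> that contain the extension of \<open>mC\<close>. They
  correspond to the ideals of the local ring of the fibre, whose chains can thus be counted inside
  \<open>C\<close>.\<close>

definition saturated :: "'a set \<Rightarrow> bool" where
  "saturated J \<longleftrightarrow> ideal_in J \<and> mC \<subseteq> J \<and> (\<forall>s\<in>C. \<forall>c\<in>C. s \<notin> n \<longrightarrow> s * c \<in> J \<longrightarrow> c \<in> J)"

definition saturation :: "'a set \<Rightarrow> 'a set" where
  "saturation J = {c \<in> C. \<exists>s\<in>C. s \<notin> n \<and> s * c \<in> J}"

lemma saturatedD:
  assumes "saturated J"
  shows "ideal_in J" "x \<in> mC \<Longrightarrow> x \<in> J" "s \<in> C \<Longrightarrow> c \<in> C \<Longrightarrow> s \<notin> n \<Longrightarrow> s * c \<in> J \<Longrightarrow> c \<in> J"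
  using assms by (auto simp: saturated_def)

lemma saturation_subset: "ideal_in J \<Longrightarrow> x \<in> J \<Longrightarrow> x \<in> saturation J"
  unfolding saturation_def using ideal_inD(1) one_C prime_inD(2)[OF prime_n]
  by (intro CollectI conjI bexI[of _ 1]) auto

lemma saturated_saturation:
  assumes J: "ideal_in J" "mC \<subseteq> J" shows "saturated (saturation J)"
  unfolding saturated_def
proof (intro conjI ballI impI)
  show "mC \<subseteq> saturation J" using J saturation_subset by blast
  show "c \<in> saturation J" if c: "s \<in> C" "c \<in> C" "s \<notin> n" "s * c \<in> saturation J" for s c
  proof -
    obtain t where t: "t \<in> C" "t \<notin> n" "t * (s * c) \<in> J" using c(4) by (auto simp: saturation_def)
    then have "t * s \<in> C" "t * s \<notin> n" "t * s * c \<in> J"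
      using c mult_C prime_inD(3)[OF prime_n] by (auto simp: mult.assoc)
    then show ?thesis using c(2) unfolding saturation_def by blast
  qed
  show "ideal_in (saturation J)"
    unfolding ideal_in_def
  proof (intro conjI ballI subsetI)
    show "0 \<in> saturation J" using J(1) ideal_inD(2) saturation_subset by blast
    show "x \<in> C" if "x \<in> saturation J" for x using that by (simp add: saturation_def)
    show "x + y \<in> saturation J" if xy: "x \<in> saturation J" "y \<in> saturation J" for x y
    proof -
      obtain s where s: "s \<in> C" "s \<notin> n" "s * x \<in> J" "x \<in> C" using xy(1) by (auto simp: saturation_def)
      obtain t where t: "t \<in> C" "t \<notin> n" "t * y \<in> J" "y \<in> C" using xy(2) by (auto simp: saturation_def)
      have "s * t * (x + y) = t * (s * x) + s * (t * y)" by (simp add: algebra_simps)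
      moreover have "t * (s * x) + s * (t * y) \<in> J"
        using ideal_inD(3)[OF J(1) ideal_inD(4)[OF J(1) t(1) s(3)] ideal_inD(4)[OF J(1) s(1) t(3)]] .
      ultimately have "s * t * (x + y) \<in> J" by simp
      moreover have "s * t \<in> C" "s * t \<notin> n" using s t mult_C prime_inD(3)[OF prime_n] by blast+
      ultimately show ?thesis using s(4) t(4) add_C unfolding saturation_def by blast
    qed
    show "c * x \<in> saturation J" if c: "c \<in> C" "x \<in> saturation J" for c x
    proof -
      obtain s where s: "s \<in> C" "s \<notin> n" "s * x \<in> J" "x \<in> C" using c(2) by (auto simp: saturation_def)
      have "s * (c * x) = c * (s * x)" by (simp add: algebra_simps)
      then have "s * (c * x) \<in> J" using ideal_inD(4)[OF J(1) c(1) s(3)] by metis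
      then show ?thesis using s(1,2,4) c(1) mult_C unfolding saturation_def by blast
    qed
  qed
qed

text \<open>The least saturated ideal; it stands for the zero ideal of the local ring of the
  fibre.\<close>

definition Q :: "'a set" where
  "Q = saturation mC"

lemma saturated_Q: "saturated Q"
  unfolding Q_def by (rule saturated_saturation) (simp_all add: ideal_mC)

lemma Q_subset: "saturated J \<Longrightarrow> x \<in> Q \<Longrightarrow> x \<in> J"
  unfolding Q_def saturation_def saturated_def by blast

lemmas ideal_Q = saturatedD(1)[OF saturated_Q]

lemma Q_n: "x \<in> Q \<Longrightarrow> x \<in> n"
  unfolding Q_def saturation_def using prime_inD(3)[OF prime_n] mC_n by blast

lemma hom_Q:
  assumes "\<sigma> \<in> decomposition n" "x \<in> Q" shows "\<sigma> x \<in> Q"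
proof -
  obtain s where s: "s \<in> C" "s \<notin> n" "s * x \<in> mC" "x \<in> C"
    using assms(2) by (auto simp: Q_def saturation_def)
  note \<sigma> = decompositionD(1)[OF assms(1)]
  have "\<sigma> s \<notin> n" using decompositionD(2)[OF assms(1) s(1)] s(2) by simp
  moreover have "\<sigma> s * \<sigma> x \<in> mC" using hom_mC[OF s(3) \<sigma>] by (simp add: hom_mult[OF \<sigma>])
  ultimately show ?thesis using s(1,4) hom_C[OF \<sigma>] unfolding Q_def saturation_def by blast
qed

text \<open>The inverse that \<open>semilocal\<close> supplies is invariant only modulo
  \<open>Z\<close>, whereas members of \<open>A\<close> are fixed exactly. The sum of its conjugates
  is exactly invariant; inverting \<open>N * a\<close> instead of \<open>a\<close> compensates for
  the number of summands.\<close>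

lemma ex_unit_A:
  assumes a: "a \<in> A" "a \<notin> n"
  shows "\<exists>b\<in>A. a * b - 1 \<in> Z"
proof -
  define N :: 'a where "N = of_nat (card G)"
  have "0 < card G" using finite_G id_G card_gt_0_iff by blast
  then have Nn: "N \<notin> n" using char by (simp add: N_def)
  have NC: "N \<in> C" and NA: "N \<in> A" by (simp_all add: N_def of_nat_C A.of_nat_C)
  have "\<exists>d\<in>C. N * a * d - 1 \<in> Z"
  proof (rule semilocal)
    show "N * a \<in> C" using NC AC[OF a(1)] by (rule mult_C)
    show "\<forall>\<sigma>\<in>G. \<sigma> (N * a) \<notin> n"
      using A_fixed[OF _ A.mult_C[OF NA a(1)]] prime_inD(3)[OF prime_n NC AC[OF a(1)]] Nn a(2)
      by metis
  qed
  then obtain d where d: "d \<in> C" "N * a * d - 1 \<in> Z" by blast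
  have adC: "a * d \<in> C" using AC[OF a(1)] d(1) by (rule mult_C)
  have inv: "\<sigma> (a * d) - a * d \<in> Z" if \<sigma>: "\<sigma> \<in> G" for \<sigma>
  proof -
    have "\<sigma> (N * a * d - 1) - (N * a * d - 1) \<in> Z"
      using ideal_diff[OF ideal_Z hom_Z[OF \<sigma> d(2)] d(2)] .
    moreover have "\<sigma> (N * a * d - 1) = N * \<sigma> (a * d) - 1"
      using A_fixed[OF \<sigma> NA] by (simp add: hom_diff[OF \<sigma>] hom_mult[OF \<sigma>] hom_one[OF \<sigma>] mult.assoc)
    ultimately have "N * (\<sigma> (a * d) - a * d) \<in> Z" by (simp add: algebra_simps)
    then show ?thesis
      using prime_inD(3)[OF prime_Z NC diff_C[OF hom_C[OF \<sigma> adC] adC]] Nn Z_n by blast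
  qed
  have "a * (\<Sum>\<sigma>\<in>G. \<sigma> d) = (\<Sum>\<sigma>\<in>G. \<sigma> (a * d))"
    unfolding sum_distrib_left
  proof (rule sum.cong[OF refl])
    fix \<sigma> assume \<sigma>: "\<sigma> \<in> G"
    show "a * \<sigma> d = \<sigma> (a * d)" unfolding hom_mult[OF \<sigma>] A_fixed[OF \<sigma> a(1)] ..
  qed
  also have "\<dots> = (\<Sum>\<sigma>\<in>G. \<sigma> (a * d) - a * d) + N * (a * d)"
    by (simp add: sum_subtractf N_def)
  finally have "a * (\<Sum>\<sigma>\<in>G. \<sigma> d) - 1 = (\<Sum>\<sigma>\<in>G. \<sigma> (a * d) - a * d) + (N * a * d - 1)"
    by (simp add: algebra_simps)
  also have "\<dots> \<in> Z"
    using inv d(2) by (intro ideal_inD(3)[OF ideal_Z] ideal_sum[OF ideal_Z])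
  finally show ?thesis using trace_A[OF d(1)] by blast
qed

text \<open>A separating element for \<open>n\<close> becomes one for \<open>Q\<close> after taking
  a power: the maximal ideal of the local ring of the fibre is nil, because the elements of
  \<open>n\<close> are integral over \<open>A\<close>.\<close>

lemma ex_separating_Q:
  "\<exists>e\<in>C. e \<notin> n \<and> (\<forall>\<sigma>\<in>G - decomposition n. \<sigma> e \<in> Q)"
proof -
  obtain e where e: "e \<in> C" "e \<notin> n" "\<forall>\<sigma>\<in>G - decomposition n. \<sigma> e \<in> n"
    using ex_separating[OF prime_n] by blast
  have pow: "c ^ card G \<in> Q" if c: "c \<in> n" for c
  proof -
    obtain a where a: "\<And>i. a i \<in> A" "a (card G) = 1" "(\<Sum>i\<le>card G. a i * c ^ i) = 0"
      using ex_integral_relation[OF nC[OF c]] by blast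
    \<comment> \<open>The index of the first coefficient that is a unit of \<open>A\<close>; the
      leading coefficient 1 guarantees one. The terms below it lie in \<open>mC\<close>, the others
      add up to \<open>s * c ^ j\<close> with \<open>s\<close> congruent to \<open>a j\<close>
      modulo \<open>n\<close>, so that \<open>c ^ j\<close> lies in \<open>Q\<close>.\<close>
    define j where "j = (LEAST j. a j \<notin> n)"
    have ex: "a (card G) \<notin> n" using a(2) prime_inD(2)[OF prime_n] by simp
    have j: "a j \<notin> n" "j \<le> card G" unfolding j_def using ex by (rule LeastI, rule Least_le)
    have low: "a i \<in> n" if "i < j" for i using not_less_Least that unfolding j_def by blast
    define s where "s = (\<Sum>i=j..card G. a i * c ^ (i - j))"
    have C: "a i * c ^ k \<in> C" for i k using AC[OF a(1)] power_C[OF nC[OF c]] by (rule mult_C)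
    have "s = a j + (\<Sum>i=Suc j..card G. a i * c ^ (i - j))"
      using j(2) by (simp add: s_def sum.atLeast_Suc_atMost)
    moreover have "(\<Sum>i=Suc j..card G. a i * c ^ (i - j)) \<in> n"
    proof (rule ideal_sum[OF ideal_n])
      fix i assume "i \<in> {Suc j..card G}"
      then obtain k where "i - j = Suc k" by (metis Suc_diff_le atLeastAtMost_iff diff_Suc_Suc)
      then have "a i * c ^ (i - j) = a i * c ^ k * c" by (simp add: mult_ac)
      then show "a i * c ^ (i - j) \<in> n" using ideal_inD(4)[OF ideal_n C c] by simp
    qed
    ultimately have sn: "s \<notin> n" using ideal_add_cancel[OF ideal_n] j(1) by simp
    have "{..card G} = {..<j} \<union> {j..card G}" using j(2) by auto
    then have "(\<Sum>i\<le>card G. a i * c ^ i) = (\<Sum>i<j. a i * c ^ i) + (\<Sum>i=j..card G. a i * c ^ i)"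
      by (simp add: sum.union_disjoint ivl_disj_int)
    also have "(\<Sum>i=j..card G. a i * c ^ i) = s * c ^ j"
      unfolding s_def sum_distrib_right
      by (intro sum.cong) (simp_all add: mult.assoc power_add[symmetric])
    finally have "s * c ^ j = - (\<Sum>i<j. a i * c ^ i)"
      using a(3) by (simp add: eq_neg_iff_add_eq_0 add.commute)
    also have "\<dots> \<in> mC"
      using low a(1) power_C[OF nC[OF c]]
      by (intro ideal_uminus[OF ideal_mC] ideal_sum[OF ideal_mC] mC_mult) auto
    finally have "c ^ j \<in> Q"
      using sn C power_C[OF nC[OF c]] unfolding Q_def saturation_def s_def by (blast intro: sum_C)
    then have "c ^ (card G - j) * c ^ j \<in> Q"
      using ideal_inD(4)[OF ideal_Q power_C[OF nC[OF c]]] by blast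
    then show ?thesis using j(2) by (simp add: power_add[symmetric])
  qed
  have "\<sigma> (e ^ card G) \<in> Q" if "\<sigma> \<in> G - decomposition n" for \<sigma>
    unfolding hom_power[OF DiffD1[OF that]] using e(3) that by (intro pow) blast
  then show ?thesis using power_C[OF e(1)] prime_power[OF prime_n e(1,2)] by blast
qed

text \<open>In the fibre, \<open>sep\<close> replaces the idempotent of the factor at
  \<open>n\<close>: it is a unit in that factor and zero in the factors at the other
  conjugates.\<close>

definition sep :: 'a where
  "sep = (SOME e. e \<in> C \<and> e \<notin> n \<and> (\<forall>\<sigma>\<in>G - decomposition n. \<sigma> e \<in> Q))"

lemma sep: "sep \<in> C" "sep \<notin> n" "\<sigma> \<in> G \<Longrightarrow> \<sigma> \<notin> decomposition n \<Longrightarrow> \<sigma> sep \<in> Q"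
proof -
  obtain e where "e \<in> C \<and> e \<notin> n \<and> (\<forall>\<sigma>\<in>G - decomposition n. \<sigma> e \<in> Q)"
    using ex_separating_Q by blast
  then have "sep \<in> C \<and> sep \<notin> n \<and> (\<forall>\<sigma>\<in>G - decomposition n. \<sigma> sep \<in> Q)"
    unfolding sep_def
    by (rule someI[where P = "\<lambda>e. e \<in> C \<and> e \<notin> n \<and> (\<forall>\<sigma>\<in>G - decomposition n. \<sigma> e \<in> Q)"])
  then show "sep \<in> C" "sep \<notin> n" "\<sigma> \<in> G \<Longrightarrow> \<sigma> \<notin> decomposition n \<Longrightarrow> \<sigma> sep \<in> Q"
    by blast+
qed

section \<open>The conjugates of \<open>n\<close> and prime avoidance\<close>

definition conjugate :: "('a \<Rightarrow> 'a) \<Rightarrow> 'a set" where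
  "conjugate \<sigma> = {c \<in> C. \<sigma> c \<in> n}"

definition rep :: "'a set \<Rightarrow> 'a \<Rightarrow> 'a" where
  "rep P = (SOME \<sigma>. \<sigma> \<in> G \<and> conjugate \<sigma> = P)"

lemma rep: "P \<in> conjugate ` G \<Longrightarrow> rep P \<in> G" "P \<in> conjugate ` G \<Longrightarrow> conjugate (rep P) = P"
proof -
  have "rep P \<in> G \<and> conjugate (rep P) = P" if P: "P \<in> conjugate ` G"
  proof -
    obtain \<sigma> where "P = conjugate \<sigma>" "\<sigma> \<in> G" using P by (rule imageE)
    then have "\<sigma> \<in> G \<and> conjugate \<sigma> = P" by simp
    then show ?thesis unfolding rep_def by (rule someI[where P = "\<lambda>\<sigma>. \<sigma> \<in> G \<and> conjugate \<sigma> = P"])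
  qed
  then show "P \<in> conjugate ` G \<Longrightarrow> rep P \<in> G" "P \<in> conjugate ` G \<Longrightarrow> conjugate (rep P) = P"
    by blast+
qed

lemma conjugate_eq:
  assumes "\<sigma> \<in> G" "\<tau> \<in> G"
  shows "conjugate \<sigma> = conjugate \<tau> \<longleftrightarrow> \<sigma> \<circ> inv_G \<tau> \<in> decomposition n"
proof
  note \<tau>' = inv_G[OF assms(2)]
  assume eq: "conjugate \<sigma> = conjugate \<tau>"
  have "\<sigma> (inv_G \<tau> c) \<in> n \<longleftrightarrow> c \<in> n" if "c \<in> C" for c
  proof -
    have "inv_G \<tau> c \<in> C" using hom_C[OF \<tau>'(1) that] .
    then have "\<sigma> (inv_G \<tau> c) \<in> n \<longleftrightarrow> \<tau> (inv_G \<tau> c) \<in> n"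
      using eq unfolding conjugate_def by blast
    then show ?thesis by (simp only: \<tau>'(4))
  qed
  then show "\<sigma> \<circ> inv_G \<tau> \<in> decomposition n"
    using comp_G[OF assms(1) \<tau>'(1)] unfolding decomposition_def by (simp add: comp_def)
next
  note \<tau>' = inv_G[OF assms(2)]
  assume D: "\<sigma> \<circ> inv_G \<tau> \<in> decomposition n"
  have "\<sigma> c \<in> n \<longleftrightarrow> \<tau> c \<in> n" if "c \<in> C" for c
    using decompositionD(2)[OF D hom_C[OF assms(2) that]] unfolding comp_def \<tau>'(5) .
  then show "conjugate \<sigma> = conjugate \<tau>" unfolding conjugate_def by blast
qed

text \<open>Orbit and stabiliser: the elements that give one and the same conjugate form a right
  coset of the decomposition group.\<close>

lemma card_conjugates: "card (conjugate ` G) * card (decomposition n) = card G"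
proof -
  have "card {\<sigma> \<in> G. conjugate \<sigma> = P} = card (decomposition n)" if P: "P \<in> conjugate ` G" for P
  proof -
    note r = rep(1)[OF P]
    have "bij_betw (\<lambda>\<delta>. \<delta> \<circ> rep P) (decomposition n) {\<sigma> \<in> G. conjugate \<sigma> = P}"
    proof (rule bij_betwI[where g = "\<lambda>\<sigma>. \<sigma> \<circ> inv_G (rep P)"])
      have i: "(\<sigma> \<circ> inv_G (rep P)) \<circ> rep P = \<sigma>" "(\<sigma> \<circ> rep P) \<circ> inv_G (rep P) = \<sigma>" for \<sigma>
        by (simp_all add: comp_assoc inv_G[OF r])
      show "\<delta> \<circ> rep P \<circ> inv_G (rep P) = \<delta>" "\<delta> \<circ> inv_G (rep P) \<circ> rep P = \<delta>" for \<delta>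
        by (rule i)+
      show "(\<lambda>\<delta>. \<delta> \<circ> rep P) \<in> decomposition n \<rightarrow> {\<sigma> \<in> G. conjugate \<sigma> = P}"
      proof
        fix \<delta> assume \<delta>: "\<delta> \<in> decomposition n"
        have "\<delta> \<circ> rep P \<in> G" using comp_G[OF decompositionD(1)[OF \<delta>] r] .
        then show "\<delta> \<circ> rep P \<in> {\<sigma> \<in> G. conjugate \<sigma> = P}"
          using conjugate_eq[of "\<delta> \<circ> rep P" "rep P"] r \<delta> rep(2)[OF P]
          unfolding i(2) by blast
      qed
      show "(\<lambda>\<sigma>. \<sigma> \<circ> inv_G (rep P)) \<in> {\<sigma> \<in> G. conjugate \<sigma> = P} \<rightarrow> decomposition n"
      proof
        fix \<sigma> assume "\<sigma> \<in> {\<sigma> \<in> G. conjugate \<sigma> = P}"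
        then have "\<sigma> \<in> G" "conjugate \<sigma> = conjugate (rep P)" unfolding rep(2)[OF P] by blast+
        then show "\<sigma> \<circ> inv_G (rep P) \<in> decomposition n" using conjugate_eq[OF _ r] by blast
      qed
    qed
    from bij_betw_same_card[OF this] show ?thesis ..
  qed
  moreover have "card G = (\<Sum>P\<in>conjugate ` G. card {\<sigma> \<in> G. conjugate \<sigma> = P})"
    using finite_G sum.image_gen[of G "\<lambda>_. 1::nat" conjugate] by simp
  ultimately show ?thesis by simp
qed

text \<open>Transported to \<open>P\<close>, the element \<open>sep\<close> vanishes in the fibre at
  every conjugate other than \<open>P\<close>. This is what splits sums over the conjugates.\<close>

lemma rep_sep:
  assumes "P \<in> conjugate ` G" "\<sigma> \<in> G" "conjugate \<sigma> \<noteq> P" "x \<in> C"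
  shows "\<sigma> (inv_G (rep P) (sep * x)) \<in> Q"
proof -
  let ?\<tau> = "\<sigma> \<circ> inv_G (rep P)"
  have \<tau>: "?\<tau> \<in> G" using comp_G[OF assms(2) inv_G(1)[OF rep(1)[OF assms(1)]]] .
  have "?\<tau> \<notin> decomposition n" using conjugate_eq[OF assms(2) rep(1)[OF assms(1)]] assms(1,3) rep(2) by simp
  then have "?\<tau> sep \<in> Q" using sep(3)[OF \<tau>] by blast
  then have "?\<tau> sep * ?\<tau> x \<in> Q" using ideal_inD(5)[OF ideal_Q hom_C[OF \<tau> assms(4)]] by blast
  then show ?thesis unfolding hom_mult[OF \<tau>, symmetric] by (simp add: comp_def)
qed

text \<open>Prime avoidance for the conjugates of \<open>n\<close>.\<close>

lemma ex_avoiding: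
  assumes "\<forall>P\<in>conjugate ` G. t P \<in> C" "\<forall>P\<in>conjugate ` G. rep P (t P) \<notin> n"
  defines "y \<equiv> (\<Sum>P\<in>conjugate ` G. inv_G (rep P) (sep * rep P (t P)))"
  shows "\<sigma> \<in> G \<Longrightarrow> \<sigma> y \<notin> n" and "y \<in> C"
    and "\<sigma> \<in> G \<Longrightarrow> \<sigma> (y - inv_G (rep (conjugate \<sigma>)) (sep * rep (conjugate \<sigma>) (t (conjugate \<sigma>)))) \<in> n"
proof -
  note t = bspec[OF assms(1)] bspec[OF assms(2)]
  let ?u = "\<lambda>P. inv_G (rep P) (sep * rep P (t P))"
  have uC: "?u P \<in> C" if "P \<in> conjugate ` G" for P
  proof -
    note r = rep(1)[OF that]
    show ?thesis using that t(1) by (intro hom_C[OF inv_G(1)[OF r]] mult_C[OF sep(1)] hom_C[OF r])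
  qed
  show "y \<in> C" unfolding y_def using uC by (rule sum_C)
  have rest: "\<sigma> (y - ?u (conjugate \<sigma>)) \<in> n" if \<sigma>: "\<sigma> \<in> G" for \<sigma>
  proof -
    have "y - ?u (conjugate \<sigma>) = (\<Sum>P\<in>conjugate ` G - {conjugate \<sigma>}. ?u P)"
      unfolding y_def using \<sigma> finite_G by (simp add: sum_diff1)
    then have "\<sigma> (y - ?u (conjugate \<sigma>)) = (\<Sum>P\<in>conjugate ` G - {conjugate \<sigma>}. \<sigma> (?u P))"
      by (simp only: hom_sum[OF \<sigma>])
    also have "\<dots> \<in> n"
    proof (rule ideal_sum[OF ideal_n])
      fix P assume P: "P \<in> conjugate ` G - {conjugate \<sigma>}"
      then have P1: "P \<in> conjugate ` G" and P2: "conjugate \<sigma> \<noteq> P" by auto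
      show "\<sigma> (?u P) \<in> n"
        using Q_n rep_sep[OF P1 \<sigma> P2 hom_C[OF rep(1)[OF P1] t(1)[OF P1]]] by blast
    qed
    finally show ?thesis .
  qed
  then show "\<sigma> \<in> G \<Longrightarrow> \<sigma> (y - ?u (conjugate \<sigma>)) \<in> n" .
  show "\<sigma> y \<notin> n" if \<sigma>: "\<sigma> \<in> G"
  proof
    assume "\<sigma> y \<in> n"
    let ?P = "conjugate \<sigma>"
    have P: "?P \<in> conjugate ` G" using \<sigma> by blast
    have "\<sigma> (?u ?P) = \<sigma> y - \<sigma> (y - ?u ?P)" by (simp add: hom_diff[OF \<sigma>])
    also have "\<dots> \<in> n" using \<open>\<sigma> y \<in> n\<close> rest[OF \<sigma>] by (rule ideal_diff[OF ideal_n])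
    finally have "?u ?P \<in> conjugate \<sigma>" using uC[OF P] by (simp add: conjugate_def)
    then have "?u ?P \<in> conjugate (rep ?P)" using rep(2)[OF P] by simp
    then have "rep ?P (?u ?P) \<in> n" by (simp add: conjugate_def)
    then have "sep * rep ?P (t ?P) \<in> n" unfolding inv_G(4)[OF rep(1)[OF P]] .
    then show False
      using prime_inD(3)[OF prime_n sep(1) hom_C[OF rep(1)[OF P] t(1)[OF P]]] sep(2) t(2)[OF P] by blast
  qed
qed

text \<open>Membership in \<open>mC\<close> can be tested at each conjugate of \<open>n\<close>. The
  denominators found there are assembled into one element outside all conjugates, which is a unit
  modulo \<open>Z\<close>.\<close>

lemma local_global:
  assumes x: "x \<in> C" "\<And>\<sigma>. \<sigma> \<in> G \<Longrightarrow> \<sigma> x \<in> Q"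
  shows "x \<in> mC"
proof -
  have "\<exists>t\<in>C. rep P t \<notin> n \<and> t * x \<in> mC" if P: "P \<in> conjugate ` G" for P
  proof -
    note r = rep(1)[OF P]
    obtain s where s: "s \<in> C" "s \<notin> n" "s * rep P x \<in> mC"
      using x(2)[OF r] by (auto simp: Q_def saturation_def)
    have "inv_G (rep P) (s * rep P x) \<in> mC" using hom_mC[OF s(3) inv_G(1)[OF r]] .
    then have "inv_G (rep P) s * x \<in> mC" by (simp add: hom_mult[OF inv_G(1)[OF r]] inv_G(5)[OF r])
    moreover have "rep P (inv_G (rep P) s) \<notin> n" unfolding inv_G(4)[OF r] by (rule s(2))
    ultimately show ?thesis using hom_C[OF inv_G(1)[OF r] s(1)] by blast
  qed
  then have "\<forall>P\<in>conjugate ` G. \<exists>t. t \<in> C \<and> rep P t \<notin> n \<and> t * x \<in> mC" by blast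
  from bchoice[OF this] obtain t where t: "\<forall>P\<in>conjugate ` G. t P \<in> C"
      "\<forall>P\<in>conjugate ` G. rep P (t P) \<notin> n" "\<forall>P\<in>conjugate ` G. t P * x \<in> mC"
    by blast
  define y where "y = (\<Sum>P\<in>conjugate ` G. inv_G (rep P) (sep * rep P (t P)))"
  note y = ex_avoiding(1,2)[OF t(1,2), folded y_def]
  have "y * x \<in> mC"
    unfolding y_def sum_distrib_right
  proof (rule ideal_sum[OF ideal_mC])
    fix P assume P: "P \<in> conjugate ` G"
    note r = rep(1)[OF P]
    have "inv_G (rep P) (sep * rep P (t P)) * x = inv_G (rep P) sep * (t P * x)"
      by (simp add: hom_mult[OF inv_G(1)[OF r]] inv_G(5)[OF r] mult.assoc)
    then show "inv_G (rep P) (sep * rep P (t P)) * x \<in> mC"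
      using ideal_inD(4)[OF ideal_mC hom_C[OF inv_G(1)[OF r] sep(1)] bspec[OF t(3) P]] by simp
  qed
  moreover obtain d where d: "d \<in> C" "y * d - 1 \<in> Z" using semilocal[OF y(2)] y(1) by blast
  moreover have "x = d * (y * x) - (y * d - 1) * x" by (simp add: algebra_simps)
  moreover have "(y * d - 1) * x \<in> mC" using ideal_inD(5)[OF ideal_Z x(1) d(2)] mC_Z by blast
  ultimately show ?thesis
    using ideal_diff[OF ideal_mC ideal_inD(4)[OF ideal_mC d(1)]] by metis
qed

text \<open>\<open>n\<close> is maximal, although \<open>semilocal\<close> only inverts elements
  outside all its conjugates. Prime avoidance with \<open>s\<close> at \<open>n\<close> and 1 at the
  other conjugates gives such an element \<open>y\<close> that is congruent modulo \<open>n\<close>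
  to a multiple of \<open>s\<close>.\<close>

lemma ex_inverse_mod_n:
  assumes s: "s \<in> C" "s \<notin> n"
  shows "\<exists>u\<in>C. s * u - 1 \<in> n"
proof -
  let ?P = "conjugate id"
  have P: "?P \<in> conjugate ` G" using id_G by blast
  note r = rep(1)[OF P]
  have D: "rep ?P \<in> decomposition n"
    using conjugate_eq[OF r id_G] rep(2)[OF P] inv_G(3)[OF id_G] by simp
  define t where "t P = (if P = ?P then s else 1)" for P
  have t: "\<forall>P\<in>conjugate ` G. t P \<in> C" "\<forall>P\<in>conjugate ` G. rep P (t P) \<notin> n"
    using decompositionD(2)[OF D s(1)] s one_C hom_one[OF rep(1)] prime_inD(2)[OF prime_n]
    by (simp_all add: t_def)
  define y where "y = (\<Sum>P\<in>conjugate ` G. inv_G (rep P) (sep * rep P (t P)))"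
  note y = ex_avoiding[OF t, folded y_def]
  define e where "e = inv_G (rep ?P) sep"
  have eC: "e \<in> C" using hom_C[OF inv_G(1)[OF r] sep(1)] by (simp add: e_def)
  have "y - e * s \<in> n"
    using y(3)[OF id_G] by (simp add: hom_mult[OF inv_G(1)[OF r]] inv_G(5)[OF r] e_def t_def)
  moreover obtain d where d: "d \<in> C" "y * d - 1 \<in> Z" using semilocal[OF y(2)] y(1) by blast
  moreover have "s * (e * d) - 1 = (y * d - 1) - (y - e * s) * d" by (simp add: algebra_simps)
  ultimately have "s * (e * d) - 1 \<in> n"
    using ideal_diff[OF ideal_n subsetD[OF Z_n] ideal_inD(5)[OF ideal_n]] by metis
  then show ?thesis using mult_C[OF eC d(1)] by blast
qed

end

section \<open>Chains of ideals in flat extensions\<close>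

text \<open>The first assumption says that modulo \<open>Z\<close> the elements of \<open>C\<close>
  are fractions of a finitely generated algebra over \<open>A\<close>, with denominators that are
  units. The second is the equational criterion of flatness at \<open>n\<close>: if the
  \<open>a i\<close> and \<open>c i\<close> satisfy a relation and \<open>c j\<close> is not in
  \<open>Q\<close>, then some relation between the \<open>a i\<close> over \<open>A\<close> has a
  unit as its \<open>j\<close>-th coefficient.\<close>

locale flat_semilocal_action = semilocal_action +
  assumes finitely_generated: "\<exists>E. finite E \<and> E \<subseteq> C \<and>
      (\<forall>c\<in>C. \<exists>s\<in>adjoin E. \<exists>r\<in>adjoin E. (\<forall>\<sigma>\<in>G. \<sigma> s \<notin> n) \<and> s * c - r \<in> Z)"
    and flat: "\<And>(K :: nat set) a c j. finite K \<Longrightarrow> j \<in> K \<Longrightarrow> \<forall>i\<in>K. a i \<in> A \<and> c i \<in> C \<Longrightarrow>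
      (\<Sum>i\<in>K. a i * c i) \<in> Z \<Longrightarrow>
      \<forall>r. (\<forall>i\<in>K. r i \<in> A) \<and> (\<Sum>i\<in>K. r i * a i) \<in> Z \<longrightarrow> r j \<in> n \<Longrightarrow> c j \<in> Q"
begin

text \<open>The core of the proof that flat modules over a local ring are free. Independence keeps
  \<open>c j\<close> out of \<open>mC\<close>, hence some conjugate of it out of \<open>Q\<close>;
  flatness then gives a relation between the coefficients with a unit in place \<open>j\<close>. It
  eliminates \<open>a j\<close>, at the price of changing the other \<open>c i\<close> by multiples
  of \<open>c j\<close>.\<close>

lemma independent_lift_nat:
  fixes K :: "nat set"
  assumes "finite K" "\<forall>i\<in>K. c i \<in> C" "independent mC K c"
  shows "independent Z K c"
proof -
  have "\<forall>i\<in>K. a i \<in> Z" if "\<forall>i\<in>K. a i \<in> A" "(\<Sum>i\<in>K. a i * c i) \<in> Z" for a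
    using assms that
  proof (induction "card K" arbitrary: K a c)
    case 0
    then show ?case by simp
  next
    case (Suc l)
    note K = Suc.prems(1) and c = bspec[OF Suc.prems(2)] and a = bspec[OF Suc.prems(4)]
    obtain j where j: "j \<in> K" using Suc.hyps(2) by fastforce
    \<comment> \<open>The criterion holds at \<open>n\<close> only. As the \<open>a i\<close> are
      invariant, applying \<open>\<sigma>\<close> to the relation changes just the
      \<open>c i\<close>, so every conjugate of \<open>c j\<close> can be examined.\<close>
    have "\<sigma> (c j) \<in> Q" if cj: "\<forall>r. (\<forall>i\<in>K. r i \<in> A) \<and> (\<Sum>i\<in>K. r i * a i) \<in> Z \<longrightarrow> r j \<in> n"
      and \<sigma>: "\<sigma> \<in> G" for \<sigma>
    proof (rule flat[OF K j, of a "\<lambda>i. \<sigma> (c i)"])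
      show "\<forall>i\<in>K. a i \<in> A \<and> \<sigma> (c i) \<in> C" using a hom_C[OF \<sigma> c] by blast
      have "\<sigma> (\<Sum>i\<in>K. a i * c i) = (\<Sum>i\<in>K. a i * \<sigma> (c i))"
        unfolding hom_sum[OF \<sigma>] hom_mult[OF \<sigma>] using A_fixed[OF \<sigma> a] by (intro sum.cong) simp_all
      then show "(\<Sum>i\<in>K. a i * \<sigma> (c i)) \<in> Z" using hom_Z[OF \<sigma> Suc.prems(5)] by simp
    qed (use cj in blast)
    then have "c j \<in> mC" if "\<forall>r. (\<forall>i\<in>K. r i \<in> A) \<and> (\<Sum>i\<in>K. r i * a i) \<in> Z \<longrightarrow> r j \<in> n"
      using local_global[OF c[OF j]] that by blast
    moreover have "c j \<notin> mC"
    proof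
      assume cj: "c j \<in> mC"
      have "(\<Sum>i\<in>K. (if i = j then 1 else 0) * c i) = (\<Sum>i\<in>K. if i = j then c i else 0)"
        by (intro sum.cong) auto
      also have "\<dots> = c j" using K j by simp
      finally have "(\<Sum>i\<in>K. (if i = j then 1 else 0) * c i) \<in> mC" using cj by simp
      moreover have "\<forall>i\<in>K. (if i = j then 1 else 0) \<in> A" by (simp add: A.one_C A.zero_C)
      ultimately have "\<forall>i\<in>K. (if i = j then 1 else 0) \<in> mC"
        using Suc.prems(3)[unfolded independent_def, rule_format, of "\<lambda>i. if i = j then 1 else 0"]
        by blast
      then have "1 \<in> mC" using j by fastforce
      then show False using mC_n prime_inD(2)[OF prime_n] by blast
    qed
    ultimately obtain r where r: "\<forall>i\<in>K. r i \<in> A" "(\<Sum>i\<in>K. r i * a i) \<in> Z" "r j \<notin> n" by blast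
    obtain b where b: "b \<in> A" "r j * b - 1 \<in> Z" using ex_unit_A r(1,3) j by blast
    define K' where "K' = K - {j}"
    define c' where "c' i = c i - b * r i * c j" for i
    \<comment> \<open>The exact error made when the relation with unit coefficient
      \<open>r j\<close> is solved for \<open>a j\<close>.\<close>
    define z where "z = b * (\<Sum>i\<in>K. r i * a i) - (r j * b - 1) * a j"
    have zZ: "z \<in> Z"
      unfolding z_def using AC b(1) AC[OF a[OF j]]
      by (intro ideal_diff[OF ideal_Z] ideal_inD(4)[OF ideal_Z _ r(2)] ideal_inD(5)[OF ideal_Z _ b(2)])
    have aj: "a j = z - b * (\<Sum>i\<in>K'. r i * a i)"
      unfolding z_def K'_def using sum.remove[OF K j, of "\<lambda>i. r i * a i"] by (simp add: algebra_simps)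
    have step: "(\<Sum>i\<in>K'. x i * c' i) = (\<Sum>i\<in>K'. x i * c i) - b * (\<Sum>i\<in>K'. r i * x i) * c j" for x
      unfolding c'_def by (simp add: right_diff_distrib sum_subtractf sum_distrib_left sum_distrib_right mult_ac)
    have K': "finite K'" "card K' = l" using K j Suc.hyps(2) by (simp_all add: K'_def)
    have "\<forall>i\<in>K'. a i \<in> Z"
    proof (rule Suc.hyps(1)[OF K'(2)[symmetric] K'(1)])
      show "\<forall>i\<in>K'. c' i \<in> C"
        unfolding c'_def K'_def using c j AC b(1) r(1) by (intro ballI diff_C mult_C) auto
      show "\<forall>i\<in>K'. a i \<in> A" using a by (simp add: K'_def)
      show "independent mC K' c'"
        unfolding independent_def
      proof (intro allI impI)
        fix x assume x: "(\<forall>i\<in>K'. x i \<in> A) \<and> (\<Sum>i\<in>K'. x i * c' i) \<in> mC"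
        \<comment> \<open>The coefficients with respect to \<open>c\<close> of the combination of
          the \<open>c' i\<close> with coefficients \<open>x\<close>.\<close>
        define x' where "x' i = (if i = j then - (b * (\<Sum>i\<in>K'. r i * x i)) else x i)" for i
        have "\<forall>i\<in>K. x' i \<in> A"
          using x r(1) b(1) by (auto simp: x'_def K'_def intro!: A.uminus_C A.mult_C A.sum_C)
        moreover have "(\<Sum>i\<in>K. x' i * c i) = (\<Sum>i\<in>K'. x i * c' i)"
        proof -
          have "(\<Sum>i\<in>K'. x' i * c i) = (\<Sum>i\<in>K'. x i * c i)"
            by (intro sum.cong) (auto simp: x'_def K'_def)
          moreover have "x' j = - (b * (\<Sum>i\<in>K'. r i * x i))" by (simp add: x'_def)
          ultimately show ?thesis
            unfolding step using sum.remove[OF K j, of "\<lambda>i. x' i * c i"] by (simp add: K'_def)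
        qed
        ultimately have "\<forall>i\<in>K. x' i \<in> mC"
          using x Suc.prems(3) unfolding independent_def by metis
        then show "\<forall>i\<in>K'. x i \<in> mC" by (auto simp: x'_def K'_def split: if_splits)
      qed
      have "(\<Sum>i\<in>K'. a i * c' i) = (\<Sum>i\<in>K. a i * c i) - z * c j"
        unfolding step sum.remove[OF K j] K'_def[symmetric] aj by (simp add: algebra_simps)
      then show "(\<Sum>i\<in>K'. a i * c' i) \<in> Z"
        using ideal_diff[OF ideal_Z Suc.prems(5) ideal_inD(5)[OF ideal_Z c[OF j] zZ]] by simp
    qed
    moreover have "a j \<in> Z"
      unfolding aj using calculation AC b(1) r(1)
      by (intro ideal_diff[OF ideal_Z zZ] ideal_inD(4)[OF ideal_Z] ideal_sum[OF ideal_Z])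
        (auto simp: K'_def)
    ultimately show ?case by (auto simp: K'_def)
  qed
  then show ?thesis unfolding independent_def by blast
qed

section \<open>Families modulo \<open>mC\<close> and the order of the group\<close>

lemma decomposition_Z: "decomposition Z = G"
proof -
  have "\<sigma> c \<in> Z \<longleftrightarrow> c \<in> Z" if "\<sigma> \<in> G" for \<sigma> c
    using hom_Z[OF that, of c] hom_Z[OF inv_G(1)[OF that], of "\<sigma> c"] inv_G(5)[OF that, of c] by auto
  then show ?thesis unfolding decomposition_def by blast
qed

text \<open>This is faithfulness. At the generic prime the decomposition group is everything and the
  inertia group trivial, so the two halves of Artin's theorem at \<open>Z\<close> compare families
  with the order of \<open>G\<close>.\<close>

lemma inertia_Z: "inertia Z = {id}"
  using faithful id_G ideal_inD(2)[OF ideal_Z] by (auto simp: inertia_def)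

text \<open>The elements remain independent at the generic point, where the rank is at most the
  order of \<open>G\<close>. The bijection \<open>h\<close> brings the index set into the naturals,
  for which flatness is assumed.\<close>

lemma card_independent:
  assumes "finite K" "\<forall>i\<in>K. c i \<in> C" "independent mC K c"
  shows "card K \<le> card G"
proof -
  obtain h where h: "bij_betw h {0..<card K} K" using ex_bij_betw_nat_finite[OF assms(1)] by blast
  let ?c = "c \<circ> h"
  have C: "\<forall>i\<in>{0..<card K}. ?c i \<in> C" using assms(2) bij_betwE[OF h] by simp
  have "independent mC {0..<card K} ?c"
    unfolding independent_def
  proof (intro allI impI)
    fix a assume a: "(\<forall>i\<in>{0..<card K}. a i \<in> A) \<and> (\<Sum>i\<in>{0..<card K}. a i * ?c i) \<in> mC"
    define g where "g = the_inv_into {0..<card K} h"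
    have g: "g (h i) = i" if "i \<in> {0..<card K}" for i
      unfolding g_def using h that by (simp add: bij_betw_def the_inv_into_f_f)
    have gK: "g i \<in> {0..<card K}" if "i \<in> K" for i
      using bij_betw_imp_surj_on[OF bij_betw_the_inv_into[OF h]] that unfolding g_def by blast
    have "(\<Sum>i\<in>K. a (g i) * c i) = (\<Sum>i\<in>{0..<card K}. a (g (h i)) * c (h i))"
      using sum.reindex_bij_betw[OF h, of "\<lambda>i. a (g i) * c i"] by simp
    also have "\<dots> = (\<Sum>i\<in>{0..<card K}. a i * ?c i)" using g by (intro sum.cong) auto
    finally have "(\<Sum>i\<in>K. a (g i) * c i) \<in> mC" using a by simp
    moreover have "\<forall>i\<in>K. a (g i) \<in> A" using a gK by blast
    ultimately have "\<forall>i\<in>K. a (g i) \<in> mC"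
      using assms(3)[unfolded independent_def, rule_format, of "\<lambda>i. a (g i)"] by blast
    then show "\<forall>i\<in>{0..<card K}. a i \<in> mC" using g bij_betwE[OF h] by metis
  qed
  then have "independent Z {0..<card K} ?c" using C by (intro independent_lift_nat) auto
  then have "card {0..<card K} * card (inertia Z) \<le> card (decomposition Z)"
    using C char Z_n by (intro card_inertia_le_independent[OF prime_Z]) auto
  then show ?thesis by (simp add: decomposition_Z inertia_Z)
qed

text \<open>The generators are first made stable under \<open>G\<close>. Then a denominator
  \<open>s\<close> can be replaced by its norm, a unit of \<open>A\<close>, while the complementary
  factor \<open>p\<close> of the norm stays in the algebra, and that is spanned by finitely many
  monomials.\<close>

lemma ex_finite_spanning:
  obtains F :: "('a \<Rightarrow> nat) set" and b where "finite F" "\<forall>k\<in>F. b k \<in> C" "spanning Z F b"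
proof -
  obtain E where E: "finite E" "E \<subseteq> C"
      "\<forall>c\<in>C. \<exists>s\<in>adjoin E. \<exists>r\<in>adjoin E. (\<forall>\<sigma>\<in>G. \<sigma> s \<notin> n) \<and> s * c - r \<in> Z"
    using finitely_generated by blast
  define E' where "E' = (\<Union>\<sigma>\<in>G. \<sigma> ` E)"
  have finE': "finite E'" unfolding E'_def using E(1) finite_G by blast
  have E'C: "E' \<subseteq> C" unfolding E'_def using E(2) hom_C by blast
  obtain F :: "('a \<Rightarrow> nat) set" and b where F: "finite F" "\<And>k. k \<in> F \<Longrightarrow> b k \<in> C"
      "\<And>x. x \<in> adjoin E' \<Longrightarrow> \<exists>a. (\<forall>k\<in>F. a k \<in> A) \<and> x = (\<Sum>k\<in>F. a k * b k)"
    by (rule adjoin_finite_spanning[OF finE' E'C]) (rule that)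
  have homE': "\<sigma> e \<in> E'" if \<sigma>: "\<sigma> \<in> G" and "e \<in> E'" for \<sigma> e
  proof -
    obtain \<tau> where \<tau>: "\<tau> \<in> G" "e \<in> \<tau> ` E" using \<open>e \<in> E'\<close> unfolding E'_def by (rule UN_E)
    obtain e' where "e = \<tau> e'" "e' \<in> E" using \<tau>(2) by (rule imageE)
    with \<tau>(1) have e': "\<tau> \<in> G" "e' \<in> E" "e = \<tau> e'" by simp_all
    have "(\<sigma> \<circ> \<tau>) e' \<in> E'" unfolding E'_def using comp_G[OF \<sigma> e'(1)] e'(2) by blast
    then show ?thesis by (simp add: e'(3))
  qed
  have "E \<subseteq> E'"
  proof
    fix e assume "e \<in> E"
    then have "e \<in> id ` E" by simp
    then show "e \<in> E'" unfolding E'_def by (rule UN_I[OF id_G])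
  qed
  have "\<exists>a. (\<forall>k\<in>F. a k \<in> A) \<and> c - (\<Sum>k\<in>F. a k * b k) \<in> Z" if c: "c \<in> C" for c
  proof -
    obtain s r where s: "s \<in> adjoin E'" and r: "r \<in> adjoin E'" and sn: "\<forall>\<sigma>\<in>G. \<sigma> s \<notin> n"
        and sc: "s * c - r \<in> Z"
      using E(3) c adjoin_mono[OF _ \<open>E \<subseteq> E'\<close>] by blast
    have sC: "s \<in> C" using adjoin_C[OF s E'C] .
    define p where "p = (\<Prod>\<sigma>\<in>G - {id}. \<sigma> s)"
    have N: "(\<Prod>\<sigma>\<in>G. \<sigma> s) = s * p" unfolding p_def using prod.remove[OF finite_G id_G, of "\<lambda>\<sigma>. \<sigma> s"] by simp
    have p: "p \<in> adjoin E'"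
      unfolding p_def
    proof (rule adjoin_prod)
      fix \<sigma> assume "\<sigma> \<in> G - {id}"
      then show "\<sigma> s \<in> adjoin E'" using hom_adjoin[OF s] homE' by blast
    qed
    have "(\<Prod>\<sigma>\<in>G. \<sigma> s) \<notin> n" using sn hom_C[OF _ sC] by (intro prime_prod[OF prime_n finite_G]) auto
    then obtain t where t: "t \<in> A" "s * p * t - 1 \<in> Z" using ex_unit_A[OF norm_A[OF sC]] N by auto
    have "t * p * r \<in> adjoin E'" using adjoin_mult[OF adjoin_mult[OF adjoin_A[OF t(1)] p] r] .
    then obtain a where a: "\<forall>k\<in>F. a k \<in> A" "t * p * r = (\<Sum>k\<in>F. a k * b k)" using F(3) by blast
    have "c - t * p * r = t * p * (s * c - r) - (s * p * t - 1) * c" by (simp add: algebra_simps)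
    moreover have "t * p * (s * c - r) - (s * p * t - 1) * c \<in> Z"
      using ideal_diff[OF ideal_Z ideal_inD(4)[OF ideal_Z mult_C[OF AC[OF t(1)] adjoin_C[OF p E'C]] sc]
          ideal_inD(5)[OF ideal_Z c t(2)]] .
    ultimately have "c - t * p * r \<in> Z" by simp
    then show ?thesis using a by auto
  qed
  then show ?thesis using that[OF F(1), of b] F(2) unfolding spanning_def by blast
qed

text \<open>Nakayama's lemma, removing one generator at a time.\<close>

lemma nakayama:
  assumes N: "N \<subseteq> C" "Z \<subseteq> N" "\<And>x y. x \<in> N \<Longrightarrow> y \<in> N \<Longrightarrow> x + y \<in> N"
      "\<And>a x. a \<in> A \<Longrightarrow> x \<in> N \<Longrightarrow> a * x \<in> N"
    and mod: "\<And>x. x \<in> C \<Longrightarrow> \<exists>y\<in>N. x - y \<in> mC"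
    and "finite F" "\<forall>k\<in>F. b k \<in> C"
    and "\<And>x. x \<in> C \<Longrightarrow> \<exists>y\<in>N. \<exists>a. (\<forall>k\<in>F. a k \<in> A) \<and> x = y + (\<Sum>k\<in>F. a k * b k)"
  shows "x \<in> C \<Longrightarrow> x \<in> N"
  using assms(6-)
proof (induction F arbitrary: x rule: finite_induct)
  case empty
  then show ?case by simp
next
  case (insert m F)
  have mC: "b m \<in> C" using insert.prems by simp
  \<comment> \<open>Substituting the expressions by generators into an element of \<open>mC\<close>
    leaves coefficients in the maximal ideal of \<open>A\<close>.\<close>
  have small: "\<exists>y\<in>N. \<exists>a. (\<forall>k\<in>insert m F. a k \<in> A \<and> a k \<in> n) \<and> x = y + (\<Sum>k\<in>insert m F. a k * b k)"
    if "x \<in> mC" for x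
    using that
  proof induction
    case (mC_Z z)
    then show ?case using N(2) A.zero_C ideal_inD(2)[OF ideal_n]
      by (intro bexI[of _ z] exI[of _ "\<lambda>_. 0"]) auto
  next
    case (mC_step r c x)
    obtain y a where y: "y \<in> N" "\<forall>k\<in>insert m F. a k \<in> A \<and> a k \<in> n" "x = y + (\<Sum>k\<in>insert m F. a k * b k)"
      using mC_step.IH by blast
    obtain w d where w: "w \<in> N" "\<forall>k\<in>insert m F. d k \<in> A" "c = w + (\<Sum>k\<in>insert m F. d k * b k)"
      using insert.prems(3)[OF mC_step.hyps(3)] by blast
    have "r * c + x = (r * w + y) + (\<Sum>k\<in>insert m F. (r * d k + a k) * b k)"
      unfolding y(3) w(3) by (simp only: distrib_left distrib_right sum.distrib sum_distrib_left mult.assoc add_ac)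
    moreover have "r * w + y \<in> N" using N(3,4) y w mC_step.hyps by blast
    moreover have "\<forall>k\<in>insert m F. r * d k + a k \<in> A \<and> r * d k + a k \<in> n"
      using y(2) w(2) mC_step.hyps AC
      by (auto intro!: A.add_C A.mult_C ideal_inD(3)[OF ideal_n] ideal_inD(5)[OF ideal_n])
    ultimately show ?case
      by (intro bexI[of _ "r * w + y"] exI[of _ "\<lambda>k. r * d k + a k"] conjI)
  qed
  have red: "\<exists>y\<in>N. \<exists>a. (\<forall>k\<in>F. a k \<in> A) \<and> b m = y + (\<Sum>k\<in>F. a k * b k)"
  proof -
    obtain y where y: "y \<in> N" "b m - y \<in> mC" using mod[OF mC] by blast
    obtain w a where w: "w \<in> N" "\<forall>k\<in>insert m F. a k \<in> A \<and> a k \<in> n"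
        "b m - y = w + (\<Sum>k\<in>insert m F. a k * b k)"
      using small[OF y(2)] by blast
    \<comment> \<open>\<open>a m\<close> lies in the maximal ideal, so \<open>1 - a m\<close> is a
      unit of \<open>A\<close> and the equation for \<open>b m\<close> can be solved for
      \<open>b m\<close> itself.\<close>
    have am: "1 - a m \<in> A" "1 - a m \<notin> n"
      using w(2) A.diff_C A.one_C ideal_inD(3)[OF ideal_n, of "1 - a m" "a m"] prime_inD(2)[OF prime_n]
      by auto
    obtain t where t: "t \<in> A" "(1 - a m) * t - 1 \<in> Z" using ex_unit_A[OF am] by blast
    define v where "v = (1 - a m) * t - 1"
    have "b m - y = w + (a m * b m + (\<Sum>k\<in>F. a k * b k))" using w(3) insert.hyps by simp
    then have eq: "(1 - a m) * b m = y + w + (\<Sum>k\<in>F. a k * b k)" by (simp add: algebra_simps)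
    have "b m = t * ((1 - a m) * b m) - v * b m" by (simp add: v_def algebra_simps)
    also have "\<dots> = (t * (y + w) + - v * b m) + (\<Sum>k\<in>F. (t * a k) * b k)"
      unfolding eq by (simp add: algebra_simps sum_distrib_left)
    finally have "b m = (t * (y + w) + - v * b m) + (\<Sum>k\<in>F. (t * a k) * b k)" .
    moreover have "- v * b m \<in> N"
      using N(2) ideal_inD(5)[OF ideal_Z mC ideal_uminus[OF ideal_Z t(2)]] by (auto simp: v_def)
    then have "t * (y + w) + - v * b m \<in> N" using N(3,4) y(1) w(1) t(1) by blast
    moreover have "\<forall>k\<in>F. t * a k \<in> A" using w(2) t(1) by (simp add: A.mult_C)
    ultimately show ?thesis by (intro bexI[of _ "t * (y + w) + - v * b m"] exI[of _ "\<lambda>k. t * a k"] conjI)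
  qed
  then obtain y a where y: "y \<in> N" "\<forall>k\<in>F. a k \<in> A" "b m = y + (\<Sum>k\<in>F. a k * b k)" by blast
  show ?case
  proof (rule insert.IH)
    show "x \<in> C" "\<forall>k\<in>F. b k \<in> C" using insert.prems by simp_all
    fix x assume "x \<in> C"
    from insert.prems(3)[OF this] obtain w d where w: "w \<in> N" "\<forall>k\<in>insert m F. d k \<in> A"
      "x = w + (\<Sum>k\<in>insert m F. d k * b k)" by blast
    have "x = w + (d m * b m + (\<Sum>k\<in>F. d k * b k))" using w(3) insert.hyps by simp
    also have "\<dots> = (w + d m * y) + (\<Sum>k\<in>F. (d m * a k + d k) * b k)"
      by (subst y(3)) (simp add: distrib_left distrib_right sum.distrib sum_distrib_left mult.assoc add_ac)
    finally have "x = (w + d m * y) + (\<Sum>k\<in>F. (d m * a k + d k) * b k)" .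
    moreover have "w + d m * y \<in> N" using N(3,4) w y(1) by simp
    moreover have "\<forall>k\<in>F. d m * a k + d k \<in> A" using w(2) y(2) by (simp add: A.add_C A.mult_C)
    ultimately show "\<exists>y\<in>N. \<exists>a. (\<forall>k\<in>F. a k \<in> A) \<and> x = y + (\<Sum>k\<in>F. a k * b k)"
      by (intro bexI[of _ "w + d m * y"] exI[of _ "\<lambda>k. d m * a k + d k"] conjI)
  qed
qed

text \<open>\<open>N\<close> is the span of the family together with \<open>Z\<close>. Spanning in
  the fibre is the hypothesis of Nakayama's lemma; its conclusion is spanning at the generic point,
  which takes at least as many elements as \<open>G\<close> has.\<close>

lemma card_spanning:
  assumes K: "finite K" "\<forall>i\<in>K. c i \<in> C" "spanning mC K c"
  shows "card G \<le> card K"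
proof -
  obtain F :: "('a \<Rightarrow> nat) set" and b where F: "finite F" "\<forall>k\<in>F. b k \<in> C" "spanning Z F b"
    using ex_finite_spanning by blast
  define N where "N = {x \<in> C. \<exists>a. (\<forall>i\<in>K. a i \<in> A) \<and> x - (\<Sum>i\<in>K. a i * c i) \<in> Z}"
  have lin: "(\<Sum>i\<in>K. a i * c i) \<in> N" if "\<forall>i\<in>K. a i \<in> A" for a
    unfolding N_def using that ideal_inD(2)[OF ideal_Z] K(2) AC
    by (auto intro!: sum_C mult_C exI[of _ a])
  have ZN: "Z \<subseteq> N"
    unfolding N_def using A.zero_C by (auto intro!: ZC exI[of _ "\<lambda>_. 0"])
  have addN: "x + y \<in> N" if xy: "x \<in> N" "y \<in> N" for x y
  proof -
    obtain a where a: "\<forall>i\<in>K. a i \<in> A" "x - (\<Sum>i\<in>K. a i * c i) \<in> Z" "x \<in> C"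
      using xy(1) unfolding N_def by blast
    obtain d where d: "\<forall>i\<in>K. d i \<in> A" "y - (\<Sum>i\<in>K. d i * c i) \<in> Z" "y \<in> C"
      using xy(2) unfolding N_def by blast
    have "x + y - (\<Sum>i\<in>K. (a i + d i) * c i) = (x - (\<Sum>i\<in>K. a i * c i)) + (y - (\<Sum>i\<in>K. d i * c i))"
      by (simp add: distrib_right sum.distrib)
    also have "\<dots> \<in> Z" using a(2) d(2) by (rule ideal_inD(3)[OF ideal_Z])
    finally show ?thesis
      using add_C[OF a(3) d(3)] a(1) d(1) A.add_C unfolding N_def
      by (intro CollectI conjI exI[of _ "\<lambda>i. a i + d i"]) auto
  qed
  have AN: "r * x \<in> N" if r: "r \<in> A" "x \<in> N" for r x
  proof -
    obtain a where a: "\<forall>i\<in>K. a i \<in> A" "x - (\<Sum>i\<in>K. a i * c i) \<in> Z" "x \<in> C"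
      using r(2) unfolding N_def by blast
    have "r * x - (\<Sum>i\<in>K. (r * a i) * c i) = r * (x - (\<Sum>i\<in>K. a i * c i))"
      by (simp add: right_diff_distrib sum_distrib_left mult.assoc)
    also have "\<dots> \<in> Z" using ideal_inD(4)[OF ideal_Z AC[OF r(1)] a(2)] .
    finally show ?thesis
      using mult_C[OF AC[OF r(1)] a(3)] a(1) A.mult_C[OF r(1)] unfolding N_def
      by (intro CollectI conjI exI[of _ "\<lambda>i. r * a i"]) auto
  qed
  have "x \<in> N" if "x \<in> C" for x
  proof (rule nakayama[OF _ ZN addN AN _ F(1,2) _ that])
    show "N \<subseteq> C" by (auto simp: N_def)
    show "\<exists>y\<in>N. x - y \<in> mC" if "x \<in> C" for x
      using K(3) that lin unfolding spanning_def by blast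
    show "\<exists>y\<in>N. \<exists>a. (\<forall>k\<in>F. a k \<in> A) \<and> x = y + (\<Sum>k\<in>F. a k * b k)" if x: "x \<in> C" for x
    proof -
      obtain a where a: "\<forall>k\<in>F. a k \<in> A" "x - (\<Sum>k\<in>F. a k * b k) \<in> Z"
        using F(3) x unfolding spanning_def by blast
      show ?thesis
        using a ZN by (intro bexI[of _ "x - (\<Sum>k\<in>F. a k * b k)"] exI[of _ a]) auto
    qed
  qed
  then have "spanning Z K c" unfolding spanning_def N_def by blast
  then have "card (decomposition Z) \<le> card K * card (inertia Z)"
    using K(1,2) by (intro card_inertia_ge_spanning[OF prime_Z]) auto
  then show ?thesis by (simp add: decomposition_Z inertia_Z)
qed

text \<open>A largest family independent modulo \<open>n\<close> is a basis of the residue field of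
  \<open>C\<close> at \<open>n\<close> over that of \<open>A\<close>. The order of the decomposition
  group bounds such families, so a largest one exists, and the two halves of Artin's theorem
  determine its size.\<close>

lemma ex_residue_basis:
  obtains f :: nat and y where "\<forall>j<f. y j \<in> C" "independent n {..<f} y" "spanning n {..<f} y"
    "f * card (inertia n) = card (decomposition n)"
proof -
  define fam where "fam f \<longleftrightarrow> (\<exists>y. (\<forall>j<f. y j \<in> C) \<and> independent n {..<f} y)" for f :: nat
  have bound: "f * card (inertia n) \<le> card (decomposition n)"
    if "\<forall>j<f. y j \<in> C" "independent n {..<f} y" for f and y :: "nat \<Rightarrow> 'a"
    using card_inertia_le_independent[OF prime_n char, of "{..<f}" y] that by simp
  have "finite (inertia n)" "id \<in> inertia n"
    using finite_G id_G ideal_inD(2)[OF ideal_n] by (auto simp: inertia_def)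
  then have "0 < card (inertia n)" using card_gt_0_iff by blast
  then have le: "f \<le> f * card (inertia n)" for f by simp
  have bounded: "f \<le> card (decomposition n)" if "fam f" for f
    using that bound le order_trans unfolding fam_def by blast
  define f where "f = (GREATEST f. fam f)"
  have "fam 0" by (simp add: fam_def independent_def)
  then have "fam f" unfolding f_def using bounded by (rule GreatestI_nat)
  then obtain y where y: "\<forall>j<f. y j \<in> C" "independent n {..<f} y" unfolding fam_def by blast
  have "\<not> fam (Suc f)"
  proof
    assume "fam (Suc f)"
    then have "Suc f \<le> f" unfolding f_def using bounded by (rule Greatest_le_nat)
    then show False by simp
  qed
  have "spanning n {..<f} y"
    unfolding spanning_def
  proof
    fix x assume x: "x \<in> C"
    define y' where "y' = y(f := x)"
    have "\<forall>j<Suc f. y' j \<in> C" using y(1) x by (auto simp: y'_def less_Suc_eq)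
    then have "\<not> independent n {..<Suc f} y'" using \<open>\<not> fam (Suc f)\<close> unfolding fam_def by blast
    then obtain a where a: "\<forall>i<Suc f. a i \<in> A" "(\<Sum>i<Suc f. a i * y' i) \<in> n"
        "\<exists>i<Suc f. a i \<notin> n"
      unfolding independent_def by auto
    have "(\<Sum>i<f. a i * y' i) = (\<Sum>i<f. a i * y i)" by (intro sum.cong) (auto simp: y'_def)
    then have s: "(\<Sum>i<f. a i * y i) + a f * x \<in> n" using a(2) by (simp add: y'_def)
    \<comment> \<open>The new element occurs with a unit coefficient, since \<open>y\<close> alone
      is independent; dividing by it expresses \<open>x\<close> through \<open>y\<close>.\<close>
    have af: "a f \<notin> n"
    proof
      assume af: "a f \<in> n"
      then have "(\<Sum>i<f. a i * y i) \<in> n"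
        using s ideal_add_cancel[OF ideal_n ideal_inD(5)[OF ideal_n x af]] by blast
      then have "\<forall>i\<in>{..<f}. a i \<in> n" using y(2) a(1) unfolding independent_def by simp
      then show False using a(3) af by (auto simp: less_Suc_eq)
    qed
    then obtain b where b: "b \<in> A" "a f * b - 1 \<in> Z" using ex_unit_A a(1) by blast
    have "x - (\<Sum>i<f. (- b * a i) * y i) = b * ((\<Sum>i<f. a i * y i) + a f * x) - (a f * b - 1) * x"
      by (simp add: algebra_simps sum_distrib_left sum_negf)
    moreover have "\<dots> \<in> n"
      using ideal_diff[OF ideal_n ideal_inD(4)[OF ideal_n AC[OF b(1)] s]
          ideal_inD(5)[OF ideal_n x subsetD[OF Z_n b(2)]]] .
    ultimately have "x - (\<Sum>i<f. (- b * a i) * y i) \<in> n" by metis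
    then show "\<exists>a. (\<forall>i\<in>{..<f}. a i \<in> A) \<and> x - (\<Sum>i<f. a i * y i) \<in> n"
      using a(1) b(1) A.mult_C A.uminus_C by (intro exI[of _ "\<lambda>i. - b * a i"]) auto
  qed
  moreover from this have "card (decomposition n) \<le> card {..<f} * card (inertia n)"
    using y(1) by (intro card_inertia_ge_spanning[OF prime_n]) auto
  then have "f * card (inertia n) = card (decomposition n)" using bound[OF y] by simp
  ultimately show ?thesis using that y by blast
qed

section \<open>Chains of saturated ideals\<close>

definition chain :: "(nat \<Rightarrow> 'a set) \<Rightarrow> nat \<Rightarrow> bool" where
  "chain J l \<longleftrightarrow> (\<forall>i\<le>l. saturated (J i)) \<and> (\<forall>i<l. J i \<subset> J (Suc i))"

lemma chain_mono: "chain J l \<Longrightarrow> i \<le> k \<Longrightarrow> k \<le> l \<Longrightarrow> J i \<subseteq> J k"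
proof (induction k)
  case (Suc k)
  then show ?case unfolding chain_def by (metis Suc_leD Suc_le_eq le_SucE order.trans psubset_imp_subset subset_refl)
qed simp

text \<open>
  For a chain of saturated ideals with \<open>x i\<close> in the \<open>(i + 1)\<close>-st but not in the \<open>i\<close>-th ideal, and a
  residue basis \<open>y\<close>, the conjugates of the products \<open>x i * y j\<close>, cut off away from \<open>n\<close> by \<open>sep\<close>,
  are independent modulo the maximal ideal of \<open>A\<close>, and spanning if the chain is maximal.
\<close>

definition cutoff_family :: "(nat \<Rightarrow> 'a) \<Rightarrow> (nat \<Rightarrow> 'a) \<Rightarrow> 'a set \<times> nat \<times> nat \<Rightarrow> 'a" where
  "cutoff_family x y = (\<lambda>(P, i, j). inv_G (rep P) (sep * (x i * y j)))"

lemma cutoff_family_C: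
  assumes "\<And>i. i < l \<Longrightarrow> x i \<in> C" "\<And>j. j < f \<Longrightarrow> y j \<in> C"
  shows "\<forall>k\<in>conjugate ` G \<times> {..<l} \<times> {..<f}. cutoff_family x y k \<in> C"
proof (clarsimp simp: cutoff_family_def simp del: image_iff)
  fix \<sigma> i j assume "\<sigma> \<in> G" "i < l" "j < (f::nat)"
  then show "inv_G (rep (conjugate \<sigma>)) (sep * (x i * y j)) \<in> C"
    using assms by (intro hom_C[OF inv_G(1)[OF rep(1)]] mult_C[OF sep(1)] mult_C) auto
qed

text \<open>At the conjugate \<open>P\<close>, only the members with index \<open>P\<close> survive modulo \<open>Q\<close>.\<close>

lemma sum_cutoff_family:
  assumes P: "P \<in> conjugate ` G" and x: "\<And>i. i < l \<Longrightarrow> x i \<in> C" and y: "\<And>j. j < f \<Longrightarrow> y j \<in> C"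
    and a: "\<forall>k\<in>conjugate ` G \<times> {..<l} \<times> {..<f}. a k \<in> A"
  shows "rep P (\<Sum>k\<in>conjugate ` G \<times> {..<l} \<times> {..<f}. a k * cutoff_family x y k)
    - sep * (\<Sum>i<l. x i * (\<Sum>j<f. a (P, i, j) * y j)) \<in> Q"
proof -
  note r = rep(1)[OF P]
  let ?t = "\<lambda>P'. \<Sum>(i, j)\<in>{..<l} \<times> {..<f}. a (P', i, j) * rep P (inv_G (rep P') (sep * (x i * y j)))"
  have "rep P (\<Sum>k\<in>conjugate ` G \<times> {..<l} \<times> {..<f}. a k * cutoff_family x y k)
      = (\<Sum>k\<in>conjugate ` G \<times> {..<l} \<times> {..<f}. a k * rep P (cutoff_family x y k))"
    unfolding hom_sum[OF r] hom_mult[OF r] using A_fixed[OF r] a by (intro sum.cong) auto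
  also have "\<dots> = (\<Sum>P'\<in>conjugate ` G. ?t P')"
    unfolding sum.cartesian_product cutoff_family_def by (rule sum.cong) auto
  also have "\<dots> = ?t P + (\<Sum>P'\<in>conjugate ` G - {P}. ?t P')"
    using sum.remove[OF finite_imageI[OF finite_G] P] .
  also have "?t P = sep * (\<Sum>i<l. x i * (\<Sum>j<f. a (P, i, j) * y j))"
    unfolding inv_G(4)[OF r] by (simp add: sum.cartesian_product[symmetric] sum_distrib_left mult_ac)
  finally have "rep P (\<Sum>k\<in>conjugate ` G \<times> {..<l} \<times> {..<f}. a k * cutoff_family x y k)
    - sep * (\<Sum>i<l. x i * (\<Sum>j<f. a (P, i, j) * y j)) = (\<Sum>P'\<in>conjugate ` G - {P}. ?t P')"
    by simp
  also have "\<dots> \<in> Q"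
  proof (rule ideal_sum[OF ideal_Q])
    fix P' assume P': "P' \<in> conjugate ` G - {P}"
    show "?t P' \<in> Q"
    proof (rule ideal_sum[OF ideal_Q])
      fix k assume "k \<in> {..<l} \<times> {..<f}"
      then obtain i j where k: "k = (i, j)" and ij: "i \<in> {..<l}" "j \<in> {..<f}" by (rule SigmaE)
      have "rep P (inv_G (rep P') (sep * (x i * y j))) \<in> Q"
        using P' rep(2)[OF P] x y ij by (intro rep_sep r mult_C) auto
      moreover have "a (P', i, j) \<in> C" using a P' ij AC by blast
      ultimately have "a (P', i, j) * rep P (inv_G (rep P') (sep * (x i * y j))) \<in> Q"
        by (intro ideal_inD(4)[OF ideal_Q])
      then show "(case k of (i, j) \<Rightarrow> a (P', i, j) * rep P (inv_G (rep P') (sep * (x i * y j)))) \<in> Q"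
        by (simp add: k)
    qed
  qed
  finally show ?thesis .
qed

text \<open>The family is triangular with respect to the chain. In the sum of the
  \<open>x k * u k\<close>, read modulo \<open>J i\<close>, the terms with \<open>k < i\<close>
  vanish since \<open>x k\<close> is in \<open>J i\<close>, and those with \<open>k > i\<close> by
  descending induction, their coefficients being in the maximal ideal. So \<open>x i * u i\<close>
  is in \<open>J i\<close> while \<open>x i\<close> is not, saturation forces \<open>u i\<close>
  into \<open>n\<close>, and independence of the residue basis gives the coefficients.\<close>

lemma chain_length_le:
  assumes J: "chain J l"
  shows "l \<le> card (inertia n)"
proof -
  obtain f :: nat and y where y: "\<forall>j<f. y j \<in> C" "independent n {..<f} y"
      "f * card (inertia n) = card (decomposition n)"
    using ex_residue_basis by metis
  have "\<forall>i. \<exists>x. i < l \<longrightarrow> x \<in> J (Suc i) \<and> x \<notin> J i" using J unfolding chain_def by blast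
  then obtain x where x: "\<And>i. i < l \<Longrightarrow> x i \<in> J (Suc i)" "\<And>i. i < l \<Longrightarrow> x i \<notin> J i" by metis
  have sat: "saturated (J i)" if "i \<le> l" for i using J that by (simp add: chain_def)
  have xC: "x i \<in> C" if "i < l" for i
    using ideal_inD(1)[OF saturatedD(1)[OF sat[of "Suc i"]] x(1)] that by simp
  let ?K = "conjugate ` G \<times> {..<l} \<times> {..<f}"
  have "independent mC ?K (cutoff_family x y)"
    unfolding independent_def
  proof (intro allI impI)
    fix a assume a: "(\<forall>k\<in>?K. a k \<in> A) \<and> (\<Sum>k\<in>?K. a k * cutoff_family x y k) \<in> mC"
    have aA: "a (P, i, j) \<in> A" if "P \<in> conjugate ` G" "i < l" "j < f" for P i j using a that by blast
    have "\<forall>j<f. a (P, i, j) \<in> n" if P: "P \<in> conjugate ` G" and "i < l" for P i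
      using \<open>i < l\<close>
    proof (induction "l - i" arbitrary: i rule: less_induct)
      case less
      define u where "u i = (\<Sum>j<f. a (P, i, j) * y j)" for i
      have uC: "u i \<in> C" if "i < l" for i
        unfolding u_def using aA[OF P that] AC y(1) by (intro sum_C mult_C) auto
      have "rep P (\<Sum>k\<in>?K. a k * cutoff_family x y k) \<in> Q"
        using hom_mC[OF _ rep(1)[OF P]] a saturatedD(2)[OF saturated_Q] by blast
      moreover have "rep P (\<Sum>k\<in>?K. a k * cutoff_family x y k) - sep * (\<Sum>i<l. x i * u i) \<in> Q"
        using sum_cutoff_family[OF P, of l x f y a] xC y(1) a unfolding u_def by blast
      ultimately have "sep * (\<Sum>i<l. x i * u i) \<in> Q"
        using ideal_diff[OF ideal_Q] by fastforce
      moreover have "(\<Sum>i<l. x i * u i) \<in> C" using xC uC by (intro sum_C mult_C) auto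
      ultimately have "(\<Sum>i<l. x i * u i) \<in> Q"
        using saturatedD(3)[OF saturated_Q sep(1) _ sep(2)] by blast
      then have sumJ: "(\<Sum>i<l. x i * u i) \<in> J i" using Q_subset[OF sat] less.prems by simp
      note Ji = saturatedD(1)[OF sat[OF less_imp_le[OF less.prems]]]
      have rest: "x k * u k \<in> J i" if k: "k < l" "k \<noteq> i" for k
      proof (cases "k < i")
        case True
        then have "x k \<in> J i" using x(1)[OF k(1)] chain_mono[OF J, of "Suc k" i] less.prems by auto
        then show ?thesis using ideal_inD(5)[OF Ji uC[OF k(1)]] by blast
      next
        case False
        then have "\<forall>j<f. a (P, k, j) \<in> n" using k less.hyps[of k] by auto
        then have "u k \<in> mC" unfolding u_def
          using aA[OF P k(1)] y(1) by (intro ideal_sum[OF ideal_mC] mC_mult) auto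
        then have "u k \<in> J i" using saturatedD(2)[OF sat] less.prems by simp
        then show ?thesis using ideal_inD(4)[OF Ji xC[OF k(1)]] by blast
      qed
      have "(\<Sum>k\<in>{..<l} - {i}. x k * u k) \<in> J i" using rest by (intro ideal_sum[OF Ji]) auto
      then have "x i * u i \<in> J i"
        using sumJ less.prems sum.remove[of "{..<l}" i "\<lambda>i. x i * u i"] ideal_add_cancel[OF Ji]
        by simp
      then have "u i \<in> n"
        using saturatedD(3)[OF sat uC xC] less.prems x(2) by (metis less_imp_le mult.commute)
      then show ?case
        using y(2)[unfolded independent_def, rule_format, of "\<lambda>j. a (P, i, j)"] aA[OF P less.prems]
        unfolding u_def by blast
    qed
    then show "\<forall>k\<in>?K. a k \<in> mC" using mC_A aA by auto
  qed
  moreover have "\<forall>k\<in>?K. cutoff_family x y k \<in> C" using cutoff_family_C xC y(1) by blast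
  moreover have "finite ?K" using finite_G by blast
  ultimately have "card ?K \<le> card G" by (intro card_independent)
  then have le: "card (conjugate ` G) * (l * f) \<le> card (conjugate ` G) * (f * card (inertia n))"
    using card_conjugates y(3) by (simp add: card_cartesian_product)
  have "conjugate ` G \<noteq> {}" using id_G by blast
  then have "0 < card (conjugate ` G)" using finite_G card_gt_0_iff by blast
  moreover have "0 < card (decomposition n)"
    using finite_decomposition id_decomposition card_gt_0_iff by blast
  then have "0 < f" using y(3) by (metis gr0I mult_0 not_gr_zero)
  ultimately show ?thesis using le by (simp add: mult.commute[of f])
qed

text \<open>Refinement at position \<open>k\<close>, which may also lie before the first or after
  the last member. A chain of maximal length admits no such \<open>J'\<close>.\<close>

lemma chain_insert:
  assumes J: "chain J l" and J': "saturated J'"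
    and k: "k \<le> Suc l" "0 < k \<longrightarrow> J (k - 1) \<subset> J'" "k \<le> l \<longrightarrow> J' \<subset> J k"
  shows "\<exists>J. chain J (Suc l)"
proof -
  define J2 where "J2 i = (if i < k then J i else if i = k then J' else J (i - 1))" for i
  have "saturated (J2 i)" if "i \<le> Suc l" for i
    using J J' k(1) that by (auto simp: J2_def chain_def)
  moreover have "J2 i \<subset> J2 (Suc i)" if i: "i < Suc l" for i
  proof -
    consider "Suc i < k" | "Suc i = k" | "i = k" | "k < i" by linarith
    then show ?thesis
    proof cases
      case 1
      then show ?thesis using J k(1) by (auto simp: J2_def chain_def)
    next
      case 2
      then show ?thesis using k(2) by (auto simp: J2_def)
    next
      case 3
      then show ?thesis using k(3) i by (auto simp: J2_def)
    next
      case 4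
      then obtain i' where "i = Suc i'" by (cases i) auto
      then show ?thesis using J i 4 by (auto simp: J2_def chain_def)
    qed
  qed
  ultimately show ?thesis unfolding chain_def by blast
qed

text \<open>A chain of maximal length starts at \<open>Q\<close> and ends at \<open>C\<close>, and
  after localisation at \<open>n\<close> its successive quotients are generated by
  \<open>x i\<close> and annihilated by \<open>n\<close>, hence one-dimensional over the residue
  field. So the cut off products span the fibre, and counting them bounds the length from
  below.\<close>

lemma ex_chain: "\<exists>J. chain J (card (inertia n))"
proof -
  define l where "l = (GREATEST l. \<exists>J. chain J l)"
  have "chain (\<lambda>_. Q) 0" by (simp add: chain_def saturated_Q)
  then have "\<exists>J. chain J l"
    unfolding l_def using chain_length_le by (intro GreatestI_nat[of "\<lambda>l. \<exists>J. chain J l" 0]) blast+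
  then obtain J where J: "chain J l" by blast
  have max: "\<not> chain J' (Suc l)" for J'
  proof
    assume "chain J' (Suc l)"
    then have "Suc l \<le> l"
      unfolding l_def using chain_length_le by (intro Greatest_le_nat[of "\<lambda>l. \<exists>J. chain J l"]) blast+
    then show False by simp
  qed
  have sat: "saturated (J i)" if "i \<le> l" for i using J that by (simp add: chain_def)
  have "J 0 = Q"
    using chain_insert[OF J saturated_Q, of 0] max Q_subset[OF sat[of 0]] by blast
  have satC: "saturated C"
    unfolding saturated_def ideal_in_def using ideal_inD(1)[OF ideal_mC]
    by (auto simp: zero_C add_C mult_C)
  have "J l = C"
    using chain_insert[OF J satC, of "Suc l"] max ideal_inD(1)[OF saturatedD(1)[OF sat[of l]]] by auto
  have "\<forall>i. \<exists>x. i < l \<longrightarrow> x \<in> J (Suc i) \<and> x \<notin> J i" using J unfolding chain_def by blast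
  then obtain x where x: "\<And>i. i < l \<Longrightarrow> x i \<in> J (Suc i)" "\<And>i. i < l \<Longrightarrow> x i \<notin> J i" by metis
  have xC: "x i \<in> C" if "i < l" for i
    using ideal_inD(1)[OF saturatedD(1)[OF sat[of "Suc i"]] x(1)] that by simp
  obtain f :: nat and y where y: "\<forall>j<f. y j \<in> C" "spanning n {..<f} y"
      "f * card (inertia n) = card (decomposition n)"
    using ex_residue_basis by metis
  \<comment> \<open>The sums of \<open>J i\<close> and \<open>K * x i\<close> are needed for
    \<open>K\<close> equal to \<open>n\<close> and to \<open>C\<close>. Their saturations lie
    between consecutive members of the chain and so equal one of the two.\<close>
  have mult_ideal: "ideal_in {j + \<nu> * x i | j \<nu>. j \<in> J i \<and> \<nu> \<in> K}" (is "ideal_in ?M")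
    and mult_sub: "J i \<subseteq> {j + \<nu> * x i | j \<nu>. j \<in> J i \<and> \<nu> \<in> K}"
    and mult_sat: "saturation {j + \<nu> * x i | j \<nu>. j \<in> J i \<and> \<nu> \<in> K} \<subseteq> J (Suc i)"
    if i: "i < l" and K: "ideal_in K" for i K
  proof -
    note Ji = saturatedD(1)[OF sat[OF less_imp_le[OF i]]]
    note JS = sat[OF Suc_leI[OF i]]
    show sub: "J i \<subseteq> ?M"
    proof
      fix j assume "j \<in> J i"
      then show "j \<in> ?M" using ideal_inD(2)[OF K] by (intro CollectI exI[of _ j] exI[of _ 0]) simp
    qed
    show "ideal_in ?M"
      unfolding ideal_in_def
    proof (intro conjI ballI)
      show "?M \<subseteq> C"
        using ideal_inD(1)[OF Ji] ideal_inD(1)[OF K] xC[OF i] add_C mult_C by blast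
      show "0 \<in> ?M" using sub ideal_inD(2)[OF Ji] by blast
      show "u + v \<in> ?M" if uv: "u \<in> ?M" "v \<in> ?M" for u v
      proof -
        obtain j \<nu> where u: "u = j + \<nu> * x i" "j \<in> J i" "\<nu> \<in> K" using uv(1) by blast
        obtain j' \<nu>' where v: "v = j' + \<nu>' * x i" "j' \<in> J i" "\<nu>' \<in> K" using uv(2) by blast
        have "u + v = (j + j') + (\<nu> + \<nu>') * x i" by (simp add: u v algebra_simps)
        then show ?thesis using ideal_inD(3)[OF Ji u(2) v(2)] ideal_inD(3)[OF K u(3) v(3)] by blast
      qed
      show "c * u \<in> ?M" if cu: "c \<in> C" "u \<in> ?M" for c u
      proof -
        obtain j \<nu> where u: "u = j + \<nu> * x i" "j \<in> J i" "\<nu> \<in> K" using cu(2) by blast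
        have "c * u = c * j + (c * \<nu>) * x i" by (simp add: u algebra_simps)
        then show ?thesis using ideal_inD(4)[OF Ji cu(1) u(2)] ideal_inD(4)[OF K cu(1) u(3)] by blast
      qed
    qed
    have "?M \<subseteq> J (Suc i)"
    proof
      fix u assume "u \<in> ?M"
      then obtain j \<nu> where u: "u = j + \<nu> * x i" "j \<in> J i" "\<nu> \<in> K" by blast
      have "j \<in> J (Suc i)" using J i u(2) unfolding chain_def by blast
      then show "u \<in> J (Suc i)"
        unfolding u(1)
        using ideal_inD(3)[OF saturatedD(1)[OF JS]] ideal_inD(4)[OF saturatedD(1)[OF JS] _ x(1)[OF i]]
          ideal_inD(1)[OF K u(3)] by blast
    qed
    then show "saturation ?M \<subseteq> J (Suc i)"
      using saturatedD(3)[OF JS] unfolding saturation_def by blast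
  qed
  have eqJ: "J' = J i \<or> J' = J (Suc i)"
    if "i < l" "saturated J'" "J i \<subseteq> J'" "J' \<subseteq> J (Suc i)" for i J'
    using chain_insert[OF J that(2), of "Suc i"] max that by auto
  have nx: "\<nu> * x i \<in> J i" if i: "i < l" and \<nu>: "\<nu> \<in> n" for i \<nu>
  proof -
    define M where "M = {j + \<nu> * x i | j \<nu>. j \<in> J i \<and> \<nu> \<in> n}"
    note M = mult_ideal[OF i ideal_n, folded M_def] mult_sub[OF i ideal_n, folded M_def]
      mult_sat[OF i ideal_n, folded M_def]
    have "mC \<subseteq> M" using M(2) saturatedD(2)[OF sat] i by auto
    then have S: "saturated (saturation M)" using M(1) by (intro saturated_saturation)
    \<comment> \<open>Nakayama's argument for a single element:
      \<open>s * x i = j + \<mu> * x i\<close> puts \<open>(s - \<mu>) * x i\<close> into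
      \<open>J i\<close>, and \<open>s - \<mu>\<close> is outside \<open>n\<close>.\<close>
    have "x i \<notin> saturation M"
    proof
      assume "x i \<in> saturation M"
      then obtain s j \<mu> where s: "s \<in> C" "s \<notin> n" "s * x i = j + \<mu> * x i" "j \<in> J i" "\<mu> \<in> n"
        unfolding saturation_def M_def by blast
      have "(s - \<mu>) * x i \<in> J i" using s(3,4) by (simp add: algebra_simps)
      moreover have "s - \<mu> \<notin> n" using ideal_inD(3)[OF ideal_n _ s(5), of "s - \<mu>"] s(2) by auto
      ultimately show False
        using saturatedD(3)[OF sat _ xC[OF i], of i "s - \<mu>"] diff_C[OF s(1) nC[OF s(5)]] i x(2) by auto
    qed
    then have "saturation M = J i"
      using eqJ[OF i S] M(2,3) saturation_subset[OF M(1)] x(1)[OF i] by blast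
    moreover have "\<nu> * x i \<in> M"
      unfolding M_def using \<nu> ideal_inD(2)[OF saturatedD(1)[OF sat]] i
      by (intro CollectI exI[of _ 0] exI[of _ \<nu>]) simp
    ultimately show ?thesis using saturation_subset[OF M(1)] by blast
  qed
  have step: "\<exists>a. (\<forall>j<f. a j \<in> A) \<and> c - sep * (x i * (\<Sum>j<f. a j * y j)) \<in> J i"
    if i: "i < l" and c: "c \<in> J (Suc i)" for i c
  proof -
    define M where "M = {j + \<nu> * x i | j \<nu>. j \<in> J i \<and> \<nu> \<in> C}"
    note M = mult_ideal[OF i saturatedD(1)[OF satC], folded M_def]
      mult_sub[OF i saturatedD(1)[OF satC], folded M_def]
      mult_sat[OF i saturatedD(1)[OF satC], folded M_def]
    note Ji = saturatedD(1)[OF sat[OF less_imp_le[OF i]]]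
    have "mC \<subseteq> M" using M(2) saturatedD(2)[OF sat] i by auto
    then have S: "saturated (saturation M)" using M(1) by (intro saturated_saturation)
    have "x i \<in> M"
      unfolding M_def using one_C ideal_inD(2)[OF Ji]
      by (intro CollectI exI[of _ 0] exI[of _ 1]) simp
    then have "saturation M \<noteq> J i" using saturation_subset[OF M(1)] x(2)[OF i] by blast
    then have "saturation M = J (Suc i)"
      using eqJ[OF i S] M(2,3) saturation_subset[OF M(1)] by blast
    then obtain s j d where s: "s \<in> C" "s \<notin> n" "s * c = j + d * x i" "j \<in> J i" "d \<in> C"
      using c unfolding saturation_def M_def by blast
    obtain u where u: "u \<in> C" "s * u - 1 \<in> n" using ex_inverse_mod_n[OF s(1,2)] by blast
    \<comment> \<open>\<open>v\<close> inverts \<open>sep\<close> modulo \<open>n\<close>, to absorb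
      the factor \<open>sep\<close> that the cut off family carries.\<close>
    obtain v where v: "v \<in> C" "sep * v - 1 \<in> n" using ex_inverse_mod_n[OF sep(1,2)] by blast
    have cC: "c \<in> C" using c ideal_inD(1)[OF saturatedD(1)[OF sat]] i by (metis Suc_leI)
    have udC: "u * d \<in> C" using u(1) s(5) by (rule mult_C)
    have "s * (c - u * d * x i) = j - d * ((s * u - 1) * x i)"
      unfolding right_diff_distrib s(3) by (simp add: algebra_simps)
    also have "\<dots> \<in> J i"
      using ideal_diff[OF Ji s(4) ideal_inD(4)[OF Ji s(5) nx[OF i u(2)]]] .
    finally have 1: "c - u * d * x i \<in> J i"
      using saturatedD(3)[OF sat s(1) diff_C[OF cC mult_C[OF udC xC[OF i]]] s(2)] i by simp
    obtain a where a: "\<forall>j\<in>{..<f}. a j \<in> A" "v * (u * d) - (\<Sum>j<f. a j * y j) \<in> n"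
      using y(2) mult_C[OF v(1) udC] unfolding spanning_def by blast
    let ?w = "\<Sum>j<f. a j * y j"
    have "c - sep * (x i * ?w) = (c - u * d * x i) + (sep * (v * (u * d) - ?w) - (sep * v - 1) * (u * d)) * x i"
      by (simp add: algebra_simps)
    also have "\<dots> \<in> J i"
      using ideal_inD(3)[OF Ji 1 nx[OF i ideal_diff[OF ideal_n ideal_inD(4)[OF ideal_n sep(1) a(2)]
          ideal_inD(5)[OF ideal_n udC v(2)]]]] .
    finally show ?thesis using a(1) by auto
  qed
  \<comment> \<open>Descending the chain one member at a time ends in \<open>J 0\<close>, which is
    \<open>Q\<close>, with one block of coefficients for each step.\<close>
  have expand: "\<exists>a. (\<forall>k<i. \<forall>j<f. a k j \<in> A) \<and> c - sep * (\<Sum>k<i. x k * (\<Sum>j<f. a k j * y j)) \<in> Q"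
    if "i \<le> l" "c \<in> J i" for i c
    using that
  proof (induction i arbitrary: c)
    case 0
    then show ?case using \<open>J 0 = Q\<close> by simp
  next
    case (Suc i)
    obtain a where a: "\<forall>j<f. a j \<in> A" "c - sep * (x i * (\<Sum>j<f. a j * y j)) \<in> J i"
      using step[of i c] Suc.prems by auto
    from Suc.IH[OF Suc_leD[OF Suc.prems(1)] a(2)] obtain a' where a': "\<forall>k<i. \<forall>j<f. a' k j \<in> A"
        "c - sep * (x i * (\<Sum>j<f. a j * y j)) - sep * (\<Sum>k<i. x k * (\<Sum>j<f. a' k j * y j)) \<in> Q"
      by (elim exE conjE)
    define b where "b = a'(i := a)"
    have "(\<Sum>k<i. x k * (\<Sum>j<f. b k j * y j)) = (\<Sum>k<i. x k * (\<Sum>j<f. a' k j * y j))"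
      by (intro sum.cong) (auto simp: b_def)
    then have "c - sep * (\<Sum>k<Suc i. x k * (\<Sum>j<f. b k j * y j)) \<in> Q"
      using a'(2) by (simp add: b_def algebra_simps)
    moreover have "\<forall>k<Suc i. \<forall>j<f. b k j \<in> A" using a(1) a'(1) by (auto simp: b_def less_Suc_eq)
    ultimately show ?case by blast
  qed
  let ?K = "conjugate ` G \<times> {..<l} \<times> {..<f}"
  have "spanning mC ?K (cutoff_family x y)"
    unfolding spanning_def
  proof
    fix c assume c: "c \<in> C"
    have "\<forall>P\<in>conjugate ` G. \<exists>a. (\<forall>k<l. \<forall>j<f. a k j \<in> A) \<and>
        rep P c - sep * (\<Sum>k<l. x k * (\<Sum>j<f. a k j * y j)) \<in> Q"
    proof
      fix P assume P: "P \<in> conjugate ` G"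
      show "\<exists>a. (\<forall>k<l. \<forall>j<f. a k j \<in> A) \<and>
          rep P c - sep * (\<Sum>k<l. x k * (\<Sum>j<f. a k j * y j)) \<in> Q"
        using hom_C[OF rep(1)[OF P] c] \<open>J l = C\<close> by (intro expand) simp_all
    qed
    from bchoice[OF this] obtain a where a: "\<forall>P\<in>conjugate ` G. (\<forall>k<l. \<forall>j<f. a P k j \<in> A) \<and>
        rep P c - sep * (\<Sum>k<l. x k * (\<Sum>j<f. a P k j * y j)) \<in> Q" by blast
    define a' where "a' = (\<lambda>(P, i, j). a P i j)"
    have a'A: "\<forall>k\<in>?K. a' k \<in> A" using a by (auto simp: a'_def)
    define r where "r = c - (\<Sum>k\<in>?K. a' k * cutoff_family x y k)"
    have famC: "\<forall>k\<in>?K. cutoff_family x y k \<in> C" using cutoff_family_C xC y(1) by blast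
    have "(\<Sum>k\<in>?K. a' k * cutoff_family x y k) \<in> C"
      using famC a'A AC by (intro sum_C mult_C) blast+
    then have rC: "r \<in> C" unfolding r_def by (rule diff_C[OF c])
    have repQ: "rep P r \<in> Q" if P: "P \<in> conjugate ` G" for P
    proof -
      let ?s = "\<Sum>k<l. x k * (\<Sum>j<f. a P k j * y j)"
      have "rep P (\<Sum>k\<in>?K. a' k * cutoff_family x y k) - sep * ?s \<in> Q"
        using sum_cutoff_family[OF P, of l x f y a'] xC y(1) a'A unfolding a'_def by simp
      then have "(rep P c - sep * ?s) - (rep P (\<Sum>k\<in>?K. a' k * cutoff_family x y k) - sep * ?s) \<in> Q"
        using ideal_diff[OF ideal_Q conjunct2[OF bspec[OF a P]]] by blast
      then show ?thesis unfolding r_def hom_diff[OF rep(1)[OF P]] by simp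
    qed
    \<comment> \<open>The representatives suffice, because \<open>Q\<close> is stable under the
      decomposition group.\<close>
    have "\<sigma> r \<in> Q" if \<sigma>: "\<sigma> \<in> G" for \<sigma>
    proof -
      have P: "conjugate \<sigma> \<in> conjugate ` G" using \<sigma> by blast
      have "\<sigma> \<circ> inv_G (rep (conjugate \<sigma>)) \<in> decomposition n"
        using conjugate_eq[OF \<sigma> rep(1)[OF P]] rep(2)[OF P] by simp
      from hom_Q[OF this repQ[OF P]] show ?thesis by (simp add: inv_G(5)[OF rep(1)[OF P]])
    qed
    then have "r \<in> mC" using local_global[OF rC] by blast
    then show "\<exists>a. (\<forall>k\<in>?K. a k \<in> A) \<and> c - (\<Sum>k\<in>?K. a k * cutoff_family x y k) \<in> mC"
      using a'A unfolding r_def by blast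
  qed
  moreover have "\<forall>k\<in>?K. cutoff_family x y k \<in> C" using cutoff_family_C xC y(1) by blast
  moreover have "finite ?K" using finite_G by blast
  ultimately have "card G \<le> card ?K" by (intro card_spanning)
  then have "card (conjugate ` G) * (f * card (inertia n)) \<le> card (conjugate ` G) * (l * f)"
    using card_conjugates y(3) by (simp add: card_cartesian_product)
  moreover have "conjugate ` G \<noteq> {}" using id_G by blast
  then have "0 < card (conjugate ` G)" using finite_G card_gt_0_iff by blast
  moreover have "0 < card (decomposition n)"
    using finite_decomposition id_decomposition card_gt_0_iff by blast
  then have "0 < f" using y(3) by (metis gr0I mult_0 not_gr_zero)
  ultimately have "card (inertia n) \<le> l" by (simp add: mult.commute[of f])
  then have "l = card (inertia n)" using chain_length_le[OF J] by simp
  then show ?thesis using J by blast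
qed

end

section \<open>Relations in flat modules\<close>

text \<open>
  The ideals of \<open>A\<close>, as modules carried by the type that the definition of flatness quantifies over.
\<close>

definition const_set :: "'r \<Rightarrow> (nat \<Rightarrow> 'r) set" where
  "const_set a = {\<lambda>_. a}"

definition const_of :: "(nat \<Rightarrow> 'r) set \<Rightarrow> 'r" where
  "const_of S = the_elem S 0"

lemma const_of_const_set [simp]: "const_of (const_set a) = a"
  by (simp add: const_of_def const_set_def)

definition ideal_module :: "('r, 'k) ring_scheme \<Rightarrow> 'r set \<Rightarrow> ('r, (nat \<Rightarrow> 'r) set) module" where
  "ideal_module A I = \<lparr> carrier = const_set ` I,
     monoid.mult = (\<lambda>S T. const_set (const_of S \<otimes>\<^bsub>A\<^esub> const_of T)),
     monoid.one = const_set \<one>\<^bsub>A\<^esub>, ring.zero = const_set \<zero>\<^bsub>A\<^esub>,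
     ring.add = (\<lambda>S T. const_set (const_of S \<oplus>\<^bsub>A\<^esub> const_of T)),
     smult = (\<lambda>a S. const_set (a \<otimes>\<^bsub>A\<^esub> const_of S)) \<rparr>"

lemma ideal_module_simps [simp]:
  "carrier (ideal_module A I) = const_set ` I"
  "\<zero>\<^bsub>ideal_module A I\<^esub> = const_set \<zero>\<^bsub>A\<^esub>"
  "S \<oplus>\<^bsub>ideal_module A I\<^esub> T = const_set (const_of S \<oplus>\<^bsub>A\<^esub> const_of T)"
  "a \<odot>\<^bsub>ideal_module A I\<^esub> S = const_set (a \<otimes>\<^bsub>A\<^esub> const_of S)"
  by (simp_all add: ideal_module_def)

lemma restrict_scalars_simps [simp]:
  "carrier (restrict_scalars B h) = carrier B"
  "\<zero>\<^bsub>restrict_scalars B h\<^esub> = \<zero>\<^bsub>B\<^esub>"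
  "x \<oplus>\<^bsub>restrict_scalars B h\<^esub> y = x \<oplus>\<^bsub>B\<^esub> y"
  "a \<odot>\<^bsub>restrict_scalars B h\<^esub> x = h a \<otimes>\<^bsub>B\<^esub> x"
  by (simp_all add: restrict_scalars_def)

lemma module_ideal_module:
  assumes A: "cring A" and I: "ideal I A"
  shows "module A (ideal_module A I)"
proof -
  interpret A: cring A by (rule A)
  interpret I: ideal I A by (rule I)
  have c: "x \<in> carrier A" if "x \<in> I" for x using that by (rule I.Icarr)
  show ?thesis
  proof (rule moduleI[OF A])
    show "abelian_group (ideal_module A I)"
    proof (rule abelian_groupI)
      fix S assume "S \<in> carrier (ideal_module A I)"
      then obtain x where x: "S = const_set x" "x \<in> I" by auto
      have "\<ominus>\<^bsub>A\<^esub> x \<oplus>\<^bsub>A\<^esub> x = \<zero>\<^bsub>A\<^esub>" using c[OF x(2)] by (rule A.l_neg)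
      then show "\<exists>T\<in>carrier (ideal_module A I). T \<oplus>\<^bsub>ideal_module A I\<^esub> S = \<zero>\<^bsub>ideal_module A I\<^esub>"
        using x I.a_inv_closed by (intro bexI[of _ "const_set (\<ominus>\<^bsub>A\<^esub> x)"]) auto
    next
      show "S \<oplus>\<^bsub>ideal_module A I\<^esub> T = T \<oplus>\<^bsub>ideal_module A I\<^esub> S"
        if "S \<in> carrier (ideal_module A I)" "T \<in> carrier (ideal_module A I)" for S T
        using that by (auto simp: A.a_comm[OF c c])
    qed (auto simp: I.a_closed c A.a_assoc I.zero_closed)
  qed (auto simp: I.I_l_closed c A.l_distr A.r_distr A.m_assoc)
qed

lemma (in ring) sums_ideal:
  assumes "finite K" "a \<in> K \<rightarrow> carrier R" "cring R"
  shows "ideal {\<Oplus>i\<in>K. r i \<otimes> a i | r. r \<in> K \<rightarrow> carrier R} R" (is "ideal ?I R")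
proof -
  interpret cring R by fact
  have a: "a i \<in> carrier R" if "i \<in> K" for i using assms(2) that by blast
  show ?thesis
  proof (rule idealI)
    show "ring R" by (rule ring_axioms)
    show "subgroup ?I (add_monoid R)"
    proof (rule add.subgroupI)
      show "?I \<subseteq> carrier R" using a by (auto intro!: finsum_closed)
      have "(\<Oplus>i\<in>K. \<zero> \<otimes> a i) \<in> ?I" by (rule CollectI, rule exI[of _ "\<lambda>_. \<zero>"]) simp
      then show "?I \<noteq> {}" by blast
    next
      fix x assume "x \<in> ?I"
      then obtain r where r: "x = (\<Oplus>i\<in>K. r i \<otimes> a i)" "r \<in> K \<rightarrow> carrier R" by blast
      have "\<ominus> x = \<ominus> \<one> \<otimes> x" using r a by (simp add: Pi_iff l_minus)
      also have "\<dots> = (\<Oplus>i\<in>K. \<ominus> \<one> \<otimes> (r i \<otimes> a i))"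
        unfolding r(1) using r(2) a assms(1) by (intro finsum_rdistr) auto
      also have "\<dots> = (\<Oplus>i\<in>K. (\<ominus> \<one> \<otimes> r i) \<otimes> a i)"
        using r(2) a by (intro finsum_cong') (auto simp: Pi_iff m_assoc)
      finally show "\<ominus> x \<in> ?I" using r(2) by (intro CollectI exI[of _ "\<lambda>i. \<ominus> \<one> \<otimes> r i"]) auto
    next
      fix x y assume "x \<in> ?I" "y \<in> ?I"
      then obtain r s where r: "x = (\<Oplus>i\<in>K. r i \<otimes> a i)" "r \<in> K \<rightarrow> carrier R"
        and s: "y = (\<Oplus>i\<in>K. s i \<otimes> a i)" "s \<in> K \<rightarrow> carrier R" by blast
      have "x \<oplus> y = (\<Oplus>i\<in>K. r i \<otimes> a i \<oplus> s i \<otimes> a i)"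
        unfolding r(1) s(1) using r(2) s(2) a by (intro finsum_addf[symmetric]) auto
      also have "\<dots> = (\<Oplus>i\<in>K. (r i \<oplus> s i) \<otimes> a i)"
        using r(2) s(2) a by (intro finsum_cong') (auto simp: Pi_iff l_distr)
      finally show "x \<oplus> y \<in> ?I" using r(2) s(2) by (intro CollectI exI[of _ "\<lambda>i. r i \<oplus> s i"]) auto
    qed
    show left: "c \<otimes> x \<in> ?I" if "x \<in> ?I" "c \<in> carrier R" for x c
    proof -
      obtain r where r: "x = (\<Oplus>i\<in>K. r i \<otimes> a i)" "r \<in> K \<rightarrow> carrier R" using \<open>x \<in> ?I\<close> by blast
      have "c \<otimes> x = (\<Oplus>i\<in>K. c \<otimes> (r i \<otimes> a i))"
        unfolding r(1) using r(2) a assms(1) that(2) by (intro finsum_rdistr) auto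
      also have "\<dots> = (\<Oplus>i\<in>K. (c \<otimes> r i) \<otimes> a i)"
        using r(2) a that(2) by (intro finsum_cong') (auto simp: Pi_iff m_assoc)
      finally show ?thesis using r(2) that(2) by (intro CollectI exI[of _ "\<lambda>i. c \<otimes> r i"]) auto
    qed
    show "x \<otimes> c \<in> ?I" if "x \<in> ?I" "c \<in> carrier R" for x c
    proof -
      have "x \<in> carrier R" using that(1) a by (auto intro!: finsum_closed)
      then show ?thesis using left[OF that] that(2) by (simp add: m_comm)
    qed
  qed
qed

text \<open>
  If \<open>(a i)\<close> are elements of \<open>A\<close> and all relations between them have their \<open>j\<close>-th coefficient in
  \<open>J\<close>, then sending the product of \<open>\<Sum>r i * a i\<close> and \<open>y\<close> to \<open>r j * y\<close> is well defined modulo \<open>J\<close>.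
  Flatness says that a relation \<open>\<Sum>a i * b i = 0\<close> in \<open>B\<close> already holds in the tensor product of
  \<open>B\<close> with the ideal generated by the \<open>a i\<close>, to which this map can be applied.
\<close>

lemma flat_relation:
  fixes A :: "('r, 'k) ring_scheme" and B :: "('b, 'l) ring_scheme"
  assumes flat: "flat_module A (restrict_scalars B h)"
    and B: "cring B" and h: "h \<in> ring_hom A B" and J: "ideal J A"
    and K: "finite K" "j \<in> K" and a: "a \<in> K \<rightarrow> carrier A" and b: "b \<in> K \<rightarrow> carrier B"
    and sum: "(\<Oplus>\<^bsub>B\<^esub>i\<in>K. h (a i) \<otimes>\<^bsub>B\<^esub> b i) = \<zero>\<^bsub>B\<^esub>"
    and rel: "\<And>r. r \<in> K \<rightarrow> carrier A \<Longrightarrow> (\<Oplus>\<^bsub>A\<^esub>i\<in>K. r i \<otimes>\<^bsub>A\<^esub> a i) = \<zero>\<^bsub>A\<^esub> \<Longrightarrow> r j \<in> J"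
  shows "b j \<in> Idl\<^bsub>B\<^esub> (h ` J)"
proof -
  let ?N = "restrict_scalars B h"
  have A: "cring A" using flat by (simp add: flat_module_def module_def)
  interpret A: cring A by (rule A)
  interpret B: cring B by (rule B)
  interpret h: ring_hom_cring A B h using A B h by (simp add: ring_hom_cring_def ring_hom_cring_axioms_def)
  interpret J: ideal J A by (rule J)
  have aK: "a i \<in> carrier A" and bK: "b i \<in> carrier B" if "i \<in> K" for i using a b that by auto
  define I where "I = {\<Oplus>\<^bsub>A\<^esub>i\<in>K. r i \<otimes>\<^bsub>A\<^esub> a i | r. r \<in> K \<rightarrow> carrier A}"
  have I: "ideal I A" unfolding I_def by (rule A.sums_ideal[OF K(1) a A])
  interpret I: ideal I A by (rule I)
  define M where "M = ideal_module A I"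
  define M' where "M' = ideal_module A (carrier A)"
  have M: "module A M" unfolding M_def by (rule module_ideal_module[OF A I])
  have M': "module A M'" unfolding M'_def by (rule module_ideal_module[OF A A.oneideal])
  have IA: "I \<subseteq> carrier A" using I.Icarr by blast
  then have sub: "carrier M \<subseteq> carrier M'" by (auto simp: M_def M'_def)
  define F where "F = free_Abelian_group (carrier M \<times> carrier ?N)"
  define F' where "F' = free_Abelian_group (carrier M' \<times> carrier ?N)"
  interpret F: comm_group F unfolding F_def by (rule abelian_free_Abelian_group)
  interpret F': comm_group F' unfolding F'_def by (rule abelian_free_Abelian_group)
  have mF [simp]: "x \<otimes>\<^bsub>F\<^esub> y = x + y" "\<one>\<^bsub>F\<^esub> = 0" for x y by (simp_all add: F_def)
  have mF' [simp]: "x \<otimes>\<^bsub>F'\<^esub> y = x + y" "\<one>\<^bsub>F'\<^esub> = 0" for x y by (simp_all add: F'_def)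
  have FF': "x \<in> carrier F'" if "x \<in> carrier F" for x
    using that sub by (auto simp: F_def F'_def)
  have inF: "frag_of (x, y) \<in> carrier F" if "x \<in> carrier M" "y \<in> carrier B" for x y
    using that by (simp add: F_def)
  have inF': "frag_of (x, y) \<in> carrier F'" if "x \<in> carrier M'" "y \<in> carrier B" for x y
    using that by (simp add: F'_def)
  have diff_F: "x - y \<in> carrier F" if "x \<in> carrier F" "y \<in> carrier F" for x y
    using that keys_diff[of x y] by (auto simp: F_def)
  have diff_F': "x - y \<in> carrier F'" if "x \<in> carrier F'" "y \<in> carrier F'" for x y
    using that keys_diff[of x y] by (auto simp: F'_def)
  define T where "T = tensor_kernel A M ?N"
  define T' where "T' = tensor_kernel A M' ?N"
  have Mc: "x \<in> carrier M \<Longrightarrow> x' \<in> carrier M \<Longrightarrow> x \<oplus>\<^bsub>M\<^esub> x' \<in> carrier M"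
    and Ms: "c \<in> carrier A \<Longrightarrow> x \<in> carrier M \<Longrightarrow> c \<odot>\<^bsub>M\<^esub> x \<in> carrier M" for c x x'
    by (auto simp: M_def I.a_closed I.I_l_closed)
  have relF: "tensor_relations A M ?N \<subseteq> carrier F"
    unfolding tensor_relations_def
    using Mc Ms h.hom_closed by (auto intro!: diff_F inF)
  have M'c: "x \<in> carrier M' \<Longrightarrow> x' \<in> carrier M' \<Longrightarrow> x \<oplus>\<^bsub>M'\<^esub> x' \<in> carrier M'"
    and M's: "c \<in> carrier A \<Longrightarrow> x \<in> carrier M' \<Longrightarrow> c \<odot>\<^bsub>M'\<^esub> x \<in> carrier M'" for c x x'
    by (auto simp: M'_def)
  have relF': "tensor_relations A M' ?N \<subseteq> carrier F'"
    unfolding tensor_relations_def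
    using M'c M's h.hom_closed by (auto intro!: diff_F' inF')
  have T: "subgroup T F"
    unfolding T_def tensor_kernel_def F_def[symmetric] by (rule F.generate_is_subgroup[OF relF])
  have T': "subgroup T' F'"
    unfolding T'_def tensor_kernel_def F'_def[symmetric] by (rule F'.generate_is_subgroup[OF relF'])
  have ops: "x \<oplus>\<^bsub>M\<^esub> y = x \<oplus>\<^bsub>M'\<^esub> y" "c \<odot>\<^bsub>M\<^esub> x = c \<odot>\<^bsub>M'\<^esub> x" for x y c
    by (simp_all add: M_def M'_def)
  have relsub: "tensor_relations A M ?N \<subseteq> tensor_relations A M' ?N"
    unfolding tensor_relations_def ops using sub by blast
  have T'add: "x + y \<in> T'" if "x \<in> T'" "y \<in> T'" for x y
    using subgroup.m_closed[OF T' that] by simp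
  have T'0: "0 \<in> T'" using subgroup.one_closed[OF T'] by simp
  have T'minus: "- x \<in> T'" if "x \<in> T'" for x
  proof -
    have "x \<in> carrier F'" using subgroup.mem_carrier[OF T' that] .
    then have "inv\<^bsub>F'\<^esub> x = - x" by (simp add: F'_def)
    then show ?thesis using subgroup.m_inv_closed[OF T' that] by simp
  qed
  have rel_T': "x \<in> T'" if "x \<in> tensor_relations A M' ?N" for x
    unfolding T'_def tensor_kernel_def using that by (rule generate.incl)
  have TT': "T \<subseteq> T'"
  proof
    fix x assume "x \<in> T"
    then have "x \<in> generate F (tensor_relations A M ?N)" by (simp add: T_def tensor_kernel_def F_def)
    then show "x \<in> T'"
    proof induction
      case one
      then show ?case using T'0 by simp
    next
      case (incl y)
      then show ?case using rel_T' relsub by blast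
    next
      case (inv y)
      then have "inv\<^bsub>F\<^esub> y = - y" using relF by (auto simp: F_def)
      then show ?case using T'minus[OF rel_T'] relsub inv by auto
    next
      case (eng y y')
      then show ?case using T'add by simp
    qed
  qed
  define z where "z = (\<Sum>i\<in>K. frag_of (const_set (a i), b i))"
  have aI: "a i \<in> I" if "i \<in> K" for i
  proof -
    have "(\<Oplus>\<^bsub>A\<^esub>k\<in>K. (if i = k then \<one>\<^bsub>A\<^esub> else \<zero>\<^bsub>A\<^esub>) \<otimes>\<^bsub>A\<^esub> a k) = (\<Oplus>\<^bsub>A\<^esub>k\<in>K. if i = k then a k else \<zero>\<^bsub>A\<^esub>)"
      using aK by (intro A.finsum_cong') auto
    also have "\<dots> = a i" using A.add.finprod_singleton[OF that K(1), of a] a by simp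
    finally have "a i = (\<Oplus>\<^bsub>A\<^esub>k\<in>K. (if i = k then \<one>\<^bsub>A\<^esub> else \<zero>\<^bsub>A\<^esub>) \<otimes>\<^bsub>A\<^esub> a k)" by simp
    then show ?thesis unfolding I_def by (intro CollectI exI[of _ "\<lambda>k. if i = k then \<one>\<^bsub>A\<^esub> else \<zero>\<^bsub>A\<^esub>"]) auto
  qed
  have aM: "const_set (a i) \<in> carrier M" if "i \<in> K" for i using aI[OF that] by (simp add: M_def)
  have zF: "z \<in> carrier F"
    unfolding z_def F_def using aM bK by (intro sum_closed_free_Abelian_group) auto
  \<comment> \<open>In the tensor product of \<open>A\<close> itself with \<open>B\<close>, the
    scalars \<open>a i\<close> move to the right factor, and \<open>z\<close> becomes 1 tensored
    with the given sum, which is zero.\<close>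
  have zT': "z \<in> T'"
  proof -
    let ?e = "const_set \<one>\<^bsub>A\<^esub>"
    have e: "?e \<in> carrier M'" by (simp add: M'_def)
    have swap: "frag_of (const_set (a i), b i) - frag_of (?e, h (a i) \<otimes>\<^bsub>B\<^esub> b i) \<in> T'" if "i \<in> K" for i
    proof (rule rel_T')
      have "frag_of (a i \<odot>\<^bsub>M'\<^esub> ?e, b i) - frag_of (?e, a i \<odot>\<^bsub>?N\<^esub> b i) \<in> tensor_relations A M' ?N"
        unfolding tensor_relations_def using aK[OF that] bK[OF that] e by (auto simp del: restrict_scalars_simps(4))
      then show "frag_of (const_set (a i), b i) - frag_of (?e, h (a i) \<otimes>\<^bsub>B\<^esub> b i) \<in> tensor_relations A M' ?N"
        using aK[OF that] by (simp add: M'_def)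
    qed
    have add: "frag_of (?e, x \<oplus>\<^bsub>B\<^esub> y) - frag_of (?e, x) - frag_of (?e, y) \<in> T'"
      if "x \<in> carrier B" "y \<in> carrier B" for x y
    proof (rule rel_T')
      have "frag_of (?e, x \<oplus>\<^bsub>?N\<^esub> y) - frag_of (?e, x) - frag_of (?e, y) \<in> tensor_relations A M' ?N"
        unfolding tensor_relations_def using that e by (auto simp del: restrict_scalars_simps(3))
      then show "frag_of (?e, x \<oplus>\<^bsub>B\<^esub> y) - frag_of (?e, x) - frag_of (?e, y) \<in> tensor_relations A M' ?N"
        by simp
    qed
    have zero: "frag_of (?e, \<zero>\<^bsub>B\<^esub>) \<in> T'"
      using T'minus[OF add[of "\<zero>\<^bsub>B\<^esub>" "\<zero>\<^bsub>B\<^esub>"]] by simp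
    have "(\<Sum>i\<in>L. frag_of (const_set (a i), b i)) - frag_of (?e, \<Oplus>\<^bsub>B\<^esub>i\<in>L. h (a i) \<otimes>\<^bsub>B\<^esub> b i) \<in> T'"
      if "L \<subseteq> K" for L
      using finite_subset[OF that K(1)] that
    proof (induction L)
      case empty
      then show ?case using T'minus[OF zero] by simp
    next
      case (insert i L)
      let ?y = "\<lambda>i. h (a i) \<otimes>\<^bsub>B\<^esub> b i"
      have y: "?y k \<in> carrier B" if "k \<in> K" for k using aK[OF that] bK[OF that] by simp
      have yL: "(\<Oplus>\<^bsub>B\<^esub>i\<in>L. ?y i) \<in> carrier B" using y insert.prems by (intro B.finsum_closed) auto
      have "(\<Oplus>\<^bsub>B\<^esub>i\<in>insert i L. ?y i) = ?y i \<oplus>\<^bsub>B\<^esub> (\<Oplus>\<^bsub>B\<^esub>i\<in>L. ?y i)"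
        using insert y by (intro B.finsum_insert) auto
      then have eq: "(\<Sum>i\<in>insert i L. frag_of (const_set (a i), b i)) - frag_of (?e, \<Oplus>\<^bsub>B\<^esub>i\<in>insert i L. ?y i)
        = (frag_of (const_set (a i), b i) - frag_of (?e, ?y i))
          + (((\<Sum>i\<in>L. frag_of (const_set (a i), b i)) - frag_of (?e, \<Oplus>\<^bsub>B\<^esub>i\<in>L. ?y i))
          + - (frag_of (?e, ?y i \<oplus>\<^bsub>B\<^esub> (\<Oplus>\<^bsub>B\<^esub>i\<in>L. ?y i)) - frag_of (?e, ?y i) - frag_of (?e, \<Oplus>\<^bsub>B\<^esub>i\<in>L. ?y i)))"
        using insert.hyps by simp
      show ?case
        unfolding eq using insert y[of i] yL by (intro T'add T'minus swap add) auto
    qed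
    from T'add[OF this[OF subset_refl] zero] show ?thesis by (simp add: z_def sum)
  qed
  \<comment> \<open>Here flatness is used: the map induced by the inclusion sends the class of
    \<open>z\<close> and the zero class both to \<open>T'\<close>, so injectivity identifies
    them.\<close>
  have zT: "z \<in> T"
  proof -
    have "id \<in> linear_maps A M M'"
      unfolding linear_maps_def hom_def using sub ops by auto
    then have inj: "inj_on (tensor_map A M' ?N id) (carrier (tensor_product A M ?N))"
      using flat M M' unfolding flat_module_def by auto
    have tm: "tensor_map A M' ?N id C = (\<Union>w\<in>C. T' #>\<^bsub>F'\<^esub> w)" for C
    proof -
      have "(\<lambda>(x, y). frag_of (id x, y)) = (frag_of :: (nat \<Rightarrow> 'r) set \<times> 'b \<Rightarrow> _)" by auto
      then show ?thesis
        unfolding tensor_map_def T'_def F'_def by (simp add: frag_expansion[symmetric])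
    qed
    have const: "tensor_map A M' ?N id C = T'" if "C \<subseteq> T'" "C \<noteq> {}" for C
      unfolding tm using that subgroup.rcos_const[OF T' F'.is_group] by blast
    have cosetT': "T #>\<^bsub>F\<^esub> z \<subseteq> T'" using TT' zT' T'add by (auto simp: r_coset_def)
    have "z \<in> T #>\<^bsub>F\<^esub> z" by (rule F.rcos_self[OF zF T])
    then have "tensor_map A M' ?N id (T #>\<^bsub>F\<^esub> z) = tensor_map A M' ?N id T"
      using const[OF cosetT'] const[OF TT'] subgroup.one_closed[OF T] by blast
    moreover have "T #>\<^bsub>F\<^esub> z \<in> carrier (tensor_product A M ?N)" "T \<in> carrier (tensor_product A M ?N)"
      using zF subgroup.subgroup_in_rcosets[OF T F.is_group]
      unfolding tensor_product_def FactGroup_def T_def[symmetric] F_def[symmetric] RCOSETS_def by auto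
    ultimately have "T #>\<^bsub>F\<^esub> z = T" using inj by (auto dest: inj_onD)
    then show ?thesis using F.coset_join1 zF T by blast
  qed
  define JB where "JB = Idl\<^bsub>B\<^esub> (h ` J)"
  have JB: "ideal JB B" unfolding JB_def by (rule B.genideal_ideal) (use J.Icarr in auto)
  interpret JB: ideal JB B by (rule JB)
  define D where "D = B Quot JB"
  interpret D: cring D unfolding D_def by (rule JB.quotient_is_cring[OF B])
  define q where "q = (\<lambda>x. JB +>\<^bsub>B\<^esub> x)"
  have q: "q \<in> ring_hom B D" unfolding q_def D_def by (rule JB.rcos_ring_hom)
  interpret q: ring_hom_cring B D q using q B D.is_cring by (simp add: ring_hom_cring_def ring_hom_cring_axioms_def)
  interpret qh: ring_hom_cring A D "q \<circ> h"
    using ring_hom_trans[OF h q] A D.is_cring by (simp add: ring_hom_cring_def ring_hom_cring_axioms_def)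
  have qJ: "(q \<circ> h) x = \<zero>\<^bsub>D\<^esub>" if "x \<in> J" for x
  proof -
    have "h x \<in> JB" unfolding JB_def using that J.Icarr by (intro subsetD[OF B.genideal_self]) auto
    then have "q (h x) = JB" unfolding q_def by (rule JB.a_rcos_const)
    then show ?thesis by (simp add: D_def FactRing_def)
  qed
  \<comment> \<open>The \<open>j\<close>-th coefficient of some expression of \<open>x\<close>. Two
    expressions differ by a relation, so by \<open>rel\<close> the choice disappears in
    \<open>B\<close> modulo the ideal generated by \<open>J\<close>.\<close>
  define \<rho> where "\<rho> x = (SOME r. r \<in> K \<rightarrow> carrier A \<and> x = (\<Oplus>\<^bsub>A\<^esub>i\<in>K. r i \<otimes>\<^bsub>A\<^esub> a i)) j" for x
  have \<rho>: "(q \<circ> h) (\<rho> x) = (q \<circ> h) (r j)" "\<rho> x \<in> carrier A"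
    if r: "r \<in> K \<rightarrow> carrier A" and x: "x = (\<Oplus>\<^bsub>A\<^esub>i\<in>K. r i \<otimes>\<^bsub>A\<^esub> a i)" for x r
  proof -
    define s where "s = (SOME r. r \<in> K \<rightarrow> carrier A \<and> x = (\<Oplus>\<^bsub>A\<^esub>i\<in>K. r i \<otimes>\<^bsub>A\<^esub> a i))"
    have s: "s \<in> K \<rightarrow> carrier A \<and> x = (\<Oplus>\<^bsub>A\<^esub>i\<in>K. s i \<otimes>\<^bsub>A\<^esub> a i)"
      unfolding s_def by (rule someI[of _ r]) (use r x in blast)
    have \<rho>s: "\<rho> x = s j" by (simp add: \<rho>_def s_def)
    have rs: "r i \<in> carrier A" "s i \<in> carrier A" if "i \<in> K" for i using r s that by auto
    have "(\<Oplus>\<^bsub>A\<^esub>i\<in>K. (s i \<ominus>\<^bsub>A\<^esub> r i) \<otimes>\<^bsub>A\<^esub> a i) = (\<Oplus>\<^bsub>A\<^esub>i\<in>K. s i \<otimes>\<^bsub>A\<^esub> a i \<oplus>\<^bsub>A\<^esub> (\<ominus>\<^bsub>A\<^esub> \<one>\<^bsub>A\<^esub>) \<otimes>\<^bsub>A\<^esub> (r i \<otimes>\<^bsub>A\<^esub> a i))"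
      using rs aK by (intro A.finsum_cong') (auto simp: A.minus_eq A.l_distr A.l_minus)
    also have "\<dots> = (\<Oplus>\<^bsub>A\<^esub>i\<in>K. s i \<otimes>\<^bsub>A\<^esub> a i) \<oplus>\<^bsub>A\<^esub> (\<Oplus>\<^bsub>A\<^esub>i\<in>K. (\<ominus>\<^bsub>A\<^esub> \<one>\<^bsub>A\<^esub>) \<otimes>\<^bsub>A\<^esub> (r i \<otimes>\<^bsub>A\<^esub> a i))"
      using rs aK by (intro A.finsum_addf) auto
    also have "(\<Oplus>\<^bsub>A\<^esub>i\<in>K. (\<ominus>\<^bsub>A\<^esub> \<one>\<^bsub>A\<^esub>) \<otimes>\<^bsub>A\<^esub> (r i \<otimes>\<^bsub>A\<^esub> a i)) = (\<ominus>\<^bsub>A\<^esub> \<one>\<^bsub>A\<^esub>) \<otimes>\<^bsub>A\<^esub> x"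
      unfolding x using rs aK K(1) by (intro A.finsum_rdistr[symmetric]) auto
    also have "(\<Oplus>\<^bsub>A\<^esub>i\<in>K. s i \<otimes>\<^bsub>A\<^esub> a i) = x" using s by simp
    also have "x \<oplus>\<^bsub>A\<^esub> (\<ominus>\<^bsub>A\<^esub> \<one>\<^bsub>A\<^esub>) \<otimes>\<^bsub>A\<^esub> x = \<zero>\<^bsub>A\<^esub>"
    proof -
      have "x \<in> carrier A" unfolding x using rs aK by (intro A.finsum_closed) auto
      then show ?thesis by (simp add: A.l_minus A.r_neg)
    qed
    finally have "s j \<ominus>\<^bsub>A\<^esub> r j \<in> J" using rel[of "\<lambda>i. s i \<ominus>\<^bsub>A\<^esub> r i"] rs by auto
    then have "(q \<circ> h) (s j \<ominus>\<^bsub>A\<^esub> r j) = \<zero>\<^bsub>D\<^esub>" by (rule qJ)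
    moreover have "s j = (s j \<ominus>\<^bsub>A\<^esub> r j) \<oplus>\<^bsub>A\<^esub> r j"
      using rs[OF K(2)] by (simp add: A.minus_eq A.a_assoc A.l_neg)
    moreover have "(q \<circ> h) ((s j \<ominus>\<^bsub>A\<^esub> r j) \<oplus>\<^bsub>A\<^esub> r j) = (q \<circ> h) (s j \<ominus>\<^bsub>A\<^esub> r j) \<oplus>\<^bsub>D\<^esub> (q \<circ> h) (r j)"
      using rs[OF K(2)] by (intro qh.hom_add) auto
    moreover have "(q \<circ> h) (r j) \<in> carrier D" using rs[OF K(2)] by (intro qh.hom_closed) auto
    ultimately show "(q \<circ> h) (\<rho> x) = (q \<circ> h) (r j)" unfolding \<rho>s by (metis D.l_zero)
    show "\<rho> x \<in> carrier A" unfolding \<rho>s using rs[OF K(2)] by simp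
  qed
  have repI: "\<exists>r. r \<in> K \<rightarrow> carrier A \<and> x = (\<Oplus>\<^bsub>A\<^esub>i\<in>K. r i \<otimes>\<^bsub>A\<^esub> a i)" if "x \<in> I" for x
  proof -
    have "\<exists>r. x = (\<Oplus>\<^bsub>A\<^esub>i\<in>K. r i \<otimes>\<^bsub>A\<^esub> a i) \<and> r \<in> K \<rightarrow> carrier A"
      using that unfolding I_def by (rule CollectD)
    then show ?thesis by (elim exE conjE) (intro exI conjI)
  qed
  define e where "e x = (q \<circ> h) (\<rho> x)" for x
  have eD: "e x \<in> carrier D" if x: "x \<in> I" for x
  proof -
    obtain r where r: "r \<in> K \<rightarrow> carrier A" "x = (\<Oplus>\<^bsub>A\<^esub>i\<in>K. r i \<otimes>\<^bsub>A\<^esub> a i)" using repI[OF x] by blast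
    show ?thesis unfolding e_def using \<rho>(2)[OF r] by (rule qh.hom_closed)
  qed
  have e_add: "e (x \<oplus>\<^bsub>A\<^esub> y) = e x \<oplus>\<^bsub>D\<^esub> e y" if xy: "x \<in> I" "y \<in> I" for x y
  proof -
    obtain r where r: "r \<in> K \<rightarrow> carrier A" "x = (\<Oplus>\<^bsub>A\<^esub>i\<in>K. r i \<otimes>\<^bsub>A\<^esub> a i)" using repI[OF xy(1)] by blast
    obtain s where s: "s \<in> K \<rightarrow> carrier A" "y = (\<Oplus>\<^bsub>A\<^esub>i\<in>K. s i \<otimes>\<^bsub>A\<^esub> a i)" using repI[OF xy(2)] by blast
    have "x \<oplus>\<^bsub>A\<^esub> y = (\<Oplus>\<^bsub>A\<^esub>i\<in>K. r i \<otimes>\<^bsub>A\<^esub> a i \<oplus>\<^bsub>A\<^esub> s i \<otimes>\<^bsub>A\<^esub> a i)"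
      unfolding r(2) s(2) using r(1) s(1) aK by (intro A.finsum_addf[symmetric]) auto
    also have "\<dots> = (\<Oplus>\<^bsub>A\<^esub>i\<in>K. (r i \<oplus>\<^bsub>A\<^esub> s i) \<otimes>\<^bsub>A\<^esub> a i)"
      using r(1) s(1) aK by (intro A.finsum_cong') (auto simp: Pi_iff A.l_distr)
    finally have "e (x \<oplus>\<^bsub>A\<^esub> y) = (q \<circ> h) (r j \<oplus>\<^bsub>A\<^esub> s j)"
      unfolding e_def using r(1) s(1) by (intro \<rho>(1)[of "\<lambda>i. r i \<oplus>\<^bsub>A\<^esub> s i"]) auto
    then show ?thesis
      unfolding e_def \<rho>(1)[OF r] \<rho>(1)[OF s]
      using qh.hom_add[OF funcset_mem[OF r(1) K(2)] funcset_mem[OF s(1) K(2)]] by (rule trans)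
  qed
  have e_mult: "e (c \<otimes>\<^bsub>A\<^esub> x) = (q \<circ> h) c \<otimes>\<^bsub>D\<^esub> e x" if c: "c \<in> carrier A" "x \<in> I" for c x
  proof -
    obtain r where r: "r \<in> K \<rightarrow> carrier A" "x = (\<Oplus>\<^bsub>A\<^esub>i\<in>K. r i \<otimes>\<^bsub>A\<^esub> a i)" using repI[OF c(2)] by blast
    have "c \<otimes>\<^bsub>A\<^esub> x = (\<Oplus>\<^bsub>A\<^esub>i\<in>K. c \<otimes>\<^bsub>A\<^esub> (r i \<otimes>\<^bsub>A\<^esub> a i))"
      unfolding r(2) using r(1) aK K(1) c(1) by (intro A.finsum_rdistr) auto
    also have "\<dots> = (\<Oplus>\<^bsub>A\<^esub>i\<in>K. (c \<otimes>\<^bsub>A\<^esub> r i) \<otimes>\<^bsub>A\<^esub> a i)"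
      using r(1) aK c(1) by (intro A.finsum_cong') (auto simp: Pi_iff A.m_assoc)
    finally have "e (c \<otimes>\<^bsub>A\<^esub> x) = (q \<circ> h) (c \<otimes>\<^bsub>A\<^esub> r j)"
      unfolding e_def using r(1) c(1) by (intro \<rho>(1)[of "\<lambda>i. c \<otimes>\<^bsub>A\<^esub> r i"]) auto
    then show ?thesis
      unfolding e_def \<rho>(1)[OF r] using qh.hom_mult[OF c(1) funcset_mem[OF r(1) K(2)]] by (rule trans)
  qed
  have e_a: "e (a i) = (if j = i then \<one>\<^bsub>D\<^esub> else \<zero>\<^bsub>D\<^esub>)" if i: "i \<in> K" for i
  proof -
    have "(\<Oplus>\<^bsub>A\<^esub>k\<in>K. (if i = k then \<one>\<^bsub>A\<^esub> else \<zero>\<^bsub>A\<^esub>) \<otimes>\<^bsub>A\<^esub> a k) = (\<Oplus>\<^bsub>A\<^esub>k\<in>K. if i = k then a k else \<zero>\<^bsub>A\<^esub>)"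
      using aK by (intro A.finsum_cong') auto
    also have "\<dots> = a i" using A.add.finprod_singleton[OF i K(1), of a] a by simp
    finally have "e (a i) = (q \<circ> h) (if i = j then \<one>\<^bsub>A\<^esub> else \<zero>\<^bsub>A\<^esub>)"
      unfolding e_def by (intro \<rho>(1)) auto
    also have "\<dots> = (if j = i then \<one>\<^bsub>D\<^esub> else \<zero>\<^bsub>D\<^esub>)"
      using qh.hom_one qh.hom_zero by (auto simp del: comp_apply)
    finally show ?thesis .
  qed
  \<comment> \<open>This map is additive in both arguments and balanced over \<open>A\<close>, so
    its extension \<open>\<psi>\<close> vanishes on \<open>T\<close>, in particular at
    \<open>z\<close>. There only the term with index \<open>j\<close> survives, since
    \<open>e (a i)\<close> is one for \<open>i = j\<close> and zero otherwise.\<close>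
  let ?\<beta> = "\<lambda>(S, y). e (const_of S) \<otimes>\<^bsub>D\<^esub> q y"
  obtain \<psi> where \<psi>: "\<psi> \<in> hom F (add_monoid D)" "\<And>p. p \<in> carrier M \<times> carrier ?N \<Longrightarrow> \<psi> (frag_of p) = ?\<beta> p"
    unfolding F_def
  proof (rule comm_group.free_Abelian_group_universal[OF D.a_comm_group, of ?\<beta> "carrier M \<times> carrier ?N"])
    show "?\<beta> ` (carrier M \<times> carrier ?N) \<subseteq> carrier (add_monoid D)"
      using eD by (auto simp: M_def)
  qed (use that in blast)
  interpret \<psi>: group_hom F "add_monoid D" \<psi>
    using \<psi>(1) D.a_group F.is_group by (simp add: group_hom_def group_hom_axioms_def)
  have \<psi>_add: "\<psi> (x + y) = \<psi> x \<oplus>\<^bsub>D\<^esub> \<psi> y" if "x \<in> carrier F" "y \<in> carrier F" for x y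
    using \<psi>.hom_mult[OF that] by simp
  have \<psi>_D: "\<psi> x \<in> carrier D" if "x \<in> carrier F" for x using \<psi>.hom_closed[OF that] by simp
  have \<psi>_diff: "\<psi> (x - y) = \<zero>\<^bsub>D\<^esub>" if xy: "x \<in> carrier F" "y \<in> carrier F" "\<psi> x = \<psi> y" for x y
  proof -
    have "\<psi> x = \<psi> (x - y) \<oplus>\<^bsub>D\<^esub> \<psi> y" using \<psi>_add[OF diff_F[OF xy(1,2)] xy(2)] by simp
    then show ?thesis
      using xy(3) D.add.r_cancel_one'[OF \<psi>_D[OF xy(2)] \<psi>_D[OF diff_F[OF xy(1,2)]]] by simp
  qed
  have \<psi>_of: "\<psi> (frag_of (S, y)) = e (const_of S) \<otimes>\<^bsub>D\<^esub> q y" if "S \<in> carrier M" "y \<in> carrier B" for S y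
    using \<psi>(2)[of "(S, y)"] that by simp
  have "\<psi> x = \<zero>\<^bsub>D\<^esub>" if x: "x \<in> tensor_relations A M ?N" for x
  proof -
    have add: "x + y \<in> carrier F" if "x \<in> carrier F" "y \<in> carrier F" for x y
      using F.m_closed[OF that] by simp
    have d3: "u - v - w = u - (v + w)" for u v w :: "(nat \<Rightarrow> 'r) set \<times> 'b \<Rightarrow>\<^sub>0 int" by simp
    consider
      (1) S S' y where "x = frag_of (S \<oplus>\<^bsub>M\<^esub> S', y) - frag_of (S, y) - frag_of (S', y)"
          "S \<in> carrier M" "S' \<in> carrier M" "y \<in> carrier B"
    | (2) S y y' where "x = frag_of (S, y \<oplus>\<^bsub>B\<^esub> y') - frag_of (S, y) - frag_of (S, y')"
          "S \<in> carrier M" "y \<in> carrier B" "y' \<in> carrier B"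
    | (3) c S y where "x = frag_of (c \<odot>\<^bsub>M\<^esub> S, y) - frag_of (S, h c \<otimes>\<^bsub>B\<^esub> y)"
          "c \<in> carrier A" "S \<in> carrier M" "y \<in> carrier B"
      using x unfolding tensor_relations_def by auto
    then show ?thesis
    proof cases
      case 1
      obtain s s' where s: "S = const_set s" "s \<in> I" "S' = const_set s'" "s' \<in> I"
        using 1(2,3) by (auto simp: M_def)
      have "e (s \<oplus>\<^bsub>A\<^esub> s') \<otimes>\<^bsub>D\<^esub> q y = e s \<otimes>\<^bsub>D\<^esub> q y \<oplus>\<^bsub>D\<^esub> e s' \<otimes>\<^bsub>D\<^esub> q y"
        unfolding e_add[OF s(2,4)] using eD s 1(4) by (intro D.l_distr) auto
      then show ?thesis
        unfolding 1(1) d3 using 1 s Mc[OF 1(2,3)]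
        by (intro \<psi>_diff inF add) (simp_all add: \<psi>_add inF \<psi>_of, simp add: M_def)
    next
      case 2
      obtain s where s: "S = const_set s" "s \<in> I" using 2(2) by (auto simp: M_def)
      have "e s \<otimes>\<^bsub>D\<^esub> q (y \<oplus>\<^bsub>B\<^esub> y') = e s \<otimes>\<^bsub>D\<^esub> q y \<oplus>\<^bsub>D\<^esub> e s \<otimes>\<^bsub>D\<^esub> q y'"
        using eD s 2(3,4) by (simp add: D.r_distr)
      then show ?thesis
        unfolding 2(1) d3 using 2 s by (intro \<psi>_diff inF add) (simp_all add: \<psi>_add inF \<psi>_of)
    next
      case 3
      obtain s where s: "S = const_set s" "s \<in> I" using 3(3) by (auto simp: M_def)
      have "e (c \<otimes>\<^bsub>A\<^esub> s) \<otimes>\<^bsub>D\<^esub> q y = e s \<otimes>\<^bsub>D\<^esub> q (h c \<otimes>\<^bsub>B\<^esub> y)"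
        unfolding e_mult[OF 3(2) s(2)] using eD[OF s(2)] 3 by (simp add: D.m_ac)
      then show ?thesis
        unfolding 3(1) using 3 s Ms[OF 3(2,3)]
        by (intro \<psi>_diff inF) (simp_all add: \<psi>_of, simp add: M_def)
    qed
  qed
  then have "tensor_relations A M ?N \<subseteq> kernel F (add_monoid D) \<psi>"
    using relF by (auto simp: kernel_def)
  then have "T \<subseteq> kernel F (add_monoid D) \<psi>"
    unfolding T_def tensor_kernel_def F_def[symmetric]
    by (intro F.generate_subgroup_incl \<psi>.subgroup_kernel)
  then have "\<psi> z = \<zero>\<^bsub>D\<^esub>" using zT by (auto simp: kernel_def)
  moreover have "\<psi> z = q (b j)"
  proof -
    have "\<psi> (\<Sum>i\<in>L. frag_of (const_set (a i), b i)) = (\<Oplus>\<^bsub>D\<^esub>i\<in>L. e (a i) \<otimes>\<^bsub>D\<^esub> q (b i))" if "L \<subseteq> K" for L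
      using finite_subset[OF that K(1)] that
    proof (induction L)
      case empty
      then show ?case using \<psi>.hom_one by simp
    next
      case (insert i L)
      have "(\<Sum>i\<in>L. frag_of (const_set (a i), b i)) \<in> carrier F"
        unfolding F_def using insert.prems aM bK by (intro sum_closed_free_Abelian_group) auto
      then have "\<psi> (\<Sum>i\<in>insert i L. frag_of (const_set (a i), b i))
          = \<psi> (frag_of (const_set (a i), b i)) \<oplus>\<^bsub>D\<^esub> \<psi> (\<Sum>i\<in>L. frag_of (const_set (a i), b i))"
        using insert aM bK by (simp add: \<psi>_add inF)
      also have "\<dots> = (\<Oplus>\<^bsub>D\<^esub>i\<in>insert i L. e (a i) \<otimes>\<^bsub>D\<^esub> q (b i))"
        using insert aM bK aI eD by (subst D.finsum_insert) (auto simp: \<psi>_of)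
      finally show ?case .
    qed
    then have "\<psi> z = (\<Oplus>\<^bsub>D\<^esub>i\<in>K. e (a i) \<otimes>\<^bsub>D\<^esub> q (b i))" by (simp add: z_def)
    also have "\<dots> = (\<Oplus>\<^bsub>D\<^esub>i\<in>K. if j = i then q (b i) else \<zero>\<^bsub>D\<^esub>)"
      using bK by (intro D.finsum_cong') (auto simp: e_a)
    also have "\<dots> = q (b j)"
      using D.add.finprod_singleton[OF K(2,1), of "\<lambda>i. q (b i)"] bK by simp
    finally show ?thesis .
  qed
  ultimately have "JB +>\<^bsub>B\<^esub> b j = JB" by (simp add: q_def D_def FactRing_def)
  then show ?thesis
    using B.a_coset_join1[OF _ bK[OF K(2)] JB.a_subgroup] by (simp add: JB_def)
qed

section \<open>Germs of functions\<close>

lemma irreducible_open_Int: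
  assumes "irreducible_in T W" "openin T U" "openin T U'" "U \<inter> W \<noteq> {}" "U' \<inter> W \<noteq> {}"
  shows "U \<inter> U' \<inter> W \<noteq> {}"
proof
  assume "U \<inter> U' \<inter> W = {}"
  moreover have "W \<subseteq> topspace T" using assms(1) by (simp add: irreducible_in_def)
  ultimately have "W \<subseteq> (topspace T - U) \<union> (topspace T - U')" by blast
  then have "W \<subseteq> topspace T - U \<or> W \<subseteq> topspace T - U'"
    using assms(1-3) unfolding irreducible_in_def by blast
  then show False using assms(4,5) by blast
qed

lemma irreducible_finite_Int:
  assumes "irreducible_in T W" "finite I" "\<And>i. i \<in> I \<Longrightarrow> openin T (U i) \<and> U i \<inter> W \<noteq> {}"
  shows "\<exists>x\<in>W. \<forall>i\<in>I. x \<in> U i"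
proof -
  have "openin T (topspace T \<inter> (\<Inter>i\<in>I. U i)) \<and> (topspace T \<inter> (\<Inter>i\<in>I. U i)) \<inter> W \<noteq> {}"
    using assms(2,3)
  proof (induction I)
    case empty
    then show ?case using assms(1) by (auto simp: irreducible_in_def)
  next
    case (insert i I)
    have eq: "topspace T \<inter> (\<Inter>i\<in>insert i I. U i) = U i \<inter> (topspace T \<inter> (\<Inter>i\<in>I. U i))" by blast
    show ?case
      unfolding eq using insert irreducible_open_Int[OF assms(1), of "U i"] by (auto intro: openin_Int)
  qed
  then show ?thesis by blast
qed

locale function_space =
  fixes S :: "'a fspace"
  assumes sections_extensional: "openin (space_top S) U \<Longrightarrow> f \<in> sections S U \<Longrightarrow> f \<in> extensional U"
    and sections_restrict: "openin (space_top S) U \<Longrightarrow> openin (space_top S) U' \<Longrightarrow> U' \<subseteq> U \<Longrightarrow>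
      f \<in> sections S U \<Longrightarrow> restrict f U' \<in> sections S U'"
    and sections_const: "openin (space_top S) U \<Longrightarrow> (\<lambda>x\<in>U. c) \<in> sections S U"
    and sections_add: "openin (space_top S) U \<Longrightarrow> f \<in> sections S U \<Longrightarrow> g \<in> sections S U \<Longrightarrow>
      (\<lambda>x\<in>U. f x + g x) \<in> sections S U"
    and sections_mult: "openin (space_top S) U \<Longrightarrow> f \<in> sections S U \<Longrightarrow> g \<in> sections S U \<Longrightarrow>
      (\<lambda>x\<in>U. f x * g x) \<in> sections S U"
begin

text \<open>Germs are represented by total functions that are regular on some open set meeting
  \<open>W\<close>. Operations are then pointwise, without domains, and the stalk is the subring
  \<open>near W\<close> modulo the relation \<open>agree W\<close>.\<close>

definition near :: "'a set \<Rightarrow> ('a \<Rightarrow> complex) set" where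
  "near W = {f. \<exists>U. openin (space_top S) U \<and> U \<inter> W \<noteq> {} \<and> restrict f U \<in> sections S U}"

definition agree :: "'a set \<Rightarrow> ('a \<Rightarrow> complex) \<Rightarrow> ('a \<Rightarrow> complex) \<Rightarrow> bool" where
  "agree W f g \<longleftrightarrow> (\<exists>U. openin (space_top S) U \<and> U \<inter> W \<noteq> {} \<and> (\<forall>x\<in>U. f x = g x))"

definition germ_of :: "'a set \<Rightarrow> ('a \<Rightarrow> complex) \<Rightarrow> ('a set \<times> ('a \<Rightarrow> complex)) set" where
  "germ_of W f = {(U, g) \<in> local_sections S W. agree W g f}"

lemma sections_restrict_restrict:
  assumes "openin (space_top S) U" "openin (space_top S) U'" "U' \<subseteq> U" "restrict f U \<in> sections S U"
  shows "restrict f U' \<in> sections S U'"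
proof -
  have "restrict (restrict f U) U' = restrict f U'" using assms(3) by (auto simp: restrict_def fun_eq_iff)
  then show ?thesis using sections_restrict[OF assms] by simp
qed

context
  fixes W :: "'a set"
  assumes W: "irreducible_in (space_top S) W"
begin

lemma agree_refl: "agree W f f"
  using W unfolding agree_def irreducible_in_def by (intro exI[of _ "points S"]) auto

lemma agree_sym: "agree W f g \<Longrightarrow> agree W g f"
  unfolding agree_def by metis

lemma agree_trans:
  assumes "agree W f g" "agree W g h" shows "agree W f h"
proof -
  obtain U where U: "openin (space_top S) U" "U \<inter> W \<noteq> {}" "\<forall>x\<in>U. f x = g x"
    using assms(1) unfolding agree_def by blast
  obtain U' where U': "openin (space_top S) U'" "U' \<inter> W \<noteq> {}" "\<forall>x\<in>U'. g x = h x"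
    using assms(2) unfolding agree_def by blast
  have "U \<inter> U' \<inter> W \<noteq> {}" using irreducible_open_Int[OF W U(1) U'(1) U(2) U'(2)] .
  then show ?thesis
    unfolding agree_def using U U' by (intro exI[of _ "U \<inter> U'"]) (auto intro: openin_Int)
qed

lemma agree_add:
  assumes "agree W f f'" "agree W g g'" shows "agree W (f + g) (f' + g')"
    and "agree W (f * g) (f' * g')"
proof -
  obtain U where U: "openin (space_top S) U" "U \<inter> W \<noteq> {}" "\<forall>x\<in>U. f x = f' x"
    using assms(1) unfolding agree_def by blast
  obtain U' where U': "openin (space_top S) U'" "U' \<inter> W \<noteq> {}" "\<forall>x\<in>U'. g x = g' x"
    using assms(2) unfolding agree_def by blast
  have "U \<inter> U' \<inter> W \<noteq> {}" using irreducible_open_Int[OF W U(1) U'(1) U(2) U'(2)] .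
  then show "agree W (f + g) (f' + g')" "agree W (f * g) (f' * g')"
    unfolding agree_def using U U'
    by (auto intro!: exI[of _ "U \<inter> U'"] openin_Int)
qed

lemmas agree_mult = agree_add(2)

lemma agree_restrict: "openin (space_top S) U \<Longrightarrow> U \<inter> W \<noteq> {} \<Longrightarrow> agree W (restrict f U) f"
  unfolding agree_def by auto

lemma near_common:
  assumes "f \<in> near W" "g \<in> near W"
  obtains U where "openin (space_top S) U" "U \<inter> W \<noteq> {}"
    "restrict f U \<in> sections S U" "restrict g U \<in> sections S U"
proof -
  obtain U where U: "openin (space_top S) U" "U \<inter> W \<noteq> {}" "restrict f U \<in> sections S U"
    using assms(1) unfolding near_def by blast
  obtain U' where U': "openin (space_top S) U'" "U' \<inter> W \<noteq> {}" "restrict g U' \<in> sections S U'"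
    using assms(2) unfolding near_def by blast
  have "U \<inter> U' \<inter> W \<noteq> {}" using irreducible_open_Int[OF W U(1) U'(1) U(2) U'(2)] .
  then show ?thesis
    using that[of "U \<inter> U'"] sections_restrict_restrict[OF U(1) openin_Int[OF U(1) U'(1)] _ U(3)]
      sections_restrict_restrict[OF U'(1) openin_Int[OF U(1) U'(1)] _ U'(3)] openin_Int[OF U(1) U'(1)]
    by auto
qed

lemma near_const: "(\<lambda>_. c) \<in> near W"
  unfolding near_def using W sections_const[of "points S" c]
  by (intro CollectI exI[of _ "points S"]) (auto simp: irreducible_in_def)

lemma near_add: "f \<in> near W \<Longrightarrow> g \<in> near W \<Longrightarrow> f + g \<in> near W"
proof -
  assume "f \<in> near W" "g \<in> near W"
  then obtain U where U: "openin (space_top S) U" "U \<inter> W \<noteq> {}"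
    "restrict f U \<in> sections S U" "restrict g U \<in> sections S U" by (rule near_common)
  have "(\<lambda>x\<in>U. restrict f U x + restrict g U x) = restrict (f + g) U" by (auto simp: restrict_def)
  then show ?thesis unfolding near_def using U sections_add[OF U(1,3,4)] by auto
qed

lemma near_mult: "f \<in> near W \<Longrightarrow> g \<in> near W \<Longrightarrow> f * g \<in> near W"
proof -
  assume "f \<in> near W" "g \<in> near W"
  then obtain U where U: "openin (space_top S) U" "U \<inter> W \<noteq> {}"
    "restrict f U \<in> sections S U" "restrict g U \<in> sections S U" by (rule near_common)
  have "(\<lambda>x\<in>U. restrict f U x * restrict g U x) = restrict (f * g) U" by (auto simp: restrict_def)
  then show ?thesis unfolding near_def using U sections_mult[OF U(1,3,4)] by auto
qed

lemma near_subring: "subring_of (near W)"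
proof
  show one: "1 \<in> near W" using near_const[of 1] by (simp add: one_fun_def)
  fix f g assume f: "f \<in> near W" and g: "g \<in> near W"
  show "f + g \<in> near W" "f * g \<in> near W" using f g by (rule near_add, rule near_mult)
next
  fix f assume f: "f \<in> near W"
  have "(\<lambda>_. - 1) * f \<in> near W" using near_const f by (rule near_mult)
  moreover have "(\<lambda>_. - 1) * f = - f" by (auto simp: fun_eq_iff)
  ultimately show "- f \<in> near W" by simp
qed

lemma near_agree:
  assumes "f \<in> near W" "agree W f g" shows "g \<in> near W"
proof -
  obtain U where U: "openin (space_top S) U" "U \<inter> W \<noteq> {}" "restrict f U \<in> sections S U"
    using assms(1) unfolding near_def by blast
  obtain U' where U': "openin (space_top S) U'" "U' \<inter> W \<noteq> {}" "\<forall>x\<in>U'. f x = g x"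
    using assms(2) unfolding agree_def by blast
  have ne: "U \<inter> U' \<inter> W \<noteq> {}" using irreducible_open_Int[OF W U(1) U'(1) U(2) U'(2)] .
  have "restrict f (U \<inter> U') \<in> sections S (U \<inter> U')"
    using sections_restrict_restrict[OF U(1) openin_Int[OF U(1) U'(1)] _ U(3)] by simp
  moreover have "restrict f (U \<inter> U') = restrict g (U \<inter> U')" using U'(3) by (auto simp: restrict_def)
  ultimately show ?thesis
    unfolding near_def using ne openin_Int[OF U(1) U'(1)] by (intro CollectI exI[of _ "U \<inter> U'"]) simp
qed

lemma local_sections_near: "(U, f) \<in> local_sections S W \<Longrightarrow> f \<in> near W"
  using sections_restrict_restrict[of U U f] sections_extensional[of U f]
  unfolding local_sections_def near_def by (auto simp: extensional_restrict)

text \<open>An open set on which \<open>f\<close> and \<open>g\<close> agree may be shrunk into both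
  domains: irreducibility of \<open>W\<close> prevents the intersection from missing
  \<open>W\<close>.\<close>

lemma germ_rel_iff:
  "((U, f), (U', g)) \<in> germ_rel S W \<longleftrightarrow>
     (U, f) \<in> local_sections S W \<and> (U', g) \<in> local_sections S W \<and> agree W f g"
proof
  assume "((U, f), (U', g)) \<in> germ_rel S W"
  then show "(U, f) \<in> local_sections S W \<and> (U', g) \<in> local_sections S W \<and> agree W f g"
    unfolding germ_rel_def agree_def by blast
next
  assume *: "(U, f) \<in> local_sections S W \<and> (U', g) \<in> local_sections S W \<and> agree W f g"
  then obtain V where V: "openin (space_top S) V" "V \<inter> W \<noteq> {}" "\<forall>x\<in>V. f x = g x"
    unfolding agree_def by blast
  have U: "openin (space_top S) U" "U \<inter> W \<noteq> {}" and U': "openin (space_top S) U'" "U' \<inter> W \<noteq> {}"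
    using * by (auto simp: local_sections_def)
  have VU: "V \<inter> U \<inter> W \<noteq> {}" using irreducible_open_Int[OF W V(1) U(1) V(2) U(2)] .
  have "(V \<inter> U) \<inter> U' \<inter> W \<noteq> {}"
    using irreducible_open_Int[OF W openin_Int[OF V(1) U(1)] U'(1) VU U'(2)] .
  then show "((U, f), (U', g)) \<in> germ_rel S W"
    unfolding germ_rel_def using * V(3) openin_Int[OF openin_Int[OF V(1) U(1)] U'(1)]
    by (intro CollectI case_prodI conjI exI[of _ "V \<inter> U \<inter> U'"]) auto
qed

lemma germ_eq: "(U, f) \<in> local_sections S W \<Longrightarrow> germ S W U f = germ_of W f"
  unfolding Image_def germ_of_def using germ_rel_iff[of U f] agree_sym by auto

lemma germ_of_eq: "f \<in> near W \<Longrightarrow> germ_of W f = germ_of W g \<longleftrightarrow> agree W f g"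
proof
  assume f: "f \<in> near W" and eq: "germ_of W f = germ_of W g"
  obtain U where U: "openin (space_top S) U" "U \<inter> W \<noteq> {}" "restrict f U \<in> sections S U"
    using f unfolding near_def by blast
  then have "(U, restrict f U) \<in> germ_of W f"
    unfolding germ_of_def local_sections_def by (auto simp: agree_restrict)
  then have "agree W (restrict f U) g" using eq by (auto simp: germ_of_def)
  then show "agree W f g" using agree_trans agree_sym agree_restrict[OF U(1,2)] by metis
next
  assume "agree W f g"
  then show "germ_of W f = germ_of W g"
    unfolding germ_of_def using agree_trans agree_sym by blast
qed

lemma near_representative:
  assumes "f \<in> near W"
  obtains U where "(U, restrict f U) \<in> local_sections S W" "germ S W U (restrict f U) = germ_of W f"
    "(U, restrict f U) \<in> germ_of W f"
proof -
  obtain U where U: "openin (space_top S) U" "U \<inter> W \<noteq> {}" "restrict f U \<in> sections S U"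
    using assms unfolding near_def by blast
  have 1: "(U, restrict f U) \<in> local_sections S W" using U by (simp add: local_sections_def)
  have ag: "agree W (restrict f U) f" using agree_restrict[OF U(1,2)] .
  have "germ S W U (restrict f U) = germ_of W (restrict f U)" by (rule germ_eq[OF 1])
  also have "\<dots> = germ_of W f" using germ_of_eq[OF local_sections_near[OF 1]] ag by blast
  finally show ?thesis using that 1 ag by (auto simp: germ_of_def)
qed

lemma carrier_stalk: "carrier (stalk S W) = germ_of W ` near W"
proof
  show "carrier (stalk S W) \<subseteq> germ_of W ` near W"
  proof
    fix a assume "a \<in> carrier (stalk S W)"
    then obtain U f where "(U, f) \<in> local_sections S W" "a = germ S W U f"
      by (auto simp: stalk_def quotient_def)
    then show "a \<in> germ_of W ` near W" using germ_eq local_sections_near by blast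
  qed
  show "germ_of W ` near W \<subseteq> carrier (stalk S W)"
  proof
    fix a assume "a \<in> germ_of W ` near W"
    then obtain f where f: "f \<in> near W" "a = germ_of W f" by blast
    obtain U where "(U, restrict f U) \<in> local_sections S W" "germ S W U (restrict f U) = germ_of W f"
      using near_representative[OF f(1)] by metis
    then show "a \<in> carrier (stalk S W)" unfolding f(2) stalk_def by (auto simp: quotient_def)
  qed
qed

lemma germ_of_closed: "f \<in> near W \<Longrightarrow> germ_of W f \<in> carrier (stalk S W)"
  by (simp add: carrier_stalk)

lemma const_sections: "(points S, \<lambda>y\<in>points S. c) \<in> local_sections S W"
  using W sections_const[of "points S" c] by (auto simp: local_sections_def irreducible_in_def)

lemma germ_const: "germ S W (points S) (\<lambda>y\<in>points S. c) = germ_of W (\<lambda>_. c)"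
proof -
  have "agree W (\<lambda>y\<in>points S. c) (\<lambda>_. c)"
    using W by (intro agree_restrict) (auto simp: irreducible_in_def)
  then show ?thesis
    using germ_eq[OF const_sections] germ_of_eq[OF local_sections_near[OF const_sections]] by metis
qed

lemma germ_of_one: "\<one>\<^bsub>stalk S W\<^esub> = germ_of W 1"
  using germ_const[of 1] by (simp add: stalk_def one_fun_def)

lemma germ_of_zero: "\<zero>\<^bsub>stalk S W\<^esub> = germ_of W 0"
  using germ_const[of 0] by (simp add: stalk_def zero_fun_def)

text \<open>The operations of the stalk are unions over all pairs of representatives. Every pair
  contributes the same germ, so the union over nonempty sets is that germ; \<open>op\<close> stands
  for addition and multiplication alike.\<close>

lemma germ_of_binop:
  assumes f: "f \<in> near W" and g: "g \<in> near W"
    and sec: "\<And>U f g. openin (space_top S) U \<Longrightarrow> f \<in> sections S U \<Longrightarrow> g \<in> sections S U \<Longrightarrow>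
      (\<lambda>x\<in>U. op (f x) (g x)) \<in> sections S U"
  shows "(\<Union>(U, f)\<in>germ_of W f. \<Union>(U', g)\<in>germ_of W g. germ S W (U \<inter> U') (\<lambda>y\<in>U \<inter> U'. op (f y) (g y)))
    = germ_of W (\<lambda>x. op (f x) (g x))"
proof -
  have *: "germ S W (U \<inter> U') (\<lambda>y\<in>U \<inter> U'. op (f' y) (g' y)) = germ_of W (\<lambda>x. op (f x) (g x))"
    if f': "(U, f') \<in> germ_of W f" and g': "(U', g') \<in> germ_of W g" for U f' U' g'
  proof -
    have U: "openin (space_top S) U" "U \<inter> W \<noteq> {}" "f' \<in> sections S U"
      using f' by (auto simp: germ_of_def local_sections_def)
    have U': "openin (space_top S) U'" "U' \<inter> W \<noteq> {}" "g' \<in> sections S U'"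
      using g' by (auto simp: germ_of_def local_sections_def)
    have ne: "U \<inter> U' \<inter> W \<noteq> {}" using irreducible_open_Int[OF W U(1) U'(1) U(2) U'(2)] .
    note op = openin_Int[OF U(1) U'(1)]
    have sec': "(\<lambda>x\<in>U \<inter> U'. op (restrict f' (U \<inter> U') x) (restrict g' (U \<inter> U') x)) \<in> sections S (U \<inter> U')"
      using sections_restrict[OF U(1) op _ U(3)] sections_restrict[OF U'(1) op _ U'(3)] by (intro sec op) blast+
    have eq: "(\<lambda>x\<in>U \<inter> U'. op (restrict f' (U \<inter> U') x) (restrict g' (U \<inter> U') x))
        = (\<lambda>y\<in>U \<inter> U'. op (f' y) (g' y))" by (auto simp: restrict_def)
    have loc: "(U \<inter> U', \<lambda>y\<in>U \<inter> U'. op (f' y) (g' y)) \<in> local_sections S W"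
      unfolding local_sections_def using op ne sec'[unfolded eq] by blast
    obtain V where V: "openin (space_top S) V" "V \<inter> W \<noteq> {}" "\<forall>x\<in>V. f' x = f x"
      using f' unfolding germ_of_def agree_def by blast
    obtain V' where V': "openin (space_top S) V'" "V' \<inter> W \<noteq> {}" "\<forall>x\<in>V'. g' x = g x"
      using g' unfolding germ_of_def agree_def by blast
    have VV: "V \<inter> V' \<inter> W \<noteq> {}" using irreducible_open_Int[OF W V(1) V'(1) V(2) V'(2)] .
    have "agree W (\<lambda>y. op (f' y) (g' y)) (\<lambda>x. op (f x) (g x))"
      unfolding agree_def using VV V(3) V'(3) openin_Int[OF V(1) V'(1)]
      by (intro exI[of _ "V \<inter> V'"]) auto
    then have "agree W (\<lambda>y\<in>U \<inter> U'. op (f' y) (g' y)) (\<lambda>x. op (f x) (g x))"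
      using agree_trans[OF agree_restrict[OF op ne]] by blast
    then show ?thesis using germ_eq[OF loc] germ_of_eq[OF local_sections_near[OF loc]] by metis
  qed
  obtain U where "(U, restrict f U) \<in> germ_of W f" using near_representative[OF f] by metis
  moreover obtain U' where "(U', restrict g U') \<in> germ_of W g" using near_representative[OF g] by metis
  ultimately have ne: "germ_of W f \<noteq> {}" "germ_of W g \<noteq> {}" by blast+
  have "(\<Union>(U', g')\<in>germ_of W g. germ S W (fst p \<inter> U') (\<lambda>y\<in>fst p \<inter> U'. op (snd p y) (g' y)))
      = germ_of W (\<lambda>x. op (f x) (g x))" if p: "p \<in> germ_of W f" for p
  proof (rule SUP_eq_const[OF ne(2)])
    fix r assume "r \<in> germ_of W g"
    then show "(case r of (U', g') \<Rightarrow> germ S W (fst p \<inter> U') (\<lambda>y\<in>fst p \<inter> U'. op (snd p y) (g' y)))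
        = germ_of W (\<lambda>x. op (f x) (g x))"
      using *[of "fst p" "snd p" "fst r" "snd r"] p by (simp add: case_prod_beta)
  qed
  then show ?thesis by (intro SUP_eq_const[OF ne(1)]) (simp add: case_prod_beta)
qed

lemma germ_of_add:
  assumes "f \<in> near W" "g \<in> near W"
  shows "germ_of W f \<oplus>\<^bsub>stalk S W\<^esub> germ_of W g = germ_of W (f + g)"
  using germ_of_binop[OF assms sections_add] by (simp add: stalk_def plus_fun_def)

lemma germ_of_mult:
  assumes "f \<in> near W" "g \<in> near W"
  shows "germ_of W f \<otimes>\<^bsub>stalk S W\<^esub> germ_of W g = germ_of W (f * g)"
  using germ_of_binop[OF assms sections_mult] by (simp add: stalk_def times_fun_def)

interpretation near: subring_of "near W"
  by (rule near_subring)

lemma cring_stalk: "cring (stalk S W)"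
proof (rule cringI)
  have c: "x \<in> carrier (stalk S W) \<Longrightarrow> \<exists>f\<in>near W. x = germ_of W f" for x
    by (auto simp: carrier_stalk)
  show "abelian_group (stalk S W)"
  proof (rule abelian_groupI)
    fix x assume "x \<in> carrier (stalk S W)"
    then obtain f where "f \<in> near W" "x = germ_of W f" using c by blast
    then show "\<exists>y\<in>carrier (stalk S W). y \<oplus>\<^bsub>stalk S W\<^esub> x = \<zero>\<^bsub>stalk S W\<^esub>"
      by (intro bexI[of _ "germ_of W (- f)"])
        (auto simp: germ_of_add near.uminus_C germ_of_zero germ_of_closed)
  qed (auto dest!: c simp: germ_of_add near.add_C germ_of_zero near.zero_C germ_of_closed add_ac)
  show "comm_monoid (stalk S W)"
    by (rule comm_monoidI)
      (auto dest!: c simp: germ_of_mult near.mult_C germ_of_one near.one_C germ_of_closed mult_ac)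
qed (auto simp: carrier_stalk germ_of_mult germ_of_add near.mult_C near.add_C distrib_right)

lemma germ_of_sum:
  assumes "finite K" "\<And>i. i \<in> K \<Longrightarrow> f i \<in> near W"
  shows "(\<Oplus>\<^bsub>stalk S W\<^esub>i\<in>K. germ_of W (f i)) = germ_of W (\<Sum>i\<in>K. f i)"
proof -
  interpret R: cring "stalk S W" by (rule cring_stalk)
  show ?thesis
    using assms
  proof (induction K)
    case (insert i K)
    then show ?case
      using germ_of_closed by (subst R.finsum_insert) (auto simp: germ_of_add near.sum_C)
  qed (simp add: germ_of_zero)
qed

lemma germ_of_uminus:
  assumes "f \<in> near W" shows "\<ominus>\<^bsub>stalk S W\<^esub> germ_of W f = germ_of W (- f)"
proof -
  interpret R: cring "stalk S W" by (rule cring_stalk)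
  show ?thesis
    using assms by (intro R.minus_equality) (auto simp: germ_of_add near.uminus_C germ_of_zero germ_of_closed)
qed

end

end

text \<open>As \<open>V\<close> is the closure of the image, an open set meeting \<open>V\<close>
  meets the image itself, and its preimage meets \<open>W\<close>. Hence the pulled back domains are
  admissible for germs along \<open>W\<close>.\<close>

lemma germ_pullback_germ_of:
  assumes S: "function_space S" and T: "function_space T" and \<phi>: "morphism S T \<phi>"
    and W: "irreducible_in (space_top S) W" and V: "irreducible_in (space_top T) V"
    and closure: "V = space_top T closure_of (\<phi> ` W)"
    and f: "f \<in> function_space.near T V"
  shows "germ_pullback S W \<phi> (function_space.germ_of T V f) = function_space.germ_of S W (f \<circ> \<phi>)"
    and "f \<circ> \<phi> \<in> function_space.near S W"
proof -
  interpret S: function_space S by (rule S)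
  interpret T: function_space T by (rule T)
  have cont: "continuous_map (space_top S) (space_top T) \<phi>" using \<phi> by (simp add: morphism_def)
  have Wp: "W \<subseteq> points S" using W by (simp add: irreducible_in_def)
  have pre: "openin (space_top S) {x \<in> points S. \<phi> x \<in> U} \<and> {x \<in> points S. \<phi> x \<in> U} \<inter> W \<noteq> {}"
    if U: "openin (space_top T) U" "U \<inter> V \<noteq> {}" for U
  proof
    show "openin (space_top S) {x \<in> points S. \<phi> x \<in> U}"
      using cont U(1) by (rule openin_continuous_map_preimage)
    obtain v where "v \<in> U" "v \<in> V" using U(2) by blast
    then have "\<exists>y\<in>\<phi> ` W. y \<in> U" using U(1) unfolding closure in_closure_of by blast
    then show "{x \<in> points S. \<phi> x \<in> U} \<inter> W \<noteq> {}" using Wp by blast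
  qed
  have *: "germ S W {x \<in> points S. \<phi> x \<in> U} (restrict (g \<circ> \<phi>) {x \<in> points S. \<phi> x \<in> U}) = S.germ_of W (f \<circ> \<phi>)
      \<and> f \<circ> \<phi> \<in> S.near W"
    if g: "(U, g) \<in> T.germ_of V f" for U g
  proof -
    let ?U = "{x \<in> points S. \<phi> x \<in> U}"
    have U: "openin (space_top T) U" "U \<inter> V \<noteq> {}" "g \<in> sections T U"
      using g by (auto simp: T.germ_of_def local_sections_def)
    have loc: "(?U, restrict (g \<circ> \<phi>) ?U) \<in> local_sections S W"
      using pre[OF U(1,2)] \<phi> U(1,3) unfolding local_sections_def morphism_def by blast
    obtain U0 where U0: "openin (space_top T) U0" "U0 \<inter> V \<noteq> {}" "\<forall>x\<in>U0. g x = f x"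
      using g unfolding T.germ_of_def T.agree_def by blast
    have "S.agree W (g \<circ> \<phi>) (f \<circ> \<phi>)"
      unfolding S.agree_def using pre[OF U0(1,2)] U0(3)
      by (intro exI[of _ "{x \<in> points S. \<phi> x \<in> U0}"]) auto
    then have ag: "S.agree W (restrict (g \<circ> \<phi>) ?U) (f \<circ> \<phi>)"
      using S.agree_trans[OF W] S.agree_restrict[OF W] pre[OF U(1,2)] by blast
    show ?thesis
      using S.germ_eq[OF W loc] S.germ_of_eq[OF W S.local_sections_near[OF W loc]] ag
        S.near_agree[OF W S.local_sections_near[OF W loc] ag] by blast
  qed
  obtain U where "(U, restrict f U) \<in> T.germ_of V f" using T.near_representative[OF V f] by metis
  then show "f \<circ> \<phi> \<in> S.near W" using * by blast
  show "germ_pullback S W \<phi> (T.germ_of V f) = S.germ_of W (f \<circ> \<phi>)"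
    unfolding germ_pullback_def
  proof (rule SUP_eq_const)
    show "T.germ_of V f \<noteq> {}" using \<open>(U, restrict f U) \<in> T.germ_of V f\<close> by blast
    show "(case p of (U, g) \<Rightarrow> germ S W {x \<in> points S. \<phi> x \<in> U}
        (restrict (g \<circ> \<phi>) {x \<in> points S. \<phi> x \<in> U})) = S.germ_of W (f \<circ> \<phi>)"
      if "p \<in> T.germ_of V f" for p
      using *[of "fst p" "snd p"] that by (simp add: case_prod_beta)
  qed
qed

lemma function_space_subspace_of:
  assumes "function_space S" shows "function_space (subspace_of S W)"
proof -
  interpret S: function_space S by fact
  have top: "space_top (subspace_of S W) = subtopology (space_top S) W"
    by (simp add: subspace_of_def)
  have sec: "f \<in> sections (subspace_of S W) U \<longleftrightarrow> f \<in> extensional U \<and>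
      (\<forall>x\<in>U. \<exists>U' g. openin (space_top S) U' \<and> x \<in> U' \<and> g \<in> sections S U' \<and> (\<forall>y \<in> U' \<inter> U. f y = g y))"
    for f U
    by (simp add: subspace_of_def)
  have binop: "(\<lambda>x\<in>U. op (f x) (g x)) \<in> sections (subspace_of S W) U"
    if f: "f \<in> sections (subspace_of S W) U" and g: "g \<in> sections (subspace_of S W) U"
      and op: "\<And>U f g. openin (space_top S) U \<Longrightarrow> f \<in> sections S U \<Longrightarrow> g \<in> sections S U \<Longrightarrow>
        (\<lambda>x\<in>U. op (f x) (g x)) \<in> sections S U" for U f g op
    unfolding sec
  proof (intro conjI ballI)
    fix x assume x: "x \<in> U"
    obtain U1 f1 where U1: "openin (space_top S) U1" "x \<in> U1" "f1 \<in> sections S U1" "\<forall>y \<in> U1 \<inter> U. f y = f1 y"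
      using f x unfolding sec by blast
    obtain U2 f2 where U2: "openin (space_top S) U2" "x \<in> U2" "f2 \<in> sections S U2" "\<forall>y \<in> U2 \<inter> U. g y = f2 y"
      using g x unfolding sec by blast
    note o = openin_Int[OF U1(1) U2(1)]
    have "(\<lambda>x\<in>U1 \<inter> U2. op (restrict f1 (U1 \<inter> U2) x) (restrict f2 (U1 \<inter> U2) x)) \<in> sections S (U1 \<inter> U2)"
      using S.sections_restrict[OF U1(1) o _ U1(3)] S.sections_restrict[OF U2(1) o _ U2(3)]
      by (intro op o) blast+
    then show "\<exists>U' h. openin (space_top S) U' \<and> x \<in> U' \<and> h \<in> sections S U' \<and>
        (\<forall>y \<in> U' \<inter> U. (\<lambda>x\<in>U. op (f x) (g x)) y = h y)"
      using o U1 U2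
      by (intro exI[of _ "U1 \<inter> U2"]
          exI[of _ "\<lambda>x\<in>U1 \<inter> U2. op (restrict f1 (U1 \<inter> U2) x) (restrict f2 (U1 \<inter> U2) x)"]) auto
  qed simp
  show ?thesis
  proof
    fix U U' f
    assume "U' \<subseteq> U" and f: "f \<in> sections (subspace_of S W) U"
    then show "restrict f U' \<in> sections (subspace_of S W) U'"
      unfolding sec
    proof (intro conjI ballI)
      fix x assume x: "x \<in> U'"
      then obtain V g where V: "openin (space_top S) V" "x \<in> V" "g \<in> sections S V" "\<forall>y \<in> V \<inter> U. f y = g y"
        using f \<open>U' \<subseteq> U\<close> unfolding sec by blast
      then show "\<exists>V g. openin (space_top S) V \<and> x \<in> V \<and> g \<in> sections S V \<and>
          (\<forall>y\<in>V \<inter> U'. restrict f U' y = g y)"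
        using \<open>U' \<subseteq> U\<close> by (intro exI[of _ V] exI[of _ g]) auto
    qed simp
  next
    fix U c assume U: "openin (space_top (subspace_of S W)) U"
    have "U \<subseteq> points S" using openin_subset[OF U] by (simp add: top)
    then show "(\<lambda>x\<in>U. c) \<in> sections (subspace_of S W) U"
      unfolding sec using S.sections_const[of "points S" c]
      by (intro conjI ballI exI[of _ "points S"] exI[of _ "\<lambda>x\<in>points S. c"]) auto
  next
    fix U f g
    assume f: "f \<in> sections (subspace_of S W) U" "g \<in> sections (subspace_of S W) U"
    show "(\<lambda>x\<in>U. f x + g x) \<in> sections (subspace_of S W) U"
      using f S.sections_add by (rule binop)
    show "(\<lambda>x\<in>U. f x * g x) \<in> sections (subspace_of S W) U"
      using f S.sections_mult by (rule binop)
  qed (simp add: sec)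
qed

section \<open>Regular functions on projective varieties\<close>

definition vec_of :: "(complex^'n) set \<Rightarrow> complex^'n" where
  "vec_of L = (SOME v. v \<in> L \<and> v \<noteq> 0)"

lemma vec_of:
  assumes "L \<in> proj_points" shows "vec_of L \<in> L" "vec_of L \<noteq> 0"
proof -
  have "\<not> L \<subseteq> {0}" using assms vec.dim_eq_0[of L] by (auto simp: proj_points_def)
  then have "\<exists>v. v \<in> L \<and> v \<noteq> 0" by auto
  then have "vec_of L \<in> L \<and> vec_of L \<noteq> 0" unfolding vec_of_def by (rule someI_ex)
  then show "vec_of L \<in> L" "vec_of L \<noteq> 0" by auto
qed

text \<open>A homogeneous form is evaluated at a line through a chosen vector; quotients of forms of the
  same degree do not depend on the choice.\<close>

definition form_at :: "(complex^'n \<Rightarrow> complex) \<Rightarrow> (complex^'n) set \<Rightarrow> complex" where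
  "form_at F L = F (vec_of L)"

lemma form_quotient:
  assumes F: "form d F" and H: "form d H" and L: "L \<in> proj_points" "v \<in> L" "v \<noteq> 0"
  shows "H v \<noteq> 0 \<longleftrightarrow> form_at H L \<noteq> 0" "F v / H v = form_at F L / form_at H L"
proof -
  obtain c where c: "v = c *s vec_of L"
    using proj_points_scale[OF L(1) vec_of(1)[OF L(1)] L(2) vec_of(2)[OF L(1)]] by blast
  then have "c \<noteq> 0" using L(3) by auto
  then show "H v \<noteq> 0 \<longleftrightarrow> form_at H L \<noteq> 0" "F v / H v = form_at F L / form_at H L"
    unfolding c form_scale[OF F] form_scale[OF H] form_at_def by auto
qed

lemma topspace_zariski: "topspace zariski = (proj_points :: (complex^'n) set set)"
proof -
  have "closedin zariski (topspace zariski :: (complex^'n) set set)" by (rule closedin_topspace)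
  then have "topspace zariski \<subseteq> (proj_points :: (complex^'n) set set)"
    unfolding closedin_zariski by blast
  moreover have "zariski_closed (proj_points :: (complex^'n) set set)"
    unfolding zariski_closed_def by (intro exI[of _ "{}"]) (simp add: zero_locus_def)
  then have "closedin zariski (proj_points :: (complex^'n) set set)" unfolding closedin_zariski by simp
  ultimately show ?thesis using closedin_subset by blast
qed

lemma openin_nonzero:
  assumes "form d H" shows "openin zariski {L \<in> proj_points. form_at H L \<noteq> 0}"
proof -
  have eq: "{L \<in> proj_points. form_at H L \<noteq> 0} = topspace zariski - zero_locus {H}"
  proof -
    have "(\<forall>v\<in>L. H v = 0) \<longleftrightarrow> form_at H L = 0" if L: "L \<in> proj_points" for L
    proof
      assume "\<forall>v\<in>L. H v = 0"
      then show "form_at H L = 0" using vec_of(1)[OF L] by (simp add: form_at_def)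
    next
      assume 0: "form_at H L = 0"
      show "\<forall>v\<in>L. H v = 0"
      proof
        fix v assume "v \<in> L"
        then obtain c where "v = c *s vec_of L"
          using proj_points_scale[OF L vec_of(1)[OF L] _ vec_of(2)[OF L]] by blast
        then show "H v = 0" using form_scale[OF assms] 0 by (simp add: form_at_def)
      qed
    qed
    then show ?thesis by (auto simp: topspace_zariski zero_locus_def)
  qed
  have "zariski_closed (zero_locus {H})" unfolding zariski_closed_def using assms by blast
  then have "closedin zariski (zero_locus {H})" unfolding closedin_zariski by (auto simp: zero_locus_def)
  then show ?thesis unfolding eq by (rule openin_diff[OF openin_topspace])
qed

text \<open>Only values on \<open>E\<close> are constrained. Thus one pointwise condition on total
  functions describes the sections of projective space, with \<open>E\<close> an open set, as well
  as those of a reduced subspace \<open>E\<close>.\<close>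

definition regular_at :: "(complex^'n) set set \<Rightarrow> ((complex^'n) set \<Rightarrow> complex) \<Rightarrow> (complex^'n) set \<Rightarrow> bool" where
  "regular_at E f x \<longleftrightarrow> (\<exists>d F H U. form d F \<and> form d H \<and> openin zariski U \<and> x \<in> U \<and>
     (\<forall>L\<in>U \<inter> E. form_at H L \<noteq> 0 \<and> f L = form_at F L / form_at H L))"

lemma regular_atI:
  assumes "form d F" "form d H" "openin zariski U" "x \<in> U"
    and "\<And>L. L \<in> U \<Longrightarrow> L \<in> E \<Longrightarrow> form_at H L \<noteq> 0 \<and> f L = form_at F L / form_at H L"
  shows "regular_at E f x"
  unfolding regular_at_def
  by (rule exI[of _ d], rule exI[of _ F], rule exI[of _ H], rule exI[of _ U]) (use assms in auto)

lemma form_cong: "form d F \<Longrightarrow> d = e \<Longrightarrow> form e F" by simp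

lemma form_uminus: "form d F \<Longrightarrow> form d (\<lambda>v. c * F v)"
  using form_mult[OF form_const[of c], of d F] by simp

lemma form_power: "form d F \<Longrightarrow> form (d * k) (\<lambda>v. F v ^ k)"
proof (induction k)
  case 0
  then show ?case using form_const[of 1] by simp
next
  case (Suc k)
  then show ?case using form_mult[of d F "d * k" "\<lambda>v. F v ^ k"] by simp
qed

lemma regular_at_const: "x \<in> proj_points \<Longrightarrow> regular_at E (\<lambda>_. c) x"
  using form_const[of c] form_const[of 1] openin_topspace[of zariski]
  by (rule regular_atI) (simp_all add: form_at_def topspace_zariski)

lemma regular_at_add_mult:
  assumes "regular_at E f x" "regular_at E g x"
  shows "regular_at E (f + g) x" "regular_at E (f * g) x"
proof -
  obtain d F H U where f: "form d F" "form d H" "openin zariski U" "x \<in> U"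
      "\<forall>L\<in>U \<inter> E. form_at H L \<noteq> 0 \<and> f L = form_at F L / form_at H L"
    using assms(1) unfolding regular_at_def by blast
  obtain e F' H' U' where g: "form e F'" "form e H'" "openin zariski U'" "x \<in> U'"
      "\<forall>L\<in>U' \<inter> E. form_at H' L \<noteq> 0 \<and> g L = form_at F' L / form_at H' L"
    using assms(2) unfolding regular_at_def by blast
  have 1: "form (d + e) (\<lambda>v. F v * H' v + F' v * H v)"
    using form_add[OF form_mult[OF f(1) g(2)] form_cong[OF form_mult[OF g(1) f(2)] add.commute]] .
  show "regular_at E (f + g) x"
    by (rule regular_atI[OF 1 form_mult[OF f(2) g(2)] openin_Int[OF f(3) g(3)]])
      (use f(4,5) g(4,5) in \<open>auto simp: form_at_def field_simps\<close>)
  show "regular_at E (f * g) x"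
    by (rule regular_atI[OF form_mult[OF f(1) g(1)] form_mult[OF f(2) g(2)] openin_Int[OF f(3) g(3)]])
      (use f(4,5) g(4,5) in \<open>auto simp: form_at_def\<close>)
qed

text \<open>On \<open>E\<close> near \<open>x\<close> the function vanishes exactly where its
  numerator does, so being nonzero is an open condition, and the inverse arises by exchanging
  \<open>F\<close> and \<open>H\<close>.\<close>

lemma regular_at_nonzero:
  assumes "regular_at E f x" "x \<in> E" "f x \<noteq> 0"
  obtains U where "openin zariski U" "x \<in> U" "\<forall>L\<in>U \<inter> E. f L \<noteq> 0"
    and "regular_at E (\<lambda>L. inverse (f L)) x"
proof -
  obtain d F H U where f: "form d F" "form d H" "openin zariski U" "x \<in> U"
      "\<forall>L\<in>U \<inter> E. form_at H L \<noteq> 0 \<and> f L = form_at F L / form_at H L"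
    using assms(1) unfolding regular_at_def by blast
  let ?U = "U \<inter> {L \<in> proj_points. form_at F L \<noteq> 0}"
  have U: "openin zariski ?U" using f(3) openin_nonzero[OF f(1)] by (rule openin_Int)
  have xU: "x \<in> ?U" using f(3-5) assms(2,3) openin_subset[OF f(3)] by (auto simp: topspace_zariski)
  have "\<forall>L\<in>?U \<inter> E. f L \<noteq> 0" using f(5) by auto
  moreover have "regular_at E (\<lambda>L. inverse (f L)) x"
    by (rule regular_atI[OF f(2,1) U xU]) (use f(5) in auto)
  ultimately show ?thesis using that[OF U xU] by blast
qed

lemma regular_at_quotient:
  assumes "form d F" "form d H" "x \<in> proj_points" "form_at H x \<noteq> 0"
  shows "regular_at E (\<lambda>L. form_at F L / form_at H L) x"
  by (rule regular_atI[OF assms(1,2) openin_nonzero[OF assms(2)]]) (use assms in auto)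

lemma sections_projective_space:
  assumes U: "openin zariski U"
  shows "f \<in> sections projective_space U \<longleftrightarrow> f \<in> extensional U \<and> (\<forall>x\<in>U. regular_at U f x)"
proof -
  have Up: "U \<subseteq> proj_points" using openin_subset[OF U] by (simp add: topspace_zariski)
  have "(\<exists>d F H U'. form d F \<and> form d H \<and> openin zariski U' \<and> x \<in> U' \<and> U' \<subseteq> U \<and>
        (\<forall>L\<in>U'. \<forall>v \<in> L - {0}. H v \<noteq> 0 \<and> f L = F v / H v)) \<longleftrightarrow> regular_at U f x" (is "?l \<longleftrightarrow> _")
    if x: "x \<in> U" for x
  proof
    assume ?l
    then obtain d F H U' where *: "form d F" "form d H" "openin zariski U'" "x \<in> U'" "U' \<subseteq> U"
        "\<forall>L\<in>U'. \<forall>v \<in> L - {0}. H v \<noteq> 0 \<and> f L = F v / H v" by blast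
    have "form_at H L \<noteq> 0 \<and> f L = form_at F L / form_at H L" if "L \<in> U' \<inter> U" for L
      using *(6) that vec_of[of L] Up by (auto simp: form_at_def)
    then show "regular_at U f x" unfolding regular_at_def using *(1-4) by blast
  next
    assume "regular_at U f x"
    then obtain d F H U' where *: "form d F" "form d H" "openin zariski U'" "x \<in> U'"
        "\<forall>L\<in>U' \<inter> U. form_at H L \<noteq> 0 \<and> f L = form_at F L / form_at H L"
      unfolding regular_at_def by blast
    have "H v \<noteq> 0 \<and> f L = F v / H v" if "L \<in> U' \<inter> U" "v \<in> L - {0}" for L v
      using form_quotient[OF *(1,2), of L v] *(5) that Up by auto
    then have "\<forall>L\<in>U' \<inter> U. \<forall>v\<in>L - {0}. H v \<noteq> 0 \<and> f L = F v / H v" by blast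
    moreover have "openin zariski (U' \<inter> U)" "x \<in> U' \<inter> U" "U' \<inter> U \<subseteq> U"
      using *(4) x openin_Int[OF *(3) U] by auto
    ultimately have "form d F \<and> form d H \<and> openin zariski (U' \<inter> U) \<and> x \<in> U' \<inter> U \<and> U' \<inter> U \<subseteq> U \<and>
        (\<forall>L\<in>U' \<inter> U. \<forall>v\<in>L - {0}. H v \<noteq> 0 \<and> f L = F v / H v)"
      using *(1,2) by (intro conjI)
    then show ?l
      by - (rule exI[of _ d], rule exI[of _ F], rule exI[of _ H], rule exI[of _ "U' \<inter> U"])
  qed
  then show ?thesis by (simp add: projective_space_def)
qed

lemma regular_at_cong:
  assumes f: "regular_at E f x" and V: "openin zariski V" "x \<in> V" and eq: "\<forall>L\<in>V \<inter> E. f L = g L"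
  shows "regular_at E g x"
proof -
  obtain d F H U where *: "form d F" "form d H" "openin zariski U" "x \<in> U"
      "\<forall>L\<in>U \<inter> E. form_at H L \<noteq> 0 \<and> f L = form_at F L / form_at H L"
    using f unfolding regular_at_def by blast
  have "form_at H L \<noteq> 0 \<and> g L = form_at F L / form_at H L" if "L \<in> U \<inter> V \<inter> E" for L
  proof -
    have L: "L \<in> U \<inter> E" "L \<in> V \<inter> E" using that by blast+
    show ?thesis using bspec[OF *(5) L(1)] unfolding bspec[OF eq L(2)] .
  qed
  moreover have "x \<in> U \<inter> V" using *(4) V(2) by (rule IntI)
  ultimately show ?thesis
    using *(1,2) openin_Int[OF *(3) V(1)] by (intro regular_atI[of d F H "U \<inter> V"]) auto
qed

lemma regular_at_mono:
  assumes f: "regular_at E f x" and sub: "E' \<subseteq> E"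
  shows "regular_at E' f x"
proof -
  obtain d F H U where *: "form d F" "form d H" "openin zariski U" "x \<in> U"
      "\<forall>L\<in>U \<inter> E. form_at H L \<noteq> 0 \<and> f L = form_at F L / form_at H L"
    using f unfolding regular_at_def by blast
  have "\<forall>L\<in>U \<inter> E'. form_at H L \<noteq> 0 \<and> f L = form_at F L / form_at H L"
    using *(5) sub by blast
  with *(1-4) show ?thesis by (intro regular_atI[of d F H U]) auto
qed

lemma regular_at_open:
  assumes "regular_at (U \<inter> E) f x" "openin zariski U" "x \<in> U" shows "regular_at E f x"
proof -
  obtain d F H U' where *: "form d F" "form d H" "openin zariski U'" "x \<in> U'"
      "\<forall>L\<in>U' \<inter> (U \<inter> E). form_at H L \<noteq> 0 \<and> f L = form_at F L / form_at H L"
    using assms(1) unfolding regular_at_def by blast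
  then show ?thesis
    using assms(2,3) openin_Int[OF *(3) assms(2)] by (intro regular_atI[of d F H "U' \<inter> U"]) auto
qed

lemma function_space_projective_space: "function_space projective_space"
proof -
  have top: "space_top projective_space = zariski" by (simp add: projective_space_def)
  have Up: "x \<in> proj_points" if "openin zariski U" "x \<in> U" for U and x :: "(complex^'n) set"
    using openin_subset[OF that(1)] that(2) by (auto simp: topspace_zariski)
  show ?thesis
  proof (unfold_locales, unfold top)
    fix U and f :: "(complex^'n) set \<Rightarrow> complex"
    assume U: "openin zariski U" and f: "f \<in> sections projective_space U"
    then show "f \<in> extensional U" by (simp add: sections_projective_space)
    fix U' assume U': "openin zariski U'" "U' \<subseteq> U"
    have "regular_at U' (restrict f U') x" if "x \<in> U'" for x
      using f that U' U
      by (intro regular_at_cong[OF regular_at_mono[OF _ U'(2)] U'(1)]) (auto simp: sections_projective_space)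
    then show "restrict f U' \<in> sections projective_space U'"
      by (simp add: sections_projective_space[OF U'(1)])
  next
    fix U and c :: complex assume U: "openin zariski (U :: (complex^'n) set set)"
    have "regular_at U (\<lambda>x\<in>U. c) x" if "x \<in> U" for x
      by (rule regular_at_cong[OF regular_at_const[OF Up[OF U that], of U c] U that]) simp
    then show "(\<lambda>x\<in>U. c) \<in> sections projective_space U" by (simp add: sections_projective_space[OF U])
  next
    fix U and f g :: "(complex^'n) set \<Rightarrow> complex"
    assume U: "openin zariski U"
      and f: "f \<in> sections projective_space U" "g \<in> sections projective_space U"
    then have r: "regular_at U f x" "regular_at U g x" if "x \<in> U" for x
      using that by (auto simp: sections_projective_space)
    have "regular_at U (\<lambda>x\<in>U. f x + g x) x" "regular_at U (\<lambda>x\<in>U. f x * g x) x" if "x \<in> U" for x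
      using regular_at_cong[OF regular_at_add_mult(1)[OF r[OF that]] U that, of "\<lambda>x\<in>U. f x + g x"]
        regular_at_cong[OF regular_at_add_mult(2)[OF r[OF that]] U that, of "\<lambda>x\<in>U. f x * g x"] by auto
    then show "(\<lambda>x\<in>U. f x + g x) \<in> sections projective_space U"
      "(\<lambda>x\<in>U. f x * g x) \<in> sections projective_space U"
      by (simp_all add: sections_projective_space[OF U])
  qed
qed

text \<open>The local extension that a section of the subspace needs is the quotient of
  \<open>F\<close> and \<open>H\<close> itself, taken on the open set where \<open>H\<close> does
  not vanish.\<close>

lemma sections_subspace_projective_space:
  assumes E: "E \<subseteq> proj_points" and U: "openin (space_top (subspace_of projective_space E)) U"
  shows "f \<in> sections (subspace_of projective_space E) U \<longleftrightarrow>
    f \<in> extensional U \<and> (\<forall>x\<in>U. regular_at E f x)"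
proof -
  have top: "space_top projective_space = zariski" by (simp add: projective_space_def)
  obtain V where V: "openin zariski V" "U = V \<inter> E"
    using U by (auto simp: subspace_of_def top openin_subtopology)
  have "(\<exists>U' g. openin zariski U' \<and> x \<in> U' \<and> g \<in> sections projective_space U' \<and> (\<forall>y \<in> U' \<inter> U. f y = g y))
      \<longleftrightarrow> regular_at E f x" (is "?l \<longleftrightarrow> _") if x: "x \<in> U" for x
  proof
    assume ?l
    then obtain U' g where U': "openin zariski U'" "x \<in> U'" "g \<in> sections projective_space U'"
        "\<forall>y \<in> U' \<inter> U. f y = g y" by blast
    have "regular_at U' g x" using U' by (simp add: sections_projective_space)
    then have "regular_at (U' \<inter> E) g x" by (rule regular_at_mono) simp
    then have "regular_at E g x" using U'(1,2) by (rule regular_at_open)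
    then show "regular_at E f x"
      by (rule regular_at_cong[OF _ openin_Int[OF U'(1) V(1)]]) (use U' V x in auto)
  next
    assume "regular_at E f x"
    then obtain d F H U' where *: "form d F" "form d H" "openin zariski U'" "x \<in> U'"
        "\<forall>L\<in>U' \<inter> E. form_at H L \<noteq> 0 \<and> f L = form_at F L / form_at H L"
      unfolding regular_at_def by blast
    let ?U = "U' \<inter> {L \<in> proj_points. form_at H L \<noteq> 0}"
    have o: "openin zariski ?U" using *(3) openin_nonzero[OF *(2)] by (rule openin_Int)
    let ?g = "\<lambda>L\<in>?U. form_at F L / form_at H L"
    have "regular_at ?U ?g y" if "y \<in> ?U" for y
      using that by (intro regular_at_cong[OF regular_at_quotient[OF *(1,2)] o]) auto
    then have "?g \<in> sections projective_space ?U" by (simp add: sections_projective_space[OF o])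
    moreover have "x \<in> ?U" using x *(4,5) V(2) E by auto
    moreover have "\<forall>y\<in>?U \<inter> U. f y = ?g y" using *(5) V(2) by auto
    ultimately show ?l using o by (intro exI conjI)
  qed
  then show ?thesis by (simp add: subspace_of_def top)
qed

text \<open>Avoidance over an infinite field: in \<open>f + t * g\<close> each of the finitely many
  points excludes at most one value of \<open>t\<close>.\<close>

lemma ex_nonvanishing_combination:
  fixes \<F> :: "('p \<Rightarrow> complex) set"
  assumes "finite P" "\<F> \<noteq> {}" "\<And>f g c. f \<in> \<F> \<Longrightarrow> g \<in> \<F> \<Longrightarrow> (\<lambda>x. f x + c * g x) \<in> \<F>"
    and "\<And>p. p \<in> P \<Longrightarrow> \<exists>f\<in>\<F>. f p \<noteq> 0"
  shows "\<exists>f\<in>\<F>. \<forall>p\<in>P. f p \<noteq> 0"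
  using assms(1,4)
proof (induction P)
  case empty
  then show ?case using assms(2) by auto
next
  case (insert p P)
  then obtain f where f: "f \<in> \<F>" "\<forall>q\<in>P. f q \<noteq> 0" by auto
  obtain g where g: "g \<in> \<F>" "g p \<noteq> 0" using insert.prems by blast
  have "finite (insert 0 ((\<lambda>q. - f q / g q) ` insert p P))" using insert.hyps(1) by simp
  then obtain t where t: "t \<notin> insert 0 ((\<lambda>q. - f q / g q) ` insert p P)"
    using infinite_UNIV_char_0 ex_new_if_finite by blast
  have "f q + t * g q \<noteq> 0" if "q \<in> insert p P" for q
  proof
    assume 0: "f q + t * g q = 0"
    have "g q \<noteq> 0" using f(2) g(2) that 0 by (cases "g q = 0") auto
    then have "t = - f q / g q" using 0 by (simp add: field_simps eq_neg_iff_add_eq_0 add.commute)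
    then show False using t that by blast
  qed
  then show ?case using assms(3)[OF f(1) g(1), of t] by (intro bexI[of _ "\<lambda>x. f x + t * g x"]) auto
qed

text \<open>A hyperplane that avoids finitely many points. For an orbit it provides a denominator
  that stays nonzero under the whole group, in place of an affine neighbourhood of the
  orbit.\<close>

lemma ex_linear_form_nonvanishing:
  fixes P :: "(complex^'n) set set"
  assumes "finite P" "P \<subseteq> proj_points"
  shows "\<exists>H. form 1 H \<and> (\<forall>L\<in>P. form_at H L \<noteq> 0)"
proof -
  have "\<exists>H\<in>{H :: complex^'n \<Rightarrow> complex. form 1 H}. \<forall>v\<in>vec_of ` P. H v \<noteq> 0"
  proof (rule ex_nonvanishing_combination)
    show "finite (vec_of ` P)" using assms(1) by simp
    show "{H :: complex^'n \<Rightarrow> complex. form 1 H} \<noteq> {}" using form_coord by blast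
    show "(\<lambda>v. F v + c * H v) \<in> {H. form 1 H}" if "F \<in> {H. form 1 H}" "H \<in> {H. form 1 H}"
      for F H :: "complex^'n \<Rightarrow> complex" and c
      using form_add[OF _ form_uminus, of 1 F H c] that by simp
    fix v assume "v \<in> vec_of ` P"
    then obtain L where "v = vec_of L" "L \<in> P" by (rule imageE)
    then have "v \<noteq> 0" using vec_of(2)[of L] assms(2) by auto
    then have "\<exists>i. v $ i \<noteq> 0" by (simp add: vec_eq_iff)
    then obtain i where "v $ i \<noteq> 0" ..
    then show "\<exists>H\<in>{H. form 1 H}. H v \<noteq> 0"
      by (intro bexI[of _ "\<lambda>v. v $ i"]) (simp_all add: form_coord[unfolded One_nat_def])
  qed
  then show ?thesis by (auto simp: form_at_def)
qed

lemma proj_points_eq: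
  assumes "L \<in> proj_points" "L' \<in> proj_points" "v \<in> L" "v \<in> L'" "v \<noteq> 0"
  shows "L = L'"
proof -
  have sub: "L1 \<subseteq> L2" if L: "L1 \<in> proj_points" "L2 \<in> proj_points" "v \<in> L1" "v \<in> L2" for L1 L2
  proof
    fix w assume "w \<in> L1"
    then obtain c where "w = c *s v" using proj_points_scale[OF L(1,3)] assms(5) by blast
    then show "w \<in> L2" using that(2,4) by (simp add: proj_points_def vec.subspace_scale)
  qed
  show ?thesis using sub[OF assms(1-4)] sub[OF assms(2,1,4,3)] by blast
qed

text \<open>If all coordinates divided by \<open>H\<close> agreed at \<open>x\<close> and
  \<open>y\<close>, the representing vectors would be proportional and the two lines equal.\<close>

lemma ex_linear_quotient_separating:
  fixes P :: "(complex^'n) set set"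
  assumes "finite P" "P \<subseteq> proj_points" "x \<in> P" "y \<in> P" "x \<noteq> y"
  shows "\<exists>F H. form 1 F \<and> form 1 H \<and> (\<forall>L\<in>P. form_at H L \<noteq> 0) \<and> form_at F x / form_at H x \<noteq> form_at F y / form_at H y"
proof -
  obtain H :: "complex^'n \<Rightarrow> complex" where H: "form 1 H" "\<forall>L\<in>P. form_at H L \<noteq> 0"
    using ex_linear_form_nonvanishing[OF assms(1,2)] by blast
  have "\<exists>i. vec_of x $ i / form_at H x \<noteq> vec_of y $ i / form_at H y"
  proof (rule ccontr)
    assume "\<not> ?thesis"
    then have eq: "vec_of x $ i = (form_at H x / form_at H y) * vec_of y $ i" for i
      using H(2) assms(3,4) by (simp add: field_simps)
    then have "vec_of x = (form_at H x / form_at H y) *s vec_of y" by (simp add: vec_eq_iff)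
    then have "vec_of x \<in> y"
      using vec_of(1)[of y] assms(2,4) by (auto simp: proj_points_def intro!: vec.subspace_scale)
    then have "x = y"
      using assms(2-4) vec_of[of x] by (intro proj_points_eq[of x y "vec_of x"]) auto
    then show False using assms(5) by blast
  qed
  then obtain i where "vec_of x $ i / form_at H x \<noteq> vec_of y $ i / form_at H y" by blast
  then show ?thesis using H form_coord[of i] by (intro exI[of _ "\<lambda>v. v $ i"] exI[of _ H]) (simp add: form_at_def)
qed

section \<open>Quotients by finite groups\<close>

locale finite_quotient = function_space S for S :: "'a fspace" +
  fixes G :: "('g, 'm) monoid_scheme" and act :: "'g \<Rightarrow> 'a \<Rightarrow> 'a"
  assumes acting: "finite_group_acting G S act"
begin

abbreviation Y :: "'a set fspace" where
  "Y \<equiv> quotient_space G S act"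

abbreviation \<pi> :: "'a \<Rightarrow> 'a set" where
  "\<pi> \<equiv> orbit G act"

lemma finite_carrier: "finite (carrier G)"
  and act_morphism: "g \<in> carrier G \<Longrightarrow> morphism S S (act g)"
  and act_faithful: "faithful_action G (points S) act"
  using acting by (auto simp: finite_group_acting_def)

sublocale action: faithful_action G "points S" act
  by (rule act_faithful)

sublocale group G
  using action.group_hom by (simp add: group_hom_def)

lemma act_closed: "g \<in> carrier G \<Longrightarrow> x \<in> points S \<Longrightarrow> act g x \<in> points S"
  using action.element_image by blast

lemma act_one: "x \<in> points S \<Longrightarrow> act \<one>\<^bsub>G\<^esub> x = x"
  using action.id_eq_one by (metis restrict_apply')

lemma act_mult:
  "g \<in> carrier G \<Longrightarrow> h \<in> carrier G \<Longrightarrow> x \<in> points S \<Longrightarrow> act (g \<otimes>\<^bsub>G\<^esub> h) x = act g (act h x)"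
  using action.composition_rule by blast

lemma act_inv:
  assumes "g \<in> carrier G" "x \<in> points S"
  shows "act (inv\<^bsub>G\<^esub> g) (act g x) = x" "act g (act (inv\<^bsub>G\<^esub> g) x) = x"
  using act_mult[of "inv\<^bsub>G\<^esub> g" g x] act_mult[of g "inv\<^bsub>G\<^esub> g" x] assms act_one by simp_all

lemma act_continuous: "g \<in> carrier G \<Longrightarrow> continuous_map (space_top S) (space_top S) (act g)"
  using act_morphism by (simp add: morphism_def)

lemma orbit_mem: "x \<in> points S \<Longrightarrow> y \<in> \<pi> x \<longleftrightarrow> (\<exists>g\<in>carrier G. y = act g x)"
  by (auto simp: orbit_def)

lemma orbit_act:
  assumes "g \<in> carrier G" "x \<in> points S" shows "\<pi> (act g x) = \<pi> x"
proof -
  have "\<pi> x \<subseteq> \<pi> (act g x)"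
  proof
    fix y assume "y \<in> \<pi> x"
    then obtain h where h: "h \<in> carrier G" "y = act h x" using orbit_mem assms(2) by blast
    have "y = act (h \<otimes>\<^bsub>G\<^esub> inv\<^bsub>G\<^esub> g) (act g x)"
      using h assms act_closed by (simp add: act_mult act_inv)
    then show "y \<in> \<pi> (act g x)" using orbit_mem act_closed h(1) assms by blast
  qed
  moreover have "\<pi> (act g x) \<subseteq> \<pi> x"
  proof
    fix y assume "y \<in> \<pi> (act g x)"
    then obtain h where h: "h \<in> carrier G" "y = act h (act g x)" using orbit_mem act_closed assms by blast
    then have "y = act (h \<otimes>\<^bsub>G\<^esub> g) x" using assms by (simp add: act_mult)
    then show "y \<in> \<pi> x" using orbit_mem h(1) assms by blast
  qed
  ultimately show ?thesis by blast
qed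

lemma orbit_eq_iff:
  assumes "x \<in> points S" "y \<in> points S"
  shows "\<pi> x = \<pi> y \<longleftrightarrow> (\<exists>g\<in>carrier G. y = act g x)"
proof
  assume "\<pi> x = \<pi> y"
  moreover have "y \<in> \<pi> y" using action.orbit_refl[OF assms(2)] .
  ultimately show "\<exists>g\<in>carrier G. y = act g x" using orbit_mem[OF assms(1)] by blast
next
  assume "\<exists>g\<in>carrier G. y = act g x"
  then show "\<pi> x = \<pi> y" using orbit_act assms(1) by auto
qed

lemma finite_orbit: "x \<in> points S \<Longrightarrow> finite (\<pi> x)"
  using finite_carrier by (simp add: orbit_def Setcompr_eq_image)

lemma openin_Y: "openin (space_top Y) U \<longleftrightarrow>
    U \<subseteq> orbits G (points S) act \<and> openin (space_top S) {x \<in> points S. \<pi> x \<in> U}"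
  unfolding quotient_space_def fspace.simps topology_inverse'[OF istopology_quotient_space] ..

lemma quotient_map: "quotient_map (space_top S) (space_top Y) \<pi>"
  by (rule quotient_map_orbit)

lemma continuous_pi: "continuous_map (space_top S) (space_top Y) \<pi>"
  using quotient_map by (rule quotient_imp_continuous_map)

lemma points_Y: "points Y = \<pi> ` points S"
  using quotient_imp_surjective_map[OF quotient_map] ..

lemma orbits_eq: "orbits G (points S) act = \<pi> ` points S"
  by (auto simp: orbits_def)

lemma sections_Y: "f \<in> sections Y U \<longleftrightarrow> f \<in> extensional U \<and>
    restrict (f \<circ> \<pi>) {x \<in> points S. \<pi> x \<in> U} \<in> sections S {x \<in> points S. \<pi> x \<in> U}"
  by (simp add: quotient_space_def)

lemma morphism_pi: "morphism S Y \<pi>"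
  unfolding morphism_def using continuous_pi sections_Y by blast

lemma function_space_Y: "function_space Y"
proof
  fix U U' f
  assume U: "openin (space_top Y) U" and f: "f \<in> sections Y U"
  then show "f \<in> extensional U" by (simp add: sections_Y)
  assume U': "openin (space_top Y) U'" "U' \<subseteq> U"
  let ?p = "\<lambda>U. {x \<in> points S. \<pi> x \<in> U}"
  have "restrict (restrict (f \<circ> \<pi>) (?p U)) (?p U') \<in> sections S (?p U')"
  proof (rule sections_restrict)
    show "restrict (f \<circ> \<pi>) (?p U) \<in> sections S (?p U)" using f by (simp add: sections_Y)
  qed (use U U' in \<open>auto simp: openin_Y\<close>)
  moreover have "restrict (restrict (f \<circ> \<pi>) (?p U)) (?p U') = restrict (restrict f U' \<circ> \<pi>) (?p U')"
    using U'(2) by (auto simp: restrict_def fun_eq_iff)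
  ultimately show "restrict f U' \<in> sections Y U'" by (simp add: sections_Y)
next
  fix U c assume U: "openin (space_top Y) U"
  let ?p = "{x \<in> points S. \<pi> x \<in> U}"
  have "(\<lambda>x\<in>?p. c) \<in> sections S ?p" using U by (intro sections_const) (simp add: openin_Y)
  moreover have "(\<lambda>x\<in>?p. c) = restrict ((\<lambda>x\<in>U. c) \<circ> \<pi>) ?p" by (auto simp: restrict_def fun_eq_iff)
  ultimately show "(\<lambda>x\<in>U. c) \<in> sections Y U" by (simp add: sections_Y)
next
  fix U f g
  assume U: "openin (space_top Y) U" and f: "f \<in> sections Y U" "g \<in> sections Y U"
  let ?p = "{x \<in> points S. \<pi> x \<in> U}"
  let ?f = "restrict (f \<circ> \<pi>) ?p" and ?g = "restrict (g \<circ> \<pi>) ?p"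
  have "(\<lambda>x\<in>?p. ?f x + ?g x) \<in> sections S ?p" "(\<lambda>x\<in>?p. ?f x * ?g x) \<in> sections S ?p"
    using U f unfolding openin_Y sections_Y by (blast intro: sections_add sections_mult)+
  moreover have "(\<lambda>x\<in>?p. ?f x + ?g x) = restrict ((\<lambda>x\<in>U. f x + g x) \<circ> \<pi>) ?p"
    "(\<lambda>x\<in>?p. ?f x * ?g x) = restrict ((\<lambda>x\<in>U. f x * g x) \<circ> \<pi>) ?p"
    by (auto simp: restrict_def fun_eq_iff)
  ultimately show "(\<lambda>x\<in>U. f x + g x) \<in> sections Y U" "(\<lambda>x\<in>U. f x * g x) \<in> sections Y U"
    by (simp_all add: sections_Y)
qed

lemma act_image_closed:
  assumes "g \<in> carrier G" "closedin (space_top S) Z" shows "closedin (space_top S) (act g ` Z)"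
proof -
  have Z: "Z \<subseteq> points S" using assms(2) by (rule closedin_subset)
  have "act g ` Z = {x \<in> points S. act (inv\<^bsub>G\<^esub> g) x \<in> Z}"
  proof (intro equalityI subsetI)
    fix x assume "x \<in> act g ` Z"
    then obtain z where "x = act g z" "z \<in> Z" by (rule imageE)
    then show "x \<in> {x \<in> points S. act (inv\<^bsub>G\<^esub> g) x \<in> Z}"
      using act_closed[OF assms(1), of z] act_inv(1)[OF assms(1), of z] Z by auto
  next
    fix x assume x: "x \<in> {x \<in> points S. act (inv\<^bsub>G\<^esub> g) x \<in> Z}"
    then have "x = act g (act (inv\<^bsub>G\<^esub> g) x)" using act_inv(2)[OF assms(1)] by simp
    then show "x \<in> act g ` Z" using x by blast
  qed
  then show ?thesis
    using closedin_continuous_map_preimage[OF act_continuous[OF inv_closed[OF assms(1)]] assms(2)] by simp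
qed

lemma preimage_image:
  assumes "Z \<subseteq> points S" shows "{x \<in> points S. \<pi> x \<in> \<pi> ` Z} = (\<Union>g\<in>carrier G. act g ` Z)"
proof (intro equalityI subsetI)
  fix x assume "x \<in> {x \<in> points S. \<pi> x \<in> \<pi> ` Z}"
  then obtain z where z: "x \<in> points S" "\<pi> z = \<pi> x" "z \<in> Z" by fastforce
  then obtain g where "g \<in> carrier G" "x = act g z" using orbit_eq_iff[of z x] assms by blast
  then show "x \<in> (\<Union>g\<in>carrier G. act g ` Z)" using z(3) by blast
next
  fix x assume "x \<in> (\<Union>g\<in>carrier G. act g ` Z)"
  then obtain g z where g: "g \<in> carrier G" "x = act g z" "z \<in> Z" by blast
  then show "x \<in> {x \<in> points S. \<pi> x \<in> \<pi> ` Z}"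
    using assms act_closed[OF g(1), of z] orbit_act[OF g(1), of z] by auto
qed

text \<open>The preimage of the image is a finite union of translates of \<open>Z\<close>, hence
  closed.\<close>

lemma pi_closed:
  assumes "closedin (space_top S) Z" shows "closedin (space_top Y) (\<pi> ` Z)"
proof -
  have Z: "Z \<subseteq> points S" using assms by (rule closedin_subset)
  have "closedin (space_top S) {x \<in> points S. \<pi> x \<in> \<pi> ` Z}"
    unfolding preimage_image[OF Z]
    using finite_carrier act_image_closed[OF _ assms] by (intro closedin_Union) auto
  moreover have "\<pi> ` Z \<subseteq> points Y" using Z points_Y by blast
  ultimately show ?thesis using quotient_map unfolding quotient_map_closedin by blast
qed

lemma irreducible_image:
  assumes W: "irreducible_in (space_top S) W" shows "irreducible_in (space_top Y) (\<pi> ` W)"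
  unfolding irreducible_in_def
proof (intro conjI allI impI)
  have Wp: "W \<subseteq> points S" using W by (simp add: irreducible_in_def)
  then show "\<pi> ` W \<subseteq> points Y" using points_Y by blast
  show "\<pi> ` W \<noteq> {}" using W by (simp add: irreducible_in_def)
  fix C D assume CD: "closedin (space_top Y) C \<and> closedin (space_top Y) D \<and> \<pi> ` W \<subseteq> C \<union> D"
  let ?p = "\<lambda>C. {x \<in> points S. \<pi> x \<in> C}"
  have "closedin (space_top S) (?p C)" "closedin (space_top S) (?p D)"
    using CD closedin_continuous_map_preimage[OF continuous_pi] by blast+
  moreover have "W \<subseteq> ?p C \<union> ?p D" using CD Wp by auto
  ultimately have "W \<subseteq> ?p C \<or> W \<subseteq> ?p D" using W unfolding irreducible_in_def by blast
  then show "\<pi> ` W \<subseteq> C \<or> \<pi> ` W \<subseteq> D" by auto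
qed

lemma irreducible_act_image:
  assumes W: "irreducible_in (space_top S) W" and g: "g \<in> carrier G"
  shows "irreducible_in (space_top S) (act g ` W)"
  unfolding irreducible_in_def
proof (intro conjI allI impI)
  have Wp: "W \<subseteq> points S" using W by (simp add: irreducible_in_def)
  then show "act g ` W \<subseteq> points S" using act_closed[OF g] by blast
  show "act g ` W \<noteq> {}" using W by (simp add: irreducible_in_def)
  fix C D assume CD: "closedin (space_top S) C \<and> closedin (space_top S) D \<and> act g ` W \<subseteq> C \<union> D"
  let ?p = "\<lambda>C. {x \<in> points S. act g x \<in> C}"
  have "closedin (space_top S) (?p C)" "closedin (space_top S) (?p D)"
    using CD closedin_continuous_map_preimage[OF act_continuous[OF g]] by blast+
  moreover have "W \<subseteq> ?p C \<union> ?p D" using CD Wp by auto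
  ultimately have "W \<subseteq> ?p C \<or> W \<subseteq> ?p D" using W unfolding irreducible_in_def by blast
  then show "act g ` W \<subseteq> C \<or> act g ` W \<subseteq> D" by auto
qed

lemma irreducible_finite_Un:
  assumes "irreducible_in T W" "finite I" "\<And>i. i \<in> I \<Longrightarrow> closedin T (Z i)" "W \<subseteq> (\<Union>i\<in>I. Z i)"
  shows "\<exists>i\<in>I. W \<subseteq> Z i"
  using assms(2-4)
proof (induction I)
  case empty
  then show ?case using assms(1) by (simp add: irreducible_in_def)
next
  case (insert i I)
  have "closedin T (\<Union>i\<in>I. Z i)" using insert by (intro closedin_Union) auto
  then have "W \<subseteq> Z i \<or> W \<subseteq> (\<Union>i\<in>I. Z i)"
    using assms(1) insert.prems unfolding irreducible_in_def by auto
  then show ?case using insert by auto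
qed

text \<open>
  A closed subset of \<open>S\<close> that is minimal among those mapping onto \<open>V\<close> is irreducible.  A minimal one
  exists because the fibres of the quotient map are finite.
\<close>

lemma ex_irreducible_over:
  assumes V: "closedin (space_top Y) V" "irreducible_in (space_top Y) V"
  obtains Z where "closedin (space_top S) Z" "irreducible_in (space_top S) Z" "\<pi> ` Z = V"
proof -
  define P where "P = {x \<in> points S. \<pi> x \<in> V}"
  have P: "closedin (space_top S) P"
    unfolding P_def using continuous_pi V(1) by (rule closedin_continuous_map_preimage)
  have VY: "V \<subseteq> \<pi> ` points S" using V(2) points_Y by (simp add: irreducible_in_def)
  \<comment> \<open>A minimal closed set is sought through its complement, so that Zorn's lemma can
    be applied to increasing unions of open sets.\<close>
  define \<U> where "\<U> = {U. openin (space_top S) U \<and> V \<subseteq> \<pi> ` (P - U)}"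
  have "{} \<in> \<U>" unfolding \<U>_def P_def using VY by auto
  then have ne: "\<U> \<noteq> {}" by blast
  have "\<exists>M\<in>\<U>. \<forall>U\<in>\<U>. M \<subseteq> U \<longrightarrow> U = M"
  proof (rule subset_Zorn_nonempty[OF ne])
    fix \<C> assume C: "\<C> \<noteq> {}" "subset.chain \<U> \<C>"
    then have CU: "\<C> \<subseteq> \<U>" by (simp add: subset.chain_def)
    have "openin (space_top S) (\<Union>\<C>)" using CU by (intro openin_Union) (auto simp: \<U>_def)
    moreover have "v \<in> \<pi> ` (P - \<Union>\<C>)" if v: "v \<in> V" for v
    proof (rule ccontr)
      assume not: "v \<notin> \<pi> ` (P - \<Union>\<C>)"
      define F where "F = {x \<in> points S. \<pi> x = v}"
      obtain x where x: "x \<in> points S" "v = \<pi> x" using VY v by blast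
      have "F \<subseteq> \<pi> x" unfolding F_def using x action.orbit_refl by auto
      then have "finite F" using finite_orbit[OF x(1)] finite_subset by blast
      moreover have "F \<subseteq> \<Union>\<C>" using not v unfolding F_def P_def by blast
      \<comment> \<open>Finiteness of the fibre is decisive: if the union of the chain covers the
        fibre over \<open>v\<close>, a single member of the chain does.\<close>
      ultimately obtain U where "U \<in> \<C>" "F \<subseteq> U"
        using finite_subset_Union_chain[of F \<C> \<U>] C by blast
      then have "v \<in> \<pi> ` (P - U)" using CU v by (auto simp: \<U>_def)
      then show False using \<open>F \<subseteq> U\<close> by (auto simp: F_def P_def)
    qed
    ultimately show "\<Union>\<C> \<in> \<U>" by (auto simp: \<U>_def)
  qed
  then obtain M where "M \<in> \<U>" and max': "\<forall>U\<in>\<U>. M \<subseteq> U \<longrightarrow> U = M" ..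
  then have M: "openin (space_top S) M" "V \<subseteq> \<pi> ` (P - M)" by (simp_all add: \<U>_def)
  have max: "U = M" if "openin (space_top S) U" "V \<subseteq> \<pi> ` (P - U)" "M \<subseteq> U" for U
    using max' that by (simp add: \<U>_def)
  define Z where "Z = P - M"
  have Z: "closedin (space_top S) Z" unfolding Z_def using P M(1) by (rule closedin_diff)
  have image: "\<pi> ` Z = V" using M(2) by (auto simp: Z_def P_def)
  have sub: "Z \<subseteq> C" if C: "closedin (space_top S) C" and VC: "V \<subseteq> \<pi> ` (Z \<inter> C)" for C
  proof -
    let ?U = "M \<union> (points S - C)"
    have "openin (space_top S) ?U" using M(1) C by (intro openin_Un) auto
    moreover have "Z \<inter> C \<subseteq> P - ?U" using closedin_subset[OF P] by (auto simp: Z_def)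
    then have "V \<subseteq> \<pi> ` (P - ?U)" using VC by (meson image_mono order_trans)
    ultimately have "?U = M" by (intro max) auto
    then show "Z \<subseteq> C" using closedin_subset[OF Z] by (auto simp: Z_def)
  qed
  have "irreducible_in (space_top S) Z"
    unfolding irreducible_in_def
  proof (intro conjI allI impI)
    show "Z \<subseteq> points S" using Z by (rule closedin_subset)
    show "Z \<noteq> {}" using image V(2) by (auto simp: irreducible_in_def)
    fix C D assume CD: "closedin (space_top S) C \<and> closedin (space_top S) D \<and> Z \<subseteq> C \<union> D"
    have "closedin (space_top Y) (\<pi> ` (Z \<inter> C))" "closedin (space_top Y) (\<pi> ` (Z \<inter> D))"
      using CD Z by (auto intro: pi_closed closedin_Int)
    moreover have "V \<subseteq> \<pi> ` (Z \<inter> C) \<union> \<pi> ` (Z \<inter> D)" using CD image by blast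
    ultimately have "V \<subseteq> \<pi> ` (Z \<inter> C) \<or> V \<subseteq> \<pi> ` (Z \<inter> D)"
      using V(2) unfolding irreducible_in_def by blast
    then show "Z \<subseteq> C \<or> Z \<subseteq> D" using sub CD by blast
  qed
  then show ?thesis using that Z image by blast
qed

text \<open>The translates of one irreducible closed set over \<open>V\<close> cover the preimage. A
  component lies in one of them and equals it by maximality, so every component maps onto
  \<open>V\<close>.\<close>

lemma component_image:
  assumes V: "closedin (space_top Y) V" "irreducible_in (space_top Y) V"
    and W: "W \<in> irreducible_components (space_top S) {x \<in> points S. \<pi> x \<in> V}"
  shows "\<pi> ` W = V"
proof -
  obtain Z where Z: "closedin (space_top S) Z" "irreducible_in (space_top S) Z" "\<pi> ` Z = V"
    using ex_irreducible_over[OF V] by blast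
  have Zp: "Z \<subseteq> points S" using Z(1) by (rule closedin_subset)
  have W': "irreducible_in (space_top S) W" "W \<subseteq> {x \<in> points S. \<pi> x \<in> V}"
    "\<And>W'. irreducible_in (space_top S) W' \<Longrightarrow> W' \<subseteq> {x \<in> points S. \<pi> x \<in> V} \<Longrightarrow> W \<subseteq> W' \<Longrightarrow> W' = W"
    using W by (auto simp: irreducible_components_def)
  have "W \<subseteq> (\<Union>g\<in>carrier G. act g ` Z)" using W'(2) preimage_image[OF Zp] Z(3) by simp
  then obtain g where g: "g \<in> carrier G" "W \<subseteq> act g ` Z"
    using irreducible_finite_Un[OF W'(1) finite_carrier] act_image_closed[OF _ Z(1)] by metis
  have im: "\<pi> ` (act g ` Z) = V"
    unfolding image_image Z(3)[symmetric] using orbit_act[OF g(1)] Zp by (intro image_cong) auto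
  have "act g ` Z \<subseteq> {x \<in> points S. \<pi> x \<in> V}" using im Zp act_closed[OF g(1)] by blast
  then have "act g ` Z = W" using W'(3)[OF irreducible_act_image[OF Z(2) g(1)]] g(2) by blast
  then show ?thesis using im by simp
qed

end

section \<open>The semilocal ring of an orbit of subvarieties\<close>

locale projective_quotient = finite_quotient X G act
  for X :: "(complex^'n) set fspace" and G :: "('g, 'm) monoid_scheme"
    and act :: "'g \<Rightarrow> (complex^'n) set \<Rightarrow> (complex^'n) set" +
  fixes E W :: "(complex^'n) set set"
  assumes X: "X = subspace_of projective_space E"
    and E: "irreducible_in zariski E"
    and W: "irreducible_in (space_top X) W"
begin

lemma E_proj: "E \<subseteq> proj_points"
  using E by (simp add: irreducible_in_def topspace_zariski)

lemma space_top_X: "space_top X = subtopology zariski E"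
  by (simp add: X subspace_of_def projective_space_def)

lemma points_X: "points X = E"
  using E_proj by (auto simp: space_top_X topspace_zariski)

lemma openin_X: "openin (space_top X) U \<longleftrightarrow> (\<exists>V. openin zariski V \<and> U = V \<inter> E)"
  by (simp add: space_top_X openin_subtopology)

lemma W_E: "W \<subseteq> E"
  using W by (simp add: irreducible_in_def points_X)

lemma openin_X_subset: "openin (space_top X) U \<Longrightarrow> U \<subseteq> E"
  using openin_subset points_X by metis

lemma irreducible_E: "irreducible_in (space_top X) E"
  unfolding irreducible_in_def
proof (intro conjI allI impI)
  show "E \<noteq> {}" using E by (simp add: irreducible_in_def)
  fix C D assume CD: "closedin (space_top X) C \<and> closedin (space_top X) D \<and> E \<subseteq> C \<union> D"
  then obtain C' D' where C': "closedin zariski C'" "C = C' \<inter> E" and D': "closedin zariski D'" "D = D' \<inter> E"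
    unfolding space_top_X closedin_subtopology by blast
  then have "E \<subseteq> C' \<union> D'" using CD by blast
  then have "E \<subseteq> C' \<or> E \<subseteq> D'" using E C'(1) D'(1) unfolding irreducible_in_def by blast
  then show "E \<subseteq> C \<or> E \<subseteq> D" using C'(2) D'(2) by blast
qed (simp add: points_X)

lemma sections_X:
  assumes U: "openin (space_top X) U"
  shows "restrict f U \<in> sections X U \<longleftrightarrow> (\<forall>x\<in>U. regular_at E f x)"
proof -
  obtain V where V: "openin zariski V" "U = V \<inter> E" using U openin_X by blast
  have "regular_at E (restrict f U) x \<longleftrightarrow> regular_at E f x" if "x \<in> U" for x
    using regular_at_cong[OF _ V(1), of E "restrict f U" x f] regular_at_cong[OF _ V(1), of E f x "restrict f U"]
      that V(2) by auto
  then show ?thesis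
    using sections_subspace_projective_space[OF E_proj U[unfolded X], of "restrict f U", folded X] by simp
qed

lemma open_regular_nonzero:
  assumes "openin (space_top X) U" "x \<in> U" "regular_at E f x" "f x \<noteq> 0"
  shows "\<exists>N. openin (space_top X) N \<and> x \<in> N \<and> N \<subseteq> U \<and> (\<forall>y\<in>N. f y \<noteq> 0)"
proof -
  have "x \<in> E" using assms(1,2) openin_X_subset by blast
  then obtain V where V: "openin zariski V" "x \<in> V" "\<forall>L\<in>V \<inter> E. f L \<noteq> 0"
    using regular_at_nonzero[OF assms(3) _ assms(4)] by metis
  have "openin (space_top X) (U \<inter> (V \<inter> E))" using assms(1) V(1) openin_X by (blast intro: openin_Int)
  then show ?thesis using V \<open>x \<in> E\<close> assms(2) by (intro exI[of _ "U \<inter> (V \<inter> E)"]) blast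
qed

text \<open>
  Extending the action by the identity outside \<open>E\<close> makes \<open>pull\<close> an action by automorphisms on
  functions of all lines.
\<close>

definition tact :: "'g \<Rightarrow> (complex^'n) set \<Rightarrow> (complex^'n) set" where
  "tact g x = (if x \<in> E then act g x else x)"

definition pull :: "'g \<Rightarrow> ((complex^'n) set \<Rightarrow> complex) \<Rightarrow> (complex^'n) set \<Rightarrow> complex" where
  "pull g f = f \<circ> tact g"

lemma tact_mult: "g \<in> carrier G \<Longrightarrow> h \<in> carrier G \<Longrightarrow> tact (g \<otimes>\<^bsub>G\<^esub> h) = tact g \<circ> tact h"
  using act_closed act_mult by (auto simp: tact_def points_X fun_eq_iff)

lemma tact_one: "tact \<one>\<^bsub>G\<^esub> = id"
  using act_one by (auto simp: tact_def points_X fun_eq_iff)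

lemma pull_mult: "g \<in> carrier G \<Longrightarrow> h \<in> carrier G \<Longrightarrow> pull h \<circ> pull g = pull (g \<otimes>\<^bsub>G\<^esub> h)"
  by (simp add: pull_def tact_mult fun_eq_iff)

lemma pull_one: "pull \<one>\<^bsub>G\<^esub> = id"
  by (simp add: pull_def tact_one fun_eq_iff)

text \<open>Functions separate points, so \<open>pull g\<close> determines \<open>act g\<close> on
  \<open>E\<close>. Faithfulness is injectivity on extensional maps, hence the passage through
  extensionality.\<close>

lemma pull_inj:
  assumes "g \<in> carrier G" "h \<in> carrier G" "pull g = pull h"
  shows "g = h"
proof -
  have "tact g x = tact h x" for x
    using fun_cong[OF fun_cong[OF assms(3)], of "\<lambda>y. if y = tact h x then 1 else 0" x]
    by (simp add: pull_def split: if_splits)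
  then have eq: "act g x = act h x" if "x \<in> points X" for x
    using that by (metis tact_def points_X)
  have "act g \<in> extensional (points X)" "act h \<in> extensional (points X)"
    using action.bij_prop0[OF assms(1)] action.bij_prop0[OF assms(2)] by (auto simp: Bij_def)
  then have "act g = act h" using eq by (intro extensionalityI) auto
  then show ?thesis using action.faithful assms(1,2) by (simp add: inj_on_def)
qed

lemma pull_regular:
  assumes g: "g \<in> carrier G" and U: "openin (space_top X) U" "\<forall>x\<in>U. regular_at E f x"
    and x: "x \<in> E" "act g x \<in> U"
  shows "regular_at E (pull g f) x"
proof -
  let ?p = "{x \<in> points X. act g x \<in> U}"
  have o: "openin (space_top X) ?p" using act_continuous[OF g] U(1) by (rule openin_continuous_map_preimage)
  have "restrict f U \<in> sections X U" using sections_X[OF U(1)] U(2) by simp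
  then have "restrict (restrict f U \<circ> act g) ?p \<in> sections X ?p"
    using act_morphism[OF g] U(1) unfolding morphism_def by blast
  moreover have "restrict (restrict f U \<circ> act g) ?p = restrict (pull g f) ?p"
    by (auto simp: restrict_def fun_eq_iff pull_def tact_def points_X)
  ultimately show ?thesis using sections_X[OF o, of "pull g f"] x by (simp add: points_X)
qed

text \<open>Regularity on a stable open set meeting \<open>W\<close> is regularity near all
  conjugates of \<open>W\<close> at once; this distinguishes the semilocal ring from the stalk along
  \<open>W\<close>.\<close>

definition stable_open :: "(complex^'n) set set \<Rightarrow> bool" where
  "stable_open U \<longleftrightarrow> openin (space_top X) U \<and> (\<forall>g\<in>carrier G. \<forall>x\<in>U. act g x \<in> U)"

text \<open>The largest stable subset of \<open>U\<close> for \<open>U\<close> in \<open>E\<close>.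
  It is open along with \<open>U\<close>, being a finite intersection of preimages, and nonempty as
  soon as \<open>U\<close> contains an orbit.\<close>

definition core :: "(complex^'n) set set \<Rightarrow> (complex^'n) set set" where
  "core U = {x \<in> E. \<forall>g\<in>carrier G. act g x \<in> U}"

lemma stable_open_core:
  assumes "openin (space_top X) U" shows "stable_open (core U)" "core U \<subseteq> U"
proof -
  have eq: "core U = points X \<inter> (\<Inter>g\<in>carrier G. {x \<in> points X. act g x \<in> U})"
    by (auto simp: core_def points_X)
  have "openin (space_top X) (points X \<inter> (\<Inter>g\<in>carrier G. {x \<in> points X. act g x \<in> U}))"
  proof (rule openin_Int_Inter)
    show "finite ((\<lambda>g. {x \<in> points X. act g x \<in> U}) ` carrier G)" using finite_carrier by simp
    show "openin (space_top X) S" if "S \<in> (\<lambda>g. {x \<in> points X. act g x \<in> U}) ` carrier G" for S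
      using that openin_continuous_map_preimage[OF act_continuous assms] by blast
  qed (rule openin_topspace)
  moreover have "act g x \<in> core U" if "g \<in> carrier G" "x \<in> core U" for g x
    unfolding core_def
  proof (intro CollectI conjI ballI)
    have x: "x \<in> points X" "\<forall>g\<in>carrier G. act g x \<in> U" using that(2) by (auto simp: core_def points_X)
    show "act g x \<in> E" using act_closed[OF that(1) x(1)] by (simp add: points_X)
    show "act h (act g x) \<in> U" if "h \<in> carrier G" for h
      using x(2) act_mult[OF that \<open>g \<in> carrier G\<close> x(1)] m_closed[OF that \<open>g \<in> carrier G\<close>] by metis
  qed
  ultimately show "stable_open (core U)" unfolding stable_open_def eq[symmetric] by blast
  show "core U \<subseteq> U"
  proof
    fix x assume x: "x \<in> core U"
    then have "act \<one>\<^bsub>G\<^esub> x \<in> U" by (simp add: core_def)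
    then show "x \<in> U" using act_one[of x] x by (simp add: core_def points_X)
  qed
qed

text \<open>
  The semilocal ring of the orbit of \<open>W\<close> is represented by functions instead of germs: elements of
  \<open>C\<close> have the same germ iff they differ by an element of \<open>Z\<close> below.
\<close>

definition C :: "((complex^'n) set \<Rightarrow> complex) set" where
  "C = {f. \<exists>U. stable_open U \<and> U \<inter> W \<noteq> {} \<and> (\<forall>x\<in>U. regular_at E f x)}"

definition vanishing :: "(complex^'n) set set \<Rightarrow> ((complex^'n) set \<Rightarrow> complex) set" where
  "vanishing P = {f \<in> C. \<exists>U. openin (space_top X) U \<and> U \<inter> P \<noteq> {} \<and> (\<forall>x\<in>U \<inter> P. f x = 0)}"

definition \<Gamma> :: "(((complex^'n) set \<Rightarrow> complex) \<Rightarrow> (complex^'n) set \<Rightarrow> complex) set" where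
  "\<Gamma> = pull ` carrier G"

lemma stable_open_Int: "stable_open U \<Longrightarrow> stable_open U' \<Longrightarrow> stable_open (U \<inter> U')"
  by (auto simp: stable_open_def intro: openin_Int)

lemma stable_open_E: "stable_open E"
  using act_closed openin_topspace[of "space_top X"] by (auto simp: stable_open_def points_X)

lemma C_common:
  assumes "f \<in> C" "g \<in> C"
  obtains U where "stable_open U" "U \<inter> W \<noteq> {}" "\<forall>x\<in>U. regular_at E f x" "\<forall>x\<in>U. regular_at E g x"
proof -
  obtain U where U: "stable_open U" "U \<inter> W \<noteq> {}" "\<forall>x\<in>U. regular_at E f x"
    using assms(1) unfolding C_def by blast
  obtain U' where U': "stable_open U'" "U' \<inter> W \<noteq> {}" "\<forall>x\<in>U'. regular_at E g x"
    using assms(2) unfolding C_def by blast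
  have "U \<inter> U' \<inter> W \<noteq> {}" using irreducible_open_Int[OF W _ _ U(2) U'(2)] U(1) U'(1)
    by (simp add: stable_open_def)
  then show ?thesis using that[OF stable_open_Int[OF U(1) U'(1)]] U(3) U'(3) by blast
qed

lemma C_const: "(\<lambda>_. c) \<in> C"
proof -
  have "E \<inter> W \<noteq> {}" using W W_E by (auto simp: irreducible_in_def)
  then show ?thesis
    unfolding C_def using stable_open_E regular_at_const E_proj by blast
qed

lemma subring_C: "subring_of C"
proof
  fix f g assume "f \<in> C" "g \<in> C"
  then obtain U where U: "stable_open U" "U \<inter> W \<noteq> {}" "\<forall>x\<in>U. regular_at E f x" "\<forall>x\<in>U. regular_at E g x"
    by (rule C_common)
  then show "f + g \<in> C" "f * g \<in> C" unfolding C_def using regular_at_add_mult by blast+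
next
  show "1 \<in> C" using C_const[of 1] by (simp add: one_fun_def)
next
  fix f assume "f \<in> C"
  then obtain U where U: "stable_open U" "U \<inter> W \<noteq> {}" "\<forall>x\<in>U. regular_at E f x" unfolding C_def by blast
  have "regular_at E (- f) x" if "x \<in> U" for x
  proof -
    have "x \<in> proj_points" using that U(1) openin_X_subset E_proj by (auto simp: stable_open_def)
    then have "regular_at E ((\<lambda>_. - 1) * f) x" using U(3) that regular_at_add_mult(2) regular_at_const by blast
    moreover have "(\<lambda>_. - 1) * f = - f" by (auto simp: fun_eq_iff)
    ultimately show ?thesis by simp
  qed
  then show "- f \<in> C" unfolding C_def using U by blast
qed

sublocale C: subring_of C
  by (rule subring_C)

text \<open>Vanishing on a nonempty open part of \<open>P\<close> spreads to every point of
  \<open>P\<close> near which the function is regular, because two nonempty open subsets of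
  \<open>P\<close> meet.\<close>

lemma vanishing_iff:
  assumes P: "irreducible_in (space_top X) P" "W \<subseteq> P"
    and U: "openin (space_top X) U" "x \<in> U" "x \<in> P" "\<forall>y\<in>U. regular_at E f y"
    and f: "f \<in> vanishing P"
  shows "f x = 0"
proof (rule ccontr)
  assume "f x \<noteq> 0"
  then obtain N where N: "openin (space_top X) N" "x \<in> N" "\<forall>y\<in>N. f y \<noteq> 0"
    using open_regular_nonzero[OF U(1,2)] U(2,4) by metis
  obtain V where V: "openin (space_top X) V" "V \<inter> P \<noteq> {}" "\<forall>x\<in>V \<inter> P. f x = 0"
    using f unfolding vanishing_def by blast
  have "N \<inter> V \<inter> P \<noteq> {}" using irreducible_open_Int[OF P(1) N(1) V(1) _ V(2)] N(2) U(3) by blast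
  then show False using N(3) V(3) by blast
qed

text \<open>A point where \<open>f\<close> is nonzero and one where \<open>g\<close> is nonzero have
  neighbourhoods that meet inside \<open>P\<close>. The inclusion of \<open>W\<close> in
  \<open>P\<close> ensures that the common domain of regularity meets \<open>P\<close>.\<close>

lemma prime_vanishing:
  assumes P: "irreducible_in (space_top X) P" "W \<subseteq> P"
  shows "C.prime_in (vanishing P)"
proof -
  have PE: "openin (space_top X) E" "E \<inter> P \<noteq> {}"
    using stable_open_E P(1) points_X by (auto simp: stable_open_def irreducible_in_def)
  have "f + g \<in> vanishing P" if fg: "f \<in> vanishing P" "g \<in> vanishing P" for f g
  proof -
    obtain U where U: "openin (space_top X) U" "U \<inter> P \<noteq> {}" "\<forall>x\<in>U \<inter> P. f x = 0"
      using fg(1) unfolding vanishing_def by blast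
    obtain V where V: "openin (space_top X) V" "V \<inter> P \<noteq> {}" "\<forall>x\<in>V \<inter> P. g x = 0"
      using fg(2) unfolding vanishing_def by blast
    have "U \<inter> V \<inter> P \<noteq> {}" using irreducible_open_Int[OF P(1) U(1) V(1) U(2) V(2)] .
    moreover have "f + g \<in> C" using fg C.add_C by (auto simp: vanishing_def)
    ultimately show ?thesis
      unfolding vanishing_def using U V openin_Int[OF U(1) V(1)]
      by (intro CollectI conjI exI[of _ "U \<inter> V"]) auto
  qed
  moreover have "c * f \<in> vanishing P" if cf: "c \<in> C" "f \<in> vanishing P" for c f
  proof -
    obtain U where U: "openin (space_top X) U" "U \<inter> P \<noteq> {}" "\<forall>x\<in>U \<inter> P. f x = 0"
      using cf(2) unfolding vanishing_def by blast
    have "c * f \<in> C" using cf C.mult_C by (simp add: vanishing_def)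
    then show ?thesis
      unfolding vanishing_def using U by (intro CollectI conjI exI[of _ U]) auto
  qed
  moreover have "0 \<in> vanishing P" unfolding vanishing_def using C.zero_C PE by auto
  moreover have "1 \<notin> vanishing P" unfolding vanishing_def by auto
  moreover have "f \<in> vanishing P \<or> g \<in> vanishing P"
    if fg: "f \<in> C" "g \<in> C" "f * g \<in> vanishing P" for f g
  proof -
    obtain U where U: "stable_open U" "U \<inter> W \<noteq> {}" "\<forall>x\<in>U. regular_at E f x" "\<forall>x\<in>U. regular_at E g x"
      using fg(1,2) by (rule C_common)
    have Uo: "openin (space_top X) U" using U(1) by (simp add: stable_open_def)
    have UP: "U \<inter> P \<noteq> {}" using U(2) P(2) by blast
    show ?thesis
    proof (rule ccontr)
      assume not: "\<not> ?thesis"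
      then obtain x where x: "x \<in> U \<inter> P" "f x \<noteq> 0" using fg(1) Uo UP unfolding vanishing_def by blast
      obtain y where y: "y \<in> U \<inter> P" "g y \<noteq> 0" using not fg(2) Uo UP unfolding vanishing_def by blast
      obtain N where N: "openin (space_top X) N" "x \<in> N" "N \<subseteq> U" "\<forall>y\<in>N. f y \<noteq> 0"
        using open_regular_nonzero[OF Uo, of x f] x U(3) by blast
      obtain M where M: "openin (space_top X) M" "y \<in> M" "\<forall>y\<in>M. g y \<noteq> 0"
        using open_regular_nonzero[OF Uo, of y g] y U(4) by blast
      have "N \<inter> M \<inter> P \<noteq> {}" using irreducible_open_Int[OF P(1) N(1) M(1)] N(2) M(2) x(1) y(1) by blast
      then obtain z where z: "z \<in> N" "z \<in> M" "z \<in> P" by blast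
      have "\<forall>y\<in>U. regular_at E (f * g) y" using U(3,4) regular_at_add_mult(2) by blast
      then have "(f * g) z = 0" using vanishing_iff[OF P Uo _ z(3) _ fg(3)] z(1) N(3) by blast
      then show False using N(4) M(3) z by auto
    qed
  qed
  ultimately show ?thesis
    unfolding C.prime_in_def C.ideal_in_def by (auto simp: vanishing_def)
qed

definition Z :: "((complex^'n) set \<Rightarrow> complex) set" where "Z = vanishing E"

definition n :: "((complex^'n) set \<Rightarrow> complex) set" where "n = vanishing W"

lemma pull_C:
  assumes "g \<in> carrier G" "f \<in> C" shows "pull g f \<in> C"
proof -
  obtain U where U: "stable_open U" "U \<inter> W \<noteq> {}" "\<forall>x\<in>U. regular_at E f x"
    using assms(2) unfolding C_def by blast
  have "regular_at E (pull g f) x" if "x \<in> U" for x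
    using U that assms(1) openin_X_subset
    by (intro pull_regular[OF assms(1) _ U(3)]) (auto simp: stable_open_def)
  then show ?thesis unfolding C_def using U by blast
qed

text \<open>It is enough that the denominator is nonzero on the orbit of one point of
  \<open>W\<close>: the core of its nonvanishing set is then a stable open set meeting
  \<open>W\<close>.\<close>

lemma quotient_C:
  assumes "form d F" "form d H" "w \<in> W" "\<And>g. g \<in> carrier G \<Longrightarrow> form_at H (act g w) \<noteq> 0"
  shows "(\<lambda>L. form_at F L / form_at H L) \<in> C"
proof -
  let ?U = "{L \<in> proj_points. form_at H L \<noteq> 0} \<inter> E"
  have o: "openin (space_top X) ?U" using openin_X openin_nonzero[OF assms(2)] by blast
  have "w \<in> core ?U"
    using assms(3,4) W_E act_closed[unfolded points_X] subsetD[OF E_proj] by (auto simp: core_def)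
  then have "core ?U \<inter> W \<noteq> {}" using assms(3) by blast
  moreover have "\<forall>x\<in>core ?U. regular_at E (\<lambda>L. form_at F L / form_at H L) x"
    using stable_open_core(2)[OF o] regular_at_quotient[OF assms(1,2)] by blast
  ultimately show ?thesis unfolding C_def using stable_open_core(1)[OF o] by blast
qed

lemma orbit_subset: "x \<in> E \<Longrightarrow> \<pi> x \<subseteq> E"
  using act_closed by (auto simp: orbit_def points_X)

lemma not_vanishing:
  assumes "irreducible_in (space_top X) P" "W \<subseteq> P" "x \<in> P" "regular_at E f x" "f x \<noteq> 0"
  shows "f \<notin> vanishing P"
proof
  assume f: "f \<in> vanishing P"
  have PE: "P \<subseteq> E" using assms(1) by (simp add: irreducible_in_def points_X)
  have E': "openin (space_top X) E" using stable_open_E by (simp add: stable_open_def)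
  obtain N where N: "openin (space_top X) N" "x \<in> N" "\<forall>y\<in>N. f y \<noteq> 0"
    using open_regular_nonzero[OF E' subsetD[OF PE assms(3)] assms(4,5)] by metis
  obtain V where V: "openin (space_top X) V" "V \<inter> P \<noteq> {}" "\<forall>x\<in>V \<inter> P. f x = 0"
    using f unfolding vanishing_def by blast
  have "N \<inter> V \<inter> P \<noteq> {}" using irreducible_open_Int[OF assms(1) N(1) V(1) _ V(2)] N(2) assms(3) by blast
  then show False using N(3) V(3) by blast
qed

text \<open>A quotient of linear forms separates \<open>act g x\<close> from \<open>x\<close>; its
  denominator is also kept nonzero on the orbit of a point of \<open>W\<close>, which puts it into
  \<open>C\<close>. For \<open>P\<close> equal to \<open>E\<close> this gives faithfulness modulo
  \<open>Z\<close>, for \<open>P\<close> equal to \<open>W\<close> the description of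
  inertia.\<close>

lemma ex_moved:
  assumes P: "irreducible_in (space_top X) P" "W \<subseteq> P" and g: "g \<in> carrier G"
    and x: "x \<in> P" "act g x \<noteq> x"
  shows "\<exists>c\<in>C. pull g c - c \<notin> vanishing P"
proof -
  have PE: "P \<subseteq> E" using P(1) by (simp add: irreducible_in_def points_X)
  have xE: "x \<in> E" using x(1) PE by blast
  obtain w where w: "w \<in> W" using W by (auto simp: irreducible_in_def)
  have wE: "w \<in> E" using w W_E by blast
  let ?P = "\<pi> x \<union> \<pi> w"
  have fin: "finite ?P" using finite_orbit xE wE by (simp add: points_X)
  have sub: "?P \<subseteq> proj_points" using orbit_subset[OF xE] orbit_subset[OF wE] E_proj by blast
  have xP: "x \<in> ?P" "act g x \<in> ?P"
    using action.orbit_refl[of x] xE g by (auto simp: points_X orbit_def)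
  obtain F H :: "complex^'n \<Rightarrow> complex" where FH: "form 1 F" "form 1 H" "\<forall>L\<in>?P. form_at H L \<noteq> 0"
      "form_at F (act g x) / form_at H (act g x) \<noteq> form_at F x / form_at H x"
    using ex_linear_quotient_separating[OF fin sub xP(2,1) x(2)] by blast
  let ?c = "\<lambda>L. form_at F L / form_at H L"
  have c: "?c \<in> C"
    by (rule quotient_C[OF FH(1,2) w]) (use FH(3) in \<open>auto simp: orbit_def\<close>)
  have reg: "regular_at E ?c y" if "y \<in> ?P" for y
    using FH(1-3) that sub by (intro regular_at_quotient) auto
  let ?U = "{L \<in> proj_points. form_at H L \<noteq> 0} \<inter> E"
  have o: "openin (space_top X) ?U" using openin_X openin_nonzero[OF FH(2)] by blast
  have gx: "act g x \<in> E" using act_closed[OF g] xE by (simp add: points_X)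
  have "regular_at E (pull g ?c) x"
    by (rule pull_regular[OF g o _ xE])
      (use FH xP gx sub in \<open>auto intro: regular_at_quotient\<close>)
  then have r: "regular_at E (pull g ?c + (\<lambda>_. - 1) * ?c) x"
    using reg[OF xP(1)] regular_at_add_mult regular_at_const E_proj xE by blast
  have eq: "pull g ?c + (\<lambda>_. - 1) * ?c = pull g ?c - ?c" by (auto simp: fun_eq_iff)
  have "(pull g ?c - ?c) x \<noteq> 0" using FH(4) xE by (simp add: pull_def tact_def)
  then show ?thesis using not_vanishing[OF P x(1) r[unfolded eq]] c by blast
qed

lemma Z_n: "Z \<subseteq> n"
proof
  fix f assume f: "f \<in> Z"
  then have "f \<in> C" by (simp add: Z_def vanishing_def)
  then obtain U where U: "stable_open U" "U \<inter> W \<noteq> {}" "\<forall>x\<in>U. regular_at E f x" unfolding C_def by blast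
  have o: "openin (space_top X) U" using U(1) by (simp add: stable_open_def)
  have "\<forall>x\<in>U \<inter> W. f x = 0"
    using vanishing_iff[OF irreducible_E W_E o _ _ U(3)] f W_E unfolding Z_def by blast
  then show "f \<in> n" unfolding n_def vanishing_def using \<open>f \<in> C\<close> o U(2) by blast
qed

lemma Z_vanish:
  assumes "f \<in> Z"
  obtains U where "stable_open U" "U \<inter> W \<noteq> {}" "\<forall>x\<in>U. f x = 0"
proof -
  have "f \<in> C" using assms by (simp add: Z_def vanishing_def)
  then obtain U where U: "stable_open U" "U \<inter> W \<noteq> {}" "\<forall>x\<in>U. regular_at E f x" unfolding C_def by blast
  have o: "openin (space_top X) U" using U(1) by (simp add: stable_open_def)
  have "\<forall>x\<in>U. f x = 0"
    using vanishing_iff[OF irreducible_E W_E o _ _ U(3)] assms openin_X_subset[OF o] unfolding Z_def by blast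
  then show ?thesis using that U by blast
qed

sublocale alg: automorphism_group C \<Gamma>
proof
  show "finite \<Gamma>" unfolding \<Gamma>_def using finite_carrier by simp
  show "id \<in> \<Gamma>" unfolding \<Gamma>_def using pull_one by (metis image_eqI one_closed)
  show "\<sigma> \<circ> \<tau> \<in> \<Gamma>" if "\<sigma> \<in> \<Gamma>" "\<tau> \<in> \<Gamma>" for \<sigma> \<tau>
    using that pull_mult m_closed unfolding \<Gamma>_def by (smt (verit) image_iff)
  show "\<exists>\<tau>\<in>\<Gamma>. \<sigma> \<circ> \<tau> = id \<and> \<tau> \<circ> \<sigma> = id" if \<sigma>: "\<sigma> \<in> \<Gamma>" for \<sigma>
  proof -
    obtain g where g: "g \<in> carrier G" "\<sigma> = pull g" using \<sigma> unfolding \<Gamma>_def by blast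
    have "pull (inv\<^bsub>G\<^esub> g) \<in> \<Gamma>" unfolding \<Gamma>_def using g(1) by simp
    moreover have "pull g \<circ> pull (inv\<^bsub>G\<^esub> g) = id" "pull (inv\<^bsub>G\<^esub> g) \<circ> pull g = id"
      using g(1) by (simp_all add: pull_mult pull_one)
    ultimately show ?thesis unfolding g(2) by blast
  qed
  fix \<sigma> assume \<sigma>: "\<sigma> \<in> \<Gamma>"
  then obtain g where g: "g \<in> carrier G" "\<sigma> = pull g" unfolding \<Gamma>_def by blast
  show "\<sigma> (x + y) = \<sigma> x + \<sigma> y" "\<sigma> (x * y) = \<sigma> x * \<sigma> y" "\<sigma> 1 = 1" for x y
    unfolding g(2) by (simp_all add: pull_def fun_eq_iff)
  show "\<sigma> c \<in> C" if "c \<in> C" for c unfolding g(2) using g(1) that by (rule pull_C)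
qed

sublocale alg: semilocal_action C \<Gamma> Z n
proof
  show "C.prime_in Z" unfolding Z_def by (rule prime_vanishing[OF irreducible_E W_E])
  show "C.prime_in n" unfolding n_def by (rule prime_vanishing[OF W subset_refl])
  show "Z \<subseteq> n" by (rule Z_n)
  show "\<sigma> z \<in> Z" if \<sigma>: "\<sigma> \<in> \<Gamma>" and z: "z \<in> Z" for \<sigma> z
  proof -
    obtain g where g: "g \<in> carrier G" "\<sigma> = pull g" using \<sigma> unfolding \<Gamma>_def by blast
    obtain U where U: "stable_open U" "U \<inter> W \<noteq> {}" "\<forall>x\<in>U. z x = 0" using Z_vanish[OF z] by blast
    have o: "openin (space_top X) U" using U(1) by (simp add: stable_open_def)
    have "\<forall>x\<in>U. pull g z x = 0"
      using U(1,3) g(1) openin_X_subset[OF o] by (auto simp: pull_def tact_def stable_open_def)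
    then show ?thesis
      unfolding g(2) Z_def vanishing_def using pull_C[OF g(1), of z] z o U(2) W_E
      by (intro CollectI conjI exI[of _ U]) (auto simp: Z_def vanishing_def)
  qed
  show "\<exists>c\<in>C. \<sigma> c - c \<notin> Z" if \<sigma>: "\<sigma> \<in> \<Gamma>" "\<sigma> \<noteq> id" for \<sigma>
  proof -
    obtain g where g: "g \<in> carrier G" "\<sigma> = pull g" using \<sigma>(1) unfolding \<Gamma>_def by blast
    have "tact g \<noteq> id" using \<sigma>(2) unfolding g(2) pull_def by auto
    then obtain x where "x \<in> E" "act g x \<noteq> x" by (auto simp: tact_def fun_eq_iff split: if_splits)
    then show ?thesis unfolding g(2) Z_def using ex_moved[OF irreducible_E W_E g(1)] by blast
  qed
  show "of_nat k \<notin> n" if "0 < k" for k :: nat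
    using that unfolding n_def vanishing_def by auto
  show "\<exists>d\<in>C. c * d - 1 \<in> Z" if c: "c \<in> C" "\<forall>\<sigma>\<in>\<Gamma>. \<sigma> c \<notin> n" for c
  proof -
    obtain U where U: "stable_open U" "U \<inter> W \<noteq> {}" "\<forall>x\<in>U. regular_at E c x"
      using c(1) unfolding C_def by blast
    have o: "openin (space_top X) U" using U(1) by (simp add: stable_open_def)
    have UE: "U \<subseteq> E" using openin_X_subset[OF o] .
    \<comment> \<open>These sets, one for each group element, are open and meet \<open>W\<close>, so
      they have a common point in \<open>W\<close>; its whole orbit avoids the zeros of
      \<open>c\<close>. On the core of the nonvanishing set the pointwise inverse is
      regular.\<close>
    define V where "V g = {x \<in> U. pull g c x \<noteq> 0}" for g
    have V: "openin (space_top X) (V g) \<and> V g \<inter> W \<noteq> {}" if g: "g \<in> carrier G" for g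
    proof
      have reg: "regular_at E (pull g c) x" if "x \<in> U" for x
        using U that g UE by (intro pull_regular[OF g o]) (auto simp: stable_open_def)
      show "openin (space_top X) (V g)"
      proof (subst openin_subopen, intro ballI)
        fix x assume "x \<in> V g"
        then have x: "x \<in> U" "pull g c x \<noteq> 0" by (auto simp: V_def)
        obtain N where "openin (space_top X) N" "x \<in> N" "N \<subseteq> U" "\<forall>y\<in>N. pull g c y \<noteq> 0"
          using open_regular_nonzero[OF o x(1) reg[OF x(1)] x(2)] by metis
        then show "\<exists>T. openin (space_top X) T \<and> x \<in> T \<and> T \<subseteq> V g" unfolding V_def by blast
      qed
      have "pull g c \<notin> n" using c(2) g by (simp add: \<Gamma>_def)
      then show "V g \<inter> W \<noteq> {}"
        unfolding n_def vanishing_def V_def using pull_C[OF g c(1)] o U(2) by blast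
    qed
    define N where "N = {x \<in> U. c x \<noteq> 0}"
    have "N = V \<one>\<^bsub>G\<^esub>" unfolding N_def V_def using pull_one by simp
    then have N: "openin (space_top X) N" using V[OF one_closed] by simp
    obtain x where x: "x \<in> W" "\<forall>g\<in>carrier G. x \<in> V g"
      using irreducible_finite_Int[OF W finite_carrier] V by blast
    have "x \<in> core N"
      using x W_E U(1) UE unfolding core_def N_def V_def
      by (auto simp: stable_open_def pull_def tact_def)
    define d where "d = (\<lambda>L. inverse (c L))"
    have "\<forall>y\<in>core N. regular_at E d y"
      unfolding d_def using stable_open_core(2)[OF N] U(3) UE
      by (auto simp: N_def intro: regular_at_nonzero)
    then have "d \<in> C"
      unfolding C_def using stable_open_core(1)[OF N] \<open>x \<in> core N\<close> x(1) by blast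
    moreover have "c * d - 1 \<in> Z"
      unfolding Z_def vanishing_def
    proof (intro CollectI conjI exI[of _ N])
      show "c * d - 1 \<in> C" using c(1) \<open>d \<in> C\<close> C.one_C by (intro C.diff_C C.mult_C)
      show "N \<inter> E \<noteq> {}" using \<open>x \<in> core N\<close> stable_open_core(2)[OF N] x(1) W_E by blast
      show "\<forall>x\<in>N \<inter> E. (c * d - 1) x = 0" by (auto simp: N_def d_def)
    qed (rule N)
    ultimately show ?thesis by blast
  qed
qed

text \<open>If \<open>g\<close> fixes \<open>W\<close> pointwise, it changes no values on
  \<open>W\<close>. Conversely a point of \<open>W\<close> that is moved would be separated from its
  image by a function in \<open>C\<close>.\<close>

lemma inertia_eq: "alg.inertia n = pull ` inertia_group G act W"
proof
  show "pull ` inertia_group G act W \<subseteq> alg.inertia n"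
  proof
    fix \<sigma> assume "\<sigma> \<in> pull ` inertia_group G act W"
    then obtain g where g: "g \<in> carrier G" "\<forall>x\<in>W. act g x = x" "\<sigma> = pull g"
      by (auto simp: inertia_group_def)
    have "pull g c - c \<in> n" if c: "c \<in> C" for c
      unfolding n_def vanishing_def
    proof (intro CollectI conjI exI[of _ E])
      show "pull g c - c \<in> C" using C.diff_C pull_C[OF g(1)] c by blast
      show "openin (space_top X) E" using stable_open_E by (simp add: stable_open_def)
      show "E \<inter> W \<noteq> {}" using W W_E by (auto simp: irreducible_in_def)
      show "\<forall>x\<in>E \<inter> W. (pull g c - c) x = 0" using g(2) by (simp add: pull_def tact_def)
    qed
    moreover have "\<sigma> \<in> \<Gamma>" using g(1,3) by (simp add: \<Gamma>_def)
    ultimately show "\<sigma> \<in> alg.inertia n" unfolding g(3) by (simp add: alg.inertia_def)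
  qed
  show "alg.inertia n \<subseteq> pull ` inertia_group G act W"
  proof
    fix \<sigma> assume \<sigma>: "\<sigma> \<in> alg.inertia n"
    then have "\<sigma> \<in> \<Gamma>" by (simp add: alg.inertia_def)
    then obtain g where g: "g \<in> carrier G" "\<sigma> = pull g" unfolding \<Gamma>_def by blast
    have "act g x = x" if "x \<in> W" for x
      using ex_moved[OF W subset_refl g(1) that] \<sigma> unfolding g(2) n_def alg.inertia_def by blast
    then show "\<sigma> \<in> pull ` inertia_group G act W" using g by (simp add: inertia_group_def)
  qed
qed

lemma card_inertia: "card (alg.inertia n) = card (inertia_group G act W)"
  unfolding inertia_eq by (rule card_image) (auto simp: inj_on_def inertia_group_def intro: pull_inj)

end

section \<open>The local ring along \<open>W\<close> as a localisation of \<open>C\<close>\<close>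

context projective_quotient begin

lemma near_X: "f \<in> near W \<longleftrightarrow>
    (\<exists>U. openin (space_top X) U \<and> U \<inter> W \<noteq> {} \<and> (\<forall>x\<in>U. regular_at E f x))"
  unfolding near_def using sections_X by auto

lemma C_near: "f \<in> C \<Longrightarrow> f \<in> near W"
  unfolding near_X C_def stable_open_def by blast

text \<open>\<open>Z\<close> is the kernel of the passage from \<open>C\<close> to germs along
  \<open>W\<close>: a function of \<open>C\<close> that vanishes on some nonempty open set vanishes
  on a stable one meeting \<open>W\<close>.\<close>

lemma agree_iff_Z:
  assumes "f \<in> C" "g \<in> C" shows "agree W f g \<longleftrightarrow> f - g \<in> Z"
proof
  assume "agree W f g"
  then obtain U where U: "openin (space_top X) U" "U \<inter> W \<noteq> {}" "\<forall>x\<in>U. f x = g x"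
    unfolding agree_def by blast
  then show "f - g \<in> Z"
    unfolding Z_def vanishing_def using C.diff_C[OF assms] W_E
    by (intro CollectI conjI exI[of _ U]) auto
next
  assume "f - g \<in> Z"
  then obtain U where "stable_open U" "U \<inter> W \<noteq> {}" "\<forall>x\<in>U. (f - g) x = 0" using Z_vanish by blast
  then show "agree W f g" unfolding agree_def stable_open_def by (intro exI[of _ U]) auto
qed

lemma ex_linear_form_orbit:
  assumes "w \<in> E"
  obtains H :: "complex^'n \<Rightarrow> complex"
  where "form 1 H" "\<And>g. g \<in> carrier G \<Longrightarrow> form_at H (act g w) \<noteq> 0" "form_at H w \<noteq> 0"
proof -
  have "finite (\<pi> w)" "\<pi> w \<subseteq> proj_points"
    using finite_orbit[of w] orbit_subset[OF assms] E_proj assms by (auto simp: points_X)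
  then obtain H :: "complex^'n \<Rightarrow> complex" where H: "form 1 H" "\<forall>L\<in>\<pi> w. form_at H L \<noteq> 0"
    using ex_linear_form_nonvanishing by blast
  then show ?thesis
    using that[OF H(1)] action.orbit_refl[of w] assms by (auto simp: orbit_def points_X)
qed

lemma form_at_power: "form_at (\<lambda>v. H v ^ k) L = form_at H L ^ k"
  by (simp add: form_at_def)

text \<open>Near a point \<open>w\<close> of \<open>W\<close> the function is a quotient of
  \<open>F\<close> by \<open>H\<close>. Dividing both by the power of the same degree of a linear
  form that is nonzero on the orbit of \<open>w\<close> makes them elements of
  \<open>C\<close>.\<close>

lemma localize:
  assumes f: "f \<in> near W"
  shows "\<exists>s\<in>C. s \<notin> n \<and> (\<exists>c\<in>C. agree W (s * f) c)"
proof -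
  obtain U w where U: "openin (space_top X) U" "w \<in> U" "w \<in> W" "regular_at E f w"
    using f unfolding near_X by blast
  have w: "w \<in> E" using U(3) W_E by blast
  obtain d F H V where *: "form d F" "form d H" "openin zariski V" "w \<in> V"
      "\<forall>L\<in>V \<inter> E. form_at H L \<noteq> 0 \<and> f L = form_at F L / form_at H L"
    using U(4) unfolding regular_at_def by blast
  obtain H0 :: "complex^'n \<Rightarrow> complex" where H0: "form 1 H0"
      "\<And>g. g \<in> carrier G \<Longrightarrow> form_at H0 (act g w) \<noteq> 0" "form_at H0 w \<noteq> 0"
    using ex_linear_form_orbit[OF w] by blast
  have H0d: "form d (\<lambda>v. H0 v ^ d)" using form_power[OF H0(1), of d] by simp
  let ?s = "\<lambda>L. form_at H L / form_at (\<lambda>v. H0 v ^ d) L"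
  let ?c = "\<lambda>L. form_at F L / form_at (\<lambda>v. H0 v ^ d) L"
  have nz: "form_at (\<lambda>v. H0 v ^ d) (act g w) \<noteq> 0" if "g \<in> carrier G" for g
    using H0(2)[OF that] by (simp add: form_at_power)
  have s: "?s \<in> C" by (rule quotient_C[OF *(2) H0d U(3) nz])
  have c: "?c \<in> C" by (rule quotient_C[OF *(1) H0d U(3) nz])
  have "?s w \<noteq> 0" using *(4,5) w H0(3) by (simp add: form_at_power)
  moreover have "regular_at E ?s w"
    using w E_proj H0(3) by (intro regular_at_quotient[OF *(2) H0d]) (auto simp: form_at_power)
  ultimately have "?s \<notin> n" unfolding n_def using not_vanishing[OF W subset_refl U(3)] by blast
  moreover have "agree W (?s * f) ?c"
    unfolding agree_def
  proof (intro exI[of _ "V \<inter> E"] conjI)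
    show "openin (space_top X) (V \<inter> E)" using openin_X *(3) by blast
    show "V \<inter> E \<inter> W \<noteq> {}" using *(4) w U(3) by blast
    show "\<forall>x\<in>V \<inter> E. (?s * f) x = ?c x" using *(5) by (auto simp: field_simps)
  qed
  ultimately show ?thesis using s c by (intro bexI[of _ ?s] conjI bexI[of _ ?c])
qed

lemma ex_inverse_near:
  assumes s: "s \<in> C" "s \<notin> n"
  shows "\<exists>t\<in>near W. agree W (s * t) 1"
proof -
  obtain U where U: "stable_open U" "U \<inter> W \<noteq> {}" "\<forall>x\<in>U. regular_at E s x"
    using s(1) unfolding C_def by blast
  have o: "openin (space_top X) U" using U(1) by (simp add: stable_open_def)
  obtain x where x: "x \<in> U" "x \<in> W" "s x \<noteq> 0" 
  proof -
    have "\<not> (\<forall>x\<in>U \<inter> W. s x = 0)" using s o U(2) by (auto simp: n_def vanishing_def)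
    then show ?thesis using that by blast
  qed
  obtain N where N: "openin (space_top X) N" "x \<in> N" "N \<subseteq> U" "\<forall>y\<in>N. s y \<noteq> 0"
    using open_regular_nonzero[OF o x(1) bspec[OF U(3) x(1)] x(3)] by blast
  let ?t = "\<lambda>L. inverse (s L)"
  have "regular_at E ?t y" if "y \<in> N" for y
  proof -
    have "regular_at E s y" "y \<in> E" "s y \<noteq> 0" using that N(3,4) U(3) openin_X_subset[OF o] by auto
    then show ?thesis by (rule regular_at_nonzero)
  qed
  then have "?t \<in> near W" unfolding near_X using N(1,2) x(2) by blast
  moreover have "agree W (s * ?t) 1"
    unfolding agree_def using N x(2) by (intro exI[of _ N]) auto
  ultimately show ?thesis by blast
qed

lemma const_A: "(\<lambda>_. c) \<in> alg.A"
  by (rule alg.A_I) (auto simp: C_const \<Gamma>_def pull_def fun_eq_iff)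

text \<open>Near each point a function is a quotient of two forms, and forms divided by powers of
  \<open>H0\<close> are polynomials in the generators. The local denominators are combined into one
  that is nonzero on an entire orbit, so that none of its conjugates lies in
  \<open>n\<close>.\<close>

lemma finitely_generated: "\<exists>B. finite B \<and> B \<subseteq> C \<and>
  (\<forall>c\<in>C. \<exists>s\<in>alg.adjoin B. \<exists>r\<in>alg.adjoin B. (\<forall>\<sigma>\<in>\<Gamma>. \<sigma> s \<notin> n) \<and> s * c - r \<in> Z)"
proof -
  obtain w where w: "w \<in> W" using W by (auto simp: irreducible_in_def)
  have wE: "w \<in> E" using w W_E by blast
  obtain H0 :: "complex^'n \<Rightarrow> complex" where H0: "form 1 H0"
      "\<And>g. g \<in> carrier G \<Longrightarrow> form_at H0 (act g w) \<noteq> 0"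
    using ex_linear_form_orbit[OF wE] by blast
  \<comment> \<open>The affine coordinates on the chart where \<open>H0\<close> is nonzero, which
    contains the orbit of \<open>w\<close>.\<close>
  define B where "B = range (\<lambda>i L. form_at (\<lambda>v. v $ i) L / form_at H0 L)"
  have BC: "B \<subseteq> C" unfolding B_def using quotient_C[OF form_coord H0(1) w H0(2)] by blast
  have form_adjoin: "(\<lambda>L. form_at F L / form_at H0 L ^ d) \<in> alg.adjoin B" if "form d F" for d F
    using that
  proof induction
    case (form_const c)
    then show ?case using const_A[of c] by (auto simp: form_at_def intro: alg.adjoin_A)
  next
    case (form_coord i)
    then show ?case by (intro alg.adjoin_gen) (auto simp: B_def)
  next
    case (form_add d F F')
    have "(\<lambda>L. form_at F L / form_at H0 L ^ d) + (\<lambda>L. form_at F' L / form_at H0 L ^ d) \<in> alg.adjoin B"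
      using form_add.IH by (rule alg.adjoin_add)
    then show ?case by (simp add: plus_fun_def form_at_def add_divide_distrib)
  next
    case (form_mult d F e F')
    have "(\<lambda>L. form_at F L / form_at H0 L ^ d) * (\<lambda>L. form_at F' L / form_at H0 L ^ e) \<in> alg.adjoin B"
      using form_mult.IH by (rule alg.adjoin_mult)
    then show ?case by (simp add: times_fun_def form_at_def power_add)
  qed
  have "\<exists>s\<in>alg.adjoin B. \<exists>r\<in>alg.adjoin B. (\<forall>\<sigma>\<in>\<Gamma>. \<sigma> s \<notin> n) \<and> s * c - r \<in> Z" if c: "c \<in> C" for c
  proof -
    obtain U where U: "stable_open U" "U \<inter> W \<noteq> {}" "\<forall>x\<in>U. regular_at E c x"
      using c unfolding C_def by blast
    let ?D = "{L \<in> proj_points. form_at H0 L \<noteq> 0} \<inter> E"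
    have oD: "openin (space_top X) ?D" using openin_X openin_nonzero[OF H0(1)] by blast
    have "w \<in> core ?D"
      using wE H0(2) act_closed[unfolded points_X] subsetD[OF E_proj] by (auto simp: core_def)
    then have "core ?D \<inter> W \<noteq> {}" using w by blast
    \<comment> \<open>\<open>H0\<close> is adapted to the orbit of \<open>w\<close>, where
      \<open>c\<close> need not be regular; irreducibility of \<open>W\<close> gives a point that is
      good for both.\<close>
    then have "U \<inter> core ?D \<inter> W \<noteq> {}"
      using U(1) stable_open_core(1)[OF oD] U(2)
      by (intro irreducible_open_Int[OF W]) (simp_all add: stable_open_def)
    then obtain x where x: "x \<in> U" "x \<in> core ?D" "x \<in> W" by blast
    have xE: "x \<in> E" using x(3) W_E by blast
    have orb: "y \<in> U" "y \<in> ?D" if "y \<in> \<pi> x" for y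
      using that x U(1) by (auto simp: orbit_def stable_open_def core_def)
    \<comment> \<open>The denominators of \<open>c\<close> in the algebra, closed under combinations
      with constants. Each point of the orbit of \<open>x\<close> has one that is nonzero there, so
      one of them is nonzero on the whole orbit.\<close>
    define \<F> where "\<F> = {s \<in> alg.adjoin B. (\<forall>y\<in>\<pi> x. regular_at E s y) \<and> (\<exists>r\<in>alg.adjoin B. s * c - r \<in> Z)}"
    have comb: "(\<lambda>L. s L + t * s' L) \<in> \<F>" if s: "s \<in> \<F>" "s' \<in> \<F>" for s s' t
    proof -
      obtain r r' where r: "r \<in> alg.adjoin B" "s * c - r \<in> Z" "r' \<in> alg.adjoin B" "s' * c - r' \<in> Z"
        using s unfolding \<F>_def by blast
      have t: "(\<lambda>_. t) \<in> alg.adjoin B" using const_A by (rule alg.adjoin_A)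
      have eq: "(\<lambda>L. s L + t * s' L) = s + (\<lambda>_. t) * s'" by (auto simp: fun_eq_iff)
      have "s + (\<lambda>_. t) * s' \<in> alg.adjoin B"
        using s t unfolding \<F>_def by (intro alg.adjoin_add alg.adjoin_mult) auto
      moreover have "regular_at E (s + (\<lambda>_. t) * s') y" if "y \<in> \<pi> x" for y
        using s that orb(2)[OF that] regular_at_const[of y E t] unfolding \<F>_def
        by (intro regular_at_add_mult) auto
      moreover have "(s + (\<lambda>_. t) * s') * c - (r + (\<lambda>_. t) * r') \<in> Z"
      proof -
        have "(s + (\<lambda>_. t) * s') * c - (r + (\<lambda>_. t) * r') = (s * c - r) + (\<lambda>_. t) * (s' * c - r')"
          by (simp add: algebra_simps)
        also have "\<dots> \<in> Z"
          using C.ideal_inD(3)[OF alg.ideal_Z r(2) C.ideal_inD(4)[OF alg.ideal_Z C_const r(4)]] .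
        finally show ?thesis .
      qed
      moreover have "r + (\<lambda>_. t) * r' \<in> alg.adjoin B"
        using r t by (intro alg.adjoin_add alg.adjoin_mult)
      ultimately show ?thesis unfolding \<F>_def eq by blast
    qed
    have loc: "\<exists>s\<in>\<F>. s y \<noteq> 0" if y: "y \<in> \<pi> x" for y
    proof -
      have yE: "y \<in> E" "form_at H0 y \<noteq> 0" using orb(2)[OF y] by auto
      obtain d F H V where *: "form d F" "form d H" "openin zariski V" "y \<in> V"
          "\<forall>L\<in>V \<inter> E. form_at H L \<noteq> 0 \<and> c L = form_at F L / form_at H L"
        using U(3) orb(1)[OF y] unfolding regular_at_def by blast
      let ?s = "\<lambda>L. form_at H L / form_at H0 L ^ d" and ?r = "\<lambda>L. form_at F L / form_at H0 L ^ d"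
      have H0d: "form d (\<lambda>v. H0 v ^ d)" using form_power[OF H0(1), of d] by simp
      have s: "?s \<in> alg.adjoin B" and r: "?r \<in> alg.adjoin B" using form_adjoin *(1,2) by blast+
      have reg: "regular_at E ?s z" if "z \<in> \<pi> x" for z
        using orb(2)[OF that] regular_at_quotient[OF *(2) H0d, of z E] by (auto simp: form_at_power)
      have "?s * c - ?r \<in> Z"
        unfolding Z_def vanishing_def
      proof (intro CollectI conjI exI[of _ "V \<inter> E"])
        show "?s * c - ?r \<in> C"
          using alg.adjoin_C[OF s BC] alg.adjoin_C[OF r BC] c by (intro C.diff_C C.mult_C)
        show "openin (space_top X) (V \<inter> E)" using openin_X *(3) by blast
        show "V \<inter> E \<inter> E \<noteq> {}" using *(4) yE(1) by blast
        show "\<forall>x\<in>V \<inter> E \<inter> E. (?s * c - ?r) x = 0" using *(5) by (auto simp: field_simps)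
      qed
      then have "?s \<in> \<F>" unfolding \<F>_def using s r reg by blast
      moreover have "?s y \<noteq> 0" using *(4,5) yE by auto
      ultimately show ?thesis by (intro bexI[of _ ?s])
    qed
    have ne: "\<F> \<noteq> {}" using loc action.orbit_refl[of x] xE by (auto simp: points_X)
    have fin: "finite (\<pi> x)" using finite_orbit xE by (simp add: points_X)
    have "\<exists>s\<in>\<F>. \<forall>y\<in>\<pi> x. s y \<noteq> 0"
      by (rule ex_nonvanishing_combination[OF fin ne]) (fact comb, fact loc)
    then obtain s where s: "s \<in> \<F>" "\<forall>y\<in>\<pi> x. s y \<noteq> 0" ..
    have "\<sigma> s \<notin> n" if "\<sigma> \<in> \<Gamma>" for \<sigma>
    proof -
      obtain g where g: "g \<in> carrier G" "\<sigma> = pull g" using \<open>\<sigma> \<in> \<Gamma>\<close> unfolding \<Gamma>_def by blast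
      have gx: "act g x \<in> \<pi> x" using g(1) by (auto simp: orbit_def)
      have "regular_at E s (act g x)" "act g x \<in> E" "s (act g x) \<noteq> 0"
        using s gx orb(2)[OF gx] unfolding \<F>_def by auto
      then obtain N where N: "openin zariski N" "act g x \<in> N" "\<forall>L\<in>N \<inter> E. s L \<noteq> 0"
        by (rule regular_at_nonzero) (rule that, assumption+)
      show ?thesis
        unfolding g(2) n_def
      proof
        assume v: "pull g s \<in> vanishing W"
        have sC: "s \<in> C" using s(1) alg.adjoin_C[OF _ BC] by (auto simp: \<F>_def)
        let ?N = "{x \<in> points X. act g x \<in> N \<inter> E}"
        have "openin (space_top X) (N \<inter> E)" using N(1) openin_X by blast
        then have "openin (space_top X) ?N"
          by (rule openin_continuous_map_preimage[OF act_continuous[OF g(1)]])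
        moreover have "?N \<inter> W \<noteq> {}"
          using x(3) xE N(2) act_closed[OF g(1), of x] by (auto simp: points_X)
        moreover obtain M where M: "openin (space_top X) M" "M \<inter> W \<noteq> {}" "\<forall>x\<in>M \<inter> W. pull g s x = 0"
          using v unfolding vanishing_def by blast
        ultimately have "?N \<inter> M \<inter> W \<noteq> {}" using irreducible_open_Int[OF W] by blast
        then obtain z where "z \<in> ?N" "z \<in> M" "z \<in> W" by blast
        then show False using M(3) N(3) by (auto simp: pull_def tact_def points_X)
      qed
    qed
    then show ?thesis using s(1) unfolding \<F>_def by blast
  qed
  then show ?thesis using BC by (intro exI[of _ B]) (auto simp: B_def)
qed

text \<open>The ideal generated by \<open>J\<close> in the stalk, as the set of fractions with
  numerator in \<open>J\<close> and denominator outside \<open>n\<close>.\<close>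

definition extended :: "((complex^'n) set \<Rightarrow> complex) set \<Rightarrow> ((complex^'n) set set \<times> ((complex^'n) set \<Rightarrow> complex)) set set" where
  "extended J = germ_of W ` {f \<in> near W. \<exists>s\<in>C. s \<notin> n \<and> (\<exists>c\<in>J. agree W (s * f) c)}"

definition contracted :: "((complex^'n) set set \<times> ((complex^'n) set \<Rightarrow> complex)) set set \<Rightarrow> ((complex^'n) set \<Rightarrow> complex) set" where
  "contracted I = {c \<in> C. germ_of W c \<in> I}"

abbreviation B :: "((complex^'n) set set \<times> ((complex^'n) set \<Rightarrow> complex)) set ring" where
  "B \<equiv> stalk X W"

sublocale B: cring B
  by (rule cring_stalk[OF W])

lemma near_ring: "subring_of (near W)"
  by (rule near_subring[OF W])

lemma ideal_extended:
  assumes J: "alg.saturated J" shows "ideal (extended J) B"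
proof -
  interpret N: subring_of "near W" by (rule near_ring)
  note JI = alg.saturatedD(1)[OF J]
  have "extended J \<subseteq> carrier B" unfolding extended_def using germ_of_closed[OF W] by blast
  have add: "germ_of W (f + g) \<in> extended J" if fg: "f \<in> near W" "g \<in> near W"
      "s \<in> C" "s \<notin> n" "c \<in> J" "agree W (s * f) c" "t \<in> C" "t \<notin> n" "d \<in> J" "agree W (t * g) d" for f g s t c d
  proof -
    have "agree W (t * (s * f) + s * (t * g)) (t * c + s * d)"
      using fg agree_refl[OF W] by (intro agree_add[OF W] agree_mult[OF W])
    moreover have "t * (s * f) + s * (t * g) = s * t * (f + g)" by (simp add: algebra_simps)
    ultimately have "agree W (s * t * (f + g)) (t * c + s * d)" by simp
    moreover have "t * c + s * d \<in> J"
      using fg C.ideal_inD(3)[OF JI C.ideal_inD(4)[OF JI] C.ideal_inD(4)[OF JI]] by blast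
    moreover have "s * t \<in> C" "s * t \<notin> n" using fg C.mult_C C.prime_inD(3)[OF alg.prime_n] by blast+
    ultimately show ?thesis unfolding extended_def using N.add_C[OF fg(1,2)] by blast
  qed
  have mult: "germ_of W (g * f) \<in> extended J" if fg: "f \<in> near W" "g \<in> near W"
      "s \<in> C" "s \<notin> n" "c \<in> J" "agree W (s * f) c" for f g s c
  proof -
    obtain t d where t: "t \<in> C" "t \<notin> n" "d \<in> C" "agree W (t * g) d" using localize[OF fg(2)] by blast
    have "agree W ((t * g) * (s * f)) (d * c)" using agree_mult[OF W t(4) fg(6)] .
    moreover have "(t * g) * (s * f) = s * t * (g * f)" by (simp add: algebra_simps)
    ultimately have "agree W (s * t * (g * f)) (d * c)" by simp
    moreover have "d * c \<in> J" using C.ideal_inD(4)[OF JI t(3) fg(5)] .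
    moreover have "s * t \<in> C" "s * t \<notin> n" using fg t C.mult_C C.prime_inD(3)[OF alg.prime_n] by blast+
    ultimately show ?thesis unfolding extended_def using N.mult_C[OF fg(2,1)] by blast
  qed
  have zero: "\<zero>\<^bsub>B\<^esub> \<in> extended J"
  proof -
    have "agree W (1 * 0) 0" using agree_refl[OF W] by simp
    then show ?thesis
      unfolding extended_def germ_of_zero[OF W]
      using N.zero_C C.one_C C.prime_inD(2)[OF alg.prime_n] C.ideal_inD(2)[OF JI] by blast
  qed
  have cl: "x \<oplus>\<^bsub>B\<^esub> y \<in> extended J" if xy: "x \<in> extended J" "y \<in> extended J" for x y
  proof -
    obtain f s c where f: "x = germ_of W f" "f \<in> near W" "s \<in> C" "s \<notin> n" "c \<in> J" "agree W (s * f) c"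
      using xy(1) unfolding extended_def by blast
    obtain g t d where g: "y = germ_of W g" "g \<in> near W" "t \<in> C" "t \<notin> n" "d \<in> J" "agree W (t * g) d"
      using xy(2) unfolding extended_def by blast
    show ?thesis unfolding f(1) g(1) germ_of_add[OF W f(2) g(2)] using f g by (intro add)
  qed
  have mu: "y \<otimes>\<^bsub>B\<^esub> x \<in> extended J" if xy: "x \<in> extended J" "y \<in> carrier B" for x y
  proof -
    obtain f s c where f: "x = germ_of W f" "f \<in> near W" "s \<in> C" "s \<notin> n" "c \<in> J" "agree W (s * f) c"
      using xy(1) unfolding extended_def by blast
    obtain g where g: "y = germ_of W g" "g \<in> near W" using xy(2) unfolding carrier_stalk[OF W] by blast
    show ?thesis unfolding f(1) g(1) germ_of_mult[OF W g(2) f(2)] using f g by (intro mult)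
  qed
  have car: "x \<in> carrier B" if "x \<in> extended J" for x using that \<open>extended J \<subseteq> carrier B\<close> by blast
  show ?thesis
  proof (rule idealI[OF B.ring_axioms])
    show "subgroup (extended J) (add_monoid B)"
    proof (rule B.add.subgroupI)
      show "extended J \<subseteq> carrier B" by fact
      show "extended J \<noteq> {}" using zero by blast
      show "\<ominus>\<^bsub>B\<^esub> x \<in> extended J" if x: "x \<in> extended J" for x
        using mu[OF x, of "\<ominus>\<^bsub>B\<^esub> \<one>\<^bsub>B\<^esub>"] car[OF x] by (simp add: B.l_minus)
      show "x \<oplus>\<^bsub>B\<^esub> y \<in> extended J" if "x \<in> extended J" "y \<in> extended J" for x y
        using that by (rule cl)
    qed
    show "y \<otimes>\<^bsub>B\<^esub> x \<in> extended J" if "x \<in> extended J" "y \<in> carrier B" for x y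
      using that by (rule mu)
    show "x \<otimes>\<^bsub>B\<^esub> y \<in> extended J" if "x \<in> extended J" "y \<in> carrier B" for x y
      using mu[OF that] car[OF that(1)] that(2) by (simp add: B.m_comm)
  qed
qed

text \<open>Contraction undoes extension for a saturated ideal: the denominator can be cancelled,
  and agreement of germs is congruence modulo \<open>Z\<close>, which every saturated ideal
  contains.\<close>

lemma extended_iff:
  assumes J: "alg.saturated J" and c: "c \<in> C"
  shows "germ_of W c \<in> extended J \<longleftrightarrow> c \<in> J"
proof
  note JI = alg.saturatedD(1)[OF J]
  assume "germ_of W c \<in> extended J"
  then obtain f s d where f: "germ_of W c = germ_of W f" "f \<in> near W" "s \<in> C" "s \<notin> n" "d \<in> J" "agree W (s * f) d"
    unfolding extended_def by blast
  have "agree W c f" using germ_of_eq[OF W C_near[OF c]] f(1) by blast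
  then have "agree W (s * c) (s * f)" using agree_mult[OF W agree_refl[OF W]] by blast
  then have "agree W (s * c) d" using agree_trans[OF W _ f(6)] by blast
  then have "s * c - d \<in> Z"
    using agree_iff_Z[OF C.mult_C[OF f(3) c] C.ideal_inD(1)[OF JI f(5)]] by blast
  then have "s * c - d \<in> J" using alg.saturatedD(2)[OF J] alg.mC_Z by blast
  then have "s * c - d + d \<in> J" using f(5) by (rule C.ideal_inD(3)[OF JI])
  then have "s * c \<in> J" by simp
  then show "c \<in> J" using alg.saturatedD(3)[OF J f(3) c f(4)] by blast
next
  assume "c \<in> J"
  moreover have "agree W (1 * c) c" using agree_refl[OF W] by simp
  ultimately show "germ_of W c \<in> extended J"
    unfolding extended_def using C_near[OF c] C.one_C C.prime_inD(2)[OF alg.prime_n] by blast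
qed

text \<open>A germ in \<open>I'\<close> outside \<open>I\<close> is brought into \<open>C\<close> by
  some \<open>s\<close> outside \<open>n\<close>. As \<open>s\<close> is a unit of the stalk, the
  product still avoids \<open>I\<close>.\<close>

lemma contracted_psubset:
  assumes I: "ideal I B" "ideal I' B" "I \<subset> I'" shows "contracted I \<subset> contracted I'"
proof -
  interpret I: ideal I B by (rule I(1))
  interpret I': ideal I' B by (rule I(2))
  obtain x where x: "x \<in> I'" "x \<notin> I" using I(3) by blast
  obtain f where f: "f \<in> near W" "x = germ_of W f"
    using I'.Icarr[OF x(1)] unfolding carrier_stalk[OF W] by blast
  obtain s c where s: "s \<in> C" "s \<notin> n" "c \<in> C" "agree W (s * f) c" using localize[OF f(1)] by blast
  obtain t where t: "t \<in> near W" "agree W (s * t) 1" using ex_inverse_near[OF s(1,2)] by blast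
  interpret N: subring_of "near W" by (rule near_ring)
  have sN: "s \<in> near W" "c \<in> near W" using s C_near by blast+
  have gc: "germ_of W c = germ_of W s \<otimes>\<^bsub>B\<^esub> germ_of W f"
    unfolding germ_of_mult[OF W sN(1) f(1)]
    using germ_of_eq[OF W N.mult_C[OF sN(1) f(1)]] s(4) by blast
  then have "c \<in> contracted I'"
    unfolding contracted_def using s(3) I'.I_l_closed[OF x(1) germ_of_closed[OF W sN(1)]] f(2) by simp
  moreover have "c \<notin> contracted I"
  proof
    assume "c \<in> contracted I"
    then have "germ_of W t \<otimes>\<^bsub>B\<^esub> germ_of W c \<in> I"
      unfolding contracted_def using I.I_l_closed germ_of_closed[OF W t(1)] by blast
    moreover have "germ_of W t \<otimes>\<^bsub>B\<^esub> germ_of W c = x"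
    proof -
      have "agree W (t * c) (t * (s * f))"
        using agree_mult[OF W agree_refl[OF W] agree_sym[OF W s(4)]] .
      moreover have "agree W ((s * t) * f) (1 * f)" using agree_mult[OF W t(2) agree_refl[OF W]] .
      moreover have "t * (s * f) = (s * t) * f" by (simp add: algebra_simps)
      ultimately have "agree W (t * c) f" using agree_trans[OF W] by (metis mult_1)
      then show ?thesis
        unfolding germ_of_mult[OF W t(1) sN(2)] f(2)
        using germ_of_eq[OF W N.mult_C[OF t(1) sN(2)]] by blast
    qed
    ultimately show False using x(2) by simp
  qed
  moreover have "contracted I \<subseteq> contracted I'" using I(3) by (auto simp: contracted_def)
  ultimately show ?thesis by blast
qed

lemma saturated_contracted:
  assumes I: "ideal I B" and sub: "\<And>c. c \<in> alg.mC \<Longrightarrow> germ_of W c \<in> I"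
  shows "alg.saturated (contracted I)"
proof -
  interpret I: ideal I B by (rule I)
  interpret N: subring_of "near W" by (rule near_ring)
  have "C.ideal_in (contracted I)"
    unfolding C.ideal_in_def
  proof (intro conjI ballI)
    show "contracted I \<subseteq> C" by (auto simp: contracted_def)
    show "0 \<in> contracted I"
      using C.zero_C I.zero_closed germ_of_zero[OF W] by (simp add: contracted_def)
    show "f + g \<in> contracted I" if "f \<in> contracted I" "g \<in> contracted I" for f g
      using that C.add_C I.a_closed[of "germ_of W f" "germ_of W g"] germ_of_add[OF W] C_near
      by (simp add: contracted_def)
    show "c * f \<in> contracted I" if "c \<in> C" "f \<in> contracted I" for c f
      using that C.mult_C I.I_l_closed[of "germ_of W f" "germ_of W c"] germ_of_mult[OF W] C_near
        germ_of_closed[OF W] by (simp add: contracted_def)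
  qed
  moreover have "alg.mC \<subseteq> contracted I"
    using sub C.ideal_inD(1)[OF alg.ideal_mC] by (auto simp: contracted_def)
  moreover have "c \<in> contracted I" if s: "s \<in> C" "c \<in> C" "s \<notin> n" "s * c \<in> contracted I" for s c
  proof -
    obtain t where t: "t \<in> near W" "agree W (s * t) 1" using ex_inverse_near[OF s(1,3)] by blast
    have cN: "c \<in> near W" "s * c \<in> near W" using s C_near C.mult_C by blast+
    have "germ_of W t \<otimes>\<^bsub>B\<^esub> germ_of W (s * c) \<in> I"
      using s(4) I.I_l_closed germ_of_closed[OF W t(1)] by (simp add: contracted_def)
    moreover have "agree W ((s * t) * c) (1 * c)" using agree_mult[OF W t(2) agree_refl[OF W]] .
    then have "agree W (t * (s * c)) c" by (simp add: algebra_simps)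
    then have "germ_of W t \<otimes>\<^bsub>B\<^esub> germ_of W (s * c) = germ_of W c"
      unfolding germ_of_mult[OF W t(1) cN(2)] using germ_of_eq[OF W N.mult_C[OF t(1) cN(2)]] by blast
    ultimately show ?thesis using s(2) by (simp add: contracted_def)
  qed
  ultimately show ?thesis unfolding alg.saturated_def by blast
qed

end

section \<open>The local ring of the fibre\<close>

lemma (in ring) quotient_ideal_obtain:
  assumes "ideal I R" "ideal K (R Quot I)"
  obtains J where "ideal J R" "I \<subseteq> J" "K = (+>) I ` J"
  using quot_ideal_correspondence[OF assms(1)] assms(2) unfolding bij_betw_def by blast

text \<open>An ideal containing \<open>I\<close> is the union of its cosets and so is recovered from
  its image.\<close>

lemma (in ring) quotient_ideal_psubset_iff:
  assumes I: "ideal I R" and J: "ideal J R" "I \<subseteq> J" and K: "ideal K R" "I \<subseteq> K"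
  shows "(+>) I ` J \<subset> (+>) I ` K \<longleftrightarrow> J \<subset> K"
proof -
  have un: "L = (\<Union>x\<in>L. I +> x)" if "ideal L R" "I \<subseteq> L" for L
    using ideal_incl_iff[OF I that(1)] that(2) by blast
  have "J \<subseteq> K \<longleftrightarrow> (+>) I ` J \<subseteq> (+>) I ` K"
  proof
    assume "(+>) I ` J \<subseteq> (+>) I ` K"
    then have "\<Union>((+>) I ` J) \<subseteq> \<Union>((+>) I ` K)" by (rule Union_mono)
    then show "J \<subseteq> K" using un[OF J] un[OF K] by simp
  qed (rule image_mono)
  moreover have "K \<subseteq> J \<longleftrightarrow> (+>) I ` K \<subseteq> (+>) I ` J"
  proof
    assume "(+>) I ` K \<subseteq> (+>) I ` J"
    then have "\<Union>((+>) I ` K) \<subseteq> \<Union>((+>) I ` J)" by (rule Union_mono)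
    then show "K \<subseteq> J" using un[OF J] un[OF K] by simp
  qed (rule image_mono)
  ultimately show ?thesis by blast
qed

locale flat_projective_quotient = projective_quotient X G act E W
  for X :: "(complex^'n) set fspace" and G :: "('g, 'm) monoid_scheme"
    and act :: "'g \<Rightarrow> (complex^'n) set \<Rightarrow> (complex^'n) set" and E W +
  assumes closed_W: "closedin (space_top X) W"
    and flat_stalk: "flat_module (stalk Y (\<pi> ` W)) (restrict_scalars (stalk X W) (germ_pullback X W \<pi>))"
begin

abbreviation V :: "(complex^'n) set set set" where
  "V \<equiv> \<pi> ` W"

sublocale Y: function_space Y
  by (rule function_space_Y)

lemma V: "irreducible_in (space_top Y) V"
  by (rule irreducible_image[OF W])

lemma closure_V: "V = space_top Y closure_of (\<pi> ` W)"
  using closure_of_closedin[OF pi_closed[OF closed_W]] by simp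

sublocale A: cring "stalk Y V"
  by (rule Y.cring_stalk[OF V])

lemma pull_pi: "g \<in> carrier G \<Longrightarrow> pull g (f \<circ> \<pi>) = f \<circ> \<pi>"
  using orbit_act by (auto simp: pull_def tact_def points_X fun_eq_iff)

lemma open_V_preimage:
  assumes U: "openin (space_top Y) U" "U \<inter> V \<noteq> {}"
  shows "stable_open {x \<in> E. \<pi> x \<in> U}" "{x \<in> E. \<pi> x \<in> U} \<inter> W \<noteq> {}"
proof -
  show "stable_open {x \<in> E. \<pi> x \<in> U}"
    using U(1) act_closed orbit_act unfolding stable_open_def openin_Y by (auto simp: points_X)
  show "{x \<in> E. \<pi> x \<in> U} \<inter> W \<noteq> {}" using U(2) W_E by blast
qed

lemma near_V:
  assumes f: "f \<in> Y.near V" shows "f \<circ> \<pi> \<in> alg.A"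
proof (rule alg.A_I)
  obtain U where U: "openin (space_top Y) U" "U \<inter> V \<noteq> {}" "restrict f U \<in> sections Y U"
    using f unfolding Y.near_def by blast
  let ?p = "{x \<in> E. \<pi> x \<in> U}"
  have "restrict (restrict f U \<circ> \<pi>) ?p \<in> sections X ?p" using U(3) by (simp add: sections_Y points_X)
  moreover have "restrict (restrict f U \<circ> \<pi>) ?p = restrict (f \<circ> \<pi>) ?p"
    by (auto simp: restrict_def fun_eq_iff)
  moreover have "openin (space_top X) ?p" using open_V_preimage(1)[OF U(1,2)] by (simp add: stable_open_def)
  ultimately have "\<forall>x\<in>?p. regular_at E (f \<circ> \<pi>) x" using sections_X by simp
  then show "f \<circ> \<pi> \<in> C" unfolding C_def using open_V_preimage[OF U(1,2)] by blast
  show "\<sigma> (f \<circ> \<pi>) = f \<circ> \<pi>" if "\<sigma> \<in> \<Gamma>" for \<sigma> using that pull_pi unfolding \<Gamma>_def by blast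
qed

text \<open>With \<open>near_V\<close> this identifies the exact invariants with functions near
  \<open>V\<close> on the quotient. The value on an orbit is read off at any of its points, and the
  domain descends because a stable open set is the full preimage of its image.\<close>

lemma descend:
  assumes a: "a \<in> alg.A"
  obtains f where "f \<in> Y.near V" "\<And>x. x \<in> E \<Longrightarrow> f (\<pi> x) = a x"
proof -
  have aC: "a \<in> C" using alg.AC[OF a] .
  have inv: "a (act g x) = a x" if "g \<in> carrier G" "x \<in> E" for g x
  proof -
    have "pull g a = a" using alg.A_fixed[OF _ a] that(1) by (simp add: \<Gamma>_def)
    then have "pull g a x = a x" by simp
    then show ?thesis using that(2) by (simp add: pull_def tact_def)
  qed
  define f where "f o' = a (SOME x. x \<in> E \<and> \<pi> x = o')" for o'
  have f: "f (\<pi> x) = a x" if x: "x \<in> E" for x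
  proof -
    define y where "y = (SOME y. y \<in> E \<and> \<pi> y = \<pi> x)"
    have "y \<in> E \<and> \<pi> y = \<pi> x" unfolding y_def by (rule someI[of _ x]) (use x in blast)
    then obtain g where "g \<in> carrier G" "y = act g x" using orbit_eq_iff[of x y] x by (auto simp: points_X)
    then show ?thesis using inv x unfolding f_def y_def[symmetric] by simp
  qed
  obtain U where U: "stable_open U" "U \<inter> W \<noteq> {}" "\<forall>x\<in>U. regular_at E a x"
    using aC unfolding C_def by blast
  have o: "openin (space_top X) U" using U(1) by (simp add: stable_open_def)
  note UE = openin_X_subset[OF o]
  have pre: "{x \<in> points X. \<pi> x \<in> \<pi> ` U} = U"
  proof (intro equalityI subsetI)
    fix x assume "x \<in> {x \<in> points X. \<pi> x \<in> \<pi> ` U}"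
    then obtain u where u: "x \<in> points X" "u \<in> U" "\<pi> u = \<pi> x" by fastforce
    then obtain g where "g \<in> carrier G" "x = act g u" using orbit_eq_iff[of u x] UE points_X by blast
    then show "x \<in> U" using U(1) u(2) by (simp add: stable_open_def)
  qed (use UE points_X in auto)
  have "\<pi> ` U \<subseteq> orbits G (points X) act" unfolding orbits_eq using UE points_X by blast
  then have oY: "openin (space_top Y) (\<pi> ` U)" unfolding openin_Y pre using o by blast
  have "restrict (restrict f (\<pi> ` U) \<circ> \<pi>) U = restrict a U"
    using f UE by (auto simp: restrict_def fun_eq_iff)
  then have "restrict f (\<pi> ` U) \<in> sections Y (\<pi> ` U)"
    unfolding sections_Y pre using sections_X[OF o, of a] U(3) by simp
  moreover have "\<pi> ` U \<inter> V \<noteq> {}" using U(2) by blast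
  ultimately have "f \<in> Y.near V" unfolding Y.near_def using oY by blast
  then show ?thesis using that f by blast
qed

lemma germ_pullback_V:
  assumes "f \<in> Y.near V"
  shows "germ_pullback X W \<pi> (Y.germ_of V f) = germ_of W (f \<circ> \<pi>)"
  by (rule germ_pullback_germ_of(1)[OF function_space_axioms function_space_Y morphism_pi W V closure_V assms])

text \<open>Matches the maximal ideal of the local ring at \<open>V\<close> with the elements of
  \<open>A\<close> in \<open>n\<close>: values on \<open>V\<close> are values on \<open>W\<close>,
  because \<open>V\<close> is its image.\<close>

lemma vanishing_germs_iff:
  assumes f: "f \<in> Y.near V"
  shows "Y.germ_of V f \<in> vanishing_germs Y V V \<longleftrightarrow> f \<circ> \<pi> \<in> n"
proof
  assume "Y.germ_of V f \<in> vanishing_germs Y V V"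
  then obtain U g where g: "(U, g) \<in> Y.germ_of V f" "\<forall>y\<in>U \<inter> V. g y = 0"
    unfolding vanishing_germs_def by blast
  have U: "openin (space_top Y) U" "U \<inter> V \<noteq> {}"
    using g(1) by (auto simp: Y.germ_of_def local_sections_def)
  obtain U' where U': "openin (space_top Y) U'" "U' \<inter> V \<noteq> {}" "\<forall>x\<in>U'. g x = f x"
    using g(1) unfolding Y.germ_of_def Y.agree_def by blast
  have "U \<inter> U' \<inter> V \<noteq> {}" using irreducible_open_Int[OF V U(1) U'(1) U(2) U'(2)] .
  note p = open_V_preimage[OF openin_Int[OF U(1) U'(1)] this]
  show "f \<circ> \<pi> \<in> n"
    unfolding n_def vanishing_def
  proof (intro CollectI conjI exI[of _ "{x \<in> E. \<pi> x \<in> U \<inter> U'}"])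
    show "f \<circ> \<pi> \<in> C" using alg.AC[OF near_V[OF f]] .
    show "openin (space_top X) {x \<in> E. \<pi> x \<in> U \<inter> U'}" using p(1) by (simp add: stable_open_def)
    show "\<forall>x\<in>{x \<in> E. \<pi> x \<in> U \<inter> U'} \<inter> W. (f \<circ> \<pi>) x = 0" using g(2) U'(3) by auto
  qed (rule p(2))
next
  assume n: "f \<circ> \<pi> \<in> n"
  obtain U where U: "openin (space_top Y) U" "U \<inter> V \<noteq> {}" "restrict f U \<in> sections Y U"
    using f unfolding Y.near_def by blast
  let ?p = "{x \<in> E. \<pi> x \<in> U}"
  have o: "openin (space_top X) ?p" using open_V_preimage(1)[OF U(1,2)] by (simp add: stable_open_def)
  have "restrict (restrict f U \<circ> \<pi>) ?p \<in> sections X ?p" using U(3) by (simp add: sections_Y points_X)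
  moreover have "restrict (restrict f U \<circ> \<pi>) ?p = restrict (f \<circ> \<pi>) ?p"
    by (auto simp: restrict_def fun_eq_iff)
  ultimately have reg: "\<forall>x\<in>?p. regular_at E (f \<circ> \<pi>) x" using sections_X[OF o] by simp
  have "restrict f U y = 0" if y: "y \<in> U \<inter> V" for y
  proof -
    obtain x where "y = \<pi> x" "x \<in> W" using y by blast
    then show ?thesis
      using vanishing_iff[OF W subset_refl o _ _ reg n[unfolded n_def], of x] y W_E by auto
  qed
  moreover have "(U, restrict f U) \<in> Y.germ_of V f"
    unfolding Y.germ_of_def local_sections_def using U Y.agree_restrict[OF V U(1,2)] by auto
  ultimately show "Y.germ_of V f \<in> vanishing_germs Y V V"
    unfolding vanishing_germs_def using Y.germ_of_closed[OF V f] by blast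
qed

lemma vanishing_germs_eq:
  "vanishing_germs Y V V = Y.germ_of V ` {f \<in> Y.near V. f \<circ> \<pi> \<in> n}"
proof
  have "vanishing_germs Y V V \<subseteq> carrier (stalk Y V)" by (auto simp: vanishing_germs_def)
  then show "vanishing_germs Y V V \<subseteq> Y.germ_of V ` {f \<in> Y.near V. f \<circ> \<pi> \<in> n}"
    unfolding Y.carrier_stalk[OF V] using vanishing_germs_iff by blast
  show "Y.germ_of V ` {f \<in> Y.near V. f \<circ> \<pi> \<in> n} \<subseteq> vanishing_germs Y V V"
    using vanishing_germs_iff by blast
qed

lemma ideal_vanishing_germs: "ideal (vanishing_germs Y V V) (stalk Y V)"
proof -
  interpret N: subring_of "Y.near V" by (rule Y.near_subring[OF V])
  have car: "vanishing_germs Y V V \<subseteq> carrier (stalk Y V)" by (auto simp: vanishing_germs_def)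
  have comp: "(f + g) \<circ> \<pi> = (f \<circ> \<pi>) + (g \<circ> \<pi>)" "(f * g) \<circ> \<pi> = (f \<circ> \<pi>) * (g \<circ> \<pi>)" "(0 \<circ> \<pi>) = 0"
    for f g :: "(complex^'n) set set \<Rightarrow> complex" by (auto simp: fun_eq_iff)
  have zero: "\<zero>\<^bsub>stalk Y V\<^esub> \<in> vanishing_germs Y V V"
    unfolding Y.germ_of_zero[OF V] vanishing_germs_iff[OF N.zero_C] comp
    by (rule C.ideal_inD(2)[OF alg.ideal_n])
  have add: "x \<oplus>\<^bsub>stalk Y V\<^esub> y \<in> vanishing_germs Y V V"
    if xy: "x \<in> vanishing_germs Y V V" "y \<in> vanishing_germs Y V V" for x y
  proof -
    obtain f where f: "x = Y.germ_of V f" "f \<in> Y.near V" "f \<circ> \<pi> \<in> n" using xy(1) vanishing_germs_eq by auto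
    obtain g where g: "y = Y.germ_of V g" "g \<in> Y.near V" "g \<circ> \<pi> \<in> n" using xy(2) vanishing_germs_eq by auto
    show ?thesis
      unfolding f(1) g(1) Y.germ_of_add[OF V f(2) g(2)] vanishing_germs_iff[OF N.add_C[OF f(2) g(2)]] comp
      using C.ideal_inD(3)[OF alg.ideal_n f(3) g(3)] .
  qed
  have mult: "y \<otimes>\<^bsub>stalk Y V\<^esub> x \<in> vanishing_germs Y V V"
    if xy: "x \<in> vanishing_germs Y V V" "y \<in> carrier (stalk Y V)" for x y
  proof -
    obtain f where f: "x = Y.germ_of V f" "f \<in> Y.near V" "f \<circ> \<pi> \<in> n" using xy(1) vanishing_germs_eq by auto
    obtain g where g: "y = Y.germ_of V g" "g \<in> Y.near V" using xy(2) unfolding Y.carrier_stalk[OF V] by blast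
    show ?thesis
      unfolding f(1) g(1) Y.germ_of_mult[OF V g(2) f(2)] vanishing_germs_iff[OF N.mult_C[OF g(2) f(2)]] comp
      using C.ideal_inD(4)[OF alg.ideal_n alg.AC[OF near_V[OF g(2)]] f(3)] .
  qed
  have c: "x \<in> carrier (stalk Y V)" if "x \<in> vanishing_germs Y V V" for x using that car by blast
  show ?thesis
  proof (rule idealI[OF A.ring_axioms])
    show "subgroup (vanishing_germs Y V V) (add_monoid (stalk Y V))"
    proof (rule A.add.subgroupI)
      show "vanishing_germs Y V V \<noteq> {}" using zero by blast
      show "\<ominus>\<^bsub>stalk Y V\<^esub> x \<in> vanishing_germs Y V V" if x: "x \<in> vanishing_germs Y V V" for x
        using mult[OF x, of "\<ominus>\<^bsub>stalk Y V\<^esub> \<one>\<^bsub>stalk Y V\<^esub>"] c[OF x] by (simp add: A.l_minus)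
    qed (fact car, fact add)
    show "y \<otimes>\<^bsub>stalk Y V\<^esub> x \<in> vanishing_germs Y V V"
      if "x \<in> vanishing_germs Y V V" "y \<in> carrier (stalk Y V)" for x y
      using that by (rule mult)
    show "x \<otimes>\<^bsub>stalk Y V\<^esub> y \<in> vanishing_germs Y V V"
      if "x \<in> vanishing_germs Y V V" "y \<in> carrier (stalk Y V)" for x y
      using mult[OF that] c[OF that(1)] that(2) by (simp add: A.m_comm)
  qed
qed

lemma germ_pullback_hom: "germ_pullback X W \<pi> \<in> ring_hom (stalk Y V) (stalk X W)"
proof -
  interpret N: subring_of "Y.near V" by (rule Y.near_subring[OF V])
  have near: "f \<circ> \<pi> \<in> near W" if "f \<in> Y.near V" for f using C_near[OF alg.AC[OF near_V[OF that]]] .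
  have comp: "(f + g) \<circ> \<pi> = (f \<circ> \<pi>) + (g \<circ> \<pi>)" "(f * g) \<circ> \<pi> = (f \<circ> \<pi>) * (g \<circ> \<pi>)" "(1 \<circ> \<pi>) = 1"
    for f g :: "(complex^'n) set set \<Rightarrow> complex" by (auto simp: fun_eq_iff)
  show ?thesis
    by (rule ring_hom_memI)
      (auto simp: Y.carrier_stalk[OF V] germ_pullback_V Y.germ_of_mult[OF V] Y.germ_of_add[OF V]
        Y.germ_of_one[OF V] N.mult_C N.add_C N.one_C comp germ_of_mult[OF W] germ_of_add[OF W]
        germ_of_one[OF W] near germ_of_closed[OF W])
qed

abbreviation fibre_ideal :: "((complex^'n) set set \<times> ((complex^'n) set \<Rightarrow> complex)) set set" where
  "fibre_ideal \<equiv> Idl\<^bsub>B\<^esub> (germ_pullback X W \<pi> ` vanishing_germs Y V V)"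

lemma germ_pullback_vanishing:
  "germ_pullback X W \<pi> ` vanishing_germs Y V V = germ_of W ` {f \<circ> \<pi> | f. f \<in> Y.near V \<and> f \<circ> \<pi> \<in> n}"
  unfolding vanishing_germs_eq image_image by (force simp: germ_pullback_V image_iff)

lemma generators_carrier: "germ_pullback X W \<pi> ` vanishing_germs Y V V \<subseteq> carrier B"
  unfolding germ_pullback_vanishing using germ_of_closed[OF W C_near[OF alg.AC[OF near_V]]] by blast

lemma ideal_fibre_ideal: "ideal fibre_ideal B"
  by (rule B.genideal_ideal[OF generators_carrier])

text \<open>The generators come from elements of \<open>A\<close> in \<open>n\<close>, which lie in
  \<open>mC\<close>. Together with \<open>mC_fibre_ideal\<close> this encloses the fibre ideal
  tightly enough to translate chains of ideals above it into chains of saturated ideals and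
  back.\<close>

lemma fibre_ideal_extended: "fibre_ideal \<subseteq> extended alg.Q"
proof (rule B.genideal_minimal[OF ideal_extended[OF alg.saturated_Q]])
  show "germ_pullback X W \<pi> ` vanishing_germs Y V V \<subseteq> extended alg.Q"
    unfolding germ_pullback_vanishing
  proof
    fix x assume "x \<in> germ_of W ` {f \<circ> \<pi> | f. f \<in> Y.near V \<and> f \<circ> \<pi> \<in> n}"
    then obtain f where f: "x = germ_of W (f \<circ> \<pi>)" "f \<in> Y.near V" "f \<circ> \<pi> \<in> n" by blast
    have "f \<circ> \<pi> \<in> alg.Q"
      using alg.mC_A[OF near_V[OF f(2)]] f(3) alg.saturatedD(2)[OF alg.saturated_Q] by blast
    then show "x \<in> extended alg.Q"
      unfolding f(1) extended_iff[OF alg.saturated_Q alg.AC[OF near_V[OF f(2)]]] .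
  qed
qed

text \<open>An invariant in \<open>n\<close> descends to a function on the quotient that vanishes on
  \<open>V\<close>, so its germ is among the generators; elements of \<open>Z\<close> have zero
  germ.\<close>

lemma mC_fibre_ideal: "c \<in> alg.mC \<Longrightarrow> germ_of W c \<in> fibre_ideal"
proof (induction rule: alg.mC.induct)
  interpret I: ideal fibre_ideal B by (rule ideal_fibre_ideal)
  case (mC_Z z)
  have zC: "z \<in> C" using alg.ZC[OF mC_Z] .
  have "agree W z 0" using agree_iff_Z[OF zC C.zero_C] mC_Z by simp
  then have "germ_of W z = \<zero>\<^bsub>B\<^esub>" unfolding germ_of_zero[OF W] using germ_of_eq[OF W C_near[OF zC]] by blast
  then show ?case using I.zero_closed by simp
next
  interpret I: ideal fibre_ideal B by (rule ideal_fibre_ideal)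
  interpret N: subring_of "near W" by (rule near_ring)
  case (mC_step a c x)
  obtain f where f: "f \<in> Y.near V" "\<And>x. x \<in> E \<Longrightarrow> f (\<pi> x) = a x" using descend[OF mC_step(1)] by blast
  note fA = near_V[OF f(1)]
  have ag: "agree W a (f \<circ> \<pi>)"
    unfolding agree_def using f(2) stable_open_E W W_E
    by (intro exI[of _ E]) (auto simp: stable_open_def irreducible_in_def)
  have "(f \<circ> \<pi>) - a \<in> Z" using agree_iff_Z[OF alg.AC[OF fA] alg.AC[OF mC_step(1)]] agree_sym[OF W ag] by blast
  then have "f \<circ> \<pi> \<in> n"
    using C.ideal_inD(3)[OF alg.ideal_n subsetD[OF Z_n] mC_step(2), of "(f \<circ> \<pi>) - a"] by simp
  then have "germ_of W (f \<circ> \<pi>) \<in> fibre_ideal"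
    using subsetD[OF B.genideal_self[OF generators_carrier]] f(1) unfolding germ_pullback_vanishing by blast
  moreover have "germ_of W a = germ_of W (f \<circ> \<pi>)"
    using germ_of_eq[OF W C_near[OF alg.AC[OF mC_step(1)]]] ag by blast
  ultimately have a: "germ_of W a \<in> fibre_ideal" by simp
  have near: "a \<in> near W" "c \<in> near W" "x \<in> near W"
    using C_near alg.AC[OF mC_step(1)] mC_step(3) C.ideal_inD(1)[OF alg.ideal_mC mC_step(4)] by blast+
  have "germ_of W (a * c + x) = germ_of W a \<otimes>\<^bsub>B\<^esub> germ_of W c \<oplus>\<^bsub>B\<^esub> germ_of W x"
    using near by (simp add: germ_of_mult[OF W] germ_of_add[OF W] N.mult_C)
  also have "\<dots> \<in> fibre_ideal"
    using I.a_closed[OF I.I_r_closed[OF a germ_of_closed[OF W near(2)]] mC_step.IH] .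
  finally show ?case .
qed

text \<open>The equational criterion for the stalks, rewritten for functions: a relation between
  germs on the quotient holds on an open set meeting \<open>V\<close>, whose preimage turns it into
  a relation modulo \<open>Z\<close>.\<close>

lemma flat_relation_C:
  fixes K :: "nat set"
  assumes K: "finite K" "j \<in> K" and ac: "\<forall>i\<in>K. a i \<in> alg.A \<and> c i \<in> C"
    and sum: "(\<Sum>i\<in>K. a i * c i) \<in> Z"
    and rel: "\<forall>r. (\<forall>i\<in>K. r i \<in> alg.A) \<and> (\<Sum>i\<in>K. r i * a i) \<in> Z \<longrightarrow> r j \<in> n"
  shows "c j \<in> alg.Q"
proof -
  interpret N: subring_of "near W" by (rule near_ring)
  interpret NY: subring_of "Y.near V" by (rule Y.near_subring[OF V])
  have "\<forall>i\<in>K. \<exists>f. f \<in> Y.near V \<and> (\<forall>x\<in>E. f (\<pi> x) = a i x)"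
  proof
    fix i assume "i \<in> K"
    then have ai: "a i \<in> alg.A" using ac by simp
    show "\<exists>f. f \<in> Y.near V \<and> (\<forall>x\<in>E. f (\<pi> x) = a i x)"
    proof (rule descend[OF ai])
      fix f assume "f \<in> Y.near V" "\<And>x. x \<in> E \<Longrightarrow> f (\<pi> x) = a i x"
      then show ?thesis by (intro exI[of _ f]) simp
    qed
  qed
  from bchoice[OF this] obtain f where f: "\<forall>i\<in>K. f i \<in> Y.near V \<and> (\<forall>x\<in>E. f i (\<pi> x) = a i x)" by blast
  have EE: "openin (space_top X) E" "E \<inter> W \<noteq> {}"
    using stable_open_E W W_E by (auto simp: stable_open_def irreducible_in_def)
  have acN: "a i * c i \<in> near W" "a i \<in> near W" "c i \<in> near W" if "i \<in> K" for i
    using ac that C_near alg.AC by (auto intro: N.mult_C)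
  have pull_f: "germ_pullback X W \<pi> (Y.germ_of V (f i)) = germ_of W (a i)" if i: "i \<in> K" for i
  proof -
    have "agree W (a i) (f i \<circ> \<pi>)" unfolding agree_def using f i EE by (intro exI[of _ E]) auto
    then show ?thesis
      using germ_pullback_V[of "f i"] f i germ_of_eq[OF W acN(2)[OF i]] by metis
  qed
  have "germ_of W (c j) \<in> fibre_ideal"
  proof (rule flat_relation[OF flat_stalk B.is_cring germ_pullback_hom ideal_vanishing_germs K(1,2)])
    show "(\<lambda>i. Y.germ_of V (f i)) \<in> K \<rightarrow> carrier (stalk Y V)" using f Y.germ_of_closed[OF V] by blast
    show "(\<lambda>i. germ_of W (c i)) \<in> K \<rightarrow> carrier B" using acN(3) germ_of_closed[OF W] by blast
    have "(\<Oplus>\<^bsub>B\<^esub>i\<in>K. germ_pullback X W \<pi> (Y.germ_of V (f i)) \<otimes>\<^bsub>B\<^esub> germ_of W (c i))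
        = (\<Oplus>\<^bsub>B\<^esub>i\<in>K. germ_of W (a i * c i))"
      using pull_f acN germ_of_closed[OF W] by (intro B.finsum_cong') (auto simp: germ_of_mult[OF W])
    also have "\<dots> = germ_of W (\<Sum>i\<in>K. a i * c i)" using acN(1) by (rule germ_of_sum[OF W K(1)])
    also have "\<dots> = germ_of W 0"
    proof -
      have "agree W (\<Sum>i\<in>K. a i * c i) 0" using agree_iff_Z[OF alg.ZC[OF sum] C.zero_C] sum by simp
      then show ?thesis using germ_of_eq[OF W C_near[OF alg.ZC[OF sum]]] by blast
    qed
    finally show "(\<Oplus>\<^bsub>B\<^esub>i\<in>K. germ_pullback X W \<pi> (Y.germ_of V (f i)) \<otimes>\<^bsub>B\<^esub> germ_of W (c i)) = \<zero>\<^bsub>B\<^esub>"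
      by (simp add: germ_of_zero[OF W])
    fix r assume r: "r \<in> K \<rightarrow> carrier (stalk Y V)"
      and r0: "(\<Oplus>\<^bsub>stalk Y V\<^esub>i\<in>K. r i \<otimes>\<^bsub>stalk Y V\<^esub> Y.germ_of V (f i)) = \<zero>\<^bsub>stalk Y V\<^esub>"
    have "\<forall>i\<in>K. \<exists>\<rho>. \<rho> \<in> Y.near V \<and> r i = Y.germ_of V \<rho>"
      using r unfolding Y.carrier_stalk[OF V] by blast
    from bchoice[OF this] obtain \<rho> where \<rho>: "\<forall>i\<in>K. \<rho> i \<in> Y.near V \<and> r i = Y.germ_of V (\<rho> i)" by blast
    have \<rho>f: "\<rho> i * f i \<in> Y.near V" if "i \<in> K" for i using \<rho> f that NY.mult_C by blast
    have "(\<Oplus>\<^bsub>stalk Y V\<^esub>i\<in>K. r i \<otimes>\<^bsub>stalk Y V\<^esub> Y.germ_of V (f i))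
        = (\<Oplus>\<^bsub>stalk Y V\<^esub>i\<in>K. Y.germ_of V (\<rho> i * f i))"
      using \<rho> f \<rho>f Y.germ_of_closed[OF V] by (intro A.finsum_cong') (auto simp: Y.germ_of_mult[OF V])
    also have "\<dots> = Y.germ_of V (\<Sum>i\<in>K. \<rho> i * f i)" using \<rho>f by (rule Y.germ_of_sum[OF V K(1)])
    finally have "Y.germ_of V (\<Sum>i\<in>K. \<rho> i * f i) = Y.germ_of V 0"
      using r0 by (simp add: Y.germ_of_zero[OF V])
    then have "Y.agree V (\<Sum>i\<in>K. \<rho> i * f i) 0"
      using Y.germ_of_eq[OF V NY.sum_C[of K "\<lambda>i. \<rho> i * f i"]] \<rho>f by blast
    then obtain U where U: "openin (space_top Y) U" "U \<inter> V \<noteq> {}" "\<forall>x\<in>U. (\<Sum>i\<in>K. \<rho> i * f i) x = 0"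
      unfolding Y.agree_def by auto
    note p = open_V_preimage[OF U(1,2)]
    have \<rho>A: "\<rho> i \<circ> \<pi> \<in> alg.A" if "i \<in> K" for i using near_V \<rho> that by blast
    have ev: "(\<Sum>i\<in>L. h i) x = (\<Sum>i\<in>L. h i x)" for h :: "nat \<Rightarrow> 'z \<Rightarrow> complex" and L x
      by (induction L rule: infinite_finite_induct) auto
    have "(\<Sum>i\<in>K. (\<rho> i \<circ> \<pi>) * a i) \<in> Z"
      unfolding Z_def vanishing_def
    proof (intro CollectI conjI exI[of _ "{x \<in> E. \<pi> x \<in> U}"])
      show "(\<Sum>i\<in>K. (\<rho> i \<circ> \<pi>) * a i) \<in> C"
        using \<rho>A ac alg.AC by (intro C.sum_C C.mult_C) blast+
      show "openin (space_top X) {x \<in> E. \<pi> x \<in> U}" using p(1) by (simp add: stable_open_def)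
      show "{x \<in> E. \<pi> x \<in> U} \<inter> E \<noteq> {}" using p(2) by blast
      show "\<forall>x\<in>{x \<in> E. \<pi> x \<in> U} \<inter> E. (\<Sum>i\<in>K. (\<rho> i \<circ> \<pi>) * a i) x = 0"
      proof
        fix x assume x: "x \<in> {x \<in> E. \<pi> x \<in> U} \<inter> E"
        have "(\<Sum>i\<in>K. (\<rho> i \<circ> \<pi>) * a i) x = (\<Sum>i\<in>K. (\<rho> i * f i) (\<pi> x))"
          unfolding ev using f x by (intro sum.cong) auto
        also have "\<dots> = 0" using U(3) x unfolding ev by blast
        finally show "(\<Sum>i\<in>K. (\<rho> i \<circ> \<pi>) * a i) x = 0" .
      qed
    qed
    then have "\<rho> j \<circ> \<pi> \<in> n" using rel[rule_format, of "\<lambda>i. \<rho> i \<circ> \<pi>"] \<rho>A by blast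
    then show "r j \<in> vanishing_germs Y V V" using vanishing_germs_iff[of "\<rho> j"] \<rho> K(2) by simp
  qed
  then have "germ_of W (c j) \<in> extended alg.Q" using fibre_ideal_extended by blast
  then show ?thesis using extended_iff[OF alg.saturated_Q] ac K(2) by blast
qed

sublocale alg: flat_semilocal_action C \<Gamma> Z n
  by unfold_locales (rule finitely_generated, rule flat_relation_C)

lemma extended_mono: "J \<subseteq> J' \<Longrightarrow> extended J \<subseteq> extended J'"
  unfolding extended_def by blast

lemma extended_psubset:
  assumes "alg.saturated J" "alg.saturated J'" "J \<subset> J'" shows "extended J \<subset> extended J'"
proof -
  obtain c where c: "c \<in> J'" "c \<notin> J" using assms(3) by blast
  then have "c \<in> C" using C.ideal_inD(1)[OF alg.saturatedD(1)[OF assms(2)]] by blast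
  then show ?thesis using extended_iff assms c extended_mono[of J J'] by blast
qed

text \<open>Ideals of the fibre ring are ideals of the stalk above the fibre ideal. Contraction to
  \<open>C\<close> bounds the length of every chain, and extension of a longest chain of saturated
  ideals attains the bound.\<close>

theorem ring_length_fibre:
  "ring_length (fibre_local_ring X Y \<pi> V W) = enat (card (inertia_group G act W))"
proof -
  let ?R = "B Quot fibre_ideal"
  have R: "fibre_local_ring X Y \<pi> V W = ?R"
    unfolding fibre_local_ring_def closure_V[symmetric] ..
  define S where "S = {enat l | l. \<exists>I. (\<forall>i\<le>l. ideal (I i) ?R) \<and> (\<forall>i<l. I i \<subset> I (Suc i))}"
  let ?q = "\<lambda>I. (+>\<^bsub>B\<^esub>) fibre_ideal ` I"
  have upper: "l \<le> card (alg.inertia n)"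
    if I: "\<forall>i\<le>l. ideal (I i) ?R" "\<forall>i<l. I i \<subset> I (Suc i)" for l I
  proof -
    have "\<exists>J. ideal J B \<and> fibre_ideal \<subseteq> J \<and> I i = ?q J" if "i \<le> l" for i
      using B.quotient_ideal_obtain[OF ideal_fibre_ideal] I(1) that by metis
    then have "\<forall>i. \<exists>J. i \<le> l \<longrightarrow> ideal J B \<and> fibre_ideal \<subseteq> J \<and> I i = ?q J" by blast
    from choice[OF this] obtain J where J: "\<And>i. i \<le> l \<Longrightarrow> ideal (J i) B \<and> fibre_ideal \<subseteq> J i \<and> I i = ?q (J i)"
      by blast
    have "alg.chain (\<lambda>i. contracted (J i)) l"
      unfolding alg.chain_def
    proof (intro conjI allI impI)
      show "alg.saturated (contracted (J i))" if "i \<le> l" for i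
        using J[OF that] mC_fibre_ideal by (intro saturated_contracted) auto
      show "contracted (J i) \<subset> contracted (J (Suc i))" if i: "i < l" for i
      proof -
        have "?q (J i) \<subset> ?q (J (Suc i))" using I(2) i J[of i] J[of "Suc i"] by (metis Suc_leI less_imp_le)
        then have "J i \<subset> J (Suc i)"
          using B.quotient_ideal_psubset_iff[OF ideal_fibre_ideal] J[of i] J[of "Suc i"] i by auto
        then show ?thesis using contracted_psubset J[of i] J[of "Suc i"] i by auto
      qed
    qed
    then show ?thesis by (rule alg.chain_length_le)
  qed
  have "enat (card (alg.inertia n)) \<in> S"
  proof -
    obtain J where J: "alg.chain J (card (alg.inertia n))" using alg.ex_chain by blast
    have sat: "alg.saturated (J i)" if "i \<le> card (alg.inertia n)" for i
      using J that by (simp add: alg.chain_def)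
    have ext: "ideal (extended (J i)) B" "fibre_ideal \<subseteq> extended (J i)" if "i \<le> card (alg.inertia n)" for i
    proof -
      show "ideal (extended (J i)) B" using ideal_extended sat that by blast
      have "alg.Q \<subseteq> J i" using alg.Q_subset[OF sat[OF that]] by blast
      then show "fibre_ideal \<subseteq> extended (J i)" using fibre_ideal_extended extended_mono by blast
    qed
    have "ideal (?q (extended (J i))) ?R" if "i \<le> card (alg.inertia n)" for i
      using B.quot_ideal_correspondence[OF ideal_fibre_ideal] ext[OF that] unfolding bij_betw_def by blast
    moreover have "?q (extended (J i)) \<subset> ?q (extended (J (Suc i)))" if i: "i < card (alg.inertia n)" for i
    proof -
      have "J i \<subset> J (Suc i)" using J i by (simp add: alg.chain_def)
      then have "extended (J i) \<subset> extended (J (Suc i))" using sat i by (intro extended_psubset) auto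
      then show ?thesis
        using B.quotient_ideal_psubset_iff[OF ideal_fibre_ideal] ext[of i] ext[of "Suc i"] i by auto
    qed
    ultimately show ?thesis
      unfolding S_def
      by (intro CollectI exI[of _ "card (alg.inertia n)"] exI[of _ "\<lambda>i. ?q (extended (J i))"] conjI) auto
  qed
  moreover have "x \<le> enat (card (alg.inertia n))" if "x \<in> S" for x
    using that upper unfolding S_def by auto
  ultimately have "Sup S = enat (card (alg.inertia n))"
    by (intro antisym Sup_least Sup_upper)
  then show ?thesis unfolding R ring_length_def S_def[symmetric] card_inertia .
qed

end

section \<open>Separability in characteristic zero\<close>

text \<open>Coefficient lists start with the leading coefficient, so each head is multiplied by the
  length of its tail. Addition of polynomials drops leading zeros, which changes this list but not
  its values; the rules below are therefore stated for values.\<close>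

fun (in ring) pderiv_list :: "'a list \<Rightarrow> 'a list" where
  "pderiv_list [] = []"
| "pderiv_list [a] = []"
| "pderiv_list (a # b # p) = add_pow R (Suc (length p)) \<one> \<otimes> a # pderiv_list (b # p)"

context cring begin

lemma length_pderiv_list: "length (pderiv_list p) = length p - 1"
  by (induction p rule: pderiv_list.induct) auto

lemma pderiv_list_carrier: "set p \<subseteq> carrier R \<Longrightarrow> set (pderiv_list p) \<subseteq> carrier R"
  by (induction p rule: pderiv_list.induct) auto

lemma eval_pderiv_Cons:
  assumes "a \<in> carrier R" "set p \<subseteq> carrier R" "x \<in> carrier R"
  shows "eval (pderiv_list (a # p)) x =
    add_pow R (length p) \<one> \<otimes> a \<otimes> x [^] (length p - 1) \<oplus> eval (pderiv_list p) x"
  using assms by (cases p) (simp_all add: length_pderiv_list)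

lemma eval_pderiv_closed:
  "set p \<subseteq> carrier R \<Longrightarrow> x \<in> carrier R \<Longrightarrow> eval (pderiv_list p) x \<in> carrier R"
  by (rule eval_in_carrier[OF pderiv_list_carrier])

lemma eval_pderiv_normalize:
  assumes "set p \<subseteq> carrier R" "x \<in> carrier R"
  shows "eval (pderiv_list (normalize p)) x = eval (pderiv_list p) x"
  using assms
proof (induction p)
  case (Cons a p)
  then show ?case
    using eval_pderiv_Cons[of a p x] eval_pderiv_closed[of p x] by (cases "a = \<zero>") auto
qed simp

lemma eval_pderiv_map2:
  assumes "length p = length q" "set p \<subseteq> carrier R" "set q \<subseteq> carrier R" "x \<in> carrier R"
  shows "eval (pderiv_list (map2 (\<oplus>) p q)) x = eval (pderiv_list p) x \<oplus> eval (pderiv_list q) x"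
  using assms
proof (induction p q rule: list_induct2)
  case (Cons a p b q)
  have map2: "set (map2 (\<oplus>) p q) \<subseteq> carrier R" using Cons.prems by (auto elim!: in_set_zipE)
  have c: "eval (pderiv_list p) x \<in> carrier R" "eval (pderiv_list q) x \<in> carrier R"
    "add_pow R (length q) \<one> \<in> carrier R" "x [^] (length q - 1) \<in> carrier R" "a \<in> carrier R" "b \<in> carrier R"
    using Cons.prems by (auto intro!: eval_pderiv_closed)
  have "add_pow R (length q) \<one> \<otimes> (a \<oplus> b) \<otimes> x [^] (length q - 1) \<oplus>
      (eval (pderiv_list p) x \<oplus> eval (pderiv_list q) x) =
    (add_pow R (length q) \<one> \<otimes> a \<otimes> x [^] (length q - 1) \<oplus> eval (pderiv_list p) x) \<oplus>
    (add_pow R (length q) \<one> \<otimes> b \<otimes> x [^] (length q - 1) \<oplus> eval (pderiv_list q) x)"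
    using c by algebra
  then show ?case
    using Cons map2 eval_pderiv_Cons[of a p x] eval_pderiv_Cons[of b q x]
      eval_pderiv_Cons[of "a \<oplus> b" "map2 (\<oplus>) p q" x] by simp
qed simp

lemma eval_pderiv_replicate:
  assumes "set p \<subseteq> carrier R" "x \<in> carrier R"
  shows "eval (pderiv_list (replicate k \<zero> @ p)) x = eval (pderiv_list p) x"
proof (induction k)
  case (Suc k)
  have "set (replicate k \<zero> @ p) \<subseteq> carrier R" using assms by auto
  then show ?case
    using Suc eval_pderiv_Cons[of \<zero> "replicate k \<zero> @ p" x] eval_pderiv_closed[OF assms] assms(2) by simp
qed simp

lemma eval_pderiv_add:
  assumes "set p \<subseteq> carrier R" "set q \<subseteq> carrier R" "x \<in> carrier R"
  shows "eval (pderiv_list (poly_add p q)) x = eval (pderiv_list p) x \<oplus> eval (pderiv_list q) x"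
proof -
  have le: "eval (pderiv_list (poly_add p q)) x = eval (pderiv_list p) x \<oplus> eval (pderiv_list q) x"
    if "length q \<le> length p" "set p \<subseteq> carrier R" "set q \<subseteq> carrier R" for p q
  proof -
    let ?q = "replicate (length p - length q) \<zero> @ q"
    have q: "set ?q \<subseteq> carrier R" "length p = length ?q" using that by auto
    have "set (map2 (\<oplus>) p ?q) \<subseteq> carrier R"
      using that(2) q(1) by (auto elim!: in_set_zipE dest!: subsetD)
    then show ?thesis
      using that assms(3) eval_pderiv_normalize[of "map2 (\<oplus>) p ?q" x]
        eval_pderiv_map2[OF q(2) that(2) q(1) assms(3)] eval_pderiv_replicate[OF that(3) assms(3)]
      by simp
  qed
  show ?thesis
  proof (cases "length q \<le> length p")
    case False
    then have "eval (pderiv_list (poly_add q p)) x = eval (pderiv_list q) x \<oplus> eval (pderiv_list p) x"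
      using le[of p q] assms by simp
    moreover have "poly_add p q = poly_add q p" using False by simp
    ultimately show ?thesis using assms a_comm eval_pderiv_closed by simp
  qed (use le assms in blast)
qed

lemma eval_pderiv_scalar:
  assumes "set p \<subseteq> carrier R" "x \<in> carrier R" "c \<in> carrier R"
  shows "eval (pderiv_list (map (\<lambda>a. c \<otimes> a) p)) x = c \<otimes> eval (pderiv_list p) x"
  using assms(1)
proof (induction p)
  case (Cons a p)
  have "set (map ((\<otimes>) c) p) \<subseteq> carrier R" using Cons.prems assms(3) by auto
  moreover have "add_pow R (length p) \<one> \<otimes> (c \<otimes> a) \<otimes> x [^] (length p - 1) \<oplus> c \<otimes> eval (pderiv_list p) x =
      c \<otimes> (add_pow R (length p) \<one> \<otimes> a \<otimes> x [^] (length p - 1) \<oplus> eval (pderiv_list p) x)"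
  proof -
    have "eval (pderiv_list p) x \<in> carrier R" "add_pow R (length p) \<one> \<in> carrier R" "x [^] (length p - 1) \<in> carrier R"
      "a \<in> carrier R"
      using Cons.prems assms by (auto intro!: eval_pderiv_closed)
    then show ?thesis using assms(3) by algebra
  qed
  ultimately show ?case
    using Cons assms eval_pderiv_Cons[of a p x] eval_pderiv_Cons[of "c \<otimes> a" "map ((\<otimes>) c) p" x] by simp
qed (use assms in simp)

text \<open>Appending a zero multiplies by the indeterminate, so this is the product rule for that
  factor.\<close>

lemma eval_pderiv_snoc_zero:
  assumes "set p \<subseteq> carrier R" "x \<in> carrier R"
  shows "eval (pderiv_list (p @ [\<zero>])) x = eval (pderiv_list p) x \<otimes> x \<oplus> eval p x"
  using assms(1)
proof (induction p)
  case (Cons a p)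
  have s: "set (p @ [\<zero>]) \<subseteq> carrier R" using Cons.prems by auto
  have c: "eval (pderiv_list p) x \<in> carrier R" "eval p x \<in> carrier R" "add_pow R (length p) \<one> \<in> carrier R"
    "x [^] (length p) \<in> carrier R" "a \<in> carrier R"
    using Cons.prems assms by (simp_all add: eval_pderiv_closed eval_in_carrier)
  show ?case
  proof (cases "length p")
    case 0
    then show ?thesis using Cons.prems assms by simp
  next
    case (Suc k)
    have k: "x [^] k \<in> carrier R" "x [^] length p = x [^] k \<otimes> x" using assms(2) by (simp_all add: Suc)
    have "add_pow R (Suc (length p)) \<one> = add_pow R (length p) \<one> \<oplus> \<one>" by simp
    then have "add_pow R (Suc (length p)) \<one> \<otimes> a \<otimes> x [^] length p \<oplus> (eval (pderiv_list p) x \<otimes> x \<oplus> eval p x) =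
      (add_pow R (length p) \<one> \<otimes> a \<otimes> x [^] k \<oplus> eval (pderiv_list p) x) \<otimes> x \<oplus> (a \<otimes> x [^] length p \<oplus> eval p x)"
      unfolding k(2) using c k(1) assms(2) by (simp only:) algebra
    then show ?thesis
      using Cons s assms eval_pderiv_Cons[of a p x] eval_pderiv_Cons[of a "p @ [\<zero>]" x] by (simp add: Suc)
  qed
qed (use assms in simp)

text \<open>The product rule at a root: multiplication by \<open>X - x\<close> is a shift plus a
  scaling, and at \<open>x\<close> the two terms with the derivative of \<open>s\<close>
  cancel.\<close>

lemma eval_pderiv_linear_mult:
  assumes s: "set s \<subseteq> carrier R" and x: "x \<in> carrier R"
  shows "eval (pderiv_list (poly_mult [\<one>, \<ominus> x] s)) x = eval s x"
proof -
  let ?t = "map ((\<otimes>) (\<ominus> x)) s"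
  have m: "map ((\<otimes>) \<one>) s = s" using s by (induction s) auto
  have t: "set ?t \<subseteq> carrier R" using s x by auto
  have "poly_mult [\<one>, \<ominus> x] s = poly_add (s @ [\<zero>]) (poly_add ?t [])" by (simp add: m)
  moreover have "set (poly_add ?t []) \<subseteq> carrier R" by (rule poly_add_in_carrier[OF t]) simp
  ultimately have "eval (pderiv_list (poly_mult [\<one>, \<ominus> x] s)) x =
      eval (pderiv_list (s @ [\<zero>])) x \<oplus> (eval (pderiv_list ?t) x \<oplus> \<zero>)"
    using eval_pderiv_add[of "s @ [\<zero>]" "poly_add ?t []" x] eval_pderiv_add[OF t _ x, of "[]"] s x by simp
  also have "\<dots> = eval (pderiv_list s) x \<otimes> x \<oplus> eval s x \<oplus> (\<ominus> x \<otimes> eval (pderiv_list s) x \<oplus> \<zero>)"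
    using eval_pderiv_snoc_zero[OF s x] eval_pderiv_scalar[OF s x, of "\<ominus> x"] x by simp
  also have "\<dots> = eval s x"
    using eval_pderiv_closed[OF s x] eval_in_carrier[OF s x] x by algebra
  finally show ?thesis .
qed

end

context field begin

text \<open>A double root of the minimal polynomial would be a root of its derivative. The latter
  has coefficients in \<open>K\<close>, smaller degree and, in characteristic zero, a nonzero
  leading coefficient, which contradicts minimality.\<close>

lemma alg_mult_Irr:
  assumes K: "subfield K R" and x: "x \<in> carrier R" "algebraic K x"
    and char: "\<And>k::nat. k > 0 \<Longrightarrow> add_pow R k \<one> \<noteq> \<zero>"
  shows "alg_mult (Irr K x) x = 1"
proof -
  let ?p = "Irr K x"
  note Kr = subfieldE(1)[OF K]
  have al: "(algebraic over K) x" using x(2) by (simp add: over_def)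
  note irr = IrrE[OF K x(1) al]
  interpret UP: domain "poly_ring R" by (rule univ_poly_is_domain[OF carrier_is_subring])
  have pK: "polynomial K ?p" using irr(1) by (simp add: univ_poly_carrier)
  have p: "?p \<in> carrier (poly_ring R)" using carrier_polynomial[OF Kr pK] by (simp add: univ_poly_carrier)
  have deg: "degree ?p \<ge> 1" by (rule pirreducible_degree[OF K irr(1,2)])
  then obtain b p' where p': "?p = \<one> # b # p'"
    using irr(3) by (cases ?p; cases "tl ?p") auto
  have gt: "alg_mult ?p x > 0"
    using alg_mult_gt_zero_iff_is_root[OF p] irr(4) x(1) p' by (auto simp: is_root_def)
  have "\<not> 2 \<le> alg_mult ?p x"
  proof
    assume "2 \<le> alg_mult ?p x"
    let ?b = "[\<one>, \<ominus> x]"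
    have b: "?b \<in> carrier (poly_ring R)"
      using x(1) unfolding sym[OF univ_poly_carrier] polynomial_def by auto
    have "(?b [^]\<^bsub>poly_ring R\<^esub> (2::nat)) pdivides ?p"
      using le_alg_mult_imp_pdivides[OF x(1) p \<open>2 \<le> _\<close>] .
    then obtain q where q: "q \<in> carrier (poly_ring R)" "?p = (?b [^]\<^bsub>poly_ring R\<^esub> (2::nat)) \<otimes>\<^bsub>poly_ring R\<^esub> q"
      unfolding pdivides_def factor_def by blast
    define s where "s = ?b \<otimes>\<^bsub>poly_ring R\<^esub> q"
    have s: "s \<in> carrier (poly_ring R)" using b q(1) by (simp add: s_def)
    have "?p = ?b \<otimes>\<^bsub>poly_ring R\<^esub> s"
      unfolding s_def q(2) using b q(1) by (simp add: numeral_2_eq_2 UP.m_assoc)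
    then have ps: "?p = poly_mult ?b s" by (simp add: univ_poly_mult)
    have "eval s x = eval ?b x \<otimes> eval q x"
      unfolding s_def using ring_hom_memE(2)[OF eval_is_hom[OF carrier_is_subring x(1)] b q(1)] .
    moreover have "eval ?b x = \<zero>" using x(1) by (simp add: r_neg)
    moreover have "eval q x \<in> carrier R"
      using ring_hom_memE(1)[OF eval_is_hom[OF carrier_is_subring x(1)] q(1)] .
    ultimately have "eval s x = \<zero>" by simp
    moreover have "set s \<subseteq> carrier R" using s polynomial_incl by (simp add: univ_poly_carrier[symmetric])
    ultimately have root: "eval (pderiv_list ?p) x = \<zero>"
      using eval_pderiv_linear_mult[OF _ x(1)] ps by simp
    have natK: "add_pow R (k::nat) \<one> \<in> K" for k
      by (induction k) (use subringE(2,3,7)[OF Kr] in \<open>auto\<close>)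
    have derivK: "set (pderiv_list r) \<subseteq> K" if "set r \<subseteq> K" for r
      using that by (induction r rule: pderiv_list.induct) (use natK subringE(6)[OF Kr] in \<open>auto simp del: add.nat_pow_Suc\<close>)
    \<comment> \<open>The minimal polynomial is monic, so the leading coefficient of its derivative
      is its degree times 1.\<close>
    have "hd (pderiv_list ?p) \<noteq> \<zero>" using char[of "Suc (length p')"] by (simp add: p' del: add.nat_pow_Suc)
    then have "polynomial K (pderiv_list ?p)"
      using derivK[OF polynomial_incl[OF pK]] by (simp add: polynomial_def)
    then have d: "pderiv_list ?p \<in> carrier (K[X])" by (simp add: univ_poly_carrier)
    have "?p pdivides pderiv_list ?p" by (rule Irr_minimal[OF K x(1) al d root])
    then have "degree ?p \<le> degree (pderiv_list ?p)"
      using pdivides_imp_degree_le[OF Kr irr(1) d] by (simp add: p')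
    then show False by (simp add: p' length_pderiv_list)
  qed
  then show ?thesis using gt by linarith
qed

text \<open>Every element is separable, so the dimension is that of the field over itself.\<close>

lemma inseparability_degree_eq_1:
  assumes K: "subfield K R" and alg: "\<And>x. x \<in> carrier R \<Longrightarrow> algebraic K x"
    and char: "\<And>k::nat. k > 0 \<Longrightarrow> add_pow R k \<one> \<noteq> \<zero>"
  shows "inseparability_degree R K = 1"
proof -
  have "separable_closure R K = carrier R"
    using alg_mult_Irr[OF K _ alg char] alg unfolding separable_closure_def by blast
  then show ?thesis
    using dimI[OF carrier_is_subfield dimension_one[OF carrier_is_subfield]]
    by (simp add: inseparability_degree_def over_def)
qed

end

section \<open>Function fields of subvarieties\<close>

lemma space_top_subspace_of: "space_top (subspace_of S W) = subtopology (space_top S) W"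
  by (simp add: subspace_of_def)

lemma sections_subspace_of: "f \<in> sections (subspace_of S W) U \<longleftrightarrow> f \<in> extensional U \<and>
    (\<forall>x\<in>U. \<exists>U' g. openin (space_top S) U' \<and> x \<in> U' \<and> g \<in> sections S U' \<and> (\<forall>y \<in> U' \<inter> U. f y = g y))"
  by (simp add: subspace_of_def)

lemma irreducible_subspace:
  assumes "irreducible_in (space_top S) W"
  shows "irreducible_in (space_top (subspace_of S W)) W"
  unfolding space_top_subspace_of irreducible_in_def
proof (intro conjI allI impI)
  show "W \<subseteq> topspace (subtopology (space_top S) W)" "W \<noteq> {}"
    using assms by (auto simp: irreducible_in_def)
  fix C D assume CD: "closedin (subtopology (space_top S) W) C \<and> closedin (subtopology (space_top S) W) D \<and> W \<subseteq> C \<union> D"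
  then obtain C' D' where C': "closedin (space_top S) C'" "C = C' \<inter> W" and D': "closedin (space_top S) D'" "D = D' \<inter> W"
    by (auto simp: closedin_subtopology)
  have "W \<subseteq> C' \<union> D'" using CD C' D' by blast
  then have "W \<subseteq> C' \<or> W \<subseteq> D'" using assms C'(1) D'(1) unfolding irreducible_in_def by blast
  then show "W \<subseteq> C \<or> W \<subseteq> D" using C' D' by blast
qed

lemma points_subspace: "irreducible_in (space_top S) W \<Longrightarrow> points (subspace_of S W) = W"
  by (auto simp: space_top_subspace_of irreducible_in_def)

lemma morphism_subspace:
  assumes S: "function_space S" and \<phi>: "morphism S T \<phi>" and W: "W \<subseteq> points S"
  shows "morphism (subspace_of S W) (subspace_of T (\<phi> ` W)) \<phi>"
  unfolding morphism_def
proof (intro conjI allI impI)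
  have c: "continuous_map (space_top S) (space_top T) \<phi>" using \<phi> by (simp add: morphism_def)
  show "continuous_map (space_top (subspace_of S W)) (space_top (subspace_of T (\<phi> ` W))) \<phi>"
    unfolding space_top_subspace_of
    by (rule continuous_map_into_subtopology[OF continuous_map_from_subtopology[OF c]]) auto
  fix U f assume "openin (space_top (subspace_of T (\<phi> ` W))) U \<and> f \<in> sections (subspace_of T (\<phi> ` W)) U"
  then have f: "f \<in> sections (subspace_of T (\<phi> ` W)) U" by blast
  let ?P = "{x \<in> points (subspace_of S W). \<phi> x \<in> U}"
  show "restrict (f \<circ> \<phi>) ?P \<in> sections (subspace_of S W) ?P"
    unfolding sections_subspace_of
  proof (intro conjI ballI)
    fix x assume x: "x \<in> ?P"
    then have "\<phi> x \<in> U" by simp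
    then obtain U' g where U': "openin (space_top T) U'" "\<phi> x \<in> U'" "g \<in> sections T U'" "\<forall>y \<in> U' \<inter> U. f y = g y"
      using f unfolding sections_subspace_of by blast
    let ?P' = "{x \<in> points S. \<phi> x \<in> U'}"
    have "openin (space_top S) ?P'" using openin_continuous_map_preimage[OF c U'(1)] .
    moreover have "restrict (g \<circ> \<phi>) ?P' \<in> sections S ?P'" using \<phi> U'(1,3) unfolding morphism_def by blast
    ultimately show "\<exists>U' g. openin (space_top S) U' \<and> x \<in> U' \<and> g \<in> sections S U' \<and>
        (\<forall>y \<in> U' \<inter> ?P. restrict (f \<circ> \<phi>) ?P y = g y)"
      using x U'(2,4)
      by (intro exI[of _ ?P'] exI[of _ "restrict (g \<circ> \<phi>) ?P'"]) (auto simp: space_top_subspace_of)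
  qed simp
qed

context function_space begin

context
  fixes W :: "'a set"
  assumes W: "irreducible_in (space_top S) W"
begin

interpretation T: function_space "subspace_of S W"
  by (rule function_space_subspace_of[OF function_space_axioms])

lemma agree_subspace_iff:
  "function_space.agree (subspace_of S W) W f g \<longleftrightarrow>
    (\<exists>U. openin (space_top S) U \<and> U \<inter> W \<noteq> {} \<and> (\<forall>x\<in>U \<inter> W. f x = g x))"
  unfolding T.agree_def space_top_subspace_of openin_subtopology by blast

lemma near_subspace:
  assumes "f \<in> near W" shows "f \<in> function_space.near (subspace_of S W) W"
proof -
  obtain U where U: "openin (space_top S) U" "U \<inter> W \<noteq> {}" "restrict f U \<in> sections S U"
    using assms unfolding near_def by blast
  have "restrict f (U \<inter> W) \<in> sections (subspace_of S W) (U \<inter> W)"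
    unfolding sections_subspace_of using U
    by (intro conjI ballI exI[of _ U] exI[of _ "restrict f U"]) auto
  moreover have "openin (space_top (subspace_of S W)) (U \<inter> W)"
    unfolding space_top_subspace_of openin_subtopology using U(1) by blast
  ultimately show ?thesis unfolding T.near_def using U(2) by blast
qed

text \<open>A local extension at a single point of \<open>W\<close> suffices: germs along
  \<open>W\<close> that agree on one nonempty open part of \<open>W\<close> are equal.\<close>

lemma near_subspace_lift:
  assumes "f \<in> function_space.near (subspace_of S W) W"
  obtains g where "g \<in> near W" "function_space.agree (subspace_of S W) W f g"
proof -
  obtain U where U: "openin (space_top (subspace_of S W)) U" "U \<inter> W \<noteq> {}"
      "restrict f U \<in> sections (subspace_of S W) U"
    using assms unfolding T.near_def by blast
  obtain O' where O': "openin (space_top S) O'" "U = O' \<inter> W"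
    using U(1) unfolding space_top_subspace_of openin_subtopology by blast
  obtain x where x: "x \<in> U" "x \<in> W" using U(2) by blast
  obtain U' g where U': "openin (space_top S) U'" "x \<in> U'" "g \<in> sections S U'" "\<forall>y \<in> U' \<inter> U. restrict f U y = g y"
    using U(3) x(1) unfolding sections_subspace_of by blast
  have "(U', g) \<in> local_sections S W" using U' x(2) by (auto simp: local_sections_def)
  then have "g \<in> near W" by (rule local_sections_near[OF W])
  moreover have "function_space.agree (subspace_of S W) W f g"
    unfolding agree_subspace_iff
    using O' U' x by (intro exI[of _ "U' \<inter> O'"]) auto
  ultimately show ?thesis by (rule that)
qed

end

end

section \<open>The function field of \<open>W\<close> as the residue field of
  \<open>n\<close>\<close>

context flat_projective_quotient begin

abbreviation XW :: "(complex^'n) set fspace" where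
  "XW \<equiv> subspace_of X W"

abbreviation YV :: "(complex^'n) set set fspace" where
  "YV \<equiv> subspace_of Y V"

lemma irreducible_XW: "irreducible_in (space_top XW) W"
  by (rule irreducible_subspace[OF W])

lemma irreducible_YV: "irreducible_in (space_top YV) V"
  by (rule irreducible_subspace[OF V])

sublocale XW: function_space XW
  by (rule function_space_subspace_of[OF function_space_axioms])

sublocale YV: function_space YV
  by (rule function_space_subspace_of[OF function_space_Y])

abbreviation L :: "((complex^'n) set set \<times> ((complex^'n) set \<Rightarrow> complex)) set ring" where
  "L \<equiv> stalk XW W"

definition residue :: "((complex^'n) set \<Rightarrow> complex) \<Rightarrow> ((complex^'n) set set \<times> ((complex^'n) set \<Rightarrow> complex)) set" where
  "residue c = XW.germ_of W c"

lemma function_field_eq: "function_field XW = L"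
  by (simp add: function_field_def points_subspace[OF W])

sublocale L: cring L
  by (rule XW.cring_stalk[OF irreducible_XW])

lemma C_near_XW: "c \<in> C \<Longrightarrow> c \<in> XW.near W"
  by (rule near_subspace[OF W C_near])

lemma agree_XW_iff:
  assumes c: "c \<in> C" "d \<in> C" shows "XW.agree W c d \<longleftrightarrow> c - d \<in> n"
  unfolding agree_subspace_iff[OF W] n_def vanishing_def using C.diff_C[OF c] by auto

lemma residue_eq_iff: "c \<in> C \<Longrightarrow> d \<in> C \<Longrightarrow> residue c = residue d \<longleftrightarrow> c - d \<in> n"
  unfolding residue_def by (simp add: XW.germ_of_eq[OF irreducible_XW C_near_XW] agree_XW_iff)

lemma residue_add: "c \<in> C \<Longrightarrow> d \<in> C \<Longrightarrow> residue (c + d) = residue c \<oplus>\<^bsub>L\<^esub> residue d"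
  and residue_mult: "c \<in> C \<Longrightarrow> d \<in> C \<Longrightarrow> residue (c * d) = residue c \<otimes>\<^bsub>L\<^esub> residue d"
  and residue_uminus: "c \<in> C \<Longrightarrow> residue (- c) = \<ominus>\<^bsub>L\<^esub> residue c"
  and residue_zero: "residue 0 = \<zero>\<^bsub>L\<^esub>"
  and residue_one: "residue 1 = \<one>\<^bsub>L\<^esub>"
  and residue_closed: "c \<in> C \<Longrightarrow> residue c \<in> carrier L"
  unfolding residue_def
  by (simp_all add: XW.germ_of_add[OF irreducible_XW] XW.germ_of_mult[OF irreducible_XW]
      XW.germ_of_uminus[OF irreducible_XW] XW.germ_of_zero[OF irreducible_XW]
      XW.germ_of_one[OF irreducible_XW] XW.germ_of_closed[OF irreducible_XW] C_near_XW)

lemma residue_power: "c \<in> C \<Longrightarrow> residue (c ^ k) = residue c [^]\<^bsub>L\<^esub> k"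
proof (induction k)
  case (Suc k)
  have "residue (c ^ Suc k) = residue (c ^ k) \<otimes>\<^bsub>L\<^esub> residue c"
    unfolding power_Suc2 by (rule residue_mult[OF C.power_C[OF Suc.prems] Suc.prems])
  then show ?case using Suc by (simp only: L.nat_pow_Suc)
qed (simp add: residue_one)

text \<open>A germ on \<open>W\<close> lifts to the stalk of \<open>X\<close>, where it is a
  fraction of \<open>c\<close> by \<open>s\<close>. An inverse of \<open>s\<close> modulo
  \<open>n\<close> already lies in \<open>C\<close>, so on \<open>W\<close> no denominator is
  left.\<close>

lemma carrier_L: "carrier L = residue ` C"
proof
  show "residue ` C \<subseteq> carrier L" using residue_closed by blast
  show "carrier L \<subseteq> residue ` C"
  proof
    fix x assume "x \<in> carrier L"
    then obtain f where f: "x = XW.germ_of W f" "f \<in> XW.near W"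
      unfolding XW.carrier_stalk[OF irreducible_XW] by blast
    obtain g where g: "g \<in> near W" "XW.agree W f g" by (rule near_subspace_lift[OF W f(2)])
    obtain s c where s: "s \<in> C" "s \<notin> n" "c \<in> C" "agree W (s * g) c"
      using localize[OF g(1)] by blast
    obtain u where u: "u \<in> C" "s * u - 1 \<in> n" using alg.ex_inverse_mod_n[OF s(1,2)] by blast
    obtain U where U: "openin (space_top X) U" "U \<inter> W \<noteq> {}" "\<forall>x\<in>U \<inter> W. (s * u - 1) x = 0"
      using u(2) unfolding n_def vanishing_def by blast
    obtain U' where U': "openin (space_top X) U'" "U' \<inter> W \<noteq> {}" "\<forall>x\<in>U'. (s * g) x = c x"
      using s(4) unfolding agree_def by blast
    have "XW.agree W g (c * u)"
      unfolding agree_subspace_iff[OF W]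
    proof (intro exI[of _ "U \<inter> U'"] conjI ballI)
      show "openin (space_top X) (U \<inter> U')" using U(1) U'(1) by blast
      show "U \<inter> U' \<inter> W \<noteq> {}" using irreducible_open_Int[OF W U(1) U'(1) U(2) U'(2)] .
      fix x assume "x \<in> U \<inter> U' \<inter> W"
      then have "s x * u x = 1" "s x * g x = c x" using U(3) U'(3) by auto
      then show "g x = (c * u) x" by (metis mult.commute mult.left_commute mult_1 times_fun_apply)
    qed
    then have "XW.agree W f (c * u)" by (rule XW.agree_trans[OF irreducible_XW g(2)])
    then have "x = residue (c * u)"
      unfolding residue_def f(1) using XW.germ_of_eq[OF irreducible_XW f(2)] by blast
    then show "x \<in> residue ` C" using s(3) u(1) C.mult_C by blast
  qed
qed

lemma residue_eq_zero: "c \<in> C \<Longrightarrow> residue c = \<zero>\<^bsub>L\<^esub> \<longleftrightarrow> c \<in> n"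
  using residue_eq_iff[of c 0] C.zero_C by (simp add: residue_zero)

sublocale L: field L
proof (rule L.cring_fieldI2)
  have "1 \<notin> n" using C.prime_inD(2)[OF alg.prime_n] .
  then show "\<zero>\<^bsub>L\<^esub> \<noteq> \<one>\<^bsub>L\<^esub>" using residue_eq_zero[OF C.one_C] by (simp add: residue_one)
  fix x assume x: "x \<in> carrier L" "x \<noteq> \<zero>\<^bsub>L\<^esub>"
  then obtain c where c: "c \<in> C" "x = residue c" unfolding carrier_L by blast
  then have "c \<notin> n" using x(2) residue_eq_zero by blast
  then obtain u where u: "u \<in> C" "c * u - 1 \<in> n" using alg.ex_inverse_mod_n[OF c(1)] by blast
  have "residue (c * u) = residue 1" using residue_eq_iff[OF C.mult_C[OF c(1) u(1)] C.one_C] u(2) by simp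
  then have "x \<otimes>\<^bsub>L\<^esub> residue u = \<one>\<^bsub>L\<^esub>" using c u(1) by (simp add: residue_mult residue_one)
  then show "\<exists>b\<in>carrier L. x \<otimes>\<^bsub>L\<^esub> b = \<one>\<^bsub>L\<^esub>" using residue_closed[OF u(1)] by blast
qed

text \<open>Rational functions on \<open>V\<close> extend to functions near \<open>V\<close> on the
  quotient, whose pullbacks are invariants, and conversely invariants descend. So
  \<open>K(V)\<close> inside \<open>K(W)\<close> is the residue field of \<open>A\<close>.\<close>

lemma base_function_field_eq: "base_function_field X Y \<pi> W = residue ` alg.A"
proof -
  have eq: "base_function_field X Y \<pi> W = germ_pullback XW W \<pi> ` carrier (stalk YV V)"
    by (simp add: base_function_field_def function_field_def points_subspace[OF V])
  have m: "morphism XW YV \<pi>"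
    by (rule morphism_subspace[OF function_space_axioms morphism_pi]) (use W in \<open>simp add: irreducible_in_def\<close>)
  have cl: "V = space_top YV closure_of (\<pi> ` W)"
    using closure_of_topspace[of "space_top YV"] by (simp only: points_subspace[OF V])
  have pb: "germ_pullback XW W \<pi> (YV.germ_of V f) = residue (f \<circ> \<pi>)" "f \<circ> \<pi> \<in> XW.near W"
    if "f \<in> YV.near V" for f
    using germ_pullback_germ_of[OF XW.function_space_axioms YV.function_space_axioms m irreducible_XW
        irreducible_YV cl that] unfolding residue_def by auto
  show ?thesis
    unfolding eq YV.carrier_stalk[OF irreducible_YV]
  proof (intro equalityI subsetI)
    fix x assume "x \<in> germ_pullback XW W \<pi> ` YV.germ_of V ` YV.near V"
    then obtain f where f: "f \<in> YV.near V" "x = germ_pullback XW W \<pi> (YV.germ_of V f)" by blast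
    obtain g where g: "g \<in> Y.near V" "YV.agree V f g" by (rule Y.near_subspace_lift[OF V f(1)])
    have "YV.germ_of V f = YV.germ_of V g" using YV.germ_of_eq[OF irreducible_YV f(1)] g(2) by blast
    then have "x = residue (g \<circ> \<pi>)" using f(2) pb(1)[OF Y.near_subspace[OF V g(1)]] by simp
    then show "x \<in> residue ` alg.A" using near_V[OF g(1)] by blast
  next
    fix x assume "x \<in> residue ` alg.A"
    then obtain a where a: "a \<in> alg.A" "x = residue a" by blast
    show "x \<in> germ_pullback XW W \<pi> ` YV.germ_of V ` YV.near V"
    proof (rule descend[OF a(1)])
      fix f assume f: "f \<in> Y.near V" "\<And>x. x \<in> E \<Longrightarrow> f (\<pi> x) = a x"
      have f': "f \<in> YV.near V" by (rule Y.near_subspace[OF V f(1)])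
      have "XW.agree W (f \<circ> \<pi>) a"
        unfolding agree_subspace_iff[OF W] using stable_open_E W W_E f(2)
        by (intro exI[of _ E]) (auto simp: stable_open_def irreducible_in_def)
      then have "residue (f \<circ> \<pi>) = residue a"
        unfolding residue_def using XW.germ_of_eq[OF irreducible_XW pb(2)[OF f']] by blast
      then have "x = germ_pullback XW W \<pi> (YV.germ_of V f)" using pb(1)[OF f'] a(2) by simp
      then show ?thesis using f' by blast
    qed
  qed
qed

lemma subfield_base: "subfield (residue ` alg.A) L"
proof (rule L.subfieldI')
  show "subring (residue ` alg.A) L"
  proof (rule L.subringI)
    show "residue ` alg.A \<subseteq> carrier L" using residue_closed alg.AC by blast
    show "\<one>\<^bsub>L\<^esub> \<in> residue ` alg.A" unfolding residue_one[symmetric] using alg.A.one_C by (rule imageI)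
    show "\<ominus>\<^bsub>L\<^esub> h \<in> residue ` alg.A" if "h \<in> residue ` alg.A" for h
      using that alg.A.uminus_C by (auto simp: residue_uminus[OF alg.AC, symmetric] intro!: imageI)
    show "h \<otimes>\<^bsub>L\<^esub> h' \<in> residue ` alg.A" if "h \<in> residue ` alg.A" "h' \<in> residue ` alg.A" for h h'
      using that alg.A.mult_C by (auto simp: residue_mult[OF alg.AC alg.AC, symmetric] intro!: imageI)
    show "h \<oplus>\<^bsub>L\<^esub> h' \<in> residue ` alg.A" if "h \<in> residue ` alg.A" "h' \<in> residue ` alg.A" for h h'
      using that alg.A.add_C by (auto simp: residue_add[OF alg.AC alg.AC, symmetric] intro!: imageI)
  qed
  fix k assume k: "k \<in> residue ` alg.A - {\<zero>\<^bsub>L\<^esub>}"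
  then obtain a where a: "a \<in> alg.A" "k = residue a" by blast
  have "a \<notin> n" using k a residue_eq_zero[OF alg.AC[OF a(1)]] by blast
  then obtain b where b: "b \<in> alg.A" "a * b - 1 \<in> Z" using alg.ex_unit_A[OF a(1)] by blast
  note aC = alg.AC[OF a(1)] and bC = alg.AC[OF b(1)]
  have "residue (a * b) = residue 1"
    using residue_eq_iff[OF C.mult_C[OF aC bC] C.one_C] b(2) Z_n by blast
  then have "k \<otimes>\<^bsub>L\<^esub> residue b = \<one>\<^bsub>L\<^esub>" using aC bC a(2) by (simp add: residue_mult residue_one)
  then have "inv\<^bsub>L\<^esub> k = residue b"
    using L.comm_inv_char residue_closed aC bC a(2) by simp
  then show "inv\<^bsub>L\<^esub> k \<in> residue ` alg.A" using b(1) by blast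
qed

text \<open>Coefficient lists begin with the highest power, hence the reversed list of
  indices.\<close>

lemma eval_residue:
  assumes "\<And>i. a i \<in> C" "c \<in> C"
  shows "L.eval (map (\<lambda>i. residue (a i)) (rev [0..<m])) (residue c) = residue (\<Sum>i<m. a i * c ^ i)"
proof (induction m)
  case (Suc m)
  have "(\<Sum>i<m. a i * c ^ i) \<in> C" using assms by (intro C.sum_C C.mult_C C.power_C)
  then have "residue (\<Sum>i<Suc m. a i * c ^ i) =
      residue (a m) \<otimes>\<^bsub>L\<^esub> residue c [^]\<^bsub>L\<^esub> m \<oplus>\<^bsub>L\<^esub> residue (\<Sum>i<m. a i * c ^ i)"
    unfolding sum.lessThan_Suc add.commute[of "sum _ _"]
    using assms by (simp only: residue_add residue_mult residue_power C.mult_C C.power_C)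
  moreover have "rev [0..<Suc m] = m # rev [0..<m]" by simp
  ultimately show ?case using Suc by (simp only: list.map L.eval.simps list.sel length_map length_rev length_upt
        diff_zero length_Cons diff_Suc_1)
qed (simp add: residue_zero[unfolded zero_fun_def])

text \<open>The integral relation of a representative in \<open>C\<close> reduces modulo
  \<open>n\<close> to a monic equation over \<open>K(V)\<close>.\<close>

lemma algebraic_over_base:
  assumes "x \<in> carrier L" shows "L.algebraic (residue ` alg.A) x"
proof -
  obtain c where c: "c \<in> C" "x = residue c" using assms unfolding carrier_L by blast
  show ?thesis
  proof (rule alg.ex_integral_relation[OF c(1)])
    fix a assume a: "\<And>i. a i \<in> alg.A" "a (card \<Gamma>) = 1" "(\<Sum>i\<le>card \<Gamma>. a i * c ^ i) = 0"
    let ?p = "map (\<lambda>i. residue (a i)) (rev [0..<Suc (card \<Gamma>)])"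
    have "set ?p \<subseteq> residue ` alg.A" using a(1) by auto
    moreover have "hd ?p = \<one>\<^bsub>L\<^esub>" using a(2) by (simp add: residue_one)
    ultimately have "polynomial\<^bsub>L\<^esub> (residue ` alg.A) ?p" by (simp add: polynomial_def)
    then have p: "?p \<in> carrier ((residue ` alg.A)[X]\<^bsub>L\<^esub>)" by (simp only: univ_poly_carrier)
    have "L.eval ?p x = \<zero>\<^bsub>L\<^esub>"
      unfolding c(2) using a(3) by (subst eval_residue) (auto simp: alg.AC a(1) c(1) lessThan_Suc_atMost residue_zero)
    then show ?thesis using L.algebraicI[OF p] by (simp add: over_def)
  qed
qed

text \<open>\<open>K(W)\<close> is algebraic over \<open>K(V)\<close> and positive integers are not
  in \<open>n\<close>, so the inseparability degree in the denominator is 1.\<close>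

lemma special_multiplicity_eq: "special_multiplicity G X act W = real (card (inertia_group G act W))"
proof -
  have nat: "add_pow L k \<one>\<^bsub>L\<^esub> = residue (of_nat k)" for k :: nat
  proof (induction k)
    case (Suc k)
    have "residue (of_nat (Suc k)) = residue (of_nat k) \<oplus>\<^bsub>L\<^esub> \<one>\<^bsub>L\<^esub>"
      unfolding of_nat_Suc add.commute[of 1] residue_one[symmetric] by (rule residue_add[OF C.of_nat_C C.one_C])
    then show ?case using Suc by (simp only: L.add.nat_pow_Suc)
  qed (simp only: L.add.nat_pow_0 of_nat_0 residue_zero)
  have char: "add_pow L k \<one>\<^bsub>L\<^esub> \<noteq> \<zero>\<^bsub>L\<^esub>" if "k > 0" for k :: nat
    unfolding nat using residue_eq_zero[OF C.of_nat_C] alg.char[OF that] by blast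
  have "inseparability_degree L (residue ` alg.A) = 1"
    by (rule L.inseparability_degree_eq_1[OF subfield_base algebraic_over_base char])
  then show ?thesis by (simp add: special_multiplicity_def function_field_eq base_function_field_eq)
qed

end

theorem proposition3p6:
  fixes X :: "(complex^'n) set fspace"
    and G :: "('g, 'm) monoid_scheme"
    and act :: "'g \<Rightarrow> (complex^'n) set \<Rightarrow> (complex^'n) set"
  assumes "projective_variety X" and "normal_variety X"
    and "finite_group_acting G X act"
    and "flat_morphism X (quotient_space G X act) (orbit G act)"
  shows "\<forall>z \<in> cycles (quotient_space G X act).
           flat_pullback X (quotient_space G X act) (orbit G act) z = special_pullback G X act z"
proof
  fix z assume z: "z \<in> cycles (quotient_space G X act)"
  obtain E where E: "E \<in> subvarieties projective_space" "X = subspace_of projective_space E"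
    using assms(1) unfolding projective_variety_def by blast
  have irr: "irreducible_in zariski E" using E(1) by (simp add: subvarieties_def projective_space_def)
  interpret finite_quotient X G act
    using function_space_subspace_of[OF function_space_projective_space] assms(3)
    unfolding finite_quotient_def finite_quotient_axioms_def E(2) by blast
  have "real (the_enat (ring_length (fibre_local_ring X Y \<pi> V W))) = special_multiplicity G X act W"
    if V: "V \<in> Poly_Mapping.keys z" and W: "W \<in> irreducible_components (space_top X) {x \<in> points X. \<pi> x \<in> V}"
    for V W
  proof -
    have V': "closedin (space_top Y) V" "irreducible_in (space_top Y) V"
      using V z by (auto simp: cycles_def subvarieties_def)
    have cW: "closedin (space_top X) W"
      using closedin_irreducible_component[OF closedin_continuous_map_preimage[OF continuous_pi V'(1)] W] .
    have iW: "irreducible_in (space_top X) W" using W by (simp add: irreducible_components_def)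
    have img: "\<pi> ` W = V" by (rule component_image[OF V' W])
    \<comment> \<open>Flatness and the fibre ring refer to the closure of the image; a component
      maps onto the closed set \<open>V\<close>, so the closure changes nothing.\<close>
    have cl: "space_top Y closure_of (\<pi> ` W) = \<pi> ` W" using closure_of_closedin V'(1) img by blast
    interpret flat_projective_quotient X G act E W
    proof
      show "flat_module (stalk Y (\<pi> ` W)) (restrict_scalars (stalk X W) (germ_pullback X W \<pi>))"
        using assms(4) cW iW cl unfolding flat_morphism_def subvarieties_def by fastforce
    qed (fact E(2) irr iW cW)+
    show ?thesis using ring_length_fibre special_multiplicity_eq img by simp
  qed
  then show "flat_pullback X Y \<pi> z = special_pullback G X act z"
    unfolding flat_pullback_def special_pullback_def component_pullback_def
    by (intro sum.cong refl) simp
qed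

end
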